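(* Let $Q(x,y)=0$ be a non-degenerate conic that is not a circumference, let $\Gamma=\{(x,y)\in\mathbb{R}^2:Q(x,y)=0\}$, let $D$ be the region enclosed by $\Gamma$, let $P$ be a polynomial in $x$ and $y$ with bicomplex coefficients, and let $A\in W^{1,q}(D,\mathbb{B})$ with $q>2$. Then the Dirichlet problem $$\begin{cases}(\bar\partial-A)^2w=0, & \text{in } D,\\ w=e^{T_D^{\mathbb{B}}[A]}P, & \text{on }\Gamma,\end{cases}$$ for a bicomplex-valued function $w$, has a unique solution.
   Context: The bicomplex numbers $\mathbb{B}$ are the commutative algebra of elements $z_1+jz_2$ with $z_1,z_2\in\mathbb{C}$, $j^2=-1$, $ij=ji$. The idempotents are $p^\pm=\frac12(1\pm ji)$; every $w=z_1+jz_2\in\mathbb{B}$ is uniquely $w=p^+w^++p^-w^-$ with $w^\pm=z_1\mp iz_2\in\mathbb{C}$, and the same notation is used pointwise for $\mathbb{B}$-valued functions. The exponential is $e^w=p^+e^{w^+}+p^-e^{w^-}$, and the norm is $\|w\|_{\mathbb{B}}=\sqrt{(|w^+|^2+|w^-|^2)/2}$. The complex conjugate of $z=x+iy\in\mathbb{C}$ is written $z^*=x-iy$. The operator $\bar\partial=\frac12\left(\frac{\partial}{\partial x}+j\frac{\partial}{\partial y}\right)$ acts on $\mathbb{B}$-valued functions of $z=x+iy\in\mathbb{C}\cong\mathbb{R}^2$, and $(\bar\partial-A)^2$ is $w\mapsto\bar\partial w-Aw$ composed with itself. $W^{1,q}(D,\mathbb{B})$ is the Sobolev space of $\mathbb{B}$-valued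 functions on $D$ that, together with their first-order derivatives, have $\|\cdot\|_{\mathbb{B}}$ in $L^q(D)$. Domains are bounded and simply connected with smooth boundary. The operator $T_D^{\mathbb{B}}$ is $$T_D^{\mathbb{B}}[A](z)=p^+\left(-\frac1\pi\iint_D\frac{A^+(\zeta)}{\zeta^*-z^*}\,d\xi\,d\eta\right)+p^-\left(-\frac1\pi\iint_D\frac{A^-(\zeta)}{\zeta-z}\,d\xi\,d\eta\right),\quad\zeta=\xi+i\eta.$$ A conic is given by $Q(x,y)=ax^2+bxy+cy^2+dx+ey+f=0$ with $a,b,c,d,e,f\in\mathbb{R}$; that it is not a circumference means that the case $a=c$, $b=0$ is excluded. The boundary condition prescribes the boundary values of $w$ in the usual sense of the Dirichlet problem. *)

theory Defs
  imports "HOL-Analysis.Analysis"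
begin

section \<open>The bicomplex numbers\<close>

text \<open>\<open>Bicomplex z1 z2\<close> stands for \<open>z1 + j z2\<close>.\<close>

datatype bicomplex = Bicomplex (bc1: complex) (bc2: complex)

lemma bicomplex_eq_iff: "v = w \<longleftrightarrow> bc1 v = bc1 w \<and> bc2 v = bc2 w"
  by (cases v; cases w) simp

instantiation bicomplex :: comm_ring_1
begin

definition "0 = Bicomplex 0 0"
definition "1 = Bicomplex 1 0"
definition "v + w = Bicomplex (bc1 v + bc1 w) (bc2 v + bc2 w)"
definition "- w = Bicomplex (- bc1 w) (- bc2 w)"
definition "v - w = Bicomplex (bc1 v - bc1 w) (bc2 v - bc2 w)"
definition "v * w = Bicomplex (bc1 v * bc1 w - bc2 v * bc2 w) (bc1 v * bc2 w + bc2 v * bc1 w)"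

instance
  by standard
    (simp_all add: bicomplex_eq_iff zero_bicomplex_def one_bicomplex_def plus_bicomplex_def
      uminus_bicomplex_def minus_bicomplex_def times_bicomplex_def algebra_simps)

end

lemma bc_simps [simp]:
  "bc1 0 = 0" "bc2 0 = 0" "bc1 1 = 1" "bc2 1 = 0"
  "bc1 (v + w) = bc1 v + bc1 w" "bc2 (v + w) = bc2 v + bc2 w"
  "bc1 (- w) = - bc1 w" "bc2 (- w) = - bc2 w"
  "bc1 (v - w) = bc1 v - bc1 w" "bc2 (v - w) = bc2 v - bc2 w"
  "bc1 (v * w) = bc1 v * bc1 w - bc2 v * bc2 w"
  "bc2 (v * w) = bc1 v * bc2 w + bc2 v * bc1 w"
  by (simp_all add: zero_bicomplex_def one_bicomplex_def plus_bicomplex_def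
      uminus_bicomplex_def minus_bicomplex_def times_bicomplex_def)

instantiation bicomplex :: real_algebra_1
begin

definition "scaleR r w = Bicomplex (r *\<^sub>R bc1 w) (r *\<^sub>R bc2 w)"

instance
  by standard (simp_all add: bicomplex_eq_iff scaleR_bicomplex_def algebra_simps)

end

lemma bc_scaleR [simp]: "bc1 (r *\<^sub>R w) = r *\<^sub>R bc1 w" "bc2 (r *\<^sub>R w) = r *\<^sub>R bc2 w"
  by (simp_all add: scaleR_bicomplex_def)

definition bc_of_complex :: "complex \<Rightarrow> bicomplex"
  where "bc_of_complex z = Bicomplex z 0"

definition bc_j :: bicomplex
  where "bc_j = Bicomplex 0 1"

definition idem_plus :: bicomplex
  where "idem_plus = (1 / 2) *\<^sub>R (1 + bc_j * bc_of_complex \<i>)"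

definition idem_minus :: bicomplex
  where "idem_minus = (1 / 2) *\<^sub>R (1 - bc_j * bc_of_complex \<i>)"

definition bc_plus :: "bicomplex \<Rightarrow> complex"
  where "bc_plus w = bc1 w - \<i> * bc2 w"

definition bc_minus :: "bicomplex \<Rightarrow> complex"
  where "bc_minus w = bc1 w + \<i> * bc2 w"

lemma bc_j_squared: "bc_j * bc_j = - 1"
  by (simp add: bicomplex_eq_iff bc_j_def)

lemma bicomplex_eq_bc_j: "w = bc_of_complex (bc1 w) + bc_j * bc_of_complex (bc2 w)"
  by (simp add: bicomplex_eq_iff bc_j_def bc_of_complex_def)

lemma idempotents: "idem_plus * idem_plus = idem_plus" "idem_minus * idem_minus = idem_minus" "idem_plus * idem_minus = 0" "idem_plus + idem_minus = 1"
  by (simp_all add: bicomplex_eq_iff idem_plus_def idem_minus_def bc_j_def bc_of_complex_def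
      complex_eq_iff)

lemma idempotent_decomposition:
  "w = idem_plus * bc_of_complex (bc_plus w) + idem_minus * bc_of_complex (bc_minus w)"
  by (simp add: bicomplex_eq_iff idem_plus_def idem_minus_def bc_j_def bc_of_complex_def
      bc_plus_def bc_minus_def complex_eq_iff field_simps)

lemma idempotent_components:
  "bc_plus (idem_plus * bc_of_complex u + idem_minus * bc_of_complex v) = u"
  "bc_minus (idem_plus * bc_of_complex u + idem_minus * bc_of_complex v) = v"
  by (simp_all add: idem_plus_def idem_minus_def bc_j_def bc_of_complex_def
      bc_plus_def bc_minus_def complex_eq_iff)

instantiation bicomplex :: real_inner
begin

definition norm_bicomplex_def:
  "norm w = sqrt (((cmod (bc_plus w))\<^sup>2 + (cmod (bc_minus w))\<^sup>2) / 2)"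

definition inner_bicomplex_def:
  "inner v w = inner (bc1 v) (bc1 w) + inner (bc2 v) (bc2 w)"

definition sgn_bicomplex_def: "sgn (w :: bicomplex) = w /\<^sub>R norm w"

definition dist_bicomplex_def: "dist (v :: bicomplex) w = norm (v - w)"

definition uniformity_bicomplex_def:
  "(uniformity :: (bicomplex \<times> bicomplex) filter) =
     (INF e\<in>{0 <..}. principal {(x, y). dist x y < e})"

definition open_bicomplex_def:
  "open (U :: bicomplex set) \<longleftrightarrow>
     (\<forall>x\<in>U. eventually (\<lambda>(x', y). x' = x \<longrightarrow> y \<in> U) uniformity)"

instance
proof
  fix r :: real and x y z :: bicomplex and U :: "bicomplex set"
  show "sgn x = x /\<^sub>R norm x" by (rule sgn_bicomplex_def)
  show "dist x y = norm (x - y)" by (rule dist_bicomplex_def)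
  show "(uniformity :: (bicomplex \<times> bicomplex) filter) =
     (INF e\<in>{0 <..}. principal {(x, y). dist x y < e})" by (rule uniformity_bicomplex_def)
  show "open U \<longleftrightarrow> (\<forall>x\<in>U. eventually (\<lambda>(x', y). x' = x \<longrightarrow> y \<in> U) uniformity)"
    by (rule open_bicomplex_def)
  show "inner x y = inner y x"
    by (simp add: inner_bicomplex_def inner_commute)
  show "inner (x + y) z = inner x z + inner y z"
    by (simp add: inner_bicomplex_def inner_add_left)
  show "inner (r *\<^sub>R x) y = r * inner x y"
    by (simp add: inner_bicomplex_def algebra_simps)
  show "0 \<le> inner x x"
    by (simp add: inner_bicomplex_def)
  show "inner x x = 0 \<longleftrightarrow> x = 0"
    by (simp add: inner_bicomplex_def bicomplex_eq_iff add_nonneg_eq_0_iff)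
  show "norm x = sqrt (inner x x)"
    unfolding norm_bicomplex_def inner_bicomplex_def bc_plus_def bc_minus_def cmod_power2
    by (simp add: inner_complex_def power2_eq_square algebra_simps)
qed

end

instantiation bicomplex :: euclidean_space
begin

definition Basis_bicomplex_def:
  "Basis = {Bicomplex 1 0, Bicomplex \<i> 0, Bicomplex 0 1, Bicomplex 0 \<i>}"

instance
proof
  show "Basis \<noteq> ({} :: bicomplex set)" "finite (Basis :: bicomplex set)"
    by (simp_all add: Basis_bicomplex_def)
  fix u v x :: bicomplex
  show "inner u v = (if u = v then 1 else 0)" if "u \<in> Basis" "v \<in> Basis"
    using that unfolding Basis_bicomplex_def
    by (elim insertE emptyE) (simp_all add: inner_bicomplex_def inner_complex_def)
  show "(\<forall>u\<in>Basis. inner x u = 0) \<longleftrightarrow> x = 0"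
    unfolding Basis_bicomplex_def bicomplex_eq_iff[of x]
    by (simp add: inner_bicomplex_def inner_complex_def complex_eq_iff[of "bc1 x"]
        complex_eq_iff[of "bc2 x"])
qed

end

definition bc_exp :: "bicomplex \<Rightarrow> bicomplex"
  where "bc_exp w = idem_plus * bc_of_complex (exp (bc_plus w)) + idem_minus * bc_of_complex (exp (bc_minus w))"

section \<open>Weak derivatives and Sobolev spaces\<close>

text \<open>
  The plane is the type \<^typ>\<open>complex\<close>; the derivatives in \<open>x\<close> and \<open>y\<close> are the derivatives in
  the directions \<open>1\<close> and \<open>\<i>\<close>. Derivatives of Sobolev functions are weak derivatives, defined
  as usual by integration by parts against compactly supported test functions of class \<open>C\<^sup>1\<close>
  (the order of differentiability that a first-order derivative requires).
\<close>

definition test_function :: "complex set \<Rightarrow> (complex \<Rightarrow> real) \<Rightarrow> bool"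
  where "test_function D \<phi> \<longleftrightarrow>
    (\<forall>z. \<phi> differentiable (at z)) \<and>
    (\<forall>e. continuous_on UNIV (\<lambda>z. frechet_derivative \<phi> (at z) e)) \<and>
    (\<exists>K. compact K \<and> K \<subseteq> D \<and> (\<forall>z. z \<notin> K \<longrightarrow> \<phi> z = 0))"

definition locally_integrable :: "complex set \<Rightarrow> (complex \<Rightarrow> 'a::euclidean_space) \<Rightarrow> bool"
  where "locally_integrable D f \<longleftrightarrow>
    (\<forall>K. compact K \<and> K \<subseteq> D \<longrightarrow> integrable (lebesgue_on K) f)"

definition has_weak_deriv ::
    "complex set \<Rightarrow> complex \<Rightarrow> (complex \<Rightarrow> 'a::euclidean_space) \<Rightarrow> (complex \<Rightarrow> 'a) \<Rightarrow> bool"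
  where "has_weak_deriv D e f g \<longleftrightarrow>
    locally_integrable D f \<and> locally_integrable D g \<and>
    (\<forall>\<phi>. test_function D \<phi> \<longrightarrow>
      (LINT z|lebesgue_on D. frechet_derivative \<phi> (at z) e *\<^sub>R f z) =
      - (LINT z|lebesgue_on D. \<phi> z *\<^sub>R g z))"

definition Lq_space :: "real \<Rightarrow> complex set \<Rightarrow> (complex \<Rightarrow> 'a::euclidean_space) set"
  where "Lq_space q D =
    {f \<in> borel_measurable (lebesgue_on D). integrable (lebesgue_on D) (\<lambda>z. norm (f z) powr q)}"

definition sobolev_W1 :: "real \<Rightarrow> complex set \<Rightarrow> (complex \<Rightarrow> 'a::euclidean_space) set"
  where "sobolev_W1 q D =
    {f \<in> Lq_space q D. \<exists>fx\<in>Lq_space q D. \<exists>fy\<in>Lq_space q D.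
       has_weak_deriv D 1 f fx \<and> has_weak_deriv D \<i> f fy}"

section \<open>The bicomplex Vekua operator\<close>

text \<open>
  \<open>has_dbar D w g\<close> says that \<open>g = (1/2) (w\<^sub>x + j w\<^sub>y)\<close> in \<open>D\<close>. As weak derivatives are
  determined only almost everywhere, the differential operators are rendered as relations between
  a function and a representative of its image, and the square of an operator as a relational
  composition.
\<close>

definition has_dbar :: "complex set \<Rightarrow> (complex \<Rightarrow> bicomplex) \<Rightarrow> (complex \<Rightarrow> bicomplex) \<Rightarrow> bool"
  where "has_dbar D w g \<longleftrightarrow>
    (\<exists>wx wy. has_weak_deriv D 1 w wx \<and> has_weak_deriv D \<i> w wy \<and>
      (AE z in lebesgue_on D. g z = (1 / 2) *\<^sub>R (wx z + bc_j * wy z)))"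

definition vekua_op ::
    "complex set \<Rightarrow> (complex \<Rightarrow> bicomplex) \<Rightarrow> (complex \<Rightarrow> bicomplex) \<Rightarrow> (complex \<Rightarrow> bicomplex) \<Rightarrow> bool"
  where "vekua_op D A w v \<longleftrightarrow>
    (\<exists>g. has_dbar D w g \<and> (AE z in lebesgue_on D. v z = g z - A z * w z))"

definition vekua_op_squared ::
    "complex set \<Rightarrow> (complex \<Rightarrow> bicomplex) \<Rightarrow> (complex \<Rightarrow> bicomplex) \<Rightarrow> (complex \<Rightarrow> bicomplex) \<Rightarrow> bool"
  where "vekua_op_squared D A = vekua_op D A OO vekua_op D A"

definition T_op :: "complex set \<Rightarrow> (complex \<Rightarrow> bicomplex) \<Rightarrow> complex \<Rightarrow> bicomplex"
  where "T_op D A z =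
    idem_plus * bc_of_complex
      (- (1 / of_real pi) * (LINT \<zeta>|lebesgue_on D. bc_plus (A \<zeta>) / (cnj \<zeta> - cnj z))) +
    idem_minus * bc_of_complex
      (- (1 / of_real pi) * (LINT \<zeta>|lebesgue_on D. bc_minus (A \<zeta>) / (\<zeta> - z)))"

section \<open>Conics, polynomials and the Dirichlet problem\<close>

definition conic :: "real \<Rightarrow> real \<Rightarrow> real \<Rightarrow> real \<Rightarrow> real \<Rightarrow> real \<Rightarrow> complex set"
  where "conic a b c d e f =
    {z. a * (Re z)\<^sup>2 + b * Re z * Im z + c * (Im z)\<^sup>2 + d * Re z + e * Im z + f = 0}"

definition nondegenerate_conic :: "real \<Rightarrow> real \<Rightarrow> real \<Rightarrow> real \<Rightarrow> real \<Rightarrow> real \<Rightarrow> bool"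
  where "nondegenerate_conic a b c d e f \<longleftrightarrow>
    det (vector [vector [a, b / 2, d / 2],
                 vector [b / 2, c, e / 2],
                 vector [d / 2, e / 2, f]] :: real^3^3) \<noteq> 0"

definition bc_polynomial :: "(complex \<Rightarrow> bicomplex) \<Rightarrow> bool"
  where "bc_polynomial P \<longleftrightarrow>
    (\<exists>(N::nat) C. \<forall>z. P z = (\<Sum>k\<le>N. \<Sum>l\<le>N. C k l * of_real (Re z) ^ k * of_real (Im z) ^ l))"

text \<open>Boundary values are attained continuously; values outside \<open>closure D\<close> are irrelevant.\<close>

definition solves_dirichlet ::
    "complex set \<Rightarrow> complex set \<Rightarrow> (complex \<Rightarrow> bicomplex) \<Rightarrow> (complex \<Rightarrow> bicomplex) \<Rightarrow>
      (complex \<Rightarrow> bicomplex) \<Rightarrow> bool"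
  where "solves_dirichlet D \<Gamma> A h w \<longleftrightarrow>
    continuous_on (closure D) w \<and>
    vekua_op_squared D A w (\<lambda>z. 0) \<and>
    (\<forall>z\<in>\<Gamma>. w z = h z)"

end

theory Submission
  imports Defs "HOL-Complex_Analysis.Complex_Analysis"
begin

text \<open>
  In the components \<open>cnj w\<^sup>+\<close> and \<open>w\<^sup>-\<close> the equation is the complex equation \<open>(\<partial> - a)\<^sup>2 u = 0\<close>,
  where \<open>\<partial>\<close> is the derivative with respect to \<open>cnj z\<close>. The transform \<open>T\<close> satisfies \<open>\<partial> (T a) = a\<close>, and
  \<open>T a\<close> is continuously differentiable because derivatives can be moved from the regularised kernels
  to \<open>a\<close>. Hence the factor \<open>exp (- T a)\<close> turns \<open>u\<close> into a solution \<open>\<phi>\<close> of \<open>\<partial>\<^sup>2 \<phi> = 0\<close>, that is, into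
  \<open>\<phi> = f0 + cnj z * f1\<close> with \<open>f0\<close>, \<open>f1\<close> holomorphic.

  Up to a similarity the ellipse is \<open>z = t + \<kappa> / t\<close> with \<open>norm t = 1\<close> and \<open>0 < norm \<kappa> < 1\<close>, and there
  \<open>cnj z = 1 / t + cnj \<kappa> * t\<close>. If \<open>\<phi>\<close> vanishes on the boundary, then \<open>f0 + (1 / t + cnj \<kappa> * t) * f1\<close>
  tends to \<open>0\<close> as \<open>norm t\<close> tends to \<open>1\<close>, so it vanishes in the annulus \<open>norm \<kappa> < norm t < 1\<close>. As \<open>z\<close> is
  invariant under \<open>t \<mapsto> \<kappa> / t\<close> but the coefficient of \<open>f1\<close> is not, \<open>f1 = 0\<close> and \<open>f0 = 0\<close>. Here \<open>\<kappa> \<noteq> 0\<close>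
  is essential: the conic is not a circle. For existence, every Laurent polynomial in \<open>t\<close> is the
  boundary value of some \<open>f0 + cnj z * f1\<close>, by a recursion with the polynomials \<open>T n\<close> that satisfy
  \<open>T n (t + \<kappa> / t) = t ^ n + \<kappa> ^ n / t ^ n\<close>.
\<close>

section \<open>Continuously differentiable functions of compact support\<close>

text \<open>Two obstacles shape the proof. The density \<open>A\<close>, extended by zero, may jump
  across the curve, so its transform is shown to be continuously differentiable only inside
  \<open>D\<close>, whereas the boundary condition uses its values on the curve. The kernel
  condition \<open>subcritical\<close>, which yields continuity on the whole plane, is therefore
  kept apart from weak differentiability, which is used only locally. Continuous differentiability
  in \<open>D\<close> matters because a solution has merely weak derivatives:
  \<open>exp (- T a)\<close> times a test function must be a test function again before the factor
  can be moved onto the solution. For the same reason the passage from the weak equation to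
  holomorphic coefficients is Weyl's lemma, applied twice. The second obstacle is that a solution is
  known only to be continuous on the closure. Its coefficient \<open>f1\<close> need not have
  boundary values, so no identity between boundary values of holomorphic functions is available, and
  uniqueness is obtained by estimates inside the annulus. On the existence side the coefficients are
  entire, so boundary values are plain evaluations.\<close>

definition C1_on ::
    "complex set \<Rightarrow> (complex \<Rightarrow> 'a::real_normed_vector) \<Rightarrow> (complex \<Rightarrow> complex \<Rightarrow> 'a) \<Rightarrow> bool"
  where "C1_on S f f' \<longleftrightarrow>
    (\<forall>z\<in>S. (f has_derivative f' z) (at z)) \<and> (\<forall>e. continuous_on S (\<lambda>z. f' z e))"

lemma C1_onI:
  assumes "\<And>z. z \<in> S \<Longrightarrow> (f has_derivative f' z) (at z)" "\<And>e. continuous_on S (\<lambda>z. f' z e)"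
  shows "C1_on S f f'"
  using assms by (auto simp: C1_on_def)

lemma C1_onD:
  assumes "C1_on S f f'"
  shows "\<And>z. z \<in> S \<Longrightarrow> (f has_derivative f' z) (at z)" "\<And>e. continuous_on S (\<lambda>z. f' z e)"
  using assms by (auto simp: C1_on_def)

lemma C1_on_imp_continuous_on: "C1_on S f f' \<Longrightarrow> continuous_on S f"
  unfolding C1_on_def by (blast intro: continuous_at_imp_continuous_on has_derivative_continuous)

lemma C1_on_subset:
  assumes "C1_on S f f'" "T \<subseteq> S"
  shows "C1_on T f f'"
proof (rule C1_onI)
  show "(f has_derivative f' z) (at z)" if "z \<in> T" for z
    using C1_onD(1)[OF assms(1), of z] assms(2) that by auto
  show "continuous_on T (\<lambda>z. f' z e)" for e
    using continuous_on_subset[OF C1_onD(2)[OF assms(1)] assms(2)] .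
qed

lemma C1_on_linear:
  assumes "C1_on S f f'" "bounded_linear L"
  shows "C1_on S (\<lambda>z. L (f z)) (\<lambda>z h. L (f' z h))"
  by (intro C1_onI bounded_linear.has_derivative[OF assms(2)] bounded_linear.continuous_on[OF assms(2)]
      C1_onD(1)[OF assms(1)] C1_onD(2)[OF assms(1)])

lemma C1_on_add:
  assumes "C1_on S f f'" "C1_on S g g'"
  shows "C1_on S (\<lambda>z. f z + g z) (\<lambda>z h. f' z h + g' z h)"
  by (intro C1_onI has_derivative_add continuous_on_add C1_onD(1)[OF assms(1)] C1_onD(2)[OF assms(1)]
      C1_onD(1)[OF assms(2)] C1_onD(2)[OF assms(2)])

lemma C1_on_diff:
  assumes "C1_on S f f'" "C1_on S g g'"
  shows "C1_on S (\<lambda>z. f z - g z) (\<lambda>z h. f' z h - g' z h)"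
  by (intro C1_onI has_derivative_diff continuous_on_diff C1_onD(1)[OF assms(1)] C1_onD(2)[OF assms(1)]
      C1_onD(1)[OF assms(2)] C1_onD(2)[OF assms(2)])

lemma C1_on_const: "C1_on S (\<lambda>z. c) (\<lambda>z h. 0)"
  by (auto simp: C1_on_def)

lemma C1_on_bilinear:
  assumes "bounded_bilinear bil" "C1_on S f f'" "C1_on S g g'"
  shows "C1_on S (\<lambda>z. bil (f z) (g z)) (\<lambda>z h. bil (f z) (g' z h) + bil (f' z h) (g z))"
  by (intro C1_onI bounded_bilinear.FDERIV[OF assms(1)] continuous_on_add
      bounded_bilinear.continuous_on[OF assms(1)] C1_on_imp_continuous_on[OF assms(2)]
      C1_on_imp_continuous_on[OF assms(3)] C1_onD(1)[OF assms(2)] C1_onD(2)[OF assms(2)]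
      C1_onD(1)[OF assms(3)] C1_onD(2)[OF assms(3)])

lemmas C1_on_mult = C1_on_bilinear[OF bounded_bilinear_mult]

lemma C1_on_holomorphic:
  assumes "f holomorphic_on S" "open S"
  shows "C1_on S f (\<lambda>z h. deriv f z * h)"
proof (rule C1_onI)
  show "(f has_derivative (\<lambda>h. deriv f z * h)) (at z)" if "z \<in> S" for z
    using holomorphic_derivI[OF assms that] by (simp add: has_field_derivative_def)
  show "continuous_on S (\<lambda>z. deriv f z * e)" for e
    by (intro continuous_intros holomorphic_on_imp_continuous_on holomorphic_deriv assms)
qed

lemma C1_on_compose_entire:
  assumes "C1_on S f f'" "g holomorphic_on UNIV"
  shows "C1_on S (\<lambda>z. g (f z)) (\<lambda>z h. deriv g (f z) * f' z h)"
proof (rule C1_onI)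
  have g: "(g has_derivative (\<lambda>h. deriv g w * h)) (at w)" for w
    using holomorphic_derivI[OF assms(2) open_UNIV, of w] by (simp add: has_field_derivative_def)
  show "((\<lambda>z. g (f z)) has_derivative (\<lambda>h. deriv g (f z) * f' z h)) (at z)" if "z \<in> S" for z
    using has_derivative_compose[OF C1_onD(1)[OF assms(1) that] g] .
  have "continuous_on UNIV (deriv g)"
    by (intro holomorphic_on_imp_continuous_on holomorphic_deriv assms) auto
  then have "continuous_on S (\<lambda>z. deriv g (f z))"
    using continuous_on_compose2 C1_on_imp_continuous_on[OF assms(1)] by blast
  then show "continuous_on S (\<lambda>z. deriv g (f z) * f' z e)" for e
    by (intro continuous_intros C1_onD(2)[OF assms(1)])
qed

lemma has_derivative_locally_zero:
  fixes f :: "complex \<Rightarrow> 'a::real_normed_vector"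
  assumes "open U" "z \<in> U" "\<And>w. w \<in> U \<Longrightarrow> f w = 0"
  shows "(f has_derivative (\<lambda>h. 0)) (at z)"
  by (rule has_derivative_transform_within_open[OF has_derivative_const assms(1,2)])
    (simp add: assms(3))

text \<open>Together with \<open>test_functionD\<close> this trades \<open>test_function\<close>,
  which speaks of \<open>frechet_derivative\<close>, for an explicit derivative that the product and
  chain rules can compute.\<close>

lemma test_functionI:
  assumes "C1_on UNIV \<phi> \<phi>'" "compact K" "K \<subseteq> D" "\<And>z. z \<notin> K \<Longrightarrow> \<phi> z = 0"
  shows "test_function D \<phi>" "frechet_derivative \<phi> (at z) = \<phi>' z"
proof -
  have d: "(\<phi> has_derivative \<phi>' z) (at z)" for z using C1_onD(1)[OF assms(1)] by simp
  then have *: "frechet_derivative \<phi> (at z) = \<phi>' z" for z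
    by (metis frechet_derivative_at)
  then show "frechet_derivative \<phi> (at z) = \<phi>' z" .
  show "test_function D \<phi>"
    unfolding test_function_def * using d C1_onD(2)[OF assms(1)] assms(2-4)
    by (auto simp: differentiable_def)
qed

lemma test_functionD:
  assumes "test_function D \<phi>"
  shows "C1_on UNIV \<phi> (\<lambda>z. frechet_derivative \<phi> (at z))"
    and "\<exists>K. compact K \<and> K \<subseteq> D \<and> (\<forall>z. z \<notin> K \<longrightarrow> \<phi> z = 0 \<and> (\<forall>e. frechet_derivative \<phi> (at z) e = 0))"
proof -
  show 1: "C1_on UNIV \<phi> (\<lambda>z. frechet_derivative \<phi> (at z))"
    using assms unfolding test_function_def C1_on_def by (auto simp: frechet_derivative_works)
  obtain K where K: "compact K" "K \<subseteq> D" "\<And>z. z \<notin> K \<Longrightarrow> \<phi> z = 0"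
    using assms unfolding test_function_def by auto
  have "frechet_derivative \<phi> (at z) e = 0" if "z \<notin> K" for z e
  proof -
    have "(\<phi> has_derivative (\<lambda>h. 0)) (at z)"
      by (rule has_derivative_locally_zero[of "- K"])
        (use that K in \<open>auto simp: open_Compl compact_imp_closed\<close>)
    then show ?thesis using frechet_derivative_at by (metis)
  qed
  with K show "\<exists>K. compact K \<and> K \<subseteq> D \<and> (\<forall>z. z \<notin> K \<longrightarrow> \<phi> z = 0 \<and> (\<forall>e. frechet_derivative \<phi> (at z) e = 0))"
    by blast
qed

lemma C1_on_vanish:
  assumes "C1_on UNIV f f'" "closed K" "\<And>z. z \<notin> K \<Longrightarrow> f z = 0" "z \<notin> K"
  shows "f' z e = 0"
proof -
  have "(f has_derivative (\<lambda>h. 0)) (at z)"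
    by (rule has_derivative_locally_zero[of "- K"]) (use assms in auto)
  then have "f' z = (\<lambda>h. 0)" using C1_onD(1)[OF assms(1)] has_derivative_unique by blast
  then show ?thesis by simp
qed

text \<open>The plane is the union of the open sets \<open>D\<close> and \<open>- K\<close>; the
  product rule applies on the first, and the product is zero on the second. Thus a test function
  times a function that is differentiable only on \<open>D\<close> is again a test function.\<close>

lemma C1_on_times_compact_support:
  fixes g :: "complex \<Rightarrow> 'b::real_normed_vector"
  assumes "bounded_bilinear bil" "C1_on UNIV f f'" "C1_on D g g'" "open D"
    and "compact K" "K \<subseteq> D" "\<And>z. z \<notin> K \<Longrightarrow> f z = 0"
  shows "C1_on UNIV (\<lambda>z. bil (f z) (g z)) (\<lambda>z h. bil (f z) (g' z h) + bil (f' z h) (g z))"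
    (is "C1_on UNIV ?F ?F'")
proof -
  interpret bounded_bilinear bil by fact
  have f': "f' z h = 0" if "z \<notin> K" for z h
    using C1_on_vanish[OF assms(2) compact_imp_closed[OF assms(5)]] assms(7) that by blast
  have D: "C1_on D ?F ?F'"
    by (rule C1_on_bilinear[OF assms(1) C1_on_subset[OF assms(2)] assms(3)]) auto
  have oK: "open (- K)" using assms(5) by (simp add: open_Compl compact_imp_closed)
  have U: "UNIV = D \<union> - K" using assms(6) by auto
  have K: "C1_on (- K) ?F ?F'"
  proof (rule C1_onI)
    fix z assume z: "z \<in> - K"
    have "(?F has_derivative (\<lambda>h. 0)) (at z)"
      by (rule has_derivative_locally_zero[of "- K"])
        (use z oK assms(7) in \<open>auto simp: zero_left\<close>)
    then show "(?F has_derivative ?F' z) (at z)"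
      using z assms(7) f' by (simp add: zero_left)
  next
    fix e
    have "continuous_on (- K) (\<lambda>z. ?F' z e) \<longleftrightarrow> continuous_on (- K) (\<lambda>z. 0::'c)"
      by (rule continuous_on_cong) (use assms(7) f' in \<open>auto simp: zero_left\<close>)
    then show "continuous_on (- K) (\<lambda>z. ?F' z e)" by simp
  qed
  show ?thesis
  proof (rule C1_onI)
    show "(?F has_derivative ?F' z) (at z)" for z
      using U C1_onD(1)[OF D] C1_onD(1)[OF K] by blast
    show "continuous_on UNIV (\<lambda>z. ?F' z e)" for e
      unfolding U using C1_onD(2)[OF D] C1_onD(2)[OF K]
      by (intro continuous_on_open_Un assms(4) oK) auto
  qed
qed

lemma LINT_lebesgue_on_support:
  fixes f :: "complex \<Rightarrow> 'a::{banach, second_countable_topology}"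
  assumes "D \<in> sets lebesgue" "\<And>z. z \<notin> D \<Longrightarrow> f z = 0"
  shows "(LINT z|lebesgue_on D. f z) = (LINT z|lebesgue. f z)"
    and "integrable (lebesgue_on D) f \<longleftrightarrow> integrable lebesgue f"
proof -
  have "(\<lambda>x. indicator D x *\<^sub>R f x) = f" using assms(2) by (auto simp: indicator_def)
  then show "(LINT z|lebesgue_on D. f z) = (LINT z|lebesgue. f z)"
    "integrable (lebesgue_on D) f \<longleftrightarrow> integrable lebesgue f"
    using assms(1) by (simp_all add: integral_restrict_space integrable_restrict_space)
qed

lemma integrable_continuous_compact_support:
  fixes f :: "complex \<Rightarrow> 'a::euclidean_space"
  assumes "continuous_on UNIV f" "compact K" "\<And>z. z \<notin> K \<Longrightarrow> f z = 0"
  shows "integrable lebesgue f"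
proof -
  have "integrable lborel (\<lambda>x. indicator K x *\<^sub>R f x)"
    by (rule borel_integrable_compact) (use assms in \<open>auto intro: continuous_on_subset\<close>)
  moreover have "(\<lambda>x. indicator K x *\<^sub>R f x) = f" using assms(3) by (auto simp: indicator_def)
  ultimately have "integrable lborel f" by simp
  then show ?thesis
    using assms(1) by (subst integrable_completion) (auto intro: borel_measurable_continuous_onI)
qed

text \<open>The derivatives in the directions 1 and \<open>\<i>\<close> are continuous and vanish
  off \<open>K\<close>, so they are bounded, and together they bound the whole derivative; the mean
  value inequality on the plane does the rest.\<close>

lemma C1_on_compact_support_Lipschitz:
  assumes "C1_on UNIV f f'" "compact K" "\<And>z. z \<notin> K \<Longrightarrow> f z = 0"
  obtains M where "M > 0" "\<And>x y. norm (f x - f y) \<le> M * norm (x - y)"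
proof -
  have cl: "closed K" using assms(2) by (rule compact_imp_closed)
  have b: "\<exists>B. \<forall>z. norm (f' z e) \<le> B" for e
  proof -
    have "compact ((\<lambda>z. f' z e) ` K)"
      by (intro compact_continuous_image assms(2) continuous_on_subset[OF C1_onD(2)[OF assms(1)]]) auto
    then obtain B where B: "\<And>z. z \<in> K \<Longrightarrow> norm (f' z e) \<le> B"
      using compact_imp_bounded bounded_iff by (metis imageI)
    have "norm (f' z e) \<le> max B 0" for z
      using B[of z] C1_on_vanish[OF assms(1) cl assms(3), of z e] by (cases "z \<in> K") auto
    then show ?thesis by blast
  qed
  obtain B1 Bi where B: "\<And>z. norm (f' z 1) \<le> B1" "\<And>z. norm (f' z \<i>) \<le> Bi"
    using b by meson
  \<comment> \<open>The summand 1 only makes the constant positive.\<close>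
  have "norm (f x - f y) \<le> (B1 + Bi + 1) * norm (x - y)" for x y
  proof (rule differentiable_bound[of UNIV f "\<lambda>z. f' z"])
    fix z :: complex
    show "(f has_derivative f' z) (at z within UNIV)" using C1_onD(1)[OF assms(1)] by simp
    then interpret l: bounded_linear "f' z" by (rule has_derivative_bounded_linear)
    show "onorm (f' z) \<le> B1 + Bi + 1"
    proof (rule onorm_bound)
      have "0 \<le> B1" "0 \<le> Bi" using B norm_ge_zero order_trans by blast+
      then show "0 \<le> B1 + Bi + 1" by simp
      fix h
      have "h = Re h *\<^sub>R 1 + Im h *\<^sub>R \<i>" by (simp add: complex_eq_iff)
      then have "f' z h = Re h *\<^sub>R f' z 1 + Im h *\<^sub>R f' z \<i>"
        by (metis l.add l.scaleR)
      then have "norm (f' z h) \<le> \<bar>Re h\<bar> * norm (f' z 1) + \<bar>Im h\<bar> * norm (f' z \<i>)"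
        using norm_triangle_ineq by (metis norm_scaleR)
      also have "\<dots> \<le> norm h * B1 + norm h * Bi"
        by (intro add_mono mult_mono B abs_Re_le_cmod abs_Im_le_cmod) auto
      also have "\<dots> \<le> (B1 + Bi + 1) * norm h" by (simp add: algebra_simps)
      finally show "norm (f' z h) \<le> (B1 + Bi + 1) * norm h" .
    qed
  qed auto
  moreover have "B1 + Bi + 1 > 0" using B norm_ge_zero
    by (smt (verit))
  ultimately show ?thesis using that by blast
qed

lemma integral_lborel_translate:
  fixes f :: "complex \<Rightarrow> 'a::euclidean_space"
  assumes "f \<in> borel_measurable borel"
  shows "(LINT z|lborel. f (c + z)) = (LINT z|lborel. f z)"
proof -
  have "(LINT z|distr lborel borel ((+) c). f z) = (LINT z|lborel. f (c + z))"
    using assms by (intro integral_distr) auto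
  then show ?thesis by (simp add: lborel_distr_plus)
qed

lemma integrable_lborel_translate:
  fixes f :: "complex \<Rightarrow> 'a::euclidean_space"
  assumes "integrable lborel f"
  shows "integrable lborel (\<lambda>z. f (c + z))"
proof -
  have "integrable (distr lborel borel ((+) c)) f" using assms by (simp add: lborel_distr_plus)
  then show ?thesis
    using borel_measurable_integrable[OF assms] by (subst (asm) integrable_distr_eq) auto
qed

text \<open>Translation invariance makes the integral of every difference quotient zero, and the
  quotients converge to the derivative under a common integrable bound. Classical integration by
  parts below always reduces to this.\<close>

lemma integral_C1_compact_support:
  fixes f :: "complex \<Rightarrow> 'a::euclidean_space"
  assumes "C1_on UNIV f f'" "compact K" "\<And>z. z \<notin> K \<Longrightarrow> f z = 0"
  shows "integrable lebesgue (\<lambda>z. f' z e)" "(LINT z|lebesgue. f' z e) = 0"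
proof -
  have cl: "closed K" using assms(2) by (rule compact_imp_closed)
  note [continuous_intros] = C1_onD(2)[OF assms(1)] C1_on_imp_continuous_on[OF assms(1)]
  have [measurable]: "f \<in> borel_measurable borel" "(\<lambda>z. f' z e) \<in> borel_measurable borel"
    by (rule borel_measurable_continuous_onI, rule continuous_intros)+
  show "integrable lebesgue (\<lambda>z. f' z e)"
    by (rule integrable_continuous_compact_support[OF C1_onD(2)[OF assms(1)] assms(2)])
      (rule C1_on_vanish[OF assms(1) cl assms(3)])
  have "integrable lebesgue f"
    by (rule integrable_continuous_compact_support[OF C1_on_imp_continuous_on[OF assms(1)] assms(2,3)])
  then have intf: "integrable lborel f" by (subst (asm) integrable_completion) auto
  obtain M where M: "M > 0" "\<And>x y. norm (f x - f y) \<le> M * norm (x - y)"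
    using C1_on_compact_support_Lipschitz[OF assms] by blast
  obtain R where R: "K \<subseteq> cball 0 R" using compact_imp_bounded[OF assms(2)] unfolding bounded_iff by (auto simp: subset_iff)
  \<comment> \<open>The increments \<open>e / (n + 1)\<close> are at most \<open>norm e\<close>
    long, so every quotient vanishes outside the ball of radius \<open>R + norm e\<close>, and the
    Lipschitz constant bounds it by \<open>M * norm e\<close>.\<close>
  define q where "q n z = real (Suc n) *\<^sub>R (f ((1 / real (Suc n)) *\<^sub>R e + z) - f z)" for n z
  have [measurable]: "q n \<in> borel_measurable borel" for n unfolding q_def by measurable
  have lim: "(\<lambda>n. LINT z|lborel. q n z) \<longlonglongrightarrow> (LINT z|lborel. f' z e)"
  proof (rule integral_dominated_convergence[where w="\<lambda>z. indicator (cball 0 (R + norm e)) z * (M * norm e)"])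
    show "integrable lborel (\<lambda>z::complex. indicator (cball 0 (R + norm e)) z * (M * norm e))"
      by (intro integrable_mult_left integrable_real_indicator) (use emeasure_bounded_finite[OF bounded_cball] in auto)
    show "AE z in lborel. (\<lambda>n. q n z) \<longlonglongrightarrow> f' z e"
    proof (rule AE_I2)
      fix z
      have d: "((\<lambda>t. f (t *\<^sub>R e + z)) has_derivative (\<lambda>t. f' z (t *\<^sub>R e))) (at (0::real))"
        by (rule has_derivative_compose[of "\<lambda>t. t *\<^sub>R e + z" "\<lambda>t. t *\<^sub>R e" 0 UNIV f])
           (auto intro!: derivative_eq_intros C1_onD(1)[OF assms(1)])
      have "bounded_linear (f' z)" using C1_onD(1)[OF assms(1)] has_derivative_bounded_linear by blast
      then have "((\<lambda>t. f (t *\<^sub>R e + z)) has_derivative (\<lambda>t. t *\<^sub>R f' z e)) (at (0::real))"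
        using d by (simp add: linear_simps)
      then have "((\<lambda>h. norm (f (h *\<^sub>R e + z) - f z - h *\<^sub>R f' z e) / norm h) \<longlongrightarrow> 0) (at 0)"
        unfolding has_derivative_at by simp
      moreover have "norm (f (h *\<^sub>R e + z) - f z - h *\<^sub>R f' z e) / norm h =
          norm ((1/h) *\<^sub>R (f (h *\<^sub>R e + z) - f z) - f' z e)" if "h \<noteq> 0" for h
      proof -
        have "(1/h) *\<^sub>R (f (h *\<^sub>R e + z) - f z) - f' z e =
            (1/h) *\<^sub>R (f (h *\<^sub>R e + z) - f z - h *\<^sub>R f' z e)"
          using that by (simp add: scaleR_diff_right)
        then show ?thesis by simp
      qed
      ultimately have "((\<lambda>h. norm ((1/h) *\<^sub>R (f (h *\<^sub>R e + z) - f z) - f' z e)) \<longlongrightarrow> 0) (at 0)"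
        by (subst tendsto_cong[where g="\<lambda>h. norm (f (h *\<^sub>R e + z) - f z - h *\<^sub>R f' z e) / norm h"])
          (auto simp: eventually_at_filter)
      then have "((\<lambda>h. (1/h) *\<^sub>R (f (h *\<^sub>R e + z) - f z)) \<longlongrightarrow> f' z e) (at 0)"
        by (simp add: tendsto_norm_zero_iff Lim_null[symmetric] LIM_zero_iff)
      moreover have "filterlim (\<lambda>n. 1 / real (Suc n)) (at 0) sequentially"
        using LIMSEQ_Suc[OF lim_1_over_n[where 'a=real]] by (auto simp: filterlim_at)
      ultimately have "(\<lambda>n. (1/(1 / real (Suc n))) *\<^sub>R (f ((1 / real (Suc n)) *\<^sub>R e + z) - f z)) \<longlonglongrightarrow> f' z e"
        by (rule filterlim_compose)
      then show "(\<lambda>n. q n z) \<longlonglongrightarrow> f' z e" by (simp add: q_def)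
    qed
    show "AE z in lborel. norm (q n z) \<le> indicator (cball 0 (R + norm e)) z * (M * norm e)" for n
    proof (rule AE_I2)
      fix z
      let ?w = "(1 / real (Suc n)) *\<^sub>R e + z"
      show "norm (q n z) \<le> indicator (cball 0 (R + norm e)) z * (M * norm e)"
      proof (cases "z \<in> cball 0 (R + norm e)")
        case True
        have "norm (f ?w - f z) \<le> M * norm (?w - z)" by (rule M)
        also have "\<dots> = M * norm e / real (Suc n)" by simp
        finally have "real (Suc n) * norm (f ?w - f z) \<le> M * norm e"
          by (simp add: field_simps del: of_nat_Suc)
        then show ?thesis using True by (simp add: q_def)
      next
        case False
        then have nz: "norm z > R + norm e" by simp
        have "norm ((1 / real (Suc n)) *\<^sub>R e) \<le> norm e" by (simp add: divide_le_eq mult_le_cancel_left1)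
        then have "norm ?w \<ge> norm z - norm e" using norm_triangle_ineq4[of ?w "(1 / real (Suc n)) *\<^sub>R e"]
          by (smt (verit) add_diff_cancel_left')
        then have "norm z > R" "norm ?w > R" using nz norm_ge_zero[of e] by linarith+
        then have "z \<notin> K" "?w \<notin> K" using R by auto
        then show ?thesis using assms(3) M(1) by (simp add: q_def)
      qed
    qed
  qed auto
  have "(LINT z|lborel. q n z) = 0" for n
    unfolding q_def
    by (subst integral_scaleR_right)
      (simp add: Bochner_Integration.integral_diff[OF integrable_lborel_translate[OF intf] intf]
        integral_lborel_translate)
  then have "(LINT z|lborel. f' z e) = 0" using lim by (simp add: LIMSEQ_const_iff)
  then show "(LINT z|lebesgue. f' z e) = 0" by (subst integral_completion) auto
qed

section \<open>Weak derivatives\<close>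

lemma locally_integrable_continuous:
  assumes "continuous_on D f"
  shows "locally_integrable D f"
  unfolding locally_integrable_def
proof (intro allI impI)
  fix K assume K: "compact K \<and> K \<subseteq> D"
  have c: "continuous_on K f" using assms K continuous_on_subset by blast
  have "integrable lborel (\<lambda>x. indicator K x *\<^sub>R f x)"
    by (rule borel_integrable_compact) (use K c in auto)
  moreover from this have "(\<lambda>x. indicator K x *\<^sub>R f x) \<in> borel_measurable lborel"
    by (rule borel_measurable_integrable)
  ultimately have "integrable lebesgue (\<lambda>x. indicator K x *\<^sub>R f x)"
    by (subst integrable_completion)
  moreover have "K \<in> sets lebesgue" using K by (simp add: lmeasurable_compact fmeasurableD)
  ultimately show "integrable (lebesgue_on K) f" by (simp add: integrable_restrict_space)
qed

lemma locally_integrableD: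
  assumes "locally_integrable D f" "compact K" "K \<subseteq> D"
  shows "integrable lebesgue (\<lambda>z. indicator K z *\<^sub>R f z)"
proof -
  have "integrable (lebesgue_on K) f" using assms by (simp add: locally_integrable_def)
  moreover have "K \<in> sets lebesgue" using assms by (simp add: lmeasurable_compact fmeasurableD)
  ultimately show ?thesis by (simp add: integrable_restrict_space)
qed

lemma locally_integrable_iff:
  "locally_integrable D f \<longleftrightarrow> (\<forall>K. compact K \<and> K \<subseteq> D \<longrightarrow> integrable lebesgue (\<lambda>z. indicator K z *\<^sub>R f z))"
proof -
  have "integrable (lebesgue_on K) f \<longleftrightarrow> integrable lebesgue (\<lambda>z. indicator K z *\<^sub>R f z)" if "compact K" for K
  proof -
    have "K \<in> sets lebesgue" using that by (simp add: lmeasurable_compact fmeasurableD)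
    then show ?thesis by (simp add: integrable_restrict_space)
  qed
  then show ?thesis unfolding locally_integrable_def by blast
qed

lemma borel_measurable_lebesgueI:
  fixes f :: "complex \<Rightarrow> 'a::euclidean_space"
  shows "f \<in> borel_measurable borel \<Longrightarrow> f \<in> borel_measurable lebesgue"
  by (simp add: measurable_completion)

lemma continuous_on_bounded_borel:
  fixes f :: "complex \<Rightarrow> 'a::euclidean_space"
  assumes "continuous_on K f" "compact K"
  obtains B where "B \<ge> 0" "\<And>z. z \<in> K \<Longrightarrow> norm (f z) \<le> B" "(\<lambda>z. indicator K z *\<^sub>R f z) \<in> borel_measurable lebesgue"
proof -
  have "bounded (f ` K)" using compact_imp_bounded compact_continuous_image assms by blast
  then obtain B where B: "\<And>z. z \<in> K \<Longrightarrow> norm (f z) \<le> B" by (auto simp: bounded_iff)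
  have K: "K \<in> sets borel" using assms(2) by (simp add: borel_compact)
  have "(\<lambda>z. indicator K z *\<^sub>R f z) \<in> borel_measurable borel"
    using borel_measurable_continuous_on_indicator[OF K assms(1)] by simp
  then show ?thesis using that[of "max B 0"] B by (force intro: borel_measurable_lebesgueI)
qed

text \<open>On a compact set \<open>g\<close> is bounded, so the product is dominated by a multiple
  of \<open>u\<close>. A general bilinear map covers real scaling and complex multiplication at
  once.\<close>

lemma locally_integrable_bilinear:
  fixes u :: "complex \<Rightarrow> 'a::euclidean_space" and g :: "complex \<Rightarrow> 'b::euclidean_space"
    and bil :: "'b \<Rightarrow> 'a \<Rightarrow> 'c::euclidean_space"
  assumes "bounded_bilinear bil" "locally_integrable D u" "continuous_on D g"
  shows "locally_integrable D (\<lambda>z. bil (g z) (u z))"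
  unfolding locally_integrable_iff
proof (intro allI impI)
  interpret bounded_bilinear bil by fact
  fix K assume K: "compact K \<and> K \<subseteq> D"
  then have "continuous_on K g" using assms(3) continuous_on_subset by blast
  then obtain B where B: "B \<ge> 0" "\<And>z. z \<in> K \<Longrightarrow> norm (g z) \<le> B"
    and m: "(\<lambda>z. indicator K z *\<^sub>R g z) \<in> borel_measurable lebesgue"
    using continuous_on_bounded_borel K by metis
  have i: "integrable lebesgue (\<lambda>z. indicator K z *\<^sub>R u z)"
    using locally_integrableD[OF assms(2)] K by blast
  obtain C where C: "C \<ge> 0" "\<And>a b. norm (bil a b) \<le> norm a * norm b * C"
    using nonneg_bounded by blast
  have cb: "continuous_on UNIV (\<lambda>p. bil (fst p) (snd p))"
    by (intro continuous_on continuous_intros)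
  have "(\<lambda>z. bil (indicator K z *\<^sub>R g z) (indicator K z *\<^sub>R u z)) \<in> borel_measurable lebesgue"
    by (rule borel_measurable_continuous_Pair[OF m borel_measurable_integrable[OF i] cb])
  moreover have eq: "(\<lambda>z. bil (indicator K z *\<^sub>R g z) (indicator K z *\<^sub>R u z)) = (\<lambda>z. indicator K z *\<^sub>R bil (g z) (u z))"
    by (auto simp: indicator_def zero_left)
  ultimately have m2: "(\<lambda>z. indicator K z *\<^sub>R bil (g z) (u z)) \<in> borel_measurable lebesgue" by simp
  have "integrable lebesgue (\<lambda>z. (B * C) *\<^sub>R (indicator K z *\<^sub>R u z))" using i by (rule integrable_scaleR_right)
  then show "integrable lebesgue (\<lambda>z. indicator K z *\<^sub>R bil (g z) (u z))"
  proof (rule Bochner_Integration.integrable_bound[OF _ m2], intro AE_I2)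
    fix z
    have "norm (bil (g z) (u z)) \<le> B * norm (u z) * C" if "z \<in> K"
      by (rule order_trans[OF C(2)]) (intro mult_right_mono B(2) that C(1) norm_ge_zero)
    then show "norm (indicator K z *\<^sub>R bil (g z) (u z)) \<le> norm ((B * C) *\<^sub>R (indicator K z *\<^sub>R u z))"
      using B C by (auto simp: indicator_def abs_mult mult_ac)
  qed
qed

lemma integrable_bilinear_compact_support:
  fixes u :: "complex \<Rightarrow> 'a::euclidean_space" and g :: "complex \<Rightarrow> 'b::euclidean_space"
    and bil :: "'b \<Rightarrow> 'a \<Rightarrow> 'c::euclidean_space"
  assumes "bounded_bilinear bil" "locally_integrable D u" "continuous_on D g"
    and "compact K" "K \<subseteq> D" "\<And>z. z \<notin> K \<Longrightarrow> g z = 0"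
  shows "integrable lebesgue (\<lambda>z. bil (g z) (u z))"
proof -
  interpret bounded_bilinear bil by fact
  have "integrable lebesgue (\<lambda>z. indicator K z *\<^sub>R bil (g z) (u z))"
    by (rule locally_integrableD[OF locally_integrable_bilinear[OF assms(1-3)] assms(4,5)])
  moreover have "(\<lambda>z. indicator K z *\<^sub>R bil (g z) (u z)) = (\<lambda>z. bil (g z) (u z))"
    using assms(6) by (auto simp: indicator_def zero_left)
  ultimately show ?thesis by simp
qed

lemmas integrable_mult_compact_support = integrable_bilinear_compact_support[OF bounded_bilinear_mult]
lemmas integrable_scaleR_compact_support = integrable_bilinear_compact_support[OF bounded_bilinear_scaleR]

text \<open>A test function and its derivative vanish off a compact subset of \<open>D\<close>, so
  the integrals may be taken over the whole plane. They then no longer mention \<open>D\<close>, and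
  the test function comes with an explicit derivative.\<close>

lemma has_weak_deriv_iff:
  assumes "open D"
  shows "has_weak_deriv D e f g \<longleftrightarrow> locally_integrable D f \<and> locally_integrable D g \<and>
    (\<forall>\<phi> \<phi>' K. C1_on UNIV \<phi> \<phi>' \<longrightarrow> compact K \<longrightarrow> K \<subseteq> D \<longrightarrow> (\<forall>z. z \<notin> K \<longrightarrow> \<phi> z = 0) \<longrightarrow>
      (LINT z|lebesgue. \<phi>' z e *\<^sub>R f z) = - (LINT z|lebesgue. \<phi> z *\<^sub>R g z))" (is "?L \<longleftrightarrow> ?R")
proof -
  have D: "D \<in> sets lebesgue" using assms by simp
  show ?thesis
  proof
    assume L: ?L
    show ?R
    proof (intro conjI allI impI)
      show "locally_integrable D f" "locally_integrable D g" using L by (auto simp: has_weak_deriv_def)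
      fix \<phi> :: "complex \<Rightarrow> real" and \<phi>' K assume h: "C1_on UNIV \<phi> \<phi>'" "compact K" "K \<subseteq> D" "\<forall>z. z \<notin> K \<longrightarrow> \<phi> z = 0"
      have t: "test_function D \<phi>" "\<And>z. frechet_derivative \<phi> (at z) = \<phi>' z"
        using test_functionI[OF h(1-3)] h(4) by blast+
      have v: "\<And>z. z \<notin> D \<Longrightarrow> \<phi>' z e = 0"
        using C1_on_vanish[OF h(1) compact_imp_closed[OF h(2)]] h by blast
      have "(LINT z|lebesgue_on D. frechet_derivative \<phi> (at z) e *\<^sub>R f z) =
          - (LINT z|lebesgue_on D. \<phi> z *\<^sub>R g z)"
        using L t(1) by (auto simp: has_weak_deriv_def)
      then show "(LINT z|lebesgue. \<phi>' z e *\<^sub>R f z) = - (LINT z|lebesgue. \<phi> z *\<^sub>R g z)"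
        unfolding t(2) using v h
        by (subst (asm) (1 2) LINT_lebesgue_on_support[OF D]) auto
    qed
  next
    assume R: ?R
    show ?L
      unfolding has_weak_deriv_def
    proof (intro conjI allI impI)
      show "locally_integrable D f" "locally_integrable D g" using R by auto
      fix \<phi> assume "test_function D \<phi>"
      then obtain K where C: "C1_on UNIV \<phi> (\<lambda>z. frechet_derivative \<phi> (at z))" and
        K: "compact K" "K \<subseteq> D" "\<forall>z. z \<notin> K \<longrightarrow> \<phi> z = 0 \<and> (\<forall>e. frechet_derivative \<phi> (at z) e = 0)"
        using test_functionD by metis
      have "(LINT z|lebesgue. frechet_derivative \<phi> (at z) e *\<^sub>R f z) = - (LINT z|lebesgue. \<phi> z *\<^sub>R g z)"
        using R C K by blast
      then show "(LINT z|lebesgue_on D. frechet_derivative \<phi> (at z) e *\<^sub>R f z) =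
          - (LINT z|lebesgue_on D. \<phi> z *\<^sub>R g z)"
        using K by (subst (1 2) LINT_lebesgue_on_support[OF D]) auto
    qed
  qed
qed

lemma has_weak_deriv_locally_integrable:
  assumes "has_weak_deriv D e f g"
  shows "locally_integrable D f" "locally_integrable D g"
  using assms by (auto simp: has_weak_deriv_def)

lemma has_weak_deriv_subset:
  assumes "has_weak_deriv D e f g" "open D" "open S" "S \<subseteq> D"
  shows "has_weak_deriv S e f g"
proof -
  have "locally_integrable S f" "locally_integrable S g"
    using has_weak_deriv_locally_integrable[OF assms(1)] assms(4)
    unfolding locally_integrable_def by blast+
  then show ?thesis using assms(1,4)
    unfolding has_weak_deriv_iff[OF assms(2)] has_weak_deriv_iff[OF assms(3)]
    by (meson order_trans)
qed

lemma locally_integrable_linear: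
  assumes "locally_integrable D f" "bounded_linear L"
  shows "locally_integrable D (\<lambda>z. L (f z))"
  using assms integrable_bounded_linear unfolding locally_integrable_def by blast

text \<open>Bounded linear maps commute with the integral. This is the passage between bicomplex
  functions and their complex components.\<close>

lemma has_weak_deriv_linear:
  fixes f :: "complex \<Rightarrow> 'a::euclidean_space" and L :: "'a \<Rightarrow> 'b::euclidean_space"
  assumes "has_weak_deriv D e f g" "bounded_linear L" "open D"
  shows "has_weak_deriv D e (\<lambda>z. L (f z)) (\<lambda>z. L (g z))"
  unfolding has_weak_deriv_iff[OF assms(3)]
proof (intro conjI allI impI)
  note l = has_weak_deriv_locally_integrable[OF assms(1)]
  interpret bounded_linear L by fact
  show "locally_integrable D (\<lambda>z. L (f z))" "locally_integrable D (\<lambda>z. L (g z))"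
    using l locally_integrable_linear assms(2) by blast+
  fix \<phi> :: "complex \<Rightarrow> real" and \<phi>' K
  assume h: "C1_on UNIV \<phi> \<phi>'" "compact K" "K \<subseteq> D" "\<forall>z. z \<notin> K \<longrightarrow> \<phi> z = 0"
  have v: "\<And>z. z \<notin> K \<Longrightarrow> \<phi>' z e = 0"
    using C1_on_vanish[OF h(1) compact_imp_closed[OF h(2)]] h by blast
  have "continuous_on D (\<lambda>z. \<phi>' z e)" "continuous_on D \<phi>"
    using C1_onD(2)[OF h(1)] C1_on_imp_continuous_on[OF h(1)] continuous_on_subset by blast+
  then have "integrable lebesgue (\<lambda>z. \<phi>' z e *\<^sub>R f z)" "integrable lebesgue (\<lambda>z. \<phi> z *\<^sub>R g z)"
    using h v l by (auto intro!: integrable_scaleR_compact_support[of D _ _ K])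
  then have "(LINT z|lebesgue. L (\<phi>' z e *\<^sub>R f z)) = L (LINT z|lebesgue. \<phi>' z e *\<^sub>R f z)"
     "(LINT z|lebesgue. L (\<phi> z *\<^sub>R g z)) = L (LINT z|lebesgue. \<phi> z *\<^sub>R g z)"
    by (auto intro!: integral_bounded_linear assms(2))
  moreover have "(LINT z|lebesgue. \<phi>' z e *\<^sub>R f z) = - (LINT z|lebesgue. \<phi> z *\<^sub>R g z)"
    using assms(1) h unfolding has_weak_deriv_iff[OF assms(3)] by blast
  ultimately show "(LINT z|lebesgue. \<phi>' z e *\<^sub>R L (f z)) = - (LINT z|lebesgue. \<phi> z *\<^sub>R L (g z))"
    by (simp add: scaleR neg)
qed

lemma has_weak_deriv_add:
  fixes f :: "complex \<Rightarrow> 'a::euclidean_space"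
  assumes "has_weak_deriv D e f f'" "has_weak_deriv D e g g'" "open D"
  shows "has_weak_deriv D e (\<lambda>z. f z + g z) (\<lambda>z. f' z + g' z)"
  unfolding has_weak_deriv_iff[OF assms(3)]
proof (intro conjI allI impI)
  note l = has_weak_deriv_locally_integrable[OF assms(1)] has_weak_deriv_locally_integrable[OF assms(2)]
  show "locally_integrable D (\<lambda>z. f z + g z)" "locally_integrable D (\<lambda>z. f' z + g' z)"
    using l unfolding locally_integrable_def by auto
  fix \<phi> :: "complex \<Rightarrow> real" and \<phi>' K
  assume h: "C1_on UNIV \<phi> \<phi>'" "compact K" "K \<subseteq> D" "\<forall>z. z \<notin> K \<longrightarrow> \<phi> z = 0"
  have v: "\<And>z. z \<notin> K \<Longrightarrow> \<phi>' z e = 0"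
    using C1_on_vanish[OF h(1) compact_imp_closed[OF h(2)]] h by blast
  have "continuous_on D (\<lambda>z. \<phi>' z e)" "continuous_on D \<phi>"
    using C1_onD(2)[OF h(1)] C1_on_imp_continuous_on[OF h(1)] continuous_on_subset by blast+
  then have i: "integrable lebesgue (\<lambda>z. \<phi>' z e *\<^sub>R f z)" "integrable lebesgue (\<lambda>z. \<phi> z *\<^sub>R f' z)"
    "integrable lebesgue (\<lambda>z. \<phi>' z e *\<^sub>R g z)" "integrable lebesgue (\<lambda>z. \<phi> z *\<^sub>R g' z)"
    using h v l by (auto intro!: integrable_scaleR_compact_support[of D _ _ K])
  moreover have "(LINT z|lebesgue. \<phi>' z e *\<^sub>R f z) = - (LINT z|lebesgue. \<phi> z *\<^sub>R f' z)"
    "(LINT z|lebesgue. \<phi>' z e *\<^sub>R g z) = - (LINT z|lebesgue. \<phi> z *\<^sub>R g' z)"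
    using assms(1,2) h unfolding has_weak_deriv_iff[OF assms(3)] by blast+
  ultimately show "(LINT z|lebesgue. \<phi>' z e *\<^sub>R (f z + g z)) = - (LINT z|lebesgue. \<phi> z *\<^sub>R (f' z + g' z))"
    by (simp add: scaleR_add_right)
qed

lemma has_weak_deriv_minus:
  fixes f :: "complex \<Rightarrow> 'a::euclidean_space"
  assumes "has_weak_deriv D e f f'" "open D"
  shows "has_weak_deriv D e (\<lambda>z. - f z) (\<lambda>z. - f' z)"
  using has_weak_deriv_linear[OF assms(1) bounded_linear_minus[OF bounded_linear_ident] assms(2)] .

lemma has_weak_deriv_diff:
  fixes f :: "complex \<Rightarrow> 'a::euclidean_space"
  assumes "has_weak_deriv D e f f'" "has_weak_deriv D e g g'" "open D"
  shows "has_weak_deriv D e (\<lambda>z. f z - g z) (\<lambda>z. f' z - g' z)"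
  using has_weak_deriv_add[OF assms(1) has_weak_deriv_minus[OF assms(2,3)] assms(3)] by simp

text \<open>A test function times \<open>f\<close> has compact support, so the integral of its
  directional derivative vanishes; the product rule splits that integral into the two sides.\<close>

lemma C1_on_imp_has_weak_deriv:
  fixes f :: "complex \<Rightarrow> 'a::euclidean_space"
  assumes "C1_on D f f'" "open D"
  shows "has_weak_deriv D e f (\<lambda>z. f' z e)"
  unfolding has_weak_deriv_iff[OF assms(2)]
proof (intro conjI allI impI)
  show l: "locally_integrable D f" "locally_integrable D (\<lambda>z. f' z e)"
    by (intro locally_integrable_continuous C1_on_imp_continuous_on[OF assms(1)] C1_onD(2)[OF assms(1)])+
  fix \<phi> :: "complex \<Rightarrow> real" and \<phi>' K
  assume h: "C1_on UNIV \<phi> \<phi>'" "compact K" "K \<subseteq> D" "\<forall>z. z \<notin> K \<longrightarrow> \<phi> z = 0"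
  have v: "\<And>z. z \<notin> K \<Longrightarrow> \<phi>' z e = 0"
    using C1_on_vanish[OF h(1) compact_imp_closed[OF h(2)]] h by blast
  have c: "continuous_on D (\<lambda>z. \<phi>' z e)" "continuous_on D \<phi>"
    using C1_onD(2)[OF h(1)] C1_on_imp_continuous_on[OF h(1)] continuous_on_subset by blast+
  have i: "integrable lebesgue (\<lambda>z. \<phi>' z e *\<^sub>R f z)" "integrable lebesgue (\<lambda>z. \<phi> z *\<^sub>R f' z e)"
    using h v l c by (auto intro!: integrable_scaleR_compact_support[of D _ _ K])
  have "C1_on UNIV (\<lambda>z. \<phi> z *\<^sub>R f z) (\<lambda>z h. \<phi> z *\<^sub>R f' z h + \<phi>' z h *\<^sub>R f z)"
    by (rule C1_on_times_compact_support[OF bounded_bilinear_scaleR h(1) assms h(2,3)]) (use h in auto)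
  from integral_C1_compact_support(2)[OF this h(2)] h(4)
  have "(LINT z|lebesgue. \<phi> z *\<^sub>R f' z e + \<phi>' z e *\<^sub>R f z) = 0" by simp
  then show "(LINT z|lebesgue. \<phi>' z e *\<^sub>R f z) = - (LINT z|lebesgue. \<phi> z *\<^sub>R f' z e)"
    using i by (simp add: add_eq_0_iff)
qed

text \<open>Weak derivatives are defined with real test functions. Complex ones arise once test
  functions are multiplied by exponentials or Cauchy kernels; they are split into real and imaginary
  parts.\<close>

lemma weak_deriv_complex_test:
  fixes u :: "complex \<Rightarrow> complex"
  assumes "has_weak_deriv D e u u'" "open D" "C1_on UNIV \<Phi> \<Phi>'" "compact K" "K \<subseteq> D"
    and "\<And>z. z \<notin> K \<Longrightarrow> \<Phi> z = (0::complex)"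
  shows "(LINT z|lebesgue. \<Phi>' z e * u z) = - (LINT z|lebesgue. \<Phi> z * u' z)"
    and "integrable lebesgue (\<lambda>z. \<Phi>' z e * u z)" "integrable lebesgue (\<lambda>z. \<Phi> z * u' z)"
proof -
  note l = has_weak_deriv_locally_integrable[OF assms(1)]
  have W: "(LINT z|lebesgue. \<phi>' z e *\<^sub>R u z) = - (LINT z|lebesgue. \<phi> z *\<^sub>R u' z)"
    if "C1_on UNIV \<phi> \<phi>'" "compact K" "K \<subseteq> D" "\<And>z. z \<notin> K \<Longrightarrow> \<phi> z = 0" for \<phi> :: "complex \<Rightarrow> real" and \<phi>'
    using assms(1) that unfolding has_weak_deriv_iff[OF assms(2)] by blast
  have R: "C1_on UNIV (\<lambda>z. Re (\<Phi> z)) (\<lambda>z h. Re (\<Phi>' z h))" and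
    I: "C1_on UNIV (\<lambda>z. Im (\<Phi> z)) (\<lambda>z h. Im (\<Phi>' z h))"
    using C1_on_linear[OF assms(3)] bounded_linear_Re bounded_linear_Im by blast+
  have v: "\<And>z. z \<notin> K \<Longrightarrow> \<Phi>' z e = 0"
    using C1_on_vanish[OF assms(3) compact_imp_closed[OF assms(4)]] assms(6) by blast
  have c: "continuous_on D (\<lambda>z. \<Phi>' z e)" "continuous_on D \<Phi>"
    using C1_onD(2)[OF assms(3)] C1_on_imp_continuous_on[OF assms(3)] continuous_on_subset by blast+
  have c2: "continuous_on D (\<lambda>z. Re (\<Phi>' z e))" "continuous_on D (\<lambda>z. Im (\<Phi>' z e))"
    "continuous_on D (\<lambda>z. Re (\<Phi> z))" "continuous_on D (\<lambda>z. Im (\<Phi> z))"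
    by (intro continuous_intros c)+
  have i: "integrable lebesgue (\<lambda>z. Re (\<Phi>' z e) *\<^sub>R u z)" "integrable lebesgue (\<lambda>z. Im (\<Phi>' z e) *\<^sub>R u z)"
     "integrable lebesgue (\<lambda>z. Re (\<Phi> z) *\<^sub>R u' z)" "integrable lebesgue (\<lambda>z. Im (\<Phi> z) *\<^sub>R u' z)"
    using assms(4-6) v l c2
    by (auto intro!: integrable_scaleR_compact_support[of D _ _ K])
  have eq: "\<Phi>' z e * u z = Re (\<Phi>' z e) *\<^sub>R u z + \<i> * (Im (\<Phi>' z e) *\<^sub>R u z)"
    "\<Phi> z * u' z = Re (\<Phi> z) *\<^sub>R u' z + \<i> * (Im (\<Phi> z) *\<^sub>R u' z)" for z
    by (simp_all add: complex_eq_iff)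
  show "integrable lebesgue (\<lambda>z. \<Phi>' z e * u z)" "integrable lebesgue (\<lambda>z. \<Phi> z * u' z)"
    unfolding eq using i by (auto intro!: Bochner_Integration.integrable_add integrable_mult_right simp del: mult_scaleR_right)
  have "(LINT z|lebesgue. Re (\<Phi>' z e) *\<^sub>R u z) = - (LINT z|lebesgue. Re (\<Phi> z) *\<^sub>R u' z)"
    "(LINT z|lebesgue. Im (\<Phi>' z e) *\<^sub>R u z) = - (LINT z|lebesgue. Im (\<Phi> z) *\<^sub>R u' z)"
    by (rule W[OF R assms(4,5)], simp add: assms(6), rule W[OF I assms(4,5)], simp add: assms(6))
  then show "(LINT z|lebesgue. \<Phi>' z e * u z) = - (LINT z|lebesgue. \<Phi> z * u' z)"
    unfolding eq using i by (simp del: mult_scaleR_right)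
qed

text \<open>For a real test function \<open>\<phi>\<close> the product of \<open>\<phi>\<close> and
  \<open>g\<close> is an admissible complex test function for \<open>u\<close>; expanding its
  derivative gives the product rule.\<close>

lemma has_weak_deriv_mult:
  fixes u g :: "complex \<Rightarrow> complex"
  assumes "has_weak_deriv D e u u'" "C1_on D g g'" "open D"
  shows "has_weak_deriv D e (\<lambda>z. g z * u z) (\<lambda>z. g z * u' z + g' z e * u z)"
  unfolding has_weak_deriv_iff[OF assms(3)]
proof (intro conjI allI impI)
  note l = has_weak_deriv_locally_integrable[OF assms(1)]
  have c: "continuous_on D g" "continuous_on D (\<lambda>z. g' z e)"
    by (intro C1_on_imp_continuous_on[OF assms(2)] C1_onD(2)[OF assms(2)])+
  note lm = locally_integrable_bilinear[OF bounded_bilinear_mult]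
  have l2: "locally_integrable D (\<lambda>z. g z * u z)" "locally_integrable D (\<lambda>z. g z * u' z)"
    "locally_integrable D (\<lambda>z. g' z e * u z)"
    by (intro lm l c)+
  then show "locally_integrable D (\<lambda>z. g z * u z)" "locally_integrable D (\<lambda>z. g z * u' z + g' z e * u z)"
    unfolding locally_integrable_def by auto
  fix \<phi> :: "complex \<Rightarrow> real" and \<phi>' K
  assume h: "C1_on UNIV \<phi> \<phi>'" "compact K" "K \<subseteq> D" "\<forall>z. z \<notin> K \<longrightarrow> \<phi> z = 0"
  have v: "\<And>z. z \<notin> K \<Longrightarrow> \<phi>' z e = 0"
    using C1_on_vanish[OF h(1) compact_imp_closed[OF h(2)]] h by blast
  have c: "continuous_on D (\<lambda>z. \<phi>' z e)" "continuous_on D \<phi>"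
    using C1_onD(2)[OF h(1)] C1_on_imp_continuous_on[OF h(1)] continuous_on_subset by blast+
  have i: "integrable lebesgue (\<lambda>z. \<phi>' z e *\<^sub>R (g z * u z))" "integrable lebesgue (\<lambda>z. \<phi> z *\<^sub>R (g z * u' z))"
    "integrable lebesgue (\<lambda>z. \<phi> z *\<^sub>R (g' z e * u z))"
    using h v l2 c by (auto intro!: integrable_scaleR_compact_support[of D _ _ K])
  have "C1_on UNIV (\<lambda>z. \<phi> z *\<^sub>R g z) (\<lambda>z h. \<phi> z *\<^sub>R g' z h + \<phi>' z h *\<^sub>R g z)"
    by (rule C1_on_times_compact_support[OF bounded_bilinear_scaleR h(1) assms(2,3) h(2,3)]) (use h in auto)
  from weak_deriv_complex_test(1)[OF assms(1,3) this h(2,3)] h(4)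
  have "(LINT z|lebesgue. (\<phi> z *\<^sub>R g' z e + \<phi>' z e *\<^sub>R g z) * u z) = - (LINT z|lebesgue. \<phi> z *\<^sub>R g z * u' z)"
    by simp
  moreover have "(\<phi> z *\<^sub>R g' z e + \<phi>' z e *\<^sub>R g z) * u z = \<phi> z *\<^sub>R (g' z e * u z) + \<phi>' z e *\<^sub>R (g z * u z)" for z
    by (simp add: algebra_simps)
  ultimately have "(LINT z|lebesgue. \<phi> z *\<^sub>R (g' z e * u z)) + (LINT z|lebesgue. \<phi>' z e *\<^sub>R (g z * u z)) =
      - (LINT z|lebesgue. \<phi> z *\<^sub>R (g z * u' z))"
    using i by (simp add: algebra_simps)
  then show "(LINT z|lebesgue. \<phi>' z e *\<^sub>R (g z * u z)) = - (LINT z|lebesgue. \<phi> z *\<^sub>R (g z * u' z + g' z e * u z))"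
    using i by (simp add: scaleR_add_right algebra_simps add_eq_0_iff)
qed

section \<open>The fundamental lemma of the calculus of variations\<close>

lemma C1_on_real_compose:
  assumes "C1_on S f f'" "\<And>x. (h has_real_derivative h' x) (at x)" "continuous_on UNIV h'"
  shows "C1_on S (\<lambda>z. h (f z)) (\<lambda>z k. h' (f z) * f' z k)"
proof (rule C1_onI)
  have h: "(h has_derivative (\<lambda>k. h' x * k)) (at x)" for x
    using assms(2) by (simp add: has_field_derivative_def)
  show "((\<lambda>z. h (f z)) has_derivative (\<lambda>k. h' (f z) * f' z k)) (at z)" if "z \<in> S" for z
    using has_derivative_compose[OF C1_onD(1)[OF assms(1) that] h] .
  have "continuous_on S (\<lambda>z. h' (f z))"
    using continuous_on_compose2[OF assms(3) C1_on_imp_continuous_on[OF assms(1)]] by simp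
  then show "continuous_on S (\<lambda>z. h' (f z) * f' z e)" for e
    by (intro continuous_on_mult C1_onD(2)[OF assms(1)])
qed

text \<open>Squaring the positive part is enough for a continuous derivative, which is all the
  smoothness that test functions must have.\<close>

definition pos_sq :: "real \<Rightarrow> real" where "pos_sq t = (max 0 t)\<^sup>2"

lemma pos_sq_deriv: "(pos_sq has_real_derivative 2 * max 0 t) (at t)"
proof -
  consider "t > 0" | "t < 0" | "t = 0" by linarith
  then show ?thesis
  proof cases
    case 1
    have "((\<lambda>t. t\<^sup>2) has_real_derivative 2 * max 0 t) (at t)"
      using 1 by (auto intro!: derivative_eq_intros)
    then show ?thesis
      by (rule has_field_derivative_transform_within_open[of _ _ _ "{0<..}"])
        (use 1 in \<open>auto simp: pos_sq_def\<close>)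
  next
    case 2
    have "((\<lambda>t. 0) has_real_derivative 2 * max 0 t) (at t)"
      using 2 by (auto intro!: derivative_eq_intros)
    then show ?thesis
      by (rule has_field_derivative_transform_within_open[of _ _ _ "{..<0}"])
        (use 2 in \<open>auto simp: pos_sq_def\<close>)
  next
    case 3
    have "((\<lambda>h. (pos_sq h - pos_sq 0) / h) \<longlongrightarrow> 0) (at 0)"
    proof (rule Lim_null_comparison)
      show "\<forall>\<^sub>F h in at 0. norm ((pos_sq h - pos_sq 0) / h) \<le> \<bar>h\<bar>"
        by (auto simp: eventually_at_filter pos_sq_def max_def power2_eq_square)
      show "((\<lambda>h. \<bar>h\<bar>) \<longlongrightarrow> (0::real)) (at 0)" by (rule tendsto_eq_intros refl | simp)+
    qed
    then show ?thesis using 3 by (simp add: has_field_derivative_iff)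
  qed
qed

lemma pos_sq_simps: "pos_sq t \<ge> 0" "t \<le> 0 \<Longrightarrow> pos_sq t = 0" "pos_sq t > 0 \<longleftrightarrow> t > 0"
  by (auto simp: pos_sq_def max_def)

lemma C1_on_pos_sq:
  assumes "C1_on S f f'"
  shows "C1_on S (\<lambda>z. pos_sq (f z)) (\<lambda>z k. 2 * max 0 (f z) * f' z k)"
  by (rule C1_on_real_compose[OF assms pos_sq_deriv]) (intro continuous_intros)

text \<open>One factor \<open>pos_sq\<close> for each of the four sides. Being positive exactly on
  the open box, such a function generates approximations to the indicator of the box.\<close>

lemma C1_on_ex_box_bump:
  fixes p q :: complex
  obtains b b' where "C1_on UNIV b b'" "\<And>z. b z \<ge> (0::real)" "\<And>z. b z > 0 \<longleftrightarrow> z \<in> box p q"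
proof -
  have R: "C1_on UNIV (\<lambda>z. Re z - c) (\<lambda>z h. Re h - 0)" and I: "C1_on UNIV (\<lambda>z. Im z - c) (\<lambda>z h. Im h - 0)"
    and R2: "C1_on UNIV (\<lambda>z. c - Re z) (\<lambda>z h. 0 - Re h)" and I2: "C1_on UNIV (\<lambda>z. c - Im z) (\<lambda>z h. 0 - Im h)" for c
    by (auto intro!: C1_onI derivative_eq_intros)
  let ?b = "\<lambda>z. pos_sq (Re z - Re p) * pos_sq (Re q - Re z) * (pos_sq (Im z - Im p) * pos_sq (Im q - Im z))"
  have "\<exists>b'. C1_on UNIV ?b b'"
    by (rule exI) (rule C1_on_mult C1_on_pos_sq R I R2 I2)+
  then obtain b' where b': "C1_on UNIV ?b b'" by blast
  show ?thesis
  proof (rule that[OF b'])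
    show "?b z \<ge> 0" for z by (simp add: pos_sq_simps)
    have "?b z > 0 \<longleftrightarrow> Re p < Re z \<and> Re z < Re q \<and> Im p < Im z \<and> Im z < Im q" for z
      using pos_sq_simps(1)[of "Re z - Re p"] pos_sq_simps(1)[of "Re q - Re z"]
        pos_sq_simps(1)[of "Im z - Im p"] pos_sq_simps(1)[of "Im q - Im z"]
        pos_sq_simps(3)[of "Re z - Re p"] pos_sq_simps(3)[of "Re q - Re z"]
        pos_sq_simps(3)[of "Im z - Im p"] pos_sq_simps(3)[of "Im q - Im z"]
      by (auto simp: zero_less_mult_iff)
    then show "?b z > 0 \<longleftrightarrow> z \<in> box p q" for z
      by (auto simp: in_box_complex_iff)
  qed
qed

lemma C1_on_ex_cutoff:
  fixes z0 :: complex
  assumes "0 < r" "r < R"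
  obtains ch ch' where "C1_on UNIV ch ch'" "\<And>z. z \<in> cball z0 r \<Longrightarrow> ch z = (1::real)"
    "\<And>z. z \<notin> cball z0 R \<Longrightarrow> ch z = 0"
proof -
  \<comment> \<open>A transition from 0 for \<open>s \<le> 0\<close> to 1 for
    \<open>s \<ge> 1\<close>. The denominator never vanishes, because \<open>s\<close> and
    \<open>1 - s\<close> are not both nonpositive.\<close>
  define \<eta> where "\<eta> s = pos_sq s / (pos_sq s + pos_sq (1 - s))" for s
  have pos: "pos_sq s + pos_sq (1 - s) > 0" for s
    using pos_sq_simps(1)[of s] pos_sq_simps(1)[of "1-s"] pos_sq_simps(3)[of s] pos_sq_simps(3)[of "1-s"]
    by linarith
  have cp: "continuous_on UNIV pos_sq"
    using pos_sq_deriv by (meson DERIV_isCont continuous_at_imp_continuous_on)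
  have cp2: "continuous_on UNIV (\<lambda>s. pos_sq (1 - s))"
    by (rule continuous_on_compose2[OF cp]) (auto intro!: continuous_intros)
  define \<eta>' where "\<eta>' s = (2 * max 0 s * (pos_sq s + pos_sq (1 - s)) -
      pos_sq s * (2 * max 0 s - 2 * max 0 (1 - s))) / ((pos_sq s + pos_sq (1 - s)) * (pos_sq s + pos_sq (1 - s)))" for s
  have d1: "((\<lambda>s. pos_sq (1 - s)) has_real_derivative - (2 * max 0 (1 - s))) (at s)" for s
  proof -
    have "((\<lambda>s. 1 - s) has_real_derivative -1) (at s)" by (auto intro!: derivative_eq_intros)
    from DERIV_chain2[OF pos_sq_deriv this] show ?thesis by simp
  qed
  have d: "(\<eta> has_real_derivative \<eta>' s) (at s)" for s
    unfolding \<eta>_def[abs_def] \<eta>'_def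
    by (rule DERIV_cong[OF DERIV_quotient[OF pos_sq_deriv DERIV_add[OF pos_sq_deriv d1]]])
       (use pos[of s] in \<open>auto simp: power2_eq_square\<close>)
  have c: "continuous_on UNIV \<eta>'"
    unfolding \<eta>'_def[abs_def] using pos
    by (intro continuous_intros cp cp2) (metis less_irrefl mult_eq_0_iff)
  have R: "C1_on UNIV (\<lambda>z. Re z - c) (\<lambda>z h. Re h - 0)" and I: "C1_on UNIV (\<lambda>z. Im z - c) (\<lambda>z h. Im h - 0)" for c
    by (auto intro!: C1_onI derivative_eq_intros)
  \<comment> \<open>Affine in the squared distance to \<open>z0\<close>, with value 1 at distance
    \<open>r\<close> and 0 at distance \<open>R\<close>. The squared distance, unlike the distance,
    is differentiable at \<open>z0\<close>.\<close>
  define f where "f z = (1 / (R\<^sup>2 - r\<^sup>2)) * (R\<^sup>2 - ((Re z - Re z0) * (Re z - Re z0) + (Im z - Im z0) * (Im z - Im z0)))" for z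
  have "\<exists>f'. C1_on UNIV f f'"
    unfolding f_def[abs_def] by (rule exI) (rule R I C1_on_const C1_on_mult C1_on_diff C1_on_add)+
  then obtain f' where f: "C1_on UNIV f f'" by blast
  have feq: "f z = (R\<^sup>2 - (dist z0 z)\<^sup>2) / (R\<^sup>2 - r\<^sup>2)" for z
  proof -
    have "(dist z0 z)\<^sup>2 = (Re z0 - Re z)\<^sup>2 + (Im z0 - Im z)\<^sup>2" by (simp add: dist_norm cmod_power2)
    also have "\<dots> = (Re z - Re z0) * (Re z - Re z0) + (Im z - Im z0) * (Im z - Im z0)"
      by (simp add: power2_eq_square algebra_simps)
    finally show ?thesis by (simp add: f_def)
  qed
  have pos2: "R\<^sup>2 - r\<^sup>2 > 0" using assms by (simp add: power_strict_mono)
  show ?thesis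
  proof (rule that)
    show "C1_on UNIV (\<lambda>z. \<eta> (f z)) (\<lambda>z k. \<eta>' (f z) * f' z k)"
      by (rule C1_on_real_compose[OF f d c])
    show "\<eta> (f z) = 1" if "z \<in> cball z0 r" for z
    proof -
      have "(dist z0 z)\<^sup>2 \<le> r\<^sup>2" using that by (simp add: power_mono)
      then have "f z \<ge> 1" unfolding feq using pos2 by (simp add: field_simps)
      then have "pos_sq (1 - f z) = 0" by (simp add: pos_sq_simps)
      then show ?thesis using pos[of "f z"] by (simp add: \<eta>_def)
    qed
    show "\<eta> (f z) = 0" if "z \<notin> cball z0 R" for z
    proof -
      have "(dist z0 z)\<^sup>2 \<ge> R\<^sup>2" using that assms by (simp add: power_mono)
      then have "f z \<le> 0" unfolding feq using pos2 by (simp add: field_simps)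
      then show ?thesis by (simp add: \<eta>_def pos_sq_simps)
    qed
  qed
qed

lemma LINT_indicator_box_eq_0:
  fixes f :: "complex \<Rightarrow> complex"
  assumes "locally_integrable D f" "cbox p q \<subseteq> D"
    and z: "\<And>\<phi> \<phi>' K. C1_on UNIV \<phi> \<phi>' \<Longrightarrow> compact K \<Longrightarrow> K \<subseteq> D \<Longrightarrow> (\<And>z. z \<notin> K \<Longrightarrow> \<phi> z = 0) \<Longrightarrow>
       (LINT z|lebesgue. \<phi> z *\<^sub>R f z) = 0"
  shows "(LINT z|lebesgue. indicator (box p q) z *\<^sub>R f z) = 0"
proof -
  obtain b b' where b: "C1_on UNIV b b'" "\<And>z. b z \<ge> (0::real)" "\<And>z. b z > 0 \<longleftrightarrow> z \<in> box p q"
    using C1_on_ex_box_bump by blast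
  \<comment> \<open>\<open>h n t\<close> equals \<open>n * t ^ 2 / (1 + n * t ^ 2)\<close>: it
    vanishes at 0, stays in the unit interval and tends to 1 for \<open>t > 0\<close>. Hence
    \<open>h n (b z)\<close> tends to the indicator of the open box, and dominated convergence
    applies.\<close>
  define h where "h n t = 1 - 1 / (1 + real n * t\<^sup>2)" for n t
  define h' where "h' n t = (2 * real n * t) / (1 + real n * t\<^sup>2)\<^sup>2" for n t
  have nz: "1 + real n * t\<^sup>2 > 0" for n t by (simp add: add_pos_nonneg)
  have hd: "(h n has_real_derivative h' n t) (at t)" for n t
    unfolding h_def[abs_def] h'_def using nz[of n t]
    by (auto intro!: derivative_eq_intros simp: power2_eq_square)
  have nz0: "1 + real n * t\<^sup>2 \<noteq> 0" for n t using nz[of n t] by linarith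
  have hc: "continuous_on UNIV (h' n)" for n
    unfolding h'_def[abs_def] by (intro continuous_intros) (simp add: nz0)
  have C: "C1_on UNIV (\<lambda>z. h n (b z)) (\<lambda>z k. h' n (b z) * b' z k)" for n
    by (rule C1_on_real_compose[OF b(1) hd hc])
  have b0: "b z = 0" if "z \<notin> box p q" for z using b(2)[of z] b(3)[of z] that by linarith
  then have s: "h n (b z) = 0" if "z \<notin> cbox p q" for n z
  proof -
    have "b z = 0" using b0[of z] box_subset_cbox[of p q] that by blast
    then show ?thesis by (simp add: h_def)
  qed
  have zero: "(LINT z|lebesgue. h n (b z) *\<^sub>R f z) = 0" for n
    by (rule z[OF C compact_cbox assms(2) s])
  have bd: "0 \<le> h n t" "h n t \<le> 1" for n t
    using nz[of n t] by (auto simp: h_def field_simps)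
  have int: "integrable lebesgue (\<lambda>z. indicator (cbox p q) z *\<^sub>R f z)"
    by (rule locally_integrableD[OF assms(1) compact_cbox assms(2)])
  have m: "(\<lambda>z. indicator (box p q) z *\<^sub>R f z) \<in> borel_measurable lebesgue"
  proof -
    have "(\<lambda>z. indicator (box p q) z *\<^sub>R (indicator (cbox p q) z *\<^sub>R f z)) \<in> borel_measurable lebesgue"
      using int by (intro borel_measurable_scaleR borel_measurable_indicator borel_measurable_integrable) auto
    moreover have "(\<lambda>z. indicator (box p q) z *\<^sub>R (indicator (cbox p q) z *\<^sub>R f z)) = (\<lambda>z. indicator (box p q) z *\<^sub>R f z)"
      using box_subset_cbox by (fastforce simp: indicator_def fun_eq_iff)
    ultimately show ?thesis by simp
  qed
  have "(\<lambda>n. LINT z|lebesgue. h n (b z) *\<^sub>R f z) \<longlonglongrightarrow> (LINT z|lebesgue. indicator (box p q) z *\<^sub>R f z)"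
  proof (rule integral_dominated_convergence[OF m _ integrable_norm[OF int]])
    show "(\<lambda>z. h n (b z) *\<^sub>R f z) \<in> borel_measurable lebesgue" for n
      by (rule borel_measurable_integrable,
          rule integrable_scaleR_compact_support[OF assms(1) _ compact_cbox assms(2) s])
        (rule continuous_on_subset[OF C1_on_imp_continuous_on[OF C] subset_UNIV])
    show "AE z in lebesgue. norm (h n (b z) *\<^sub>R f z) \<le> norm (indicator (cbox p q) z *\<^sub>R f z)" for n
    proof (rule AE_I2)
      show "norm (h n (b z) *\<^sub>R f z) \<le> norm (indicator (cbox p q) z *\<^sub>R f z)" for z
        using bd[of n "b z"] s[of z n] by (auto simp: indicator_def mult_left_le_one_le)
    qed
    show "AE z in lebesgue. (\<lambda>n. h n (b z) *\<^sub>R f z) \<longlonglongrightarrow> indicator (box p q) z *\<^sub>R f z"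
    proof (rule AE_I2, rule tendsto_scaleR[OF _ tendsto_const])
      fix z
      show "(\<lambda>n. h n (b z)) \<longlonglongrightarrow> indicator (box p q) z"
      proof (cases "z \<in> box p q")
        case True
        then have "b z > 0" using b(3) by blast
        then have "(\<lambda>n. h n (b z)) \<longlonglongrightarrow> 1" unfolding h_def by real_asymp
        then show ?thesis using True by simp
      qed (simp add: b0 h_def)
    qed
  qed
  then show ?thesis by (simp add: zero LIMSEQ_const_iff)
qed

text \<open>A Borel representative is needed where an argument runs over the Borel sets, as in the
  induction over a generator, or over a product of Borel measures, as in Fubini's theorem.\<close>

lemma completion_ex_borel_complex:
  fixes f :: "complex \<Rightarrow> complex"
  assumes "f \<in> borel_measurable lebesgue"
  obtains g where "g \<in> borel_measurable borel" "AE z in lebesgue. f z = g z"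
proof -
  have "(\<lambda>z. Re (f z)) \<in> borel_measurable lebesgue" "(\<lambda>z. Im (f z)) \<in> borel_measurable lebesgue"
    using assms by auto
  from completion_ex_borel_measurable_real[OF this(1)] completion_ex_borel_measurable_real[OF this(2)]
  obtain a b where [measurable]: "a \<in> borel_measurable lborel" "b \<in> borel_measurable lborel"
    and "AE z in lborel. Re (f z) = a z" "AE z in lborel. Im (f z) = b z"
    by blast
  then have "AE z in lborel. f z = Complex (a z) (b z)" by (auto simp: complex_eq_iff)
  then have "AE z in lebesgue. f z = Complex (a z) (b z)" by (rule AE_completion)
  moreover have "(\<lambda>z. Complex (a z) (b z)) \<in> borel_measurable borel"
    by (simp add: borel_measurable_complex_iff)
  ultimately show ?thesis using that by blast
qed

lemma box_Int_stable: "Int_stable (range (\<lambda>(a, b). box a b :: complex set))"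
  by (auto simp: Int_stable_def box_Int_box)

text \<open>Open boxes are stable under intersection and generate the Borel sets. As the integral
  over every box vanishes, a Dynkin argument extends this to every Borel set, and a function all of
  whose integrals vanish is zero almost everywhere.\<close>

lemma AE_box_eq_0:
  fixes f :: "complex \<Rightarrow> complex"
  assumes "locally_integrable D f" "cbox a b \<subseteq> D"
    and z: "\<And>\<phi> \<phi>' K. C1_on UNIV \<phi> \<phi>' \<Longrightarrow> compact K \<Longrightarrow> K \<subseteq> D \<Longrightarrow> (\<And>z. z \<notin> K \<Longrightarrow> \<phi> z = 0) \<Longrightarrow>
       (LINT z|lebesgue. \<phi> z *\<^sub>R f z) = 0"
  shows "AE z in lebesgue. z \<in> box a b \<longrightarrow> f z = 0"
proof -
  let ?f = "\<lambda>z. indicator (box a b) z *\<^sub>R f z"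
  have int: "integrable lebesgue (\<lambda>z. indicator (cbox a b) z *\<^sub>R f z)"
    by (rule locally_integrableD[OF assms(1) compact_cbox assms(2)])
  have "integrable lebesgue (\<lambda>z. indicator (box a b) z *\<^sub>R (indicator (cbox a b) z *\<^sub>R f z))"
    by (rule integrable_mult_indicator[OF _ int]) auto
  moreover have "(\<lambda>z. indicator (box a b) z *\<^sub>R (indicator (cbox a b) z *\<^sub>R f z)) = ?f"
    using box_subset_cbox by (fastforce simp: indicator_def fun_eq_iff)
  ultimately have intf: "integrable lebesgue ?f" by simp
  obtain g where g[measurable]: "g \<in> borel_measurable borel" and ae: "AE z in lebesgue. ?f z = g z"
    using completion_ex_borel_complex[OF borel_measurable_integrable[OF intf]] by blast
  have "integrable lebesgue g"
    using intf by (rule integrable_cong_AE_imp) (use ae g in \<open>auto intro: borel_measurable_lebesgueI simp: eq_commute\<close>)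
  then have gi: "integrable lborel g" by (simp add: integrable_completion)
  have boxes: "(LINT z|lborel. indicator (box c d) z *\<^sub>R g z) = 0" for c d
  proof -
    obtain p q where pq: "box c d \<inter> box a b = box p q" using box_Int_box[of c d a b] by blast
    have "(LINT z|lborel. indicator (box c d) z *\<^sub>R g z) = (LINT z|lebesgue. indicator (box c d) z *\<^sub>R g z)"
      by (subst integral_completion) auto
    also have "\<dots> = (LINT z|lebesgue. indicator (box c d) z *\<^sub>R ?f z)"
    proof (rule integral_cong_AE)
      show "(\<lambda>z. indicator (box c d) z *\<^sub>R g z) \<in> borel_measurable lebesgue"
        by (rule borel_measurable_lebesgueI) measurable
      show "(\<lambda>z. indicator (box c d) z *\<^sub>R ?f z) \<in> borel_measurable lebesgue"
        by (rule borel_measurable_integrable, rule integrable_mult_indicator[OF _ intf]) auto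
      show "AE z in lebesgue. indicator (box c d) z *\<^sub>R g z = indicator (box c d) z *\<^sub>R ?f z"
        using ae by eventually_elim simp
    qed
    also have "\<dots> = (LINT z|lebesgue. indicator (box p q) z *\<^sub>R f z)"
      by (rule Bochner_Integration.integral_cong) (auto simp: pq[symmetric] indicator_def)
    also have "\<dots> = 0"
    \<comment> \<open>An empty open box may belong to a degenerate, nonempty \<open>cbox p q\<close>
      that need not lie in \<open>D\<close>; this case is settled by the integrand being
      zero.\<close>
    proof (cases "box p q = {}")
      case False
      have "cbox p q = closure (box p q)" using False by (simp add: closure_box)
      also have "\<dots> \<subseteq> closure (box a b)" by (rule closure_mono) (use pq in auto)
      also have "\<dots> \<subseteq> cbox a b" by (rule closure_minimal[OF box_subset_cbox closed_cbox])
      finally have "cbox p q \<subseteq> D" using assms(2) by blast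
      then show ?thesis by (rule LINT_indicator_box_eq_0[OF assms(1) _ z])
    qed simp
    finally show ?thesis .
  qed
  have "AE z in lborel. g z = 0"
  proof (rule sigma_finite_measure.density_zero[OF sigma_finite_lborel gi])
    fix A :: "complex set" assume "A \<in> sets lborel"
    then have A: "A \<in> sigma_sets UNIV (range (\<lambda>(a, b). box a b :: complex set))"
      by (simp add: borel_eq_box)
    have "range (\<lambda>(a, b). box a b :: complex set) \<subseteq> Pow UNIV" by simp
    from box_Int_stable this A have "A \<in> sets borel \<and> (LINT z|lborel. indicator A z *\<^sub>R g z) = 0"
    proof (induct rule: sigma_sets_induct_disjoint)
      case (basic A) then show ?case using boxes by auto
    next
      case empty then show ?case by simp
    next
      case (compl A)
      have t: "(LINT z|lborel. g z) = 0"
      proof -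
        have "(LINT z|lborel. g z) = (LINT z|lebesgue. g z)" by (subst integral_completion) auto
        also have "\<dots> = (LINT z|lebesgue. ?f z)"
          by (rule integral_cong_AE)
            (use ae g intf in \<open>auto intro: borel_measurable_lebesgueI borel_measurable_integrable\<close>)
        also have "\<dots> = 0"
          by (rule LINT_indicator_box_eq_0[OF assms(1,2) z])
        finally show ?thesis .
      qed
      have "(LINT z|lborel. indicator (UNIV - A) z *\<^sub>R g z) = (LINT z|lborel. g z - indicator A z *\<^sub>R g z)"
        by (rule Bochner_Integration.integral_cong) (auto simp: indicator_def)
      also have "\<dots> = 0"
        using t compl integrable_mult_indicator[OF _ gi, of A]
        by (subst Bochner_Integration.integral_diff) (auto simp: gi)
      finally show ?case using compl by auto
    next
      case (union A)
      then have U: "(\<Union>i. A i) \<in> sets borel" by auto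
      from union have "set_lebesgue_integral lborel (\<Union>i. A i) g = (\<Sum>i. set_lebesgue_integral lborel (A i) g)"
        using integrable_mult_indicator[OF _ gi, of "\<Union>i. A i"] U
        by (intro lebesgue_integral_countable_add)
          (auto simp: disjoint_family_on_def set_integrable_def)
      then show ?case using union by (auto simp: set_lebesgue_integral_def)
    qed
    then show "set_lebesgue_integral lborel A g = 0" by (simp add: set_lebesgue_integral_def)
  qed
  then have "AE z in lebesgue. g z = 0" by (rule AE_completion)
  with ae show ?thesis by eventually_elim (auto simp: indicator_def split: if_splits)
qed

text \<open>An open set is a countable union of closed boxes, and the frontier of a box is a null
  set, so the result for open boxes suffices.\<close>

theorem fundamental_lemma_variations:
  fixes f :: "complex \<Rightarrow> complex"
  assumes "locally_integrable D f" "open D"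
    and z: "\<And>\<phi> \<phi>' K. C1_on UNIV \<phi> \<phi>' \<Longrightarrow> compact K \<Longrightarrow> K \<subseteq> D \<Longrightarrow> (\<And>z. z \<notin> K \<Longrightarrow> \<phi> z = 0) \<Longrightarrow>
       (LINT z|lebesgue. \<phi> z *\<^sub>R f z) = 0"
  shows "AE z in lebesgue. z \<in> D \<longrightarrow> f z = 0"
proof -
  obtain \<D> where \<D>: "countable \<D>" "\<D> \<subseteq> Pow D" "\<And>X. X \<in> \<D> \<Longrightarrow> \<exists>a b. X = cbox a b" "\<Union>\<D> = D"
    using open_countable_Union_open_cbox[OF assms(2)] by metis
  have "AE z in lebesgue. z \<in> X \<longrightarrow> f z = 0" if "X \<in> \<D>" for X
  proof -
    obtain a b where X: "X = cbox a b" using \<D>(3) \<open>X \<in> \<D>\<close> by blast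
    then have "cbox a b \<subseteq> D" using \<D>(2) \<open>X \<in> \<D>\<close> by blast
    then have "AE z in lebesgue. z \<in> box a b \<longrightarrow> f z = 0"
      by (rule AE_box_eq_0[OF assms(1) _ z])
    moreover have "cbox a b - box a b \<in> null_sets lebesgue"
      using negligible_frontier_interval negligible_iff_null_sets by blast
    then have "AE z in lebesgue. z \<notin> cbox a b - box a b" by (rule AE_not_in)
    ultimately show ?thesis unfolding X by eventually_elim auto
  qed
  then have "AE z in lebesgue. \<forall>X\<in>\<D>. z \<in> X \<longrightarrow> f z = 0"
    unfolding AE_ball_countable[OF \<D>(1)] by blast
  then show ?thesis by eventually_elim (use \<D>(4) in blast)
qed

section \<open>The Cauchy transform\<close>

lemma nn_integral_abs_powr_finite:
  fixes s :: real
  assumes "s < 1"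
  shows "(\<integral>\<^sup>+t. ennreal (indicator {-1..1} t * \<bar>t\<bar> powr (-s)) \<partial>lborel) < \<infinity>"
proof -
  define g where "g t = ennreal (t powr (-s)) * indicator {0..1} t" for t :: real
  have [measurable]: "g \<in> borel_measurable borel" unfolding g_def by measurable
  have "((\<lambda>x. x powr (-s)) has_integral (1 powr (-s+1) / (-s+1))) {0..1}"
    by (rule has_integral_powr_from_0) (use assms in auto)
  from nn_integral_has_integral_lebesgue'[OF _ this]
  have fin: "(\<integral>\<^sup>+t. g t \<partial>lborel) < \<infinity>" unfolding g_def by simp
  have refl: "(\<integral>\<^sup>+t. g t \<partial>lborel) = (\<integral>\<^sup>+t. g (- t) \<partial>lborel)"
    using nn_integral_real_affine[of g "-1" 0] by simp
  have "(\<integral>\<^sup>+t. ennreal (indicator {-1..1} t * \<bar>t\<bar> powr (-s)) \<partial>lborel) \<le> (\<integral>\<^sup>+t. g t + g (-t) \<partial>lborel)"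
    by (rule nn_integral_mono) (auto simp: g_def indicator_def abs_if)
  also have "\<dots> = (\<integral>\<^sup>+t. g t \<partial>lborel) + (\<integral>\<^sup>+t. g (-t) \<partial>lborel)"
    by (rule nn_integral_add) auto
  also have "\<dots> < \<infinity>" using fin refl by (simp add: less_top)
  finally show ?thesis .
qed

text \<open>Since \<open>norm u\<close> dominates both coordinates, \<open>norm u powr (-p)\<close>
  is at most the product of the powers \<open>-(p / 2)\<close> of the coordinates. The double
  integral becomes a product of one-dimensional ones, finite because
  \<open>p / 2 < 1\<close>.\<close>

lemma nn_integral_norm_powr_finite:
  assumes "0 \<le> p" "p < 2"
  shows "(\<integral>\<^sup>+u. ennreal (indicator (cball 0 1) u * norm (u::complex) powr (-p)) \<partial>lborel) < \<infinity>"
proof -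
  define f where "f t = indicator {-1..1} t * \<bar>t\<bar> powr (-(p/2))" for t :: real
  have [measurable]: "f \<in> borel_measurable borel" unfolding f_def by measurable
  have nn: "f t \<ge> 0" for t by (simp add: f_def)
  have ff: "(\<integral>\<^sup>+t. ennreal (f t) \<partial>lborel) < \<infinity>"
    unfolding f_def by (rule nn_integral_abs_powr_finite) (use assms in auto)
  have pr: "(\<Prod>b\<in>Basis. ennreal (f (u \<bullet> b))) = ennreal (f (Re u) * f (Im u))" for u :: complex
  proof -
    have "(1::complex) \<noteq> \<i>" by (simp add: complex_eq_iff)
    then show ?thesis by (simp add: Basis_complex_def inner_complex_def ennreal_mult nn)
  qed
  have "(\<integral>\<^sup>+u. ennreal (f (Re u) * f (Im u)) \<partial>(lborel :: complex measure)) = (\<Prod>b\<in>(Basis::complex set). (\<integral>\<^sup>+t. ennreal (f t) \<partial>lborel))"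
    unfolding pr[symmetric] by (rule nn_integral_lborel_prod) auto
  also have "\<dots> < \<infinity>"
    using ff by (simp add: power_less_top_ennreal)
  finally have fin: "(\<integral>\<^sup>+u. ennreal (f (Re u) * f (Im u)) \<partial>(lborel :: complex measure)) < \<infinity>" .
  \<comment> \<open>The axes are removed because \<open>0 powr x\<close> is 0, so the comparison
    with the product would fail on them.\<close>
  have n1: "{u::complex. Re u = 0} \<in> null_sets lborel" "{u::complex. Im u = 0} \<in> null_sets lborel"
  proof -
    have "negligible {u::complex. 1 \<bullet> u = 0}" "negligible {u::complex. \<i> \<bullet> u = 0}"
      by (rule negligible_hyperplane, simp)+
    moreover have "closed {u::complex. Re u = 0}" "closed {u::complex. Im u = 0}"
      by (auto intro!: closed_Collect_eq continuous_intros)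
    ultimately show "{u::complex. Re u = 0} \<in> null_sets lborel" "{u::complex. Im u = 0} \<in> null_sets lborel"
      by (simp_all add: negligible_iff_null_sets null_sets_completion_iff inner_complex_def borel_closed)
  qed
  have "(\<integral>\<^sup>+u. ennreal (indicator (cball 0 1) u * norm (u::complex) powr (-p)) \<partial>lborel)
      \<le> (\<integral>\<^sup>+u. ennreal (f (Re u) * f (Im u)) \<partial>lborel)"
  proof (rule nn_integral_mono_AE)
    show "AE u in lborel. ennreal (indicator (cball 0 1) u * norm (u::complex) powr (-p)) \<le> ennreal (f (Re u) * f (Im u))"
      using AE_not_in[OF n1(1)] AE_not_in[OF n1(2)]
    proof eventually_elim
      fix u :: complex
      assume nz: "u \<notin> {u. Re u = 0}" "u \<notin> {u. Im u = 0}"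
      show "ennreal (indicator (cball 0 1) u * norm u powr (-p)) \<le> ennreal (f (Re u) * f (Im u))"
      proof (cases "u \<in> cball 0 1")
        case True
        have le: "\<bar>Re u\<bar> \<le> norm u" "\<bar>Im u\<bar> \<le> norm u" by (rule abs_Re_le_cmod abs_Im_le_cmod)+
        then have r: "Re u \<in> {-1..1}" "Im u \<in> {-1..1}" using True by auto
        have "norm u powr (-p) = norm u powr (-(p/2)) * norm u powr (-(p/2))"
          by (simp add: powr_add[symmetric])
        also have "\<dots> \<le> \<bar>Re u\<bar> powr (-(p/2)) * \<bar>Im u\<bar> powr (-(p/2))"
          using nz le assms by (intro mult_mono powr_mono2') auto
        finally show ?thesis using True r by (simp add: f_def)
      qed (simp add: nn)
    qed
  qed
  then show ?thesis using fin by (rule order_le_less_trans)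
qed

text \<open>The point of \<open>M\<close> is that it does not depend on \<open>z\<close>: within
  distance 1 of \<open>z\<close> the kernel is a translate of a fixed integrable function, and
  farther away it is at most 1.\<close>

lemma integrable_riesz_kernel:
  assumes "0 \<le> p" "p < 2"
  obtains M where "M \<ge> 0"
    "\<And>z. integrable lebesgue (\<lambda>\<zeta>::complex. indicator (cball 0 R) \<zeta> * norm (\<zeta> - z) powr (-p))"
    "\<And>z. (LINT \<zeta>::complex|lebesgue. indicator (cball 0 R) \<zeta> * norm (\<zeta> - z) powr (-p)) \<le> M"
proof -
  have [measurable]: "cball (0::complex) r \<in> sets borel" for r by simp
  let ?f = "\<lambda>u::complex. indicator (cball 0 1) u * norm u powr (-p)"
  have i0: "integrable lborel ?f"
  proof (rule integrableI_bounded)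
    show "?f \<in> borel_measurable lborel" by measurable
    show "(\<integral>\<^sup>+u. ennreal (norm (?f u)) \<partial>lborel) < \<infinity>"
      using nn_integral_norm_powr_finite[OF assms] by simp
  qed
  have i1: "integrable lborel (indicator (cball 0 R) :: complex \<Rightarrow> real)"
    by (intro integrable_real_indicator) (use emeasure_bounded_finite[OF bounded_cball] in auto)
  have tr: "integrable lborel (\<lambda>u. ?f (-z + u))" "(LINT u|lborel. ?f (-z + u)) = (LINT u|lborel. ?f u)" for z
    by (rule integrable_lborel_translate[OF i0], rule integral_lborel_translate) auto
  let ?g = "\<lambda>z \<zeta>::complex. indicator (cball 0 R) \<zeta> * norm (\<zeta> - z) powr (-p)"
  have bd: "norm (?g z \<zeta>) \<le> norm (?f (-z + \<zeta>) + indicator (cball 0 R) \<zeta>)" for z \<zeta>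
  proof (cases "norm (\<zeta> - z) \<le> 1")
    case True then show ?thesis by (auto simp: indicator_def)
  next
    case False
    then have "norm (\<zeta> - z) powr (-p) \<le> norm (\<zeta> - z) powr 0" using assms by (intro powr_mono) auto
    moreover have "\<zeta> \<noteq> z" using False by auto
    ultimately show ?thesis using False by (auto simp: indicator_def)
  qed
  have ig: "integrable lborel (?g z)" for z
    by (rule Bochner_Integration.integrable_bound[OF Bochner_Integration.integrable_add[OF tr(1)[of z] i1]])
      (measurable, use bd in \<open>auto simp del: norm_mult\<close>)
  have "(LINT \<zeta>|lborel. ?g z \<zeta>) \<le> (LINT u|lborel. ?f u) + (LINT u|lborel. indicator (cball 0 R) (u::complex))" for z
  proof -
    have "(LINT \<zeta>|lborel. ?g z \<zeta>) \<le> (LINT \<zeta>|lborel. ?f (-z + \<zeta>) + indicator (cball 0 R) \<zeta>)"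
    proof (rule integral_mono[OF ig Bochner_Integration.integrable_add[OF tr(1)[of z] i1]])
      fix \<zeta>
      have "0 \<le> ?f (-z + \<zeta>) + indicator (cball 0 R) \<zeta>" "0 \<le> ?g z \<zeta>" by auto
      then show "?g z \<zeta> \<le> ?f (-z + \<zeta>) + indicator (cball 0 R) \<zeta>" using bd[where z=z and \<zeta>=\<zeta>] by (simp only: real_norm_def abs_of_nonneg)
    qed
    also have "\<dots> = (LINT u|lborel. ?f u) + (LINT u|lborel. indicator (cball 0 R) (u::complex))"
      unfolding Bochner_Integration.integral_add[OF tr(1)[of z] i1] tr(2) ..
    finally show ?thesis .
  qed
  moreover have eq: "(LINT \<zeta>|lebesgue. ?g z \<zeta>) = (LINT \<zeta>|lborel. ?g z \<zeta>)" for z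
    by (subst integral_completion) auto
  moreover have ig': "integrable lebesgue (?g z)" for z
    using ig by (subst integrable_completion) auto
  moreover have "0 \<le> (LINT u|lborel. ?f u) + (LINT u|lborel. indicator (cball 0 R) (u::complex))"
    by (intro add_nonneg_nonneg Bochner_Integration.integral_nonneg) auto
  ultimately show ?thesis
    by (intro that[of "(LINT u|lborel. ?f u) + (LINT u|lborel. indicator (cball 0 R) (u::complex))"]) simp_all
qed

text \<open>The weight \<open>bump_mass \<epsilon>\<close> is the \<open>z\<close>-bar derivative of the regularised Cauchy kernel
  \<open>cnj u / (norm u ^ 2 + \<epsilon> ^ 2)\<close>; by the layer cake formula its mass reduces to areas of discs.\<close>

definition bump_mass :: "real \<Rightarrow> complex \<Rightarrow> real"
  where "bump_mass \<epsilon> u = \<epsilon>\<^sup>2 / ((norm u)\<^sup>2 + \<epsilon>\<^sup>2)\<^sup>2"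

lemma bump_mass_nonneg: "bump_mass \<epsilon> u \<ge> 0" by (simp add: bump_mass_def)

lemma nn_integral_bump_mass:
  assumes e: "\<epsilon> > 0"
  shows "(\<integral>\<^sup>+u. ennreal (bump_mass \<epsilon> u) \<partial>lborel) = ennreal pi"
proof -
  \<comment> \<open>Minus the derivative of
    \<open>\<epsilon> ^ 2 / (\<epsilon> ^ 2 + s) ^ 2\<close>, so that its integral over
    \<open>s \<ge> norm u ^ 2\<close> is \<open>bump_mass \<epsilon> u\<close>. After the exchange
    of integrals it multiplies the area \<open>pi * s\<close> of a disc.\<close>
  define f where "f s = 2 * \<epsilon>\<^sup>2 / (\<epsilon>\<^sup>2 + s)^3" for s
  have [measurable]: "f \<in> borel_measurable borel" unfolding f_def by measurable
  have p: "\<epsilon>\<^sup>2 + s > 0" if "s \<ge> 0" for s using that e by (simp add: add_pos_nonneg)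
  have f0: "f s \<ge> 0" if "s \<ge> 0" for s using p[OF that] by (simp add: f_def)
  have inner: "(\<integral>\<^sup>+s. ennreal (f s) * indicator {(norm u)\<^sup>2 ..} s \<partial>lborel) = ennreal (bump_mass \<epsilon> u)" for u :: complex
  proof -
    have "(\<integral>\<^sup>+s. ennreal (f s) * indicator {(norm u)\<^sup>2 ..} s \<partial>lborel) = 0 - (- \<epsilon>\<^sup>2 / (\<epsilon>\<^sup>2 + (norm u)\<^sup>2)\<^sup>2)"
    proof (rule nn_integral_FTC_atLeast)
      fix s assume "(norm u)\<^sup>2 \<le> s"
      then have s: "s \<ge> 0" by (meson order_trans zero_le_power2)
      show "((\<lambda>s. - \<epsilon>\<^sup>2 / (\<epsilon>\<^sup>2 + s)\<^sup>2) has_real_derivative f s) (at s)"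
        using p[OF s] by (auto intro!: derivative_eq_intros simp: f_def divide_simps power2_eq_square power3_eq_cube)
      show "0 \<le> f s" by (rule f0[OF s])
    next
      show "((\<lambda>s. - \<epsilon>\<^sup>2 / (\<epsilon>\<^sup>2 + s)\<^sup>2) \<longlongrightarrow> 0) at_top" using e by real_asymp
    qed auto
    then show ?thesis by (simp add: bump_mass_def add.commute)
  qed
  have area: "emeasure lborel {u::complex. (norm u)\<^sup>2 \<le> s} = ennreal (pi * s)" if "s \<ge> 0" for s
  proof -
    have "{u::complex. (norm u)\<^sup>2 \<le> s} = cball 0 (sqrt s)"
      using that by (auto simp: real_le_rsqrt sqrt_le_D real_sqrt_ge_zero) (metis norm_ge_zero real_le_lsqrt real_sqrt_le_iff real_sqrt_abs abs_norm_cancel real_sqrt_pow2 power_mono)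
    then show ?thesis using that by (simp add: emeasure_cball unit_ball_vol_2)
  qed
  have "(\<integral>\<^sup>+u. ennreal (bump_mass \<epsilon> u) \<partial>lborel) =
      (\<integral>\<^sup>+u. (\<integral>\<^sup>+s. ennreal (f s) * indicator {(norm (u::complex))\<^sup>2 ..} s \<partial>lborel) \<partial>lborel)"
    by (simp add: inner)
  also have "\<dots> = (\<integral>\<^sup>+s. (\<integral>\<^sup>+u. ennreal (f s) * indicator {(norm (u::complex))\<^sup>2 ..} s \<partial>lborel) \<partial>lborel)"
  proof -
    have "(\<lambda>(s, u). ennreal (f s) * indicator {s. (norm (u::complex))\<^sup>2 \<le> s} s) \<in> borel_measurable (lborel \<Otimes>\<^sub>M lborel)"
      by measurable
    then have "(\<lambda>(s, u). ennreal (f s) * indicator {(norm (u::complex))\<^sup>2 ..} s) \<in> borel_measurable (lborel \<Otimes>\<^sub>M lborel)"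
      by (simp add: atLeast_def)
    from lborel_pair.Fubini'[OF this] show ?thesis .
  qed
  also have "\<dots> = (\<integral>\<^sup>+s. ennreal (2 * pi * \<epsilon>\<^sup>2 * s / (\<epsilon>\<^sup>2 + s)^3) * indicator {0..} s \<partial>lborel)"
  proof (rule nn_integral_cong)
    fix s :: real
    show "(\<integral>\<^sup>+u. ennreal (f s) * indicator {(norm (u::complex))\<^sup>2 ..} s \<partial>lborel) =
        ennreal (2 * pi * \<epsilon>\<^sup>2 * s / (\<epsilon>\<^sup>2 + s)^3) * indicator {0..} s"
    proof (cases "s \<ge> 0")
      case True
      have "(\<integral>\<^sup>+u. ennreal (f s) * indicator {(norm (u::complex))\<^sup>2 ..} s \<partial>lborel) =
         (\<integral>\<^sup>+u. ennreal (f s) * indicator {u::complex. (norm u)\<^sup>2 \<le> s} u \<partial>lborel)"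
        by (rule nn_integral_cong) (auto simp: indicator_def)
      also have "\<dots> = ennreal (f s) * ennreal (pi * s)"
        by (subst nn_integral_cmult_indicator) (auto simp: area[OF True])
      also have "\<dots> = ennreal (2 * pi * \<epsilon>\<^sup>2 * s / (\<epsilon>\<^sup>2 + s)^3)"
        using True f0[OF True] by (simp add: ennreal_mult[symmetric] f_def mult_ac)
      finally show ?thesis using True by simp
    next
      case False
      then have "s < (norm (u::complex))\<^sup>2" for u by (meson not_le order_less_le_trans zero_le_power2)
      then have "indicator {(norm (u::complex))\<^sup>2 ..} s = (0::ennreal)" for u by (simp add: indicator_def not_le)
      then show ?thesis using False by simp
    qed
  qed
  \<comment> \<open>The primitive \<open>pi * (s / (\<epsilon> ^ 2 + s)) ^ 2\<close> rises from 0 to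
    \<open>pi\<close>.\<close>
  also have "\<dots> = ennreal (pi - pi * (0/(\<epsilon>\<^sup>2 + 0))\<^sup>2)"
  proof (rule nn_integral_FTC_atLeast)
    fix s :: real assume s: "0 \<le> s"
    show "((\<lambda>s. pi * (s/(\<epsilon>\<^sup>2 + s))\<^sup>2) has_real_derivative 2 * pi * \<epsilon>\<^sup>2 * s / (\<epsilon>\<^sup>2 + s)^3) (at s)"
      using p[OF s] by (auto intro!: derivative_eq_intros simp: divide_simps power2_eq_square power3_eq_cube)
         (simp add: algebra_simps)
    show "0 \<le> 2 * pi * \<epsilon>\<^sup>2 * s / (\<epsilon>\<^sup>2 + s)^3" using s p[OF s] by auto
  next
    show "((\<lambda>s. pi * (s/(\<epsilon>\<^sup>2 + s))\<^sup>2) \<longlongrightarrow> pi) at_top" using e by real_asymp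
  qed auto
  finally show ?thesis by simp
qed

lemma integral_bump_mass:
  assumes "\<epsilon> > 0"
  shows "integrable lborel (bump_mass \<epsilon>)" "(LINT u|lborel. bump_mass \<epsilon> u) = pi"
proof -
  have m[measurable]: "bump_mass \<epsilon> \<in> borel_measurable borel" unfolding bump_mass_def[abs_def] by measurable
  show "integrable lborel (bump_mass \<epsilon>)"
    by (rule integrableI_nonneg) (use nn_integral_bump_mass[OF assms] bump_mass_nonneg in auto)
  show "(LINT u|lborel. bump_mass \<epsilon> u) = pi"
    by (subst integral_eq_nn_integral) (use nn_integral_bump_mass[OF assms] bump_mass_nonneg in auto)
qed

section \<open>The Cauchy transform and its regularisation\<close>

definition cauchy_transform :: "(complex \<Rightarrow> complex) \<Rightarrow> complex \<Rightarrow> complex"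
  where "cauchy_transform g z = (LINT \<zeta>|lebesgue. g \<zeta> / (\<zeta> - z))"

text \<open>A smooth approximation of \<open>1 / u\<close>, which is
  \<open>cnj u / (u * cnj u)\<close>. Writing \<open>u * cnj u\<close> for the squared norm keeps it
  rational in \<open>u\<close> and \<open>cnj u\<close>, so the quotient rule applies.\<close>

definition reg_kernel :: "real \<Rightarrow> complex \<Rightarrow> complex"
  where "reg_kernel \<epsilon> u = cnj u / (u * cnj u + of_real (\<epsilon>\<^sup>2))"

definition reg_cauchy :: "real \<Rightarrow> (complex \<Rightarrow> complex) \<Rightarrow> complex \<Rightarrow> complex"
  where "reg_cauchy \<epsilon> g z = (LINT \<zeta>|lebesgue. g \<zeta> * reg_kernel \<epsilon> (\<zeta> - z))"

text \<open>The exponent beyond \<open>1\<close> makes the transforms with regularised kernels converge uniformly, with the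
  rate \<open>\<epsilon> powr s\<close>.\<close>

definition subcritical :: "(complex \<Rightarrow> complex) \<Rightarrow> bool"
  where "subcritical g \<longleftrightarrow> integrable lebesgue g \<and> (\<exists>R. \<forall>z. z \<notin> cball 0 R \<longrightarrow> g z = 0) \<and>
    (\<exists>s M. 0 < s \<and> s < 1 \<and>
       (\<forall>z. integrable lebesgue (\<lambda>\<zeta>. norm (g \<zeta>) * norm (\<zeta> - z) powr (-1-s)) \<and>
         (LINT \<zeta>|lebesgue. norm (g \<zeta>) * norm (\<zeta> - z) powr (-1-s)) \<le> M))"

lemma lebesgue_times_borel:
  fixes g :: "complex \<Rightarrow> 'a::{real_normed_algebra,euclidean_space}"
  assumes "g \<in> borel_measurable lebesgue" "h \<in> borel_measurable borel"
  shows "(\<lambda>z. g z * h z) \<in> borel_measurable lebesgue"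
  by (rule borel_measurable_times[OF assms(1) borel_measurable_lebesgueI[OF assms(2)]])

lemma integrable_indicator_cball: "integrable lebesgue (indicator (cball 0 R) :: complex \<Rightarrow> real)"
proof -
  have "integrable lborel (indicator (cball 0 R) :: complex \<Rightarrow> real)"
    by (intro integrable_real_indicator) (use emeasure_bounded_finite[OF bounded_cball] in auto)
  then show ?thesis by (subst integrable_completion) auto
qed

lemma reg_denominator_pos:
  assumes "\<epsilon> > 0"
  shows "u * cnj u + of_real (\<epsilon>\<^sup>2) = of_real ((norm u)\<^sup>2 + \<epsilon>\<^sup>2)" "(norm u)\<^sup>2 + \<epsilon>\<^sup>2 > 0"
    "u * cnj u + of_real (\<epsilon>\<^sup>2) \<noteq> 0"
proof -
  show 1: "u * cnj u + of_real (\<epsilon>\<^sup>2) = of_real ((norm u)\<^sup>2 + \<epsilon>\<^sup>2)"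
    by (simp add: complex_norm_square[symmetric])
  show 2: "(norm u)\<^sup>2 + \<epsilon>\<^sup>2 > 0" using assms by (simp add: add_nonneg_pos)
  show "u * cnj u + of_real (\<epsilon>\<^sup>2) \<noteq> 0" unfolding 1 using 2 by (metis less_irrefl of_real_eq_0_iff)
qed

text \<open>In the combination \<open>k' u 1 + \<i> * k' u \<i>\<close> the terms linear in the
  direction \<open>h\<close> cancel and those linear in \<open>cnj h\<close> double, which leaves
  only the weight of mass \<open>pi\<close>.\<close>

lemma reg_kernel_C1:
  assumes "\<epsilon> > 0"
  obtains k' where "C1_on UNIV (reg_kernel \<epsilon>) k'"
    "\<And>u. (k' u 1 + \<i> * k' u \<i>) / 2 = of_real (bump_mass \<epsilon> u)"
proof -
  define k' where "k' u h = (cnj h * (u * cnj u + of_real (\<epsilon>\<^sup>2)) - cnj u * (u * cnj h + h * cnj u)) /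
      ((u * cnj u + of_real (\<epsilon>\<^sup>2)) * (u * cnj u + of_real (\<epsilon>\<^sup>2)))" for u h
  note nz = reg_denominator_pos(3)[OF assms]
  have "C1_on UNIV (reg_kernel \<epsilon>) k'"
  proof (rule C1_onI)
    fix u
    have c: "(cnj has_derivative cnj) (at u)"
      by (rule bounded_linear_imp_has_derivative[OF bounded_linear_cnj])
    have d: "((\<lambda>u. u * cnj u + of_real (\<epsilon>\<^sup>2)) has_derivative (\<lambda>h. u * cnj h + h * cnj u)) (at u)"
      by (auto intro!: derivative_eq_intros c)
    show "(reg_kernel \<epsilon> has_derivative k' u) (at u)"
      unfolding reg_kernel_def[abs_def] k'_def[abs_def]
      by (rule has_derivative_divide'[OF c d nz])
  next
    show "continuous_on UNIV (\<lambda>u. k' u e)" for e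
      unfolding k'_def by (intro continuous_intros) (use nz in auto)
  qed
  moreover have "(k' u 1 + \<i> * k' u \<i>) / 2 = of_real (bump_mass \<epsilon> u)" for u
  proof -
    let ?N = "u * cnj u + of_real (\<epsilon>\<^sup>2)"
    have "k' u 1 + \<i> * k' u \<i> = (2 * ?N - 2 * (u * cnj u)) / (?N * ?N)"
      by (simp add: k'_def add_divide_distrib[symmetric] algebra_simps)
    also have "\<dots> / 2 = of_real (\<epsilon>\<^sup>2) / (?N * ?N)" by simp
    also have "\<dots> = of_real (bump_mass \<epsilon> u)"
      unfolding reg_denominator_pos(1)[OF assms] bump_mass_def by (simp add: power2_eq_square)
    finally show ?thesis .
  qed
  ultimately show ?thesis using that by blast
qed

lemma reg_kernel_measurable: "reg_kernel \<epsilon> \<in> borel_measurable borel"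
  unfolding reg_kernel_def[abs_def] by (intro borel_measurable_divide borel_measurable_continuous_onI continuous_intros)

lemma kernel_measurable: "(\<lambda>\<zeta>. 1 / (\<zeta> - z :: complex)) \<in> borel_measurable borel"
  by measurable

text \<open>The difference has norm \<open>1 / norm u\<close> times
  \<open>\<epsilon> ^ 2 / (norm u ^ 2 + \<epsilon> ^ 2)\<close>. Part of the decay in the second
  factor is traded for the extra exponent \<open>s\<close> of the singularity, leaving a power of
  \<open>\<epsilon>\<close> that is uniform in \<open>u\<close>.\<close>

lemma reg_kernel_diff:
  assumes "\<epsilon> > 0" "0 < s" "s < 1"
  shows "norm (1 / u - reg_kernel \<epsilon> u) \<le> \<epsilon> powr s * norm u powr (-1-s)"
proof (cases "u = 0")
  \<comment> \<open>At 0 both sides are 0, by the conventions for \<open>1 / 0\<close> and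
    \<open>0 powr x\<close>.\<close>
  case True then show ?thesis by (simp add: reg_kernel_def)
next
  case False
  let ?n = "norm u"
  have n: "?n > 0" using False by simp
  note N = reg_denominator_pos[OF assms(1), of u]
  have "1 / u - reg_kernel \<epsilon> u = of_real (\<epsilon>\<^sup>2) / (u * (u * cnj u + of_real (\<epsilon>\<^sup>2)))"
    unfolding reg_kernel_def using False N(3) by (simp add: divide_simps)
  then have eq: "norm (1 / u - reg_kernel \<epsilon> u) = \<epsilon>\<^sup>2 / (?n * (?n\<^sup>2 + \<epsilon>\<^sup>2))"
    unfolding N(1) using N(2) by (simp add: norm_divide norm_mult norm_power del: of_real_add)
  have key: "\<epsilon>\<^sup>2 / (?n\<^sup>2 + \<epsilon>\<^sup>2) \<le> (\<epsilon> / ?n) powr s"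
  proof (cases "\<epsilon> \<le> ?n")
    case True
    have t: "0 < \<epsilon> / ?n" "\<epsilon> / ?n \<le> 1" using True n assms by auto
    have "\<epsilon>\<^sup>2 / (?n\<^sup>2 + \<epsilon>\<^sup>2) \<le> \<epsilon>\<^sup>2 / ?n\<^sup>2" using n N(2) by (intro divide_left_mono mult_pos_pos) auto
    also have "\<dots> = (\<epsilon> / ?n) powr 2" using t by (simp add: power_divide)
    also have "\<dots> \<le> (\<epsilon> / ?n) powr s" using t assms by (intro powr_mono') auto
    finally show ?thesis .
  next
    case False
    have "\<epsilon>\<^sup>2 / (?n\<^sup>2 + \<epsilon>\<^sup>2) \<le> 1" using N(2) by simp
    also have "\<dots> \<le> (\<epsilon> / ?n) powr s" using False n assms by (intro ge_one_powr_ge_zero) auto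
    finally show ?thesis .
  qed
  have "\<epsilon>\<^sup>2 / (?n * (?n\<^sup>2 + \<epsilon>\<^sup>2)) = (1 / ?n) * (\<epsilon>\<^sup>2 / (?n\<^sup>2 + \<epsilon>\<^sup>2))" by simp
  also have "\<dots> \<le> (1 / ?n) * (\<epsilon> / ?n) powr s" using key n by (intro mult_left_mono) auto
  also have "\<dots> = \<epsilon> powr s * ?n powr (-1-s)"
    using n assms by (simp add: powr_divide powr_diff powr_minus divide_simps powr_add)
  finally show ?thesis using eq by simp
qed

lemma subcriticalE:
  assumes "subcritical g"
  obtains s M where "0 < s" "s < 1" "M \<ge> 0"
    "\<And>z. integrable lebesgue (\<lambda>\<zeta>. norm (g \<zeta>) * norm (\<zeta> - z) powr (-1-s))"
    "\<And>z. (LINT \<zeta>|lebesgue. norm (g \<zeta>) * norm (\<zeta> - z) powr (-1-s)) \<le> M"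
proof -
  obtain s M where *: "0 < s" "s < 1"
    "\<And>z. integrable lebesgue (\<lambda>\<zeta>. norm (g \<zeta>) * norm (\<zeta> - z) powr (-1-s))"
    "\<And>z. (LINT \<zeta>|lebesgue. norm (g \<zeta>) * norm (\<zeta> - z) powr (-1-s)) \<le> M"
    using assms unfolding subcritical_def by blast
  have "0 \<le> (LINT \<zeta>|lebesgue. norm (g \<zeta>) * norm (\<zeta> - 0) powr (-1-s))"
    by (rule Bochner_Integration.integral_nonneg) auto
  also have "\<dots> \<le> M" by (rule *(4))
  finally show ?thesis using that * by blast
qed

lemma subcriticalI:
  assumes "integrable lebesgue g" "\<And>z. z \<notin> cball 0 R \<Longrightarrow> g z = 0" "0 < s" "s < 1"
    "\<And>z. integrable lebesgue (\<lambda>\<zeta>. norm (g \<zeta>) * norm (\<zeta> - z) powr (-1-s))"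
    "\<And>z. (LINT \<zeta>|lebesgue. norm (g \<zeta>) * norm (\<zeta> - z) powr (-1-s)) \<le> M"
  shows "subcritical g"
  using assms unfolding subcritical_def by blast

lemma subcritical_measurable: "subcritical g \<Longrightarrow> g \<in> borel_measurable lebesgue"
  by (auto simp: subcritical_def)

text \<open>The kernel is at most the one with exponent \<open>1 + s\<close> near the pole and at
  most 1 away from it. The uniform bound on the integral of norms is what later makes Fubini's
  theorem applicable.\<close>

lemma subcritical_kernel_integrable:
  assumes "subcritical g"
  obtains M where "M \<ge> 0" "\<And>z. integrable lebesgue (\<lambda>\<zeta>. g \<zeta> / (\<zeta> - z))"
    "\<And>z. (LINT \<zeta>|lebesgue. norm (g \<zeta> / (\<zeta> - z))) \<le> M"
proof -
  obtain s M where s: "0 < s" "s < 1" "M \<ge> 0"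
    and i: "\<And>z. integrable lebesgue (\<lambda>\<zeta>. norm (g \<zeta>) * norm (\<zeta> - z) powr (-1-s))"
    and b: "\<And>z. (LINT \<zeta>|lebesgue. norm (g \<zeta>) * norm (\<zeta> - z) powr (-1-s)) \<le> M"
    using subcriticalE[OF assms] by blast
  have ig: "integrable lebesgue g" using assms by (simp add: subcritical_def)
  have bd: "norm (g \<zeta> / (\<zeta> - z)) \<le> norm (g \<zeta>) * norm (\<zeta> - z) powr (-1-s) + norm (g \<zeta>)" for \<zeta> z
  proof (cases "norm (\<zeta> - z) \<le> 1")
    case True
    have "1 / norm (\<zeta> - z) \<le> norm (\<zeta> - z) powr (-1-s)"
    proof (cases "\<zeta> = z")
      case False
      have "norm (\<zeta> - z) powr (-1) \<le> norm (\<zeta> - z) powr (-1-s)"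
        using False True s by (intro powr_mono') auto
      then show ?thesis using False by (simp add: powr_minus divide_inverse)
    qed simp
    then have "norm (g \<zeta>) * (1 / norm (\<zeta> - z)) \<le> norm (g \<zeta>) * norm (\<zeta> - z) powr (-1-s)"
      by (intro mult_left_mono) auto
    then show ?thesis by (simp add: norm_divide) (smt (verit) norm_ge_zero)
  next
    case False
    have "norm (g \<zeta> / (\<zeta> - z)) \<le> norm (g \<zeta>)"
      using False by (simp add: norm_divide divide_le_eq mult_le_cancel_left1)
    moreover have "0 \<le> norm (g \<zeta>) * norm (\<zeta> - z) powr (-1-s)" by simp
    ultimately show ?thesis by linarith
  qed
  have m: "(\<lambda>\<zeta>. g \<zeta> / (\<zeta> - z)) \<in> borel_measurable lebesgue" for z
    using lebesgue_times_borel[OF subcritical_measurable[OF assms] kernel_measurable[of z]] by simp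
  note isum = Bochner_Integration.integrable_add[OF i integrable_norm[OF ig]]
  have ii: "integrable lebesgue (\<lambda>\<zeta>. g \<zeta> / (\<zeta> - z))" for z
    by (rule Bochner_Integration.integrable_bound[OF isum[of z] m])
      (use bd[of _ z] in \<open>auto intro!: AE_I2 order_trans[OF bd]\<close>)
  have "(LINT \<zeta>|lebesgue. norm (g \<zeta> / (\<zeta> - z))) \<le> M + (LINT \<zeta>|lebesgue. norm (g \<zeta>))" for z
  proof -
    have "(LINT \<zeta>|lebesgue. norm (g \<zeta> / (\<zeta> - z))) \<le> (LINT \<zeta>|lebesgue. norm (g \<zeta>) * norm (\<zeta> - z) powr (-1-s) + norm (g \<zeta>))"
      by (rule integral_mono[OF integrable_norm[OF ii] isum bd])
    also have "\<dots> \<le> M + (LINT \<zeta>|lebesgue. norm (g \<zeta>))"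
      unfolding Bochner_Integration.integral_add[OF i integrable_norm[OF ig]] using b by simp
    finally show ?thesis .
  qed
  moreover have "0 \<le> M + (LINT \<zeta>|lebesgue. norm (g \<zeta>))" using s by simp
  ultimately show ?thesis using that ii by blast
qed

lemma reg_cauchy_integrable:
  assumes "subcritical g" "\<epsilon> > 0"
  shows "integrable lebesgue (\<lambda>\<zeta>. g \<zeta> * reg_kernel \<epsilon> (\<zeta> - z))"
proof (rule Bochner_Integration.integrable_bound[where f="\<lambda>\<zeta>. (1/\<epsilon>) *\<^sub>R g \<zeta>"])
  show "integrable lebesgue (\<lambda>\<zeta>. (1/\<epsilon>) *\<^sub>R g \<zeta>)" using assms by (auto simp: subcritical_def)
  have "(\<lambda>\<zeta>. reg_kernel \<epsilon> (\<zeta> - z)) \<in> borel_measurable borel"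
    using reg_kernel_measurable by measurable
  then show "(\<lambda>\<zeta>. g \<zeta> * reg_kernel \<epsilon> (\<zeta> - z)) \<in> borel_measurable lebesgue"
    by (rule lebesgue_times_borel[OF subcritical_measurable[OF assms(1)]])
  have "norm (reg_kernel \<epsilon> u) \<le> 1 / \<epsilon>" for u
  proof -
    note N = reg_denominator_pos[OF assms(2), of u]
    have "2 * \<epsilon> * norm u \<le> (norm u)\<^sup>2 + \<epsilon>\<^sup>2" using sum_squares_bound[of \<epsilon> "norm u"] by simp
    moreover have "0 \<le> \<epsilon> * norm u" using assms(2) by simp
    ultimately have le: "\<epsilon> * norm u \<le> (norm u)\<^sup>2 + \<epsilon>\<^sup>2" by linarith
    have "norm (reg_kernel \<epsilon> u) = norm u / ((norm u)\<^sup>2 + \<epsilon>\<^sup>2)"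
      unfolding reg_kernel_def N(1) using N(2) by (simp add: norm_divide del: of_real_add)
    also have "\<dots> \<le> 1 / \<epsilon>" using le N(2) assms(2) by (simp add: divide_simps mult.commute)
    finally show ?thesis .
  qed
  then have "norm (g \<zeta>) * norm (reg_kernel \<epsilon> (\<zeta> - z)) \<le> norm (g \<zeta>) * (1 / \<epsilon>)" for \<zeta>
    by (intro mult_left_mono) auto
  then show "AE \<zeta> in lebesgue. norm (g \<zeta> * reg_kernel \<epsilon> (\<zeta> - z)) \<le> norm ((1/\<epsilon>) *\<^sub>R g \<zeta>)"
    using assms(2) by (auto simp: norm_mult)
qed

lemma reg_cauchy_converges:
  assumes "subcritical g"
  obtains s M where "s > 0" "M \<ge> 0" "\<And>\<epsilon> z. \<epsilon> > 0 \<Longrightarrow> norm (cauchy_transform g z - reg_cauchy \<epsilon> g z) \<le> M * \<epsilon> powr s"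
proof -
  obtain s M where s: "0 < s" "s < 1" "M \<ge> 0"
    and i: "\<And>z. integrable lebesgue (\<lambda>\<zeta>. norm (g \<zeta>) * norm (\<zeta> - z) powr (-1-s))"
    and b: "\<And>z. (LINT \<zeta>|lebesgue. norm (g \<zeta>) * norm (\<zeta> - z) powr (-1-s)) \<le> M"
    using subcriticalE[OF assms] by blast
  have ik: "\<And>z. integrable lebesgue (\<lambda>\<zeta>. g \<zeta> / (\<zeta> - z))"
    using subcritical_kernel_integrable[OF assms] by blast
  have "norm (cauchy_transform g z - reg_cauchy \<epsilon> g z) \<le> M * \<epsilon> powr s" if e: "\<epsilon> > 0" for \<epsilon> z
  proof -
    have "cauchy_transform g z - reg_cauchy \<epsilon> g z = (LINT \<zeta>|lebesgue. g \<zeta> / (\<zeta> - z) - g \<zeta> * reg_kernel \<epsilon> (\<zeta> - z))"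
      unfolding cauchy_transform_def reg_cauchy_def
      by (rule Bochner_Integration.integral_diff[symmetric, OF ik reg_cauchy_integrable[OF assms e]])
    also have "norm \<dots> \<le> (LINT \<zeta>|lebesgue. (norm (g \<zeta>) * norm (\<zeta> - z) powr (-1-s)) * \<epsilon> powr s)"
    proof (rule Bochner_Integration.integral_norm_bound_integral)
      show "integrable lebesgue (\<lambda>\<zeta>. g \<zeta> / (\<zeta> - z) - g \<zeta> * reg_kernel \<epsilon> (\<zeta> - z))"
        by (intro Bochner_Integration.integrable_diff ik reg_cauchy_integrable[OF assms e])
      show "integrable lebesgue (\<lambda>\<zeta>. (norm (g \<zeta>) * norm (\<zeta> - z) powr (-1-s)) * \<epsilon> powr s)"
        using i by simp
      fix \<zeta>
      have "g \<zeta> / (\<zeta> - z) - g \<zeta> * reg_kernel \<epsilon> (\<zeta> - z) = g \<zeta> * (1 / (\<zeta> - z) - reg_kernel \<epsilon> (\<zeta> - z))"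
        by (simp add: algebra_simps)
      then have "norm (g \<zeta> / (\<zeta> - z) - g \<zeta> * reg_kernel \<epsilon> (\<zeta> - z)) = norm (g \<zeta>) * norm (1 / (\<zeta> - z) - reg_kernel \<epsilon> (\<zeta> - z))"
        by (simp add: norm_mult)
      also have "\<dots> \<le> norm (g \<zeta>) * (\<epsilon> powr s * norm (\<zeta> - z) powr (-1-s))"
        by (intro mult_left_mono reg_kernel_diff e s norm_ge_zero)
      finally show "norm (g \<zeta> / (\<zeta> - z) - g \<zeta> * reg_kernel \<epsilon> (\<zeta> - z)) \<le> (norm (g \<zeta>) * norm (\<zeta> - z) powr (-1-s)) * \<epsilon> powr s"
        by (simp add: mult_ac)
    qed
    also have "\<dots> \<le> M * \<epsilon> powr s" using b[of z] by (simp add: mult_right_mono)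
    finally show ?thesis .
  qed
  then show ?thesis using that s by blast
qed

lemma subcritical_bounded:
  assumes "g \<in> borel_measurable lebesgue" "\<And>z. norm (g z) \<le> B" "\<And>z. z \<notin> cball 0 R \<Longrightarrow> g z = 0"
  shows "subcritical g"
proof -
  \<comment> \<open>The exponent \<open>3 / 2\<close> is \<open>1 + s\<close> with
    \<open>s = 1 / 2\<close>; any value strictly between 1 and 2 would serve.\<close>
  obtain M where M: "M \<ge> 0"
    and i: "\<And>z. integrable lebesgue (\<lambda>\<zeta>::complex. indicator (cball 0 R) \<zeta> * norm (\<zeta> - z) powr (-(3/2)))"
    and b: "\<And>z. (LINT \<zeta>::complex|lebesgue. indicator (cball 0 R) \<zeta> * norm (\<zeta> - z) powr (-(3/2))) \<le> M"
    using integrable_riesz_kernel[of "3/2" R] by auto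
  have B: "B \<ge> 0" using assms(2)[of 0] norm_ge_zero order_trans by blast
  have bd: "norm (g \<zeta>) \<le> indicator (cball 0 R) \<zeta> * B" for \<zeta>
    using assms(2,3)[of \<zeta>] by (auto simp: indicator_def)
  have "integrable lebesgue (\<lambda>z::complex. indicator (cball 0 R) z *\<^sub>R B)"
    by (rule integrable_scaleR_left) (rule integrable_indicator_cball)
  then have ig: "integrable lebesgue g"
    by (rule Bochner_Integration.integrable_bound[OF _ assms(1)]) (use bd B in auto)
  have e: "-1-1/2 = -(3/2::real)" by simp
  have bd2: "norm (g \<zeta>) * norm (\<zeta> - z) powr (-(3/2)) \<le> B * (indicator (cball 0 R) \<zeta> * norm (\<zeta> - z) powr (-(3/2)))" for \<zeta> z
    using mult_right_mono[OF bd[of \<zeta>], of "norm (\<zeta> - z) powr (-(3/2))"] by (simp add: mult_ac)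
  have "(\<lambda>\<zeta>. norm (g \<zeta>) * norm (\<zeta> - z) powr (-(3/2))) \<in> borel_measurable lebesgue" for z
    by (rule lebesgue_times_borel) (use assms(1) in measurable)
  then have ii: "integrable lebesgue (\<lambda>\<zeta>. norm (g \<zeta>) * norm (\<zeta> - z) powr (-1-1/2))" for z
    unfolding e using bd2 B
    by (intro Bochner_Integration.integrable_bound[OF integrable_mult_right[OF i[of z], of B]])
      (auto simp: abs_mult)
  have le: "(LINT \<zeta>|lebesgue. norm (g \<zeta>) * norm (\<zeta> - z) powr (-1-1/2)) \<le> B * M" for z
  proof -
  have "(LINT \<zeta>|lebesgue. norm (g \<zeta>) * norm (\<zeta> - z) powr (-1-1/2)) \<le>
      (LINT \<zeta>|lebesgue. B * (indicator (cball 0 R) \<zeta> * norm (\<zeta> - z) powr (-(3/2))))"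
    by (rule integral_mono[OF ii]) (use i bd2 in auto)
  also have "\<dots> \<le> B * M" using b[of z] B by (simp add: mult_left_mono)
  finally show ?thesis .
  qed
  show ?thesis by (rule subcriticalI[OF ig assms(3) _ _ ii le]) auto
qed

text \<open>Young's inequality separates the density from the kernel: the first is raised to
  \<open>q\<close>, the second to the conjugate exponent \<open>q / (q - 1)\<close>. The resulting
  kernel exponent \<open>p\<close> can be kept below 2 while \<open>s > 0\<close> because
  \<open>q > 2\<close> makes the conjugate exponent smaller than 2.\<close>

lemma subcritical_Lq:
  assumes q: "q > 2" and m: "g \<in> borel_measurable lebesgue"
    and iq: "integrable lebesgue (\<lambda>z. norm (g z) powr q)" and R: "\<And>z. z \<notin> cball 0 R \<Longrightarrow> g z = 0"
  shows "subcritical g"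
proof -
  \<comment> \<open>Half of \<open>(q - 2) / q\<close>, the value of \<open>s\<close> at which
    \<open>p\<close> would reach 2.\<close>
  define s where "s = (q - 2) / (2 * q)"
  define p where "p = (1 + s) * (q / (q - 1))"
  have s: "0 < s" "s < 1" using q by (auto simp: s_def divide_simps)
  have "1 + s = (3 * q - 2) / (2 * q)" using q by (simp add: s_def field_simps)
  then have "p = (3 * q - 2) / (2 * (q - 1))" using q by (simp add: p_def)
  then have p: "0 \<le> p" "p < 2" using q by (simp_all add: pos_divide_less_eq)
  obtain M where M: "M \<ge> 0"
    and i: "\<And>z. integrable lebesgue (\<lambda>\<zeta>::complex. indicator (cball 0 R) \<zeta> * norm (\<zeta> - z) powr (-p))"
    and b: "\<And>z. (LINT \<zeta>::complex|lebesgue. indicator (cball 0 R) \<zeta> * norm (\<zeta> - z) powr (-p)) \<le> M"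
    using integrable_riesz_kernel[OF p, of R] by auto
  have young: "a * c \<le> a powr q + c powr (q / (q - 1))" if "a \<ge> 0" "c \<ge> 0" for a c :: real
  proof -
    have "q / (q - 1) > 1" "1 / q + 1 / (q / (q - 1)) = 1" using q by (auto simp: field_simps)
    from Youngs_inequality[OF _ this that] q
    have "a * c \<le> a powr q / q + c powr (q / (q - 1)) / (q / (q - 1))" by simp
    also have "\<dots> \<le> a powr q + c powr (q / (q - 1))"
    proof (rule add_mono)
      show "a powr q / q \<le> a powr q" using q by (simp add: divide_le_eq mult_le_cancel_left1)
      show "c powr (q / (q - 1)) / (q / (q - 1)) \<le> c powr (q / (q - 1))"
        using q by (simp add: divide_le_eq mult_left_mono field_simps)
    qed
    finally show ?thesis .
  qed
  have ig: "integrable lebesgue g"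
  proof (rule Bochner_Integration.integrable_bound[OF _ m])
    show "integrable lebesgue (\<lambda>z. norm (g z) powr q + indicator (cball 0 R) z *\<^sub>R 1)"
      by (intro Bochner_Integration.integrable_add iq integrable_scaleR_left integrable_indicator_cball)
    have "norm (g z) \<le> norm (g z) powr q + indicator (cball 0 R) z" for z
      using young[of "norm (g z)" 1] R[of z] by (auto simp: indicator_def)
    then show "AE z in lebesgue. norm (g z) \<le> norm (norm (g z) powr q + indicator (cball 0 R) z *\<^sub>R 1)"
      by (auto intro!: AE_I2)
  qed
  have bd: "norm (g \<zeta>) * norm (\<zeta> - z) powr (-1-s) \<le>
      norm (g \<zeta>) powr q + indicator (cball 0 R) \<zeta> * norm (\<zeta> - z) powr (-p)" for \<zeta> z
  proof (cases "\<zeta> \<in> cball 0 R")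
    case True
    have "-1-s = - (1+s)" by simp
    then have "(-1-s) * (q / (q-1)) = -p" by (simp only: p_def mult_minus_left)
    then have "(norm (\<zeta> - z) powr (-1-s)) powr (q / (q-1)) = norm (\<zeta> - z) powr (-p)"
      by (simp add: powr_powr)
    then show ?thesis using young[of "norm (g \<zeta>)" "norm (\<zeta> - z) powr (-1-s)"] True by simp
  qed (simp add: R)
  have mm: "(\<lambda>\<zeta>. norm (g \<zeta>) * norm (\<zeta> - z) powr (-1-s)) \<in> borel_measurable lebesgue" for z
    by (rule lebesgue_times_borel) (use m in measurable)
  note isum = Bochner_Integration.integrable_add[OF iq i]
  have ii: "integrable lebesgue (\<lambda>\<zeta>. norm (g \<zeta>) * norm (\<zeta> - z) powr (-1-s))" for z
    by (rule Bochner_Integration.integrable_bound[OF isum mm]) (use bd in \<open>auto intro!: AE_I2 order_trans[OF bd]\<close>)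
  have le: "(LINT \<zeta>|lebesgue. norm (g \<zeta>) * norm (\<zeta> - z) powr (-1-s)) \<le> (LINT \<zeta>|lebesgue. norm (g \<zeta>) powr q) + M" for z
  proof -
  have "(LINT \<zeta>|lebesgue. norm (g \<zeta>) * norm (\<zeta> - z) powr (-1-s)) \<le>
     (LINT \<zeta>|lebesgue. norm (g \<zeta>) powr q + indicator (cball 0 R) \<zeta> * norm (\<zeta> - z) powr (-p))"
    by (rule integral_mono[OF ii isum bd])
  also have "\<dots> \<le> (LINT \<zeta>|lebesgue. norm (g \<zeta>) powr q) + M"
    unfolding Bochner_Integration.integral_add[OF iq i] using b by simp
  finally show ?thesis .
  qed
  show ?thesis by (rule subcriticalI[OF ig R s ii le])
qed

section \<open>Differentiability of the Cauchy transform\<close>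

lemma C1_on_translate:
  assumes "C1_on UNIV k k'"
  shows "C1_on UNIV (\<lambda>\<zeta>. k (\<zeta> - z)) (\<lambda>\<zeta>. k' (\<zeta> - z))"
proof (rule C1_onI)
  fix \<zeta>
  have "((\<lambda>\<zeta>. \<zeta> - z) has_derivative (\<lambda>h. h)) (at \<zeta>)" by (auto intro!: derivative_eq_intros)
  from has_derivative_compose[OF this C1_onD(1)[OF assms, of "\<zeta> - z"]]
  show "((\<lambda>\<zeta>. k (\<zeta> - z)) has_derivative k' (\<zeta> - z)) (at \<zeta>)" by simp
next
  show "continuous_on UNIV (\<lambda>\<zeta>. k' (\<zeta> - z) e)" for e
    by (rule continuous_on_compose2[OF C1_onD(2)[OF assms, of e]]) (auto intro!: continuous_intros)
qed

lemma C1_on_linear_parts: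
  assumes "C1_on S k k'" "u \<in> S"
  shows "k' u h = Re h *\<^sub>R k' u 1 + Im h *\<^sub>R k' u \<i>"
proof -
  interpret bounded_linear "k' u" by (rule has_derivative_bounded_linear[OF C1_onD(1)[OF assms]])
  have "h = Re h *\<^sub>R 1 + Im h *\<^sub>R \<i>" by (simp add: complex_eq_iff)
  then show ?thesis by (metis add scaleR)
qed

lemma integrable_locally_integrable: "integrable lebesgue (g :: complex \<Rightarrow> complex) \<Longrightarrow> locally_integrable D g"
  unfolding locally_integrable_iff
  by (auto intro!: integrable_mult_indicator simp: lmeasurable_compact fmeasurableD)

lemma integrable_continuous_times:
  fixes g c :: "complex \<Rightarrow> complex"
  assumes "integrable lebesgue g" "\<And>z. z \<notin> cball 0 R \<Longrightarrow> g z = 0" "continuous_on UNIV c"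
  shows "integrable lebesgue (\<lambda>z. g z * c z)"
proof -
  have "locally_integrable UNIV (\<lambda>z. c z * g z)"
    by (rule locally_integrable_bilinear[OF bounded_bilinear_mult integrable_locally_integrable[OF assms(1)] assms(3)])
  from locally_integrableD[OF this compact_cball[of 0 R]]
  have "integrable lebesgue (\<lambda>z. indicator (cball 0 R) z *\<^sub>R (c z * g z))" by simp
  moreover have "(\<lambda>z. indicator (cball 0 R) z *\<^sub>R (c z * g z)) = (\<lambda>z. g z * c z)"
    using assms(2) by (auto simp: indicator_def fun_eq_iff)
  ultimately show ?thesis by simp
qed

text \<open>The derivative falls on the kernel. As the density has bounded support, only kernel
  values in a bounded set matter, and there the linearisation error is uniform by uniform continuity
  of the derivative.\<close>

lemma has_derivative_convolution:
  fixes g k :: "complex \<Rightarrow> complex"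
  assumes ig: "integrable lebesgue g" and R: "\<And>z. z \<notin> cball 0 R \<Longrightarrow> g z = 0" and k: "C1_on UNIV k k'"
  shows "((\<lambda>z. LINT \<zeta>|lebesgue. g \<zeta> * k (\<zeta> - z)) has_derivative
    (\<lambda>h. - (Re h *\<^sub>R (LINT \<zeta>|lebesgue. g \<zeta> * k' (\<zeta> - z) 1) + Im h *\<^sub>R (LINT \<zeta>|lebesgue. g \<zeta> * k' (\<zeta> - z) \<i>)))) (at z)"
    (is "(?F has_derivative ?F') _")
proof -
  have c: "continuous_on UNIV (\<lambda>\<zeta>. k (\<zeta> - z))" "continuous_on UNIV (\<lambda>\<zeta>. k' (\<zeta> - z) e)" for z e
    using C1_on_imp_continuous_on[OF C1_on_translate[OF k]] C1_onD(2)[OF C1_on_translate[OF k]] by blast+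
  have i1: "integrable lebesgue (\<lambda>\<zeta>. g \<zeta> * k (\<zeta> - z))" for z
    by (rule integrable_continuous_times[OF ig R c(1)])
  have i2: "integrable lebesgue (\<lambda>\<zeta>. g \<zeta> * k' (\<zeta> - z) e)" for z e
    by (rule integrable_continuous_times[OF ig R c(2)])
  have F': "?F' h = - (LINT \<zeta>|lebesgue. g \<zeta> * k' (\<zeta> - z) h)" for h
  proof -
    have "g \<zeta> * k' (\<zeta> - z) h = Re h *\<^sub>R (g \<zeta> * k' (\<zeta> - z) 1) + Im h *\<^sub>R (g \<zeta> * k' (\<zeta> - z) \<i>)" for \<zeta>
      using C1_on_linear_parts[OF k, of "\<zeta> - z" h] by (simp add: algebra_simps)
    then show ?thesis using i2 by simp
  qed
  show ?thesis
    unfolding has_derivative_at_alt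
  proof (intro conjI allI impI)
    show "bounded_linear ?F'"
      by (intro bounded_linear_minus bounded_linear_add bounded_linear_scaleR_left[THEN bounded_linear_compose]
          bounded_linear_Re bounded_linear_Im)
    fix e :: real assume e: "e > 0"
    define N where "N = (LINT \<zeta>|lebesgue. norm (g \<zeta>)) + 1"
    have N: "N > 0" unfolding N_def by (simp add: add_nonneg_pos)
    define \<eta> where "\<eta> = e / (2 * N)"
    have \<eta>: "\<eta> > 0" using e N by (simp add: \<eta>_def)
    \<comment> \<open>This ball contains \<open>\<zeta> - y\<close> for all \<open>\<zeta>\<close>
      in the ball of radius \<open>R\<close> and all \<open>y\<close> within distance 1 of
      \<open>z\<close>; hence the 1 in the minimum \<open>\<delta>\<close>.\<close>
    let ?B = "cball (-z) (R + 1)"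
    have "uniformly_continuous_on ?B (\<lambda>u. k' u d)" for d
      by (rule compact_uniformly_continuous[OF continuous_on_subset[OF C1_onD(2)[OF k]]]) auto
    then have "\<exists>\<delta>>0. \<forall>u\<in>?B. \<forall>v\<in>?B. dist v u < \<delta> \<longrightarrow> dist (k' v d) (k' u d) < \<eta>" for d
      using \<eta> unfolding uniformly_continuous_on_def by blast
    then obtain \<delta>1 \<delta>2 where \<delta>: "\<delta>1 > 0" "\<delta>2 > 0"
      "\<And>u v. u \<in> ?B \<Longrightarrow> v \<in> ?B \<Longrightarrow> dist v u < \<delta>1 \<Longrightarrow> dist (k' v 1) (k' u 1) < \<eta>"
      "\<And>u v. u \<in> ?B \<Longrightarrow> v \<in> ?B \<Longrightarrow> dist v u < \<delta>2 \<Longrightarrow> dist (k' v \<i>) (k' u \<i>) < \<eta>"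
      by metis
    define \<delta> where "\<delta> = min 1 (min \<delta>1 \<delta>2)"
    have \<delta>0: "\<delta> > 0" using \<delta> by (simp add: \<delta>_def)
    have est: "norm (g \<zeta> * k (\<zeta> - y) - g \<zeta> * k (\<zeta> - z) + g \<zeta> * k' (\<zeta> - z) (y - z)) \<le> norm (g \<zeta>) * (norm (y - z) * (2 * \<eta>))"
      if y: "norm (y - z) < \<delta>" for y \<zeta>
    proof (cases "\<zeta> \<in> cball 0 R")
      case True
      have dB: "u \<in> ?B \<and> dist u (\<zeta> - z) < \<delta>" if "u \<in> ball (\<zeta> - z) \<delta>" for u
      proof -
        have "dist (-z) u \<le> dist (-z) (\<zeta> - z) + dist (\<zeta> - z) u" by (rule dist_triangle)
        also have "\<dots> \<le> R + 1" using that True by (simp add: dist_norm \<delta>_def)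
        finally show ?thesis using that by (simp add: dist_commute)
      qed
      have "norm (k (\<zeta> - y) - k (\<zeta> - z) - k' (\<zeta> - z) ((\<zeta> - y) - (\<zeta> - z))) \<le> norm ((\<zeta> - y) - (\<zeta> - z)) * (2 * \<eta>)"
      proof (rule differentiable_bound_linearization[where S="ball (\<zeta> - z) \<delta>" and f=k and f'=k'
            and a="\<zeta> - z" and b="\<zeta> - y" and ?x0.0="\<zeta> - z"])
        fix t :: real assume t: "t \<in> {0..1}"
        have "norm (t *\<^sub>R (z - y)) \<le> norm (z - y)" using t by (simp add: mult_left_le_one_le)
        also have "\<dots> < \<delta>" using y by (simp add: norm_minus_commute)
        finally show "(\<zeta> - z) + t *\<^sub>R ((\<zeta> - y) - (\<zeta> - z)) \<in> ball (\<zeta> - z) \<delta>"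
          by (simp add: dist_norm norm_minus_commute)
      next
        show "(k has_derivative k' x) (at x within ball (\<zeta> - z) \<delta>)" for x
          using C1_onD(1)[OF k] has_derivative_at_withinI by blast
      next
        fix x assume x: "x \<in> ball (\<zeta> - z) \<delta>"
        have z0: "\<zeta> - z \<in> ?B" using dB[of "\<zeta> - z"] \<delta>0 by simp
        show "onorm (k' x - k' (\<zeta> - z)) \<le> 2 * \<eta>"
        proof (rule onorm_bound)
          fix h
          have "(k' x - k' (\<zeta> - z)) h = Re h *\<^sub>R (k' x 1 - k' (\<zeta> - z) 1) + Im h *\<^sub>R (k' x \<i> - k' (\<zeta> - z) \<i>)"
            using C1_on_linear_parts[OF k, of x h] C1_on_linear_parts[OF k, of "\<zeta> - z" h]
            by (simp add: algebra_simps)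
          then have "norm ((k' x - k' (\<zeta> - z)) h) \<le> \<bar>Re h\<bar> * norm (k' x 1 - k' (\<zeta> - z) 1) + \<bar>Im h\<bar> * norm (k' x \<i> - k' (\<zeta> - z) \<i>)"
            using norm_triangle_ineq by (metis norm_scaleR)
          also have "\<dots> \<le> norm h * \<eta> + norm h * \<eta>"
            using \<delta>(3)[OF z0, of x] \<delta>(4)[OF z0, of x] dB[OF x]
            by (intro add_mono mult_mono abs_Re_le_cmod abs_Im_le_cmod) (auto simp: dist_norm \<delta>_def)
          finally show "norm ((k' x - k' (\<zeta> - z)) h) \<le> 2 * \<eta> * norm h" by simp
        qed (use \<eta> in simp)
      qed (use \<delta>0 in simp)
      moreover have "(\<zeta> - y) - (\<zeta> - z) = - (y - z)" by simp
      moreover have "k' (\<zeta> - z) (- (y - z)) = - k' (\<zeta> - z) (y - z)"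
        using C1_on_linear_parts[OF k, of "\<zeta> - z"] by (metis UNIV_I add.inverse_inverse minus_add_distrib scaleR_minus_left uminus_complex.simps)
      ultimately have "norm (k (\<zeta> - y) - k (\<zeta> - z) + k' (\<zeta> - z) (y - z)) \<le> norm (y - z) * (2 * \<eta>)"
        by (metis diff_minus_eq_add norm_minus_cancel)
      then have "norm (g \<zeta>) * norm (k (\<zeta> - y) - k (\<zeta> - z) + k' (\<zeta> - z) (y - z)) \<le> norm (g \<zeta>) * (norm (y - z) * (2 * \<eta>))"
        by (intro mult_left_mono) auto
      moreover have "g \<zeta> * k (\<zeta> - y) - g \<zeta> * k (\<zeta> - z) + g \<zeta> * k' (\<zeta> - z) (y - z) =
          g \<zeta> * (k (\<zeta> - y) - k (\<zeta> - z) + k' (\<zeta> - z) (y - z))" by (simp add: algebra_simps)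
      ultimately show ?thesis by (simp add: norm_mult)
    qed (simp add: R)
    show "\<exists>d>0. \<forall>y. norm (y - z) < d \<longrightarrow> norm (?F y - ?F z - ?F' (y - z)) \<le> e * norm (y - z)"
    proof (intro exI[of _ \<delta>] conjI allI impI \<delta>0)
      fix y assume y: "norm (y - z) < \<delta>"
      have "?F y - ?F z - ?F' (y - z) =
        (LINT \<zeta>|lebesgue. g \<zeta> * k (\<zeta> - y) - g \<zeta> * k (\<zeta> - z) + g \<zeta> * k' (\<zeta> - z) (y - z))"
        unfolding F' using i1 i2 by simp
      also have "norm \<dots> \<le> (LINT \<zeta>|lebesgue. norm (g \<zeta>) * (norm (y - z) * (2 * \<eta>)))"
        by (rule Bochner_Integration.integral_norm_bound_integral)
          (use i1 i2 ig est[OF y] in auto)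
      also have "\<dots> = (LINT \<zeta>|lebesgue. norm (g \<zeta>)) * (2 * \<eta>) * norm (y - z)" by simp
      also have "\<dots> \<le> N * (2 * \<eta>) * norm (y - z)"
        using \<eta> by (intro mult_right_mono) (auto simp: N_def)
      also have "\<dots> = e * norm (y - z)" using N by (simp add: \<eta>_def)
      finally show "norm (?F y - ?F z - ?F' (y - z)) \<le> e * norm (y - z)" .
    qed
  qed
qed

lemma subcriticalD:
  assumes "subcritical g"
  obtains R where "integrable lebesgue g" "\<And>z. z \<notin> cball 0 R \<Longrightarrow> g z = 0"
  using assms unfolding subcritical_def by blast

lemma eventually_reg_cauchy_close:
  assumes "subcritical g" "e > 0"
  shows "\<forall>\<^sub>F n in sequentially. \<forall>z. norm (reg_cauchy (1 / real (Suc n)) g z - cauchy_transform g z) < e"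
proof -
  obtain s M where sM: "s > 0" "M \<ge> 0"
    "\<And>\<epsilon> z. \<epsilon> > 0 \<Longrightarrow> norm (cauchy_transform g z - reg_cauchy \<epsilon> g z) \<le> M * \<epsilon> powr s"
    using reg_cauchy_converges[OF assms(1)] by blast
  have "(\<lambda>n. M * (1 / real (Suc n)) powr s) \<longlonglongrightarrow> 0"
    using sM(1) by real_asymp
  then have "\<forall>\<^sub>F n in sequentially. M * (1 / real (Suc n)) powr s < e"
    using assms(2) by (rule order_tendstoD)
  then show ?thesis
  proof eventually_elim
    case (elim n)
    have "1 / real (Suc n) > 0" by simp
    show ?case
    proof
      fix z
      have "norm (reg_cauchy (1 / real (Suc n)) g z - cauchy_transform g z) \<le> M * (1 / real (Suc n)) powr s"
        using sM(3)[OF \<open>1 / real (Suc n) > 0\<close>, of z] by (simp only: norm_minus_commute)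
      then show "norm (reg_cauchy (1 / real (Suc n)) g z - cauchy_transform g z) < e" using elim by linarith
    qed
  qed
qed

lemma continuous_reg_cauchy:
  assumes "subcritical g" "\<epsilon> > 0"
  shows "continuous_on UNIV (reg_cauchy \<epsilon> g)"
proof -
  obtain R where R: "integrable lebesgue g" "\<And>z. z \<notin> cball 0 R \<Longrightarrow> g z = 0"
    using subcriticalD[OF assms(1)] by blast
  obtain k' where k: "C1_on UNIV (reg_kernel \<epsilon>) k'" using reg_kernel_C1[OF assms(2)] by blast
  show ?thesis
    unfolding reg_cauchy_def[abs_def]
    by (rule has_derivative_continuous_on) (rule has_derivative_at_withinI[OF has_derivative_convolution[OF R k]])
qed

lemma continuous_cauchy_transform:
  assumes "subcritical g"
  shows "continuous_on UNIV (cauchy_transform g)"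
proof (rule uniform_limit_theorem)
  show "\<forall>\<^sub>F n in sequentially. continuous_on UNIV (reg_cauchy (1 / real (Suc n)) g)"
    by (intro always_eventually allI continuous_reg_cauchy assms) simp
  show "uniform_limit UNIV (\<lambda>n. reg_cauchy (1 / real (Suc n)) g) (cauchy_transform g) sequentially"
    unfolding uniform_limit_iff dist_norm using eventually_reg_cauchy_close[OF assms] by simp
qed simp

text \<open>For the regularised kernels the derivative passes from the kernel to the density by the
  hypotheses \<open>wx\<close> and \<open>wy\<close>; the derivatives then converge uniformly, so
  the limit may be differentiated. The hypotheses allow test functions of arbitrary support because
  the kernels do not vanish at a distance; the compact support is that of \<open>g\<close>.\<close>

theorem C1_cauchy_transform:
  assumes g: "subcritical g" and gx: "subcritical gx" and gy: "subcritical gy"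
    and wx: "\<And>\<Phi> \<Phi>'. C1_on UNIV \<Phi> \<Phi>' \<Longrightarrow> (LINT z|lebesgue. \<Phi>' z 1 * g z) = - (LINT z|lebesgue. \<Phi> z * gx z)"
    and wy: "\<And>\<Phi> \<Phi>'. C1_on UNIV \<Phi> \<Phi>' \<Longrightarrow> (LINT z|lebesgue. \<Phi>' z \<i> * g z) = - (LINT z|lebesgue. \<Phi> z * gy z)"
  shows "C1_on UNIV (cauchy_transform g) (\<lambda>z h. Re h *\<^sub>R cauchy_transform gx z + Im h *\<^sub>R cauchy_transform gy z)"
proof (rule C1_onI)
  obtain R where R: "integrable lebesgue g" "\<And>z. z \<notin> cball 0 R \<Longrightarrow> g z = 0"
    using subcriticalD[OF g] by blast
  have der: "(reg_cauchy \<epsilon> g has_derivative (\<lambda>h. Re h *\<^sub>R reg_cauchy \<epsilon> gx z + Im h *\<^sub>R reg_cauchy \<epsilon> gy z)) (at z)"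
    if e: "\<epsilon> > 0" for \<epsilon> z
  proof -
    obtain k' where k: "C1_on UNIV (reg_kernel \<epsilon>) k'" using reg_kernel_C1[OF e] by blast
    note t = C1_on_translate[OF k, of z]
    have x: "(LINT \<zeta>|lebesgue. g \<zeta> * k' (\<zeta> - z) 1) = - reg_cauchy \<epsilon> gx z"
      using wx[OF t] by (simp add: reg_cauchy_def mult.commute)
    have y: "(LINT \<zeta>|lebesgue. g \<zeta> * k' (\<zeta> - z) \<i>) = - reg_cauchy \<epsilon> gy z"
      using wy[OF t] by (simp add: reg_cauchy_def mult.commute)
    show ?thesis
      using has_derivative_convolution[OF R k, where z=z] unfolding x y reg_cauchy_def[abs_def] by (simp add: add.commute)
  qed
  define F where "F n = reg_cauchy (1 / real (Suc n)) g" for n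
  define F' where "F' n z h = Re h *\<^sub>R reg_cauchy (1 / real (Suc n)) gx z + Im h *\<^sub>R reg_cauchy (1 / real (Suc n)) gy z" for n z h
  define G' where "G' z h = Re h *\<^sub>R cauchy_transform gx z + Im h *\<^sub>R cauchy_transform gy z" for z h
  have lim: "(\<lambda>n. F n z) \<longlonglongrightarrow> cauchy_transform g z" for z
  proof (rule tendstoI)
    fix e :: real assume "e > 0"
    from eventually_reg_cauchy_close[OF g this]
    show "\<forall>\<^sub>F n in sequentially. dist (F n z) (cauchy_transform g z) < e"
      by eventually_elim (simp add: F_def dist_norm)
  qed
  have "\<exists>f. \<forall>x\<in>UNIV. (\<lambda>n. F n x) \<longlonglongrightarrow> f x \<and> (f has_derivative G' x) (at x within UNIV)"
  proof (rule has_derivative_sequence)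
    show "(F n has_derivative F' n z) (at z within UNIV)" for n z
      unfolding F_def F'_def by (rule der) simp
    fix e :: real assume e: "e > 0"
    then have e2: "e / 2 > 0" by simp
    show "\<forall>\<^sub>F n in sequentially. \<forall>x\<in>UNIV. \<forall>h. norm (F' n x h - G' x h) \<le> e * norm h"
      using eventually_reg_cauchy_close[OF gx e2] eventually_reg_cauchy_close[OF gy e2]
    proof eventually_elim
      case (elim n)
      show ?case
      proof (intro ballI allI)
        fix x h
        have "F' n x h - G' x h = Re h *\<^sub>R (reg_cauchy (1 / real (Suc n)) gx x - cauchy_transform gx x) +
            Im h *\<^sub>R (reg_cauchy (1 / real (Suc n)) gy x - cauchy_transform gy x)"
          by (simp add: F'_def G'_def algebra_simps)
        then have "norm (F' n x h - G' x h) \<le> \<bar>Re h\<bar> * norm (reg_cauchy (1 / real (Suc n)) gx x - cauchy_transform gx x) +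
            \<bar>Im h\<bar> * norm (reg_cauchy (1 / real (Suc n)) gy x - cauchy_transform gy x)"
          using norm_triangle_ineq by (metis norm_scaleR)
        also have "\<dots> \<le> norm h * (e / 2) + norm h * (e / 2)"
          using elim by (intro add_mono mult_mono abs_Re_le_cmod abs_Im_le_cmod) (auto intro: less_imp_le)
        finally show "norm (F' n x h - G' x h) \<le> e * norm h" by (simp add: mult.commute)
      qed
    qed
  qed (use lim in auto)
  then obtain f where f: "\<And>x. (\<lambda>n. F n x) \<longlonglongrightarrow> f x" "\<And>x. (f has_derivative G' x) (at x)" by auto
  have "f = cauchy_transform g" using LIMSEQ_unique[OF f(1) lim] by auto
  with f(2) show "(cauchy_transform g has_derivative (\<lambda>h. Re h *\<^sub>R cauchy_transform gx z + Im h *\<^sub>R cauchy_transform gy z)) (at z)" for z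
    by (simp add: G'_def[abs_def])
  show "continuous_on UNIV (\<lambda>z. Re e *\<^sub>R cauchy_transform gx z + Im e *\<^sub>R cauchy_transform gy z)" for e
    by (intro continuous_intros continuous_cauchy_transform gx gy)
qed

section \<open>The Cauchy-Pompeiu formula\<close>

definition dbar_of :: "(complex \<Rightarrow> complex \<Rightarrow> complex) \<Rightarrow> complex \<Rightarrow> complex"
  where "dbar_of f' z = (f' z 1 + \<i> * f' z \<i>) / 2"

lemma continuous_on_dbar_of: "C1_on S f f' \<Longrightarrow> continuous_on S (dbar_of f')"
  unfolding dbar_of_def[abs_def] by (intro continuous_intros C1_onD(2)) auto

lemma subcritical_continuous:
  assumes "continuous_on UNIV g" "compact K" "\<And>z. z \<notin> K \<Longrightarrow> g z = 0"
  shows "subcritical g"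
proof -
  obtain B where B: "B \<ge> 0" "\<And>z. z \<in> K \<Longrightarrow> norm (g z) \<le> B"
    using continuous_on_bounded_borel[OF continuous_on_subset[OF assms(1)] assms(2)] by auto
  obtain R where R: "\<And>z. z \<in> K \<Longrightarrow> norm z \<le> R" using compact_imp_bounded[OF assms(2)] bounded_iff by blast
  show ?thesis
  proof (rule subcritical_bounded)
    show "g \<in> borel_measurable lebesgue"
      by (rule borel_measurable_lebesgueI, rule borel_measurable_continuous_onI[OF assms(1)])
    show "norm (g z) \<le> B" for z using B assms(3)[of z] by (cases "z \<in> K") auto
    show "g z = 0" if "z \<notin> cball 0 R" for z using that R assms(3) by force
  qed
qed

text \<open>The product of \<open>\<phi>\<close> and the translated kernel has compact support, so
  its derivatives integrate to zero. Combining the directions 1 and \<open>\<i>\<close> moves the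
  derivative from \<open>\<phi>\<close> to the kernel, where it becomes the weight
  \<open>bump_mass \<epsilon>\<close>.\<close>

lemma reg_cauchy_dbar:
  assumes "C1_on UNIV \<phi> \<phi>'" "compact K" "\<And>z. z \<notin> K \<Longrightarrow> \<phi> z = 0" "\<epsilon> > 0"
  shows "reg_cauchy \<epsilon> (dbar_of \<phi>') z = - (LINT u|lborel. \<phi> (z + u) * of_real (bump_mass \<epsilon> u))"
    and "integrable lborel (\<lambda>u. \<phi> (z + u) * of_real (bump_mass \<epsilon> u))"
proof -
  obtain k' where k: "C1_on UNIV (reg_kernel \<epsilon>) k'"
    "\<And>u. (k' u 1 + \<i> * k' u \<i>) / 2 = of_real (bump_mass \<epsilon> u)" using reg_kernel_C1[OF assms(4)] by blast
  have v: "\<phi>' z e = 0" if "z \<notin> K" for z e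
    using C1_on_vanish[OF assms(1) compact_imp_closed[OF assms(2)] assms(3) that] by blast
  have subcritical: "subcritical (dbar_of \<phi>')"
    by (rule subcritical_continuous[OF continuous_on_dbar_of[OF assms(1)] assms(2)]) (simp add: dbar_of_def v)
  let ?k = "\<lambda>\<zeta>. reg_kernel \<epsilon> (\<zeta> - z)" and ?k' = "\<lambda>\<zeta>. k' (\<zeta> - z)"
  have P: "C1_on UNIV (\<lambda>\<zeta>. \<phi> \<zeta> * ?k \<zeta>) (\<lambda>\<zeta> h. \<phi> \<zeta> * ?k' \<zeta> h + \<phi>' \<zeta> h * ?k \<zeta>)"
    by (rule C1_on_mult[OF assms(1) C1_on_translate[OF k(1)]])
  have zero: "\<phi> \<zeta> * ?k \<zeta> = 0" if "\<zeta> \<notin> K" for \<zeta> using assms(3) that by simp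
  note Q = integral_C1_compact_support[OF P assms(2) zero]
  have eq: "(\<phi> \<zeta> * ?k' \<zeta> 1 + \<phi>' \<zeta> 1 * ?k \<zeta>) / 2 + \<i> * (\<phi> \<zeta> * ?k' \<zeta> \<i> + \<phi>' \<zeta> \<i> * ?k \<zeta>) / 2
      = \<phi> \<zeta> * of_real (bump_mass \<epsilon> (\<zeta> - z)) + dbar_of \<phi>' \<zeta> * ?k \<zeta>" for \<zeta>
    unfolding k(2)[symmetric] dbar_of_def by (simp add: field_simps)
  have i1: "integrable lebesgue (\<lambda>\<zeta>. \<phi> \<zeta> * of_real (bump_mass \<epsilon> (\<zeta> - z)) + dbar_of \<phi>' \<zeta> * ?k \<zeta>)"
    unfolding eq[symmetric] using Q(1)[of 1] Q(1)[of \<i>] by auto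
  have "(LINT \<zeta>|lebesgue. \<phi> \<zeta> * of_real (bump_mass \<epsilon> (\<zeta> - z)) + dbar_of \<phi>' \<zeta> * ?k \<zeta>) = 0"
    unfolding eq[symmetric] using Q(1)[of 1] Q(1)[of \<i>] Q(2)[of 1] Q(2)[of \<i>] by simp
  moreover have i2: "integrable lebesgue (\<lambda>\<zeta>. dbar_of \<phi>' \<zeta> * ?k \<zeta>)" by (rule reg_cauchy_integrable[OF subcritical assms(4)])
  moreover have i3: "integrable lebesgue (\<lambda>\<zeta>. \<phi> \<zeta> * of_real (bump_mass \<epsilon> (\<zeta> - z)))"
    using Bochner_Integration.integrable_diff[OF i1 i2] by simp
  ultimately have r: "reg_cauchy \<epsilon> (dbar_of \<phi>') z = - (LINT \<zeta>|lebesgue. \<phi> \<zeta> * of_real (bump_mass \<epsilon> (\<zeta> - z)))"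
    unfolding reg_cauchy_def by (simp add: add_eq_0_iff2)
  have [measurable]: "\<phi> \<in> borel_measurable borel"
    by (rule borel_measurable_continuous_onI[OF C1_on_imp_continuous_on[OF assms(1)]])
  have m: "(\<lambda>\<zeta>. \<phi> \<zeta> * of_real (bump_mass \<epsilon> (\<zeta> - z))) \<in> borel_measurable borel"
    unfolding bump_mass_def by measurable
  have i4: "integrable lborel (\<lambda>\<zeta>. \<phi> \<zeta> * of_real (bump_mass \<epsilon> (\<zeta> - z)))"
    using i3 m by (subst (asm) integrable_completion) auto
  from integrable_lborel_translate[OF this, of z]
  show "integrable lborel (\<lambda>u. \<phi> (z + u) * of_real (bump_mass \<epsilon> u))" by simp
  have "(LINT \<zeta>|lebesgue. \<phi> \<zeta> * of_real (bump_mass \<epsilon> (\<zeta> - z))) = (LINT \<zeta>|lborel. \<phi> \<zeta> * of_real (bump_mass \<epsilon> (\<zeta> - z)))"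
    using m by (subst integral_completion) auto
  also have "\<dots> = (LINT u|lborel. \<phi> (z + u) * of_real (bump_mass \<epsilon> u))"
    using integral_lborel_translate[OF m, of z] by simp
  finally show "reg_cauchy \<epsilon> (dbar_of \<phi>') z = - (LINT u|lborel. \<phi> (z + u) * of_real (bump_mass \<epsilon> u))"
    using r by simp
qed

text \<open>Away from 0 the weights are dominated by the fixed integrable function
  \<open>bump_mass 1\<close> with a factor that is quadratic in \<open>\<epsilon>\<close>, so the
  mass outside any disc about 0 tends to 0.\<close>

lemma bump_mass_tail:
  assumes "\<delta> > 0" "norm u \<ge> \<delta>" "\<epsilon> > 0"
  shows "bump_mass \<epsilon> u \<le> \<epsilon>\<^sup>2 * (1 + 1 / \<delta>\<^sup>2)\<^sup>2 * bump_mass 1 u"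
proof -
  let ?n = "norm u"
  have n: "?n > 0" using assms by linarith
  have d: "\<delta>\<^sup>2 \<le> ?n\<^sup>2" using assms by (simp add: power_mono)
  have "1 + ?n\<^sup>2 \<le> (1 + 1 / \<delta>\<^sup>2) * ?n\<^sup>2"
    using d assms(1) by (simp add: field_simps)
  also have "\<dots> \<le> (1 + 1 / \<delta>\<^sup>2) * (?n\<^sup>2 + \<epsilon>\<^sup>2)" by (intro mult_left_mono) auto
  finally have le: "?n\<^sup>2 + 1 \<le> (1 + 1 / \<delta>\<^sup>2) * (?n\<^sup>2 + \<epsilon>\<^sup>2)" by simp
  then have "(?n\<^sup>2 + 1)\<^sup>2 \<le> ((1 + 1 / \<delta>\<^sup>2) * (?n\<^sup>2 + \<epsilon>\<^sup>2))\<^sup>2" by (intro power_mono) auto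
  then have "(?n\<^sup>2 + 1)\<^sup>2 \<le> (1 + 1 / \<delta>\<^sup>2)\<^sup>2 * (?n\<^sup>2 + \<epsilon>\<^sup>2)\<^sup>2" by (simp add: power_mult_distrib)
  moreover have "?n\<^sup>2 + 1 > 0" "?n\<^sup>2 + \<epsilon>\<^sup>2 > 0" using n by (simp_all add: add_pos_nonneg add_nonneg_pos)
  then have "(?n\<^sup>2 + 1)\<^sup>2 > 0" "(?n\<^sup>2 + \<epsilon>\<^sup>2)\<^sup>2 > 0" by (simp_all only: zero_less_power)
  ultimately have "1 / (?n\<^sup>2 + \<epsilon>\<^sup>2)\<^sup>2 \<le> (1 + 1 / \<delta>\<^sup>2)\<^sup>2 / (?n\<^sup>2 + 1)\<^sup>2"
    by (simp add: field_simps)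
  then have "\<epsilon>\<^sup>2 * (1 / (?n\<^sup>2 + \<epsilon>\<^sup>2)\<^sup>2) \<le> \<epsilon>\<^sup>2 * ((1 + 1 / \<delta>\<^sup>2)\<^sup>2 / (?n\<^sup>2 + 1)\<^sup>2)" by (intro mult_left_mono) auto
  then show ?thesis by (simp add: bump_mass_def)
qed

text \<open>The weights \<open>bump_mass \<epsilon>\<close> have mass \<open>pi\<close> and
  concentrate at 0, so the regularised transforms tend to \<open>- pi * \<phi> z\<close>; they also
  tend to the transform itself.\<close>

theorem cauchy_pompeiu:
  assumes "C1_on UNIV \<phi> \<phi>'" "compact K" "\<And>z. z \<notin> K \<Longrightarrow> \<phi> z = 0"
  shows "cauchy_transform (dbar_of \<phi>') z = - (of_real pi * \<phi> z)"
proof -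
  have v: "\<phi>' z e = 0" if "z \<notin> K" for z e
    using C1_on_vanish[OF assms(1) compact_imp_closed[OF assms(2)] assms(3) that] by blast
  have subcritical: "subcritical (dbar_of \<phi>')"
    by (rule subcritical_continuous[OF continuous_on_dbar_of[OF assms(1)] assms(2)]) (simp add: dbar_of_def v)
  obtain L where L: "L > 0" "\<And>x y. norm (\<phi> x - \<phi> y) \<le> L * norm (x - y)"
    using C1_on_compact_support_Lipschitz[OF assms] by blast
  obtain B0 where B0: "\<And>z. z \<in> K \<Longrightarrow> norm (\<phi> z) \<le> B0" "B0 \<ge> 0"
    using continuous_on_bounded_borel[OF continuous_on_subset[OF C1_on_imp_continuous_on[OF assms(1)]] assms(2)] by auto
  have B: "norm (\<phi> z) \<le> B0" for z using B0 assms(3)[of z] by (cases "z \<in> K") auto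
  have l1: "(\<lambda>n. reg_cauchy (1 / real (Suc n)) (dbar_of \<phi>') z) \<longlonglongrightarrow> cauchy_transform (dbar_of \<phi>') z"
  proof (rule tendstoI)
    fix e :: real assume "e > 0"
    from eventually_reg_cauchy_close[OF subcritical this]
    show "\<forall>\<^sub>F n in sequentially. dist (reg_cauchy (1 / real (Suc n)) (dbar_of \<phi>') z) (cauchy_transform (dbar_of \<phi>') z) < e"
      by eventually_elim (simp add: dist_norm)
  qed
  \<comment> \<open>The first summand comes from the disc of radius \<open>\<delta>\<close>, where
    \<open>\<phi>\<close> is controlled by its Lipschitz constant; the second from its complement,
    where only the bound \<open>B0\<close> on \<open>\<phi>\<close> and the small tail are
    used.\<close>
  have est: "norm (reg_cauchy \<epsilon> (dbar_of \<phi>') z + of_real pi * \<phi> z) \<le> L * \<delta> * pi + 2 * B0 * (\<epsilon>\<^sup>2 * (1 + 1 / \<delta>\<^sup>2)\<^sup>2) * pi"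
    if e: "\<epsilon> > 0" "\<delta> > 0" for \<epsilon> \<delta>
  proof -
    have r: "reg_cauchy \<epsilon> (dbar_of \<phi>') z = - (LINT u|lborel. \<phi> (z + u) * of_real (bump_mass \<epsilon> u))"
      "integrable lborel (\<lambda>u. \<phi> (z + u) * of_real (bump_mass \<epsilon> u))"
      by (rule reg_cauchy_dbar[OF assms e(1)], assumption)+
    note b = integral_bump_mass[OF e(1)]
    have b': "integrable lborel (\<lambda>u. of_real (bump_mass \<epsilon> u) :: complex)" using b(1) by simp
    have ib: "integrable lborel (\<lambda>u. \<phi> z * of_real (bump_mass \<epsilon> u))" using b' by simp
    have "reg_cauchy \<epsilon> (dbar_of \<phi>') z + of_real pi * \<phi> z =
        (LINT u|lborel. \<phi> z * of_real (bump_mass \<epsilon> u)) - (LINT u|lborel. \<phi> (z + u) * of_real (bump_mass \<epsilon> u))"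
    proof -
      have X: "(LINT u|lborel. \<phi> z * of_real (bump_mass \<epsilon> u)) = of_real pi * \<phi> z"
        using b by (simp add: mult.commute[of "\<phi> z"])
      show ?thesis unfolding X r(1) by simp
    qed
    also have "\<dots> = (LINT u|lborel. \<phi> z * of_real (bump_mass \<epsilon> u) - \<phi> (z + u) * of_real (bump_mass \<epsilon> u))"
      by (rule Bochner_Integration.integral_diff[symmetric, OF ib r(2)])
    also have "norm \<dots> \<le> (LINT u|lborel. (L * \<delta>) * bump_mass \<epsilon> u + (2 * B0 * (\<epsilon>\<^sup>2 * (1 + 1 / \<delta>\<^sup>2)\<^sup>2)) * bump_mass 1 u)"
    proof (rule Bochner_Integration.integral_norm_bound_integral[OF Bochner_Integration.integrable_diff[OF ib r(2)]])
      show "integrable lborel (\<lambda>u. (L * \<delta>) * bump_mass \<epsilon> u + (2 * B0 * (\<epsilon>\<^sup>2 * (1 + 1 / \<delta>\<^sup>2)\<^sup>2)) * bump_mass 1 u)"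
        using b(1) integral_bump_mass(1)[of 1] by simp
      fix u
      have "\<phi> z * of_real (bump_mass \<epsilon> u) - \<phi> (z + u) * of_real (bump_mass \<epsilon> u) = (\<phi> z - \<phi> (z + u)) * of_real (bump_mass \<epsilon> u)"
        by (simp add: algebra_simps)
      then have n: "norm (\<phi> z * of_real (bump_mass \<epsilon> u) - \<phi> (z + u) * of_real (bump_mass \<epsilon> u)) = norm (\<phi> z - \<phi> (z + u)) * bump_mass \<epsilon> u"
        using bump_mass_nonneg[of \<epsilon> u] by (simp add: norm_mult)
      show "norm (\<phi> z * of_real (bump_mass \<epsilon> u) - \<phi> (z + u) * of_real (bump_mass \<epsilon> u)) \<le>
          (L * \<delta>) * bump_mass \<epsilon> u + (2 * B0 * (\<epsilon>\<^sup>2 * (1 + 1 / \<delta>\<^sup>2)\<^sup>2)) * bump_mass 1 u"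
      proof (cases "norm u < \<delta>")
        case True
        have "norm (\<phi> z - \<phi> (z + u)) \<le> L * norm u" using L(2)[of z "z + u"] by simp
        also have "\<dots> \<le> L * \<delta>" using L True by simp
        finally have "norm (\<phi> z - \<phi> (z + u)) * bump_mass \<epsilon> u \<le> (L * \<delta>) * bump_mass \<epsilon> u"
          by (rule mult_right_mono[OF _ bump_mass_nonneg])
        moreover have "0 \<le> (2 * B0 * (\<epsilon>\<^sup>2 * (1 + 1 / \<delta>\<^sup>2)\<^sup>2)) * bump_mass 1 u"
          using B0 by (intro mult_nonneg_nonneg bump_mass_nonneg) auto
        ultimately show ?thesis unfolding n by linarith
      next
        case False
        have "norm (\<phi> z - \<phi> (z + u)) \<le> 2 * B0"
          using norm_triangle_ineq4[of "\<phi> z" "\<phi> (z + u)"] B[of z] B[of "z + u"] by linarith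
        then have "norm (\<phi> z - \<phi> (z + u)) * bump_mass \<epsilon> u \<le> 2 * B0 * (\<epsilon>\<^sup>2 * (1 + 1 / \<delta>\<^sup>2)\<^sup>2 * bump_mass 1 u)"
          using bump_mass_tail[OF e(2) _ e(1), of u] False B0(2) by (intro mult_mono bump_mass_nonneg) auto
        moreover have "0 \<le> (L * \<delta>) * bump_mass \<epsilon> u"
          using L e by (intro mult_nonneg_nonneg bump_mass_nonneg) auto
        ultimately show ?thesis unfolding n by (simp add: mult_ac)
      qed
    qed
    also have "\<dots> = L * \<delta> * pi + 2 * B0 * (\<epsilon>\<^sup>2 * (1 + 1 / \<delta>\<^sup>2)\<^sup>2) * pi"
      using b integral_bump_mass[of 1] by simp
    finally show ?thesis .
  qed
  have l2: "(\<lambda>n. reg_cauchy (1 / real (Suc n)) (dbar_of \<phi>') z) \<longlonglongrightarrow> - (of_real pi * \<phi> z)"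
  proof (rule tendstoI)
    fix e :: real assume e: "e > 0"
    \<comment> \<open>Makes the first summand of the estimate equal to \<open>e / 2\<close> for
      every \<open>n\<close>.\<close>
    define \<delta> where "\<delta> = e / (2 * L * pi)"
    have \<delta>: "\<delta> > 0" "L * \<delta> * pi = e / 2" using e L by (simp_all add: \<delta>_def)
    have "(\<lambda>n. 2 * B0 * ((1 / real (Suc n))\<^sup>2 * (1 + 1 / \<delta>\<^sup>2)\<^sup>2) * pi) \<longlonglongrightarrow> 0"
      by real_asymp
    then have "\<forall>\<^sub>F n in sequentially. 2 * B0 * ((1 / real (Suc n))\<^sup>2 * (1 + 1 / \<delta>\<^sup>2)\<^sup>2) * pi < e / 2"
      by (rule order_tendstoD(2)) (use e in simp)
    then show "\<forall>\<^sub>F n in sequentially. dist (reg_cauchy (1 / real (Suc n)) (dbar_of \<phi>') z) (- (of_real pi * \<phi> z)) < e"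
    proof eventually_elim
      case (elim n)
      then show ?case using est[of "1 / real (Suc n)" \<delta>] \<delta> by (simp add: dist_norm)
    qed
  qed
  show ?thesis using LIMSEQ_unique[OF l1 l2] .
qed

section \<open>Skew symmetry, and holomorphy away from the support\<close>

lemma cauchy_transform_cong_AE:
  assumes "AE z in lebesgue. f z = g z" "f \<in> borel_measurable lebesgue" "g \<in> borel_measurable lebesgue"
  shows "cauchy_transform f z = cauchy_transform g z"
  unfolding cauchy_transform_def
proof (rule integral_cong_AE)
  show "(\<lambda>\<zeta>. f \<zeta> / (\<zeta> - z)) \<in> borel_measurable lebesgue" "(\<lambda>\<zeta>. g \<zeta> / (\<zeta> - z)) \<in> borel_measurable lebesgue"
    using lebesgue_times_borel[OF assms(2) kernel_measurable[of z]]
      lebesgue_times_borel[OF assms(3) kernel_measurable[of z]] by simp_all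
  show "AE \<zeta> in lebesgue. f \<zeta> / (\<zeta> - z) = g \<zeta> / (\<zeta> - z)" using assms(1) by eventually_elim simp
qed

text \<open>The kernel \<open>1 / (\<zeta> - z)\<close> changes sign when its arguments are
  exchanged, and Fubini's theorem applies. Only \<open>g2\<close> needs a uniform kernel bound;
  \<open>g1\<close> may be merely integrable, which is all that is known of the density in Weyl's
  lemma.\<close>

theorem cauchy_transform_skew:
  assumes g1: "integrable lebesgue g1" and g2: "subcritical g2"
  shows "(LINT z|lebesgue. g2 z * cauchy_transform g1 z) = - (LINT z|lebesgue. g1 z * cauchy_transform g2 z)"
    and "integrable lebesgue (\<lambda>z. g2 z * cauchy_transform g1 z)"
proof -
  obtain b1 where b1[measurable]: "b1 \<in> borel_measurable borel" and e1: "AE z in lebesgue. g1 z = b1 z"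
    using completion_ex_borel_complex[OF borel_measurable_integrable[OF g1]] by blast
  obtain b2 where b2[measurable]: "b2 \<in> borel_measurable borel" and e2: "AE z in lebesgue. g2 z = b2 z"
    using completion_ex_borel_complex[OF subcritical_measurable[OF g2]] by blast
  have m1: "b1 \<in> borel_measurable lebesgue" and m2: "b2 \<in> borel_measurable lebesgue"
    using b1 b2 by (auto intro: borel_measurable_lebesgueI)
  have c1: "cauchy_transform g1 = cauchy_transform b1" and c2: "cauchy_transform g2 = cauchy_transform b2"
    using cauchy_transform_cong_AE[OF e1 borel_measurable_integrable[OF g1] m1]
      cauchy_transform_cong_AE[OF e2 subcritical_measurable[OF g2] m2] by auto
  obtain M where M: "M \<ge> 0" "\<And>z. integrable lebesgue (\<lambda>\<zeta>. g2 \<zeta> / (\<zeta> - z))"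
    "\<And>z. (LINT \<zeta>|lebesgue. norm (g2 \<zeta> / (\<zeta> - z))) \<le> M" using subcritical_kernel_integrable[OF g2] by blast
  have i2: "integrable lborel (\<lambda>\<zeta>. b2 \<zeta> / (\<zeta> - z))" and l2: "(LINT \<zeta>|lborel. norm (b2 \<zeta> / (\<zeta> - z))) \<le> M" for z
  proof -
    have m: "(\<lambda>\<zeta>. b2 \<zeta> / (\<zeta> - z)) \<in> borel_measurable lebesgue" by (rule borel_measurable_lebesgueI) measurable
    have ae: "AE \<zeta> in lebesgue. g2 \<zeta> / (\<zeta> - z) = b2 \<zeta> / (\<zeta> - z)" using e2 by eventually_elim simp
    have "integrable lebesgue (\<lambda>\<zeta>. b2 \<zeta> / (\<zeta> - z))"
      by (rule integrable_cong_AE_imp[OF M(2)[of z] m]) (use ae in \<open>eventually_elim, simp\<close>)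
    then show "integrable lborel (\<lambda>\<zeta>. b2 \<zeta> / (\<zeta> - z))" by (subst (asm) integrable_completion) auto
    have "(LINT \<zeta>|lborel. norm (b2 \<zeta> / (\<zeta> - z))) = (LINT \<zeta>|lebesgue. norm (b2 \<zeta> / (\<zeta> - z)))"
      by (subst integral_completion) auto
    also have "\<dots> = (LINT \<zeta>|lebesgue. norm (g2 \<zeta> / (\<zeta> - z)))"
      by (rule integral_cong_AE) (use m borel_measurable_integrable[OF M(2)[of z]] ae in \<open>auto\<close>)
    also have "\<dots> \<le> M" by (rule M)
    finally show "(LINT \<zeta>|lborel. norm (b2 \<zeta> / (\<zeta> - z))) \<le> M" .
  qed
  have i1: "integrable lborel b1"
  proof -
    have "integrable lebesgue b1"
      by (rule integrable_cong_AE_imp[OF g1 m1]) (use e1 in \<open>eventually_elim, simp\<close>)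
    then show ?thesis by (subst (asm) integrable_completion) auto
  qed
  let ?f = "\<lambda>\<zeta> z. b1 \<zeta> * (b2 z / (\<zeta> - z))"
  have neg: "b2 z / (\<zeta> - z) = - (b2 z / (z - \<zeta>))" for z \<zeta>
    by (metis minus_diff_eq minus_divide_right)
  have int: "integrable (lborel \<Otimes>\<^sub>M lborel) (case_prod ?f)"
  proof (rule lborel_pair.Fubini_integrable)
    show "case_prod ?f \<in> borel_measurable (lborel \<Otimes>\<^sub>M lborel)" by measurable
    show "integrable lborel (\<lambda>\<zeta>. LINT z|lborel. norm (case (\<zeta>, z) of (\<zeta>, z) \<Rightarrow> ?f \<zeta> z))"
    proof (rule Bochner_Integration.integrable_bound[where f="\<lambda>\<zeta>. M * norm (b1 \<zeta>)"])
      show "integrable lborel (\<lambda>\<zeta>. M * norm (b1 \<zeta>))" using i1 by simp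
      show "AE \<zeta> in lborel. norm (LINT z|lborel. norm (case (\<zeta>, z) of (\<zeta>, z) \<Rightarrow> ?f \<zeta> z)) \<le> norm (M * norm (b1 \<zeta>))"
      proof (rule AE_I2)
        fix \<zeta>
        have "(LINT z|lborel. norm (?f \<zeta> z)) = norm (b1 \<zeta>) * (LINT z|lborel. norm (b2 z / (z - \<zeta>)))"
          unfolding neg by (simp add: norm_mult del: times_divide_eq_right)
        also have "\<dots> \<le> norm (b1 \<zeta>) * M" by (intro mult_left_mono l2) auto
        finally have "(LINT z|lborel. norm (?f \<zeta> z)) \<le> M * norm (b1 \<zeta>)" by (simp add: mult.commute)
        moreover have "0 \<le> (LINT z|lborel. norm (?f \<zeta> z))" by (rule Bochner_Integration.integral_nonneg) simp
        ultimately show "norm (LINT z|lborel. norm (case (\<zeta>, z) of (\<zeta>, z) \<Rightarrow> ?f \<zeta> z)) \<le> norm (M * norm (b1 \<zeta>))"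
          by simp
      qed
    qed measurable
    show "AE \<zeta> in lborel. integrable lborel (\<lambda>z. case (\<zeta>, z) of (\<zeta>, z) \<Rightarrow> ?f \<zeta> z)"
    proof (rule AE_I2)
      fix \<zeta>
      have "integrable lborel (\<lambda>z. b1 \<zeta> * - (b2 z / (z - \<zeta>)))"
        by (intro integrable_mult_right Bochner_Integration.integrable_minus i2)
      then show "integrable lborel (\<lambda>z. case (\<zeta>, z) of (\<zeta>, z) \<Rightarrow> ?f \<zeta> z)" unfolding neg[symmetric] by simp
    qed
  qed
  have L: "(LINT \<zeta>|lborel. ?f \<zeta> z) = b2 z * cauchy_transform b1 z" for z
  proof -
    have "(LINT \<zeta>|lborel. ?f \<zeta> z) = (LINT \<zeta>|lborel. b2 z * (b1 \<zeta> / (\<zeta> - z)))"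
      by (rule Bochner_Integration.integral_cong) auto
    also have "\<dots> = b2 z * (LINT \<zeta>|lborel. b1 \<zeta> / (\<zeta> - z))" by (rule integral_mult_right_zero)
    also have "(LINT \<zeta>|lborel. b1 \<zeta> / (\<zeta> - z)) = cauchy_transform b1 z"
      unfolding cauchy_transform_def by (subst integral_completion) auto
    finally show ?thesis .
  qed
  have R: "(LINT z|lborel. ?f \<zeta> z) = - (b1 \<zeta> * cauchy_transform b2 \<zeta>)" for \<zeta>
  proof -
    have "(LINT z|lborel. ?f \<zeta> z) = b1 \<zeta> * (LINT z|lborel. - (b2 z / (z - \<zeta>)))"
      unfolding neg by (rule integral_mult_right_zero)
    also have "(LINT z|lborel. - (b2 z / (z - \<zeta>))) = - cauchy_transform b2 \<zeta>"
      unfolding cauchy_transform_def by (subst integral_completion) auto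
    finally show ?thesis by simp
  qed
  have mc: "(\<lambda>z. cauchy_transform b1 z) \<in> borel_measurable borel" "(\<lambda>z. cauchy_transform b2 z) \<in> borel_measurable borel"
  proof -
    have "cauchy_transform b z = (LINT \<zeta>|lborel. b \<zeta> / (\<zeta> - z))" if "b \<in> borel_measurable borel" for b z
      unfolding cauchy_transform_def using that by (subst integral_completion) auto
    then have "cauchy_transform b1 = (\<lambda>z. LINT \<zeta>|lborel. b1 \<zeta> / (\<zeta> - z))" "cauchy_transform b2 = (\<lambda>z. LINT \<zeta>|lborel. b2 \<zeta> / (\<zeta> - z))"
      using b1 b2 by auto
    then show "(\<lambda>z. cauchy_transform b1 z) \<in> borel_measurable borel" "(\<lambda>z. cauchy_transform b2 z) \<in> borel_measurable borel"
      by simp_all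
  qed
  have t1: "(LINT z|lebesgue. g2 z * cauchy_transform g1 z) = (LINT z|lborel. b2 z * cauchy_transform b1 z)"
  proof -
    have "(LINT z|lebesgue. g2 z * cauchy_transform g1 z) = (LINT z|lebesgue. b2 z * cauchy_transform b1 z)"
      unfolding c1 using e2
      by (intro integral_cong_AE lebesgue_times_borel subcritical_measurable[OF g2] mc m2) auto
    also have "\<dots> = (LINT z|lborel. b2 z * cauchy_transform b1 z)" using mc by (subst integral_completion) auto
    finally show ?thesis .
  qed
  have t2: "(LINT z|lebesgue. g1 z * cauchy_transform g2 z) = (LINT z|lborel. b1 z * cauchy_transform b2 z)"
  proof -
    have "(LINT z|lebesgue. g1 z * cauchy_transform g2 z) = (LINT z|lebesgue. b1 z * cauchy_transform b2 z)"
      unfolding c2 using e1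
      by (intro integral_cong_AE lebesgue_times_borel borel_measurable_integrable[OF g1] mc m1) auto
    also have "\<dots> = (LINT z|lborel. b1 z * cauchy_transform b2 z)" using mc by (subst integral_completion) auto
    finally show ?thesis .
  qed
  have "(LINT z|lborel. b2 z * cauchy_transform b1 z) = (LINT \<zeta>|lborel. - (b1 \<zeta> * cauchy_transform b2 \<zeta>))"
    using lborel_pair.Fubini_integral[OF int] unfolding L R .
  then show "(LINT z|lebesgue. g2 z * cauchy_transform g1 z) = - (LINT z|lebesgue. g1 z * cauchy_transform g2 z)"
    unfolding t1 t2 by simp
  have "integrable lborel (\<lambda>z. b2 z * cauchy_transform b1 z)"
    using lborel_pair.integrable_snd[OF int] unfolding L .
  then have il: "integrable lebesgue (\<lambda>z. b2 z * cauchy_transform b1 z)"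
    using mc by (subst integrable_completion) auto
  show "integrable lebesgue (\<lambda>z. g2 z * cauchy_transform g1 z)"
  proof (rule integrable_cong_AE_imp[OF il])
    show "(\<lambda>z. g2 z * cauchy_transform g1 z) \<in> borel_measurable lebesgue"
      unfolding c1 by (intro lebesgue_times_borel subcritical_measurable[OF g2] mc)
    show "AE z in lebesgue. b2 z * cauchy_transform b1 z = g2 z * cauchy_transform g1 z"
      unfolding c1 using e2 by eventually_elim simp
  qed
qed

text \<open>On the support the kernel has no singularity. Its first-order remainder is
  \<open>(y - w) ^ 2 / ((\<zeta> - y) * (\<zeta> - w) ^ 2)\<close>, uniformly of second order in
  \<open>y - w\<close>.\<close>

lemma cauchy_transform_holomorphic_off_support:
  assumes ig: "integrable lebesgue g" and z: "\<And>z. z \<in> ball z0 r \<Longrightarrow> g z = 0"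
  shows "cauchy_transform g holomorphic_on ball z0 r"
  unfolding holomorphic_on_open[OF open_ball]
proof (intro ballI)
  fix w assume w: "w \<in> ball z0 r"
  define \<delta> where "\<delta> = r - dist z0 w"
  have \<delta>: "\<delta> > 0" using w by (simp add: \<delta>_def)
  have far: "norm (\<zeta> - w) \<ge> \<delta>" if "g \<zeta> \<noteq> 0" for \<zeta>
  proof -
    have "dist z0 \<zeta> \<ge> r" using z[of \<zeta>] that by (meson mem_ball not_le)
    then show ?thesis using dist_triangle[of z0 \<zeta> w] by (simp add: \<delta>_def dist_norm norm_minus_commute)
  qed
  have far2: "norm (\<zeta> - y) \<ge> \<delta> / 2" if "g \<zeta> \<noteq> 0" "norm (y - w) < \<delta> / 2" for \<zeta> y
    using far[OF that(1)] that(2) norm_triangle_ineq[of "\<zeta> - y" "y - w"] by simp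
  note mg = borel_measurable_integrable[OF ig]
  have i1: "integrable lebesgue (\<lambda>\<zeta>. g \<zeta> / (\<zeta> - y))" if y: "norm (y - w) < \<delta> / 2" for y
  proof (rule Bochner_Integration.integrable_bound[where f="\<lambda>\<zeta>. (2 / \<delta>) *\<^sub>R g \<zeta>"])
    show "integrable lebesgue (\<lambda>\<zeta>. (2 / \<delta>) *\<^sub>R g \<zeta>)" using ig by simp
    show "(\<lambda>\<zeta>. g \<zeta> / (\<zeta> - y)) \<in> borel_measurable lebesgue"
      using lebesgue_times_borel[OF mg kernel_measurable[of y]] by simp
    have "norm (g \<zeta> / (\<zeta> - y)) \<le> norm ((2 / \<delta>) *\<^sub>R g \<zeta>)" for \<zeta>
    proof (cases "g \<zeta> = 0")
      case False
      have "norm (g \<zeta>) / norm (\<zeta> - y) \<le> norm (g \<zeta>) / (\<delta> / 2)"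
        using far2[OF False y] \<delta> by (intro divide_left_mono mult_pos_pos) auto
      then show ?thesis using \<delta> by (simp add: norm_divide mult.commute)
    qed simp
    then show "AE \<zeta> in lebesgue. norm (g \<zeta> / (\<zeta> - y)) \<le> norm ((2 / \<delta>) *\<^sub>R g \<zeta>)" by simp
  qed
  have i2: "integrable lebesgue (\<lambda>\<zeta>. g \<zeta> / (\<zeta> - w)\<^sup>2)"
  proof (rule Bochner_Integration.integrable_bound[where f="\<lambda>\<zeta>. (1 / \<delta>\<^sup>2) *\<^sub>R g \<zeta>"])
    show "integrable lebesgue (\<lambda>\<zeta>. (1 / \<delta>\<^sup>2) *\<^sub>R g \<zeta>)" using ig by simp
    have "(\<lambda>\<zeta>. 1 / (\<zeta> - w)\<^sup>2) \<in> borel_measurable borel" by measurable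
    then show "(\<lambda>\<zeta>. g \<zeta> / (\<zeta> - w)\<^sup>2) \<in> borel_measurable lebesgue"
      using lebesgue_times_borel[OF mg, of "\<lambda>\<zeta>. 1 / (\<zeta> - w)\<^sup>2"] by simp
    have "norm (g \<zeta> / (\<zeta> - w)\<^sup>2) \<le> norm ((1 / \<delta>\<^sup>2) *\<^sub>R g \<zeta>)" for \<zeta>
    proof (cases "g \<zeta> = 0")
      case False
      have "\<delta>\<^sup>2 \<le> (norm (\<zeta> - w))\<^sup>2" using far[OF False] \<delta> by (simp add: power_mono)
      then have "norm (g \<zeta>) / (norm (\<zeta> - w))\<^sup>2 \<le> norm (g \<zeta>) / \<delta>\<^sup>2"
        using \<delta> far[OF False] by (intro divide_left_mono mult_pos_pos) auto
      then show ?thesis using \<delta> by (simp add: norm_divide norm_power)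
    qed simp
    then show "AE \<zeta> in lebesgue. norm (g \<zeta> / (\<zeta> - w)\<^sup>2) \<le> norm ((1 / \<delta>\<^sup>2) *\<^sub>R g \<zeta>)" by simp
  qed
  define I where "I = (LINT \<zeta>|lebesgue. g \<zeta> / (\<zeta> - w)\<^sup>2)"
  have "(cauchy_transform g has_derivative (\<lambda>h. I * h)) (at w)"
    unfolding has_derivative_at_alt
  proof (intro conjI allI impI bounded_linear_mult_right)
    fix e :: real assume e: "e > 0"
    define N where "N = (LINT \<zeta>|lebesgue. norm (g \<zeta>)) + 1"
    have N: "N > 0" unfolding N_def by (simp add: add_nonneg_pos)
    \<comment> \<open>The first bound keeps \<open>y\<close> at distance at least
      \<open>\<delta> / 2\<close> from the support; the second turns the quadratic remainder into at
      most \<open>e * norm (y - w)\<close>.\<close>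
    define d where "d = min (\<delta> / 2) (e * \<delta>^3 / (2 * N))"
    have d: "d > 0" using e \<delta> N by (simp add: d_def)
    show "\<exists>d>0. \<forall>y. norm (y - w) < d \<longrightarrow> norm (cauchy_transform g y - cauchy_transform g w - I * (y - w)) \<le> e * norm (y - w)"
    proof (intro exI[of _ d] conjI allI impI d)
      fix y assume y: "norm (y - w) < d"
      then have y2: "norm (y - w) < \<delta> / 2" by (simp add: d_def)
      have iw: "integrable lebesgue (\<lambda>\<zeta>. g \<zeta> / (\<zeta> - w))" by (rule i1) (use \<delta> in simp)
      have "cauchy_transform g y - cauchy_transform g w - I * (y - w) =
          (LINT \<zeta>|lebesgue. g \<zeta> / (\<zeta> - y) - g \<zeta> / (\<zeta> - w) - g \<zeta> / (\<zeta> - w)\<^sup>2 * (y - w))"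
        unfolding cauchy_transform_def I_def using i1[OF y2] iw i2 by (simp del: times_divide_eq_left)
      also have "norm \<dots> \<le> (LINT \<zeta>|lebesgue. norm (g \<zeta>) * ((norm (y - w))\<^sup>2 * (2 / \<delta>^3)))"
      proof (rule Bochner_Integration.integral_norm_bound_integral)
        show "integrable lebesgue (\<lambda>\<zeta>. g \<zeta> / (\<zeta> - y) - g \<zeta> / (\<zeta> - w) - g \<zeta> / (\<zeta> - w)\<^sup>2 * (y - w))"
          using i1[OF y2] iw i2 by (simp del: times_divide_eq_left)
        show "integrable lebesgue (\<lambda>\<zeta>. norm (g \<zeta>) * ((norm (y - w))\<^sup>2 * (2 / \<delta>^3)))" using ig by simp
        fix \<zeta>
        show "norm (g \<zeta> / (\<zeta> - y) - g \<zeta> / (\<zeta> - w) - g \<zeta> / (\<zeta> - w)\<^sup>2 * (y - w)) \<le> norm (g \<zeta>) * ((norm (y - w))\<^sup>2 * (2 / \<delta>^3))"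
        proof (cases "g \<zeta> = 0")
          case False
          have f1: "norm (\<zeta> - w) \<ge> \<delta>" and f2: "norm (\<zeta> - y) \<ge> \<delta> / 2" using far[OF False] far2[OF False y2] .
          then have nz: "\<zeta> - w \<noteq> 0" "\<zeta> - y \<noteq> 0" using \<delta> by auto
          have "g \<zeta> / (\<zeta> - y) - g \<zeta> / (\<zeta> - w) - g \<zeta> / (\<zeta> - w)\<^sup>2 * (y - w) = g \<zeta> * ((y - w)\<^sup>2 / ((\<zeta> - y) * (\<zeta> - w)\<^sup>2))"
            using nz by (simp add: divide_simps power2_eq_square) (simp add: algebra_simps)
          then have eq: "norm (g \<zeta> / (\<zeta> - y) - g \<zeta> / (\<zeta> - w) - g \<zeta> / (\<zeta> - w)\<^sup>2 * (y - w)) =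
              norm (g \<zeta>) * ((norm (y - w))\<^sup>2 * (1 / (norm (\<zeta> - y) * (norm (\<zeta> - w))\<^sup>2)))"
            by (simp add: norm_mult norm_divide norm_power)
          have "\<delta>\<^sup>2 \<le> (norm (\<zeta> - w))\<^sup>2" using f1 \<delta> by (simp add: power_mono)
          then have "(\<delta> / 2) * \<delta>\<^sup>2 \<le> norm (\<zeta> - y) * (norm (\<zeta> - w))\<^sup>2"
            using f2 \<delta> by (intro mult_mono) auto
          then have "1 / (norm (\<zeta> - y) * (norm (\<zeta> - w))\<^sup>2) \<le> 1 / ((\<delta> / 2) * \<delta>\<^sup>2)"
            using \<delta> nz by (intro divide_left_mono mult_pos_pos) auto
          also have "\<dots> = 2 / \<delta>^3" by (simp add: power2_eq_square power3_eq_cube)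
          finally show ?thesis unfolding eq by (intro mult_left_mono) auto
        qed simp
      qed
      also have "\<dots> = (LINT \<zeta>|lebesgue. norm (g \<zeta>)) * (norm (y - w) * (norm (y - w) * (2 / \<delta>^3)))"
        by (simp add: power2_eq_square)
      also have "\<dots> \<le> N * (norm (y - w) * (d * (2 / \<delta>^3)))"
        using y \<delta> d N by (intro mult_mono mult_left_mono mult_right_mono) (auto simp: N_def)
      also have "\<dots> \<le> N * (norm (y - w) * ((e * \<delta>^3 / (2 * N)) * (2 / \<delta>^3)))"
        using \<delta> N by (intro mult_left_mono mult_right_mono) (auto simp: d_def)
      also have "\<dots> = e * norm (y - w)" using \<delta> N by simp
      finally show "norm (cauchy_transform g y - cauchy_transform g w - I * (y - w)) \<le> e * norm (y - w)" .
    qed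
  qed
  then show "\<exists>f'. (cauchy_transform g has_field_derivative f') (at w)"
    unfolding has_field_derivative_def by blast
qed

text \<open>The derivatives on different balls are separate witnesses;
  \<open>frechet_derivative\<close> is a choice that agrees with each of them and so glues them
  together.\<close>

lemma C1_on_local:
  assumes "\<And>z. z \<in> D \<Longrightarrow> \<exists>r>0. \<exists>f'. C1_on (ball z r) f f'" "open D"
  shows "C1_on D f (\<lambda>z. frechet_derivative f (at z))"
proof (rule C1_onI)
  have fr: "frechet_derivative f (at w) = f' w" if "C1_on (ball z r) f f'" "w \<in> ball z r" for f' w z r
    using frechet_derivative_at[OF C1_onD(1)[OF that]] by simp
  show "(f has_derivative frechet_derivative f (at z)) (at z)" if z: "z \<in> D" for z
  proof -
    obtain r f' where r: "r > 0" "C1_on (ball z r) f f'" using assms(1)[OF z] by blast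
    then have "(f has_derivative f' z) (at z)" using C1_onD(1)[OF r(2)] by simp
    then show ?thesis by (metis frechet_derivative_at)
  qed
  show "continuous_on D (\<lambda>z. frechet_derivative f (at z) e)" for e
  proof (intro continuous_at_imp_continuous_on ballI)
    fix z assume z: "z \<in> D"
    obtain r f' where r: "r > 0" "C1_on (ball z r) f f'" using assms(1)[OF z] by blast
    have "continuous_on (ball z r) (\<lambda>w. frechet_derivative f (at w) e) \<longleftrightarrow> continuous_on (ball z r) (\<lambda>w. f' w e)"
      by (rule continuous_on_cong) (use fr[OF r(2)] in auto)
    then have "continuous_on (ball z r) (\<lambda>w. frechet_derivative f (at w) e)" using C1_onD(2)[OF r(2)] by simp
    then show "isCont (\<lambda>w. frechet_derivative f (at w) e) z"
      using r(1) by (simp add: continuous_on_eq_continuous_at)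
  qed
qed

text \<open>The kernel conditions concern the extensions by zero, whereas the weak derivatives are
  taken in \<open>D\<close> only: the extension of \<open>A\<close> by zero need not have weak
  derivatives in the plane.\<close>

definition sobolev_subcritical :: "complex set \<Rightarrow> (complex \<Rightarrow> complex) \<Rightarrow> bool"
  where "sobolev_subcritical D A \<longleftrightarrow> subcritical (\<lambda>z. indicator D z * A z) \<and>
    (\<exists>Ax Ay. has_weak_deriv D 1 A Ax \<and> has_weak_deriv D \<i> A Ay \<and>
      subcritical (\<lambda>z. indicator D z * Ax z) \<and> subcritical (\<lambda>z. indicator D z * Ay z))"

lemma subcritical_bounded_times:
  assumes "subcritical g" "c \<in> borel_measurable borel" "\<And>z. norm (c z) \<le> B"
  shows "subcritical (\<lambda>z. c z * g z)"
proof -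
  obtain R where ig: "integrable lebesgue g" and R: "\<And>z. z \<notin> cball 0 R \<Longrightarrow> g z = 0"
    using subcriticalD[OF assms(1)] by blast
  obtain s M where s: "0 < s" "s < 1" "M \<ge> 0"
    and i: "\<And>z. integrable lebesgue (\<lambda>\<zeta>. norm (g \<zeta>) * norm (\<zeta> - z) powr (-1-s))"
    and b: "\<And>z. (LINT \<zeta>|lebesgue. norm (g \<zeta>) * norm (\<zeta> - z) powr (-1-s)) \<le> M"
    using subcriticalE[OF assms(1)] by blast
  have B: "B \<ge> 0" using assms(3) norm_ge_zero order_trans by blast
  have m: "(\<lambda>z. c z * g z) \<in> borel_measurable lebesgue"
    using lebesgue_times_borel[OF subcritical_measurable[OF assms(1)] assms(2)] by (simp add: mult.commute)
  have bd: "norm (c z * g z) \<le> B * norm (g z)" for z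
    using assms(3)[of z] by (simp add: norm_mult mult_right_mono)
  have ic: "integrable lebesgue (\<lambda>z. c z * g z)"
    by (rule Bochner_Integration.integrable_bound[where f="\<lambda>z. B *\<^sub>R g z", OF _ m])
      (use ig bd B in auto)
  have bd2: "norm (c \<zeta> * g \<zeta>) * norm (\<zeta> - z) powr (-1-s) \<le> B * (norm (g \<zeta>) * norm (\<zeta> - z) powr (-1-s))" for \<zeta> z
    using mult_right_mono[OF bd[of \<zeta>], of "norm (\<zeta> - z) powr (-1-s)"] by (simp add: mult_ac)
  have mm: "(\<lambda>\<zeta>. norm (c \<zeta> * g \<zeta>) * norm (\<zeta> - z) powr (-1-s)) \<in> borel_measurable lebesgue" for z
    by (rule lebesgue_times_borel) (use m in measurable)
  have ii: "integrable lebesgue (\<lambda>\<zeta>. norm (c \<zeta> * g \<zeta>) * norm (\<zeta> - z) powr (-1-s))" for z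
  proof (rule Bochner_Integration.integrable_bound[OF integrable_mult_right[OF i[of z], of B] mm])
    show "AE \<zeta> in lebesgue. norm (norm (c \<zeta> * g \<zeta>) * norm (\<zeta> - z) powr (-1-s)) \<le> norm (B * (norm (g \<zeta>) * norm (\<zeta> - z) powr (-1-s)))"
      using bd2 B by (intro AE_I2) (auto simp: abs_mult)
  qed
  have "(LINT \<zeta>|lebesgue. norm (c \<zeta> * g \<zeta>) * norm (\<zeta> - z) powr (-1-s)) \<le> B * M" for z
  proof -
    have "(LINT \<zeta>|lebesgue. norm (c \<zeta> * g \<zeta>) * norm (\<zeta> - z) powr (-1-s)) \<le> (LINT \<zeta>|lebesgue. B * (norm (g \<zeta>) * norm (\<zeta> - z) powr (-1-s)))"
      by (rule integral_mono[OF ii integrable_mult_right[OF i] bd2])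
    also have "\<dots> \<le> B * M" using b[of z] B by (simp add: mult_left_mono)
    finally show ?thesis .
  qed
  then show ?thesis by (intro subcriticalI[OF ic _ s(1,2) ii]) (use R in auto)
qed

text \<open>The kernel with the smaller exponent \<open>1 + t\<close> is at most the one with
  exponent \<open>1 + s\<close> plus 1. Hence two subcritical functions can be given a common
  exponent, as their sum requires.\<close>

lemma subcritical_exponent:
  assumes "subcritical g"
  obtains s where "0 < s" "s < 1"
    "\<And>t. 0 < t \<Longrightarrow> t \<le> s \<Longrightarrow> \<exists>M. \<forall>z. integrable lebesgue (\<lambda>\<zeta>. norm (g \<zeta>) * norm (\<zeta> - z) powr (-1-t)) \<and>
        (LINT \<zeta>|lebesgue. norm (g \<zeta>) * norm (\<zeta> - z) powr (-1-t)) \<le> M"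
proof -
  obtain s M where s: "0 < s" "s < 1" "M \<ge> 0"
    and i: "\<And>z. integrable lebesgue (\<lambda>\<zeta>. norm (g \<zeta>) * norm (\<zeta> - z) powr (-1-s))"
    and b: "\<And>z. (LINT \<zeta>|lebesgue. norm (g \<zeta>) * norm (\<zeta> - z) powr (-1-s)) \<le> M"
    using subcriticalE[OF assms] by blast
  have ig: "integrable lebesgue g" using assms by (simp add: subcritical_def)
  have "\<exists>M. \<forall>z. integrable lebesgue (\<lambda>\<zeta>. norm (g \<zeta>) * norm (\<zeta> - z) powr (-1-t)) \<and>
        (LINT \<zeta>|lebesgue. norm (g \<zeta>) * norm (\<zeta> - z) powr (-1-t)) \<le> M" if t: "0 < t" "t \<le> s" for t
  proof (intro exI allI conjI)
    fix z
    have bd: "norm (g \<zeta>) * norm (\<zeta> - z) powr (-1-t) \<le> norm (g \<zeta>) * norm (\<zeta> - z) powr (-1-s) + norm (g \<zeta>)" for \<zeta>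
    proof -
      have "norm (\<zeta> - z) powr (-1-t) \<le> norm (\<zeta> - z) powr (-1-s) + 1"
      proof (cases "norm (\<zeta> - z) \<le> 1")
        case True
        have "norm (\<zeta> - z) powr (-1-t) \<le> norm (\<zeta> - z) powr (-1-s)"
          using True t by (cases "\<zeta> = z") (auto intro!: powr_mono')
        then show ?thesis by simp
      next
        case False
        then have "norm (\<zeta> - z) powr (-1-t) \<le> norm (\<zeta> - z) powr 0" using t by (intro powr_mono) auto
        also have "\<dots> = 1" using False by auto
        finally show ?thesis by (simp add: add_increasing)
      qed
      then have "norm (g \<zeta>) * norm (\<zeta> - z) powr (-1-t) \<le> norm (g \<zeta>) * (norm (\<zeta> - z) powr (-1-s) + 1)"
        by (intro mult_left_mono) auto
      then show ?thesis by (simp add: algebra_simps)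
    qed
    note isum = Bochner_Integration.integrable_add[OF i[of z] integrable_norm[OF ig]]
    have mm: "(\<lambda>\<zeta>. norm (g \<zeta>) * norm (\<zeta> - z) powr (-1-t)) \<in> borel_measurable lebesgue"
      by (rule lebesgue_times_borel) (use subcritical_measurable[OF assms] in measurable)
    show ii: "integrable lebesgue (\<lambda>\<zeta>. norm (g \<zeta>) * norm (\<zeta> - z) powr (-1-t))"
      by (rule Bochner_Integration.integrable_bound[OF isum mm]) (use bd in \<open>auto intro!: AE_I2 order_trans[OF bd]\<close>)
    have "(LINT \<zeta>|lebesgue. norm (g \<zeta>) * norm (\<zeta> - z) powr (-1-t)) \<le>
        (LINT \<zeta>|lebesgue. norm (g \<zeta>) * norm (\<zeta> - z) powr (-1-s) + norm (g \<zeta>))"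
      by (rule integral_mono[OF ii isum bd])
    also have "\<dots> \<le> M + (LINT \<zeta>|lebesgue. norm (g \<zeta>))"
      unfolding Bochner_Integration.integral_add[OF i integrable_norm[OF ig]] using b by simp
    finally show "(LINT \<zeta>|lebesgue. norm (g \<zeta>) * norm (\<zeta> - z) powr (-1-t)) \<le> M + (LINT \<zeta>|lebesgue. norm (g \<zeta>))" .
  qed
  then show ?thesis using that s by blast
qed

lemma subcritical_add:
  assumes f: "subcritical f" and g: "subcritical g"
  shows "subcritical (\<lambda>z. f z + g z)"
proof -
  obtain Rf where F: "integrable lebesgue f" "\<And>z. z \<notin> cball 0 Rf \<Longrightarrow> f z = 0" using subcriticalD[OF f] by blast
  obtain Rg where G: "integrable lebesgue g" "\<And>z. z \<notin> cball 0 Rg \<Longrightarrow> g z = 0" using subcriticalD[OF g] by blast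
  obtain s where s: "0 < s" "s < 1"
    "\<And>t. 0 < t \<Longrightarrow> t \<le> s \<Longrightarrow> \<exists>M. \<forall>z. integrable lebesgue (\<lambda>\<zeta>. norm (f \<zeta>) * norm (\<zeta> - z) powr (-1-t)) \<and>
        (LINT \<zeta>|lebesgue. norm (f \<zeta>) * norm (\<zeta> - z) powr (-1-t)) \<le> M"
    using subcritical_exponent[OF f] by blast
  obtain s' where s': "0 < s'" "s' < 1"
    "\<And>t. 0 < t \<Longrightarrow> t \<le> s' \<Longrightarrow> \<exists>M. \<forall>z. integrable lebesgue (\<lambda>\<zeta>. norm (g \<zeta>) * norm (\<zeta> - z) powr (-1-t)) \<and>
        (LINT \<zeta>|lebesgue. norm (g \<zeta>) * norm (\<zeta> - z) powr (-1-t)) \<le> M"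
    using subcritical_exponent[OF g] by blast
  define t where "t = min s s'"
  have t: "0 < t" "t \<le> s" "t \<le> s'" "t < 1" using s s' by (auto simp: t_def)
  obtain M where M: "\<And>z. integrable lebesgue (\<lambda>\<zeta>. norm (f \<zeta>) * norm (\<zeta> - z) powr (-1-t))"
    "\<And>z. (LINT \<zeta>|lebesgue. norm (f \<zeta>) * norm (\<zeta> - z) powr (-1-t)) \<le> M" using s(3)[OF t(1,2)] by blast
  obtain M' where M': "\<And>z. integrable lebesgue (\<lambda>\<zeta>. norm (g \<zeta>) * norm (\<zeta> - z) powr (-1-t))"
    "\<And>z. (LINT \<zeta>|lebesgue. norm (g \<zeta>) * norm (\<zeta> - z) powr (-1-t)) \<le> M'" using s'(3)[OF t(1,3)] by blast
  note isum = Bochner_Integration.integrable_add[OF M(1) M'(1)]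
  have bd: "norm (f \<zeta> + g \<zeta>) * norm (\<zeta> - z) powr (-1-t) \<le>
      norm (f \<zeta>) * norm (\<zeta> - z) powr (-1-t) + norm (g \<zeta>) * norm (\<zeta> - z) powr (-1-t)" for \<zeta> z
    using mult_right_mono[OF norm_triangle_ineq[of "f \<zeta>" "g \<zeta>"], of "norm (\<zeta> - z) powr (-1-t)"]
    by (simp add: algebra_simps)
  have mm: "(\<lambda>\<zeta>. norm (f \<zeta> + g \<zeta>) * norm (\<zeta> - z) powr (-1-t)) \<in> borel_measurable lebesgue" for z
    by (rule lebesgue_times_borel) (use subcritical_measurable[OF f] subcritical_measurable[OF g] in measurable)
  have ii: "integrable lebesgue (\<lambda>\<zeta>. norm (f \<zeta> + g \<zeta>) * norm (\<zeta> - z) powr (-1-t))" for z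
    by (rule Bochner_Integration.integrable_bound[OF isum mm]) (use bd in \<open>auto intro!: AE_I2 order_trans[OF bd]\<close>)
  have le: "(LINT \<zeta>|lebesgue. norm (f \<zeta> + g \<zeta>) * norm (\<zeta> - z) powr (-1-t)) \<le> M + M'" for z
  proof -
    have "(LINT \<zeta>|lebesgue. norm (f \<zeta> + g \<zeta>) * norm (\<zeta> - z) powr (-1-t)) \<le>
        (LINT \<zeta>|lebesgue. norm (f \<zeta>) * norm (\<zeta> - z) powr (-1-t) + norm (g \<zeta>) * norm (\<zeta> - z) powr (-1-t))"
      by (rule integral_mono[OF ii isum bd])
    also have "\<dots> \<le> M + M'"
      unfolding Bochner_Integration.integral_add[OF M(1) M'(1)] using M(2) M'(2) by (intro add_mono) auto
    finally show ?thesis .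
  qed
  show ?thesis
  proof (rule subcriticalI[OF Bochner_Integration.integrable_add[OF F(1) G(1)] _ t(1,4) ii le])
    show "f z + g z = 0" if "z \<notin> cball 0 (max Rf Rg)" for z
      using F(2)[of z] G(2)[of z] that by auto
  qed
qed

section \<open>Regularity of the transform and Weyl's lemma\<close>

lemma weak_dbar_complex_test:
  assumes "has_weak_deriv D 1 u ux" "has_weak_deriv D \<i> u uy" "open D"
    and "C1_on UNIV \<Phi> \<Phi>'" "compact K" "K \<subseteq> D" "\<And>z. z \<notin> K \<Longrightarrow> \<Phi> z = (0::complex)"
  shows "(LINT z|lebesgue. dbar_of \<Phi>' z * u z) = - (LINT z|lebesgue. \<Phi> z * ((ux z + \<i> * uy z) / 2))"
proof -
  have x: "(LINT z|lebesgue. \<Phi>' z 1 * u z) = - (LINT z|lebesgue. \<Phi> z * ux z)"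
    "integrable lebesgue (\<lambda>z. \<Phi>' z 1 * u z)" "integrable lebesgue (\<lambda>z. \<Phi> z * ux z)"
    using weak_deriv_complex_test[OF assms(1,3-6)] assms(7) by blast+
  have y: "(LINT z|lebesgue. \<Phi>' z \<i> * u z) = - (LINT z|lebesgue. \<Phi> z * uy z)"
    "integrable lebesgue (\<lambda>z. \<Phi>' z \<i> * u z)" "integrable lebesgue (\<lambda>z. \<Phi> z * uy z)"
    using weak_deriv_complex_test[OF assms(2,3-6)] assms(7) by blast+
  have 1: "dbar_of \<Phi>' z * u z = (\<Phi>' z 1 * u z) / 2 + \<i> * (\<Phi>' z \<i> * u z) / 2" for z
    by (simp add: dbar_of_def algebra_simps add_divide_distrib)
  have 2: "\<Phi> z * ((ux z + \<i> * uy z) / 2) = (\<Phi> z * ux z) / 2 + \<i> * (\<Phi> z * uy z) / 2" for z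
    by (simp add: algebra_simps add_divide_distrib)
  show ?thesis unfolding 1 2 using x y by simp
qed

lemma C1_on_of_real: "C1_on S f f' \<Longrightarrow> C1_on S (\<lambda>z. of_real (f z) :: complex) (\<lambda>z h. of_real (f' z h))"
  by (rule C1_on_linear[OF _ bounded_linear_of_real])

lemma subcritical_cutoff_times:
  fixes c :: "complex \<Rightarrow> real"
  assumes "subcritical g" "continuous_on UNIV c" "compact K" "\<And>z. z \<notin> K \<Longrightarrow> c z = 0"
  shows "subcritical (\<lambda>z. of_real (c z) * g z)"
proof -
  obtain B where B: "B \<ge> 0" "\<And>z. z \<in> K \<Longrightarrow> norm (c z) \<le> B"
    by (rule continuous_on_bounded_borel[OF continuous_on_subset[OF assms(2)] assms(3)]) auto
  show ?thesis
  proof (rule subcritical_bounded_times[OF assms(1)])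
    have [measurable]: "c \<in> borel_measurable borel" by (rule borel_measurable_continuous_onI[OF assms(2)])
    show "(\<lambda>z. complex_of_real (c z)) \<in> borel_measurable borel" by measurable
    show "norm (complex_of_real (c z)) \<le> B" for z using B assms(4)[of z] by (cases "z \<in> K") auto
  qed
qed

text \<open>Away from the boundary a cutoff turns \<open>A\<close> into a compactly supported function with weak
  derivatives on the whole plane, while the remaining part contributes a holomorphic function.\<close>

theorem C1_cauchy_transform_sobolev:
  assumes D: "open D" and A: "sobolev_subcritical D A"
  shows "C1_on D (cauchy_transform (\<lambda>z. indicator D z * A z))
    (\<lambda>z. frechet_derivative (cauchy_transform (\<lambda>z. indicator D z * A z)) (at z))"
proof (rule C1_on_local[OF _ D])
  fix z0 assume "z0 \<in> D"
  then obtain R where R: "R > 0" "cball z0 R \<subseteq> D" using D open_contains_cball by blast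
  define a where "a z = indicator D z * A z" for z
  obtain Ax Ay where W: "has_weak_deriv D 1 A Ax" "has_weak_deriv D \<i> A Ay"
    and n: "subcritical a" "subcritical (\<lambda>z. indicator D z * Ax z)" "subcritical (\<lambda>z. indicator D z * Ay z)"
    using A unfolding sobolev_subcritical_def a_def[abs_def] by blast
  obtain ch ch' where ch: "C1_on UNIV ch ch'" "\<And>z. z \<in> cball z0 (R/2) \<Longrightarrow> ch z = (1::real)"
    "\<And>z. z \<notin> cball z0 R \<Longrightarrow> ch z = 0"
    using C1_on_ex_cutoff[of "R/2" R z0] R by auto
  have v: "ch' z e = 0" if "z \<notin> cball z0 R" for z e
    using C1_on_vanish[OF ch(1) closed_cball ch(3) that] by blast
  define g where "g z = of_real (ch z) * a z" for z
  \<comment> \<open>By the product rule this is the weak derivative of \<open>g\<close> in direction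
    \<open>e\<close> when \<open>B\<close> is the weak derivative of \<open>A\<close> in that
    direction.\<close>
  define ge where "ge e B z = of_real (ch' z e) * a z + of_real (ch z) * (indicator D z * B z)" for e B z
  have ng: "subcritical g" unfolding g_def[abs_def]
    by (rule subcritical_cutoff_times[OF n(1) C1_on_imp_continuous_on[OF ch(1)] compact_cball ch(3)])
  have nge: "subcritical (ge e B)" if "subcritical (\<lambda>z. indicator D z * B z)" for e B
    unfolding ge_def[abs_def]
    by (intro subcritical_add subcritical_cutoff_times[OF n(1) C1_onD(2)[OF ch(1)] compact_cball v]
        subcritical_cutoff_times[OF that C1_on_imp_continuous_on[OF ch(1)] compact_cball ch(3)])
  \<comment> \<open>The function \<open>\<Phi>\<close> is arbitrary, but \<open>ch\<close> times
    \<open>\<Phi>\<close> has compact support in \<open>D\<close> and may be tested against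
    \<open>A\<close>. Reading the cutoff as part of the density gives the statement for
    \<open>g\<close>.\<close>
  have wk: "(LINT z|lebesgue. \<Phi>' z e * g z) = - (LINT z|lebesgue. \<Phi> z * ge e B z)"
    if \<Phi>: "C1_on UNIV \<Phi> \<Phi>'" and w: "has_weak_deriv D e A B" and nB: "subcritical (\<lambda>z. indicator D z * B z)" for \<Phi> \<Phi>' e B
  proof -
    have C: "C1_on UNIV (\<lambda>z. of_real (ch z) * \<Phi> z) (\<lambda>z h. of_real (ch z) * \<Phi>' z h + of_real (ch' z h) * \<Phi> z)"
      by (rule C1_on_mult[OF C1_on_of_real[OF ch(1)] \<Phi>])
    have s0: "of_real (ch z) * \<Phi> z = 0" if "z \<notin> cball z0 R" for z using ch(3)[OF that] by simp
    note T = weak_deriv_complex_test(1)[OF w D C compact_cball R(2) s0]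
    obtain Rg where Rg: "integrable lebesgue g" "\<And>z. z \<notin> cball 0 Rg \<Longrightarrow> g z = 0" using subcriticalD[OF ng] by blast
    have i1: "integrable lebesgue (\<lambda>z. g z * \<Phi>' z e)"
      by (rule integrable_continuous_times[OF Rg C1_onD(2)[OF \<Phi>]])
    have n2: "subcritical (\<lambda>z. of_real (ch' z e) * a z)" "subcritical (\<lambda>z. of_real (ch z) * (indicator D z * B z))"
      by (rule subcritical_cutoff_times[OF n(1) C1_onD(2)[OF ch(1)] compact_cball v], assumption)
        (rule subcritical_cutoff_times[OF nB C1_on_imp_continuous_on[OF ch(1)] compact_cball ch(3)])
    have i2: "integrable lebesgue (\<lambda>z. h z * \<Phi> z)" if nh: "subcritical h" for h
    proof -
      obtain Rh where Rh: "integrable lebesgue h" "\<And>z. z \<notin> cball 0 Rh \<Longrightarrow> h z = 0" using subcriticalD[OF nh] by blast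
      show ?thesis by (rule integrable_continuous_times[OF Rh C1_on_imp_continuous_on[OF \<Phi>]])
    qed
    have in1: "ch z = 0 \<and> ch' z e = 0" if "z \<notin> D" for z using that ch(3)[of z] v[of z e] R(2) by blast
    have eq1: "(of_real (ch z) * \<Phi>' z e + of_real (ch' z e) * \<Phi> z) * A z = g z * \<Phi>' z e + (of_real (ch' z e) * a z) * \<Phi> z" for z
      using in1[of z] by (cases "z \<in> D") (auto simp: g_def a_def algebra_simps)
    have eq2: "of_real (ch z) * \<Phi> z * B z = (of_real (ch z) * (indicator D z * B z)) * \<Phi> z" for z
      using in1[of z] by (cases "z \<in> D") auto
    have "(LINT z|lebesgue. g z * \<Phi>' z e) + (LINT z|lebesgue. (of_real (ch' z e) * a z) * \<Phi> z) =
        - (LINT z|lebesgue. (of_real (ch z) * (indicator D z * B z)) * \<Phi> z)"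
      using T unfolding eq1 eq2 using i1 i2[OF n2(1)] by simp
    moreover have "(LINT z|lebesgue. \<Phi> z * ge e B z) = (LINT z|lebesgue. (of_real (ch' z e) * a z) * \<Phi> z) +
        (LINT z|lebesgue. (of_real (ch z) * (indicator D z * B z)) * \<Phi> z)"
      by (subst Bochner_Integration.integral_add[OF i2[OF n2(1)] i2[OF n2(2)], symmetric])
        (simp add: ge_def algebra_simps)
    moreover have "(LINT z|lebesgue. \<Phi>' z e * g z) = (LINT z|lebesgue. g z * \<Phi>' z e)" by (simp add: mult.commute)
    ultimately show ?thesis by (simp add: eq_neg_iff_add_eq_0 algebra_simps)
  qed
  have C: "C1_on UNIV (cauchy_transform g) (\<lambda>z h. Re h *\<^sub>R cauchy_transform (ge 1 Ax) z + Im h *\<^sub>R cauchy_transform (ge \<i> Ay) z)"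
  proof (rule C1_cauchy_transform[OF ng nge[OF n(2)] nge[OF n(3)]])
    fix \<Phi> :: "complex \<Rightarrow> complex" and \<Phi>' assume c: "C1_on UNIV \<Phi> \<Phi>'"
    show "(LINT z|lebesgue. \<Phi>' z 1 * g z) = - (LINT z|lebesgue. \<Phi> z * ge 1 Ax z)"
      by (rule wk[OF c W(1) n(2)])
    show "(LINT z|lebesgue. \<Phi>' z \<i> * g z) = - (LINT z|lebesgue. \<Phi> z * ge \<i> Ay z)"
      by (rule wk[OF c W(2) n(3)])
  qed
  define h where "h z = a z - g z" for z
  have ih: "integrable lebesgue h"
    unfolding h_def[abs_def] using n(1) ng by (auto simp: subcritical_def)
  have "h z = 0" if "z \<in> ball z0 (R/2)" for z
    using ch(2)[of z] that by (simp add: h_def g_def)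
  from cauchy_transform_holomorphic_off_support[OF ih this]
  have "cauchy_transform h holomorphic_on ball z0 (R/2)" .
  then have Ch: "C1_on (ball z0 (R/2)) (cauchy_transform h) (\<lambda>z k. deriv (cauchy_transform h) z * k)"
    by (rule C1_on_holomorphic) simp
  have "cauchy_transform a z = cauchy_transform g z + cauchy_transform h z" for z
  proof -
    have "integrable lebesgue (\<lambda>\<zeta>. a \<zeta> / (\<zeta> - z))" "integrable lebesgue (\<lambda>\<zeta>. g \<zeta> / (\<zeta> - z))"
      using subcritical_kernel_integrable[OF n(1)] subcritical_kernel_integrable[OF ng] by blast+
    then show ?thesis by (simp add: cauchy_transform_def h_def diff_divide_distrib)
  qed
  then have "cauchy_transform a = (\<lambda>z. cauchy_transform g z + cauchy_transform h z)" by auto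
  then have "\<exists>f'. C1_on (ball z0 (R/2)) (cauchy_transform a) f'"
    using C1_on_add[OF C1_on_subset[OF C] Ch] by auto
  then show "\<exists>r>0. \<exists>f'. C1_on (ball z0 r) (cauchy_transform (\<lambda>z. indicator D z * A z)) f'"
    using R(1) unfolding a_def[abs_def] by (intro exI[of _ "R/2"]) auto
qed

text \<open>Tested against \<open>\<phi>\<close>, the derivative of the transform moves to
  \<open>\<phi>\<close>, skew symmetry moves the transform there as well, and the Cauchy-Pompeiu
  formula returns a multiple of \<open>\<phi>\<close>. The fundamental lemma removes the test
  function.\<close>

theorem dbar_cauchy_transform_sobolev:
  assumes D: "open D" and A: "sobolev_subcritical D A" and C: "C1_on D (cauchy_transform (\<lambda>z. indicator D z * A z)) C'"
  shows "AE z in lebesgue. z \<in> D \<longrightarrow> dbar_of C' z = - (of_real pi * A z)"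
proof -
  let ?a = "\<lambda>z. indicator D z * A z"
  have na: "subcritical ?a" and lA: "locally_integrable D A"
    using A has_weak_deriv_locally_integrable unfolding sobolev_subcritical_def by blast+
  have ld: "locally_integrable D (dbar_of C')"
    by (rule locally_integrable_continuous[OF continuous_on_dbar_of[OF C]])
  have "AE z in lebesgue. z \<in> D \<longrightarrow> dbar_of C' z + of_real pi * A z = 0"
  proof (rule fundamental_lemma_variations[OF _ D])
    show "locally_integrable D (\<lambda>z. dbar_of C' z + of_real pi * A z)"
      using ld lA unfolding locally_integrable_def by auto
    fix \<phi> :: "complex \<Rightarrow> real" and \<phi>' K
    assume h: "C1_on UNIV \<phi> \<phi>'" "compact K" "K \<subseteq> D" "\<And>z. z \<notin> K \<Longrightarrow> \<phi> z = 0"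
    let ?\<Phi> = "\<lambda>z. complex_of_real (\<phi> z)" and ?\<Phi>' = "\<lambda>z h. complex_of_real (\<phi>' z h)"
    have \<Phi>: "C1_on UNIV ?\<Phi> ?\<Phi>'" by (rule C1_on_of_real[OF h(1)])
    have z: "?\<Phi> z = 0" if "z \<notin> K" for z using h(4)[OF that] by simp
    have v: "?\<Phi>' z e = 0" if "z \<notin> K" for z e
      using C1_on_vanish[OF h(1) compact_imp_closed[OF h(2)] h(4) that] by simp
    have nd: "subcritical (dbar_of ?\<Phi>')"
      by (rule subcritical_continuous[OF continuous_on_dbar_of[OF \<Phi>] h(2)]) (simp add: dbar_of_def v)
    have 1: "(LINT z|lebesgue. dbar_of ?\<Phi>' z * cauchy_transform ?a z) = - (LINT z|lebesgue. ?\<Phi> z * ((C' z 1 + \<i> * C' z \<i>) / 2))"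
      by (rule weak_dbar_complex_test[OF C1_on_imp_has_weak_deriv[OF C D] C1_on_imp_has_weak_deriv[OF C D] D \<Phi> h(2,3) z])
    have ia: "integrable lebesgue ?a" using na by (simp add: subcritical_def)
    have "(LINT z|lebesgue. dbar_of ?\<Phi>' z * cauchy_transform ?a z) = - (LINT z|lebesgue. ?a z * cauchy_transform (dbar_of ?\<Phi>') z)"
      by (rule cauchy_transform_skew(1)[OF ia nd])
    also have "\<dots> = (LINT z|lebesgue. of_real pi * (?\<Phi> z * A z))"
    proof -
      have "?a z * cauchy_transform (dbar_of ?\<Phi>') z = - (of_real pi * (?\<Phi> z * A z))" for z
        using cauchy_pompeiu[OF \<Phi> h(2) z, of z] h(3) h(4)[of z] by (cases "z \<in> D") auto
      then show ?thesis by simp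
    qed
    finally have 2: "(LINT z|lebesgue. of_real pi * (?\<Phi> z * A z)) = - (LINT z|lebesgue. ?\<Phi> z * dbar_of C' z)"
      using 1 by (simp add: dbar_of_def)
    have c: "continuous_on D \<phi>" by (rule continuous_on_subset[OF C1_on_imp_continuous_on[OF h(1)]]) simp
    have i: "integrable lebesgue (\<lambda>z. \<phi> z *\<^sub>R dbar_of C' z)" "integrable lebesgue (\<lambda>z. \<phi> z *\<^sub>R A z)"
      by (rule integrable_scaleR_compact_support[OF ld c h(2,3,4)] integrable_scaleR_compact_support[OF lA c h(2,3,4)], assumption)+
    have "(LINT z|lebesgue. \<phi> z *\<^sub>R (dbar_of C' z + of_real pi * A z)) =
        (LINT z|lebesgue. \<phi> z *\<^sub>R dbar_of C' z) + of_real pi * (LINT z|lebesgue. \<phi> z *\<^sub>R A z)"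
    proof -
      have "\<phi> z *\<^sub>R (dbar_of C' z + of_real pi * A z) = \<phi> z *\<^sub>R dbar_of C' z + of_real pi * (\<phi> z *\<^sub>R A z)" for z
        by (simp add: scaleR_add_right)
      then show ?thesis using i by (simp del: mult_scaleR_right)
    qed
    also have "\<dots> = 0" using 2 by (simp add: scaleR_conv_of_real)
    finally show "(LINT z|lebesgue. \<phi> z *\<^sub>R (dbar_of C' z + of_real pi * A z)) = 0" .
  qed
  then show ?thesis by eventually_elim (auto simp: eq_neg_iff_add_eq_0)
qed

text \<open>The classical derivatives of \<open>\<Phi>\<close> serve as the densities of the
  differentiated transform. This solves the equation for the derivative with respect to
  \<open>cnj z\<close> with a given right-hand side, though without compact support of the
  solution.\<close>

lemma C1_cauchy_transform_test:
  assumes "C1_on UNIV \<Phi> \<Phi>'" "compact K" "\<And>z. z \<notin> K \<Longrightarrow> \<Phi> z = 0"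
  shows "C1_on UNIV (cauchy_transform \<Phi>) (\<lambda>z h. Re h *\<^sub>R cauchy_transform (\<lambda>z. \<Phi>' z 1) z + Im h *\<^sub>R cauchy_transform (\<lambda>z. \<Phi>' z \<i>) z)"
    (is "C1_on _ _ ?C'")
    and "dbar_of (\<lambda>z h. Re h *\<^sub>R cauchy_transform (\<lambda>z. \<Phi>' z 1) z + Im h *\<^sub>R cauchy_transform (\<lambda>z. \<Phi>' z \<i>) z) z = - (of_real pi * \<Phi> z)"
proof -
  have v: "\<Phi>' z e = 0" if "z \<notin> K" for z e
    using C1_on_vanish[OF assms(1) compact_imp_closed[OF assms(2)] assms(3) that] by simp
  have n: "subcritical \<Phi>" "\<And>e. subcritical (\<lambda>z. \<Phi>' z e)"
    using subcritical_continuous[OF C1_on_imp_continuous_on[OF assms(1)] assms(2,3)]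
      subcritical_continuous[OF C1_onD(2)[OF assms(1)] assms(2) v] by auto
  have w: "(LINT z|lebesgue. \<Psi>' z e * \<Phi> z) = - (LINT z|lebesgue. \<Psi> z * \<Phi>' z e)" if "C1_on UNIV \<Psi> \<Psi>'" for \<Psi> \<Psi>' e
  proof -
    have P: "C1_on UNIV (\<lambda>z. \<Psi> z * \<Phi> z) (\<lambda>z h. \<Psi> z * \<Phi>' z h + \<Psi>' z h * \<Phi> z)"
      by (rule C1_on_mult[OF that assms(1)])
    have z: "\<Psi> z * \<Phi> z = 0" if "z \<notin> K" for z using assms(3)[OF that] by simp
    have c: "continuous_on UNIV (\<lambda>z. \<Psi> z * \<Phi>' z e)" "continuous_on UNIV (\<lambda>z. \<Psi>' z e * \<Phi> z)"
      by (intro continuous_on_mult C1_on_imp_continuous_on[OF that] C1_onD(2)[OF assms(1)]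
          C1_on_imp_continuous_on[OF assms(1)] C1_onD(2)[OF that])+
    have "integrable lebesgue (\<lambda>z. \<Psi> z * \<Phi>' z e)" "integrable lebesgue (\<lambda>z. \<Psi>' z e * \<Phi> z)"
      by (rule integrable_continuous_compact_support[OF c(1) assms(2)], simp add: v)
        (rule integrable_continuous_compact_support[OF c(2) assms(2)], simp add: assms(3))
    then show ?thesis
      using integral_C1_compact_support(2)[OF P assms(2) z, of e] by (simp add: add_eq_0_iff2)
  qed
  show "C1_on UNIV (cauchy_transform \<Phi>) ?C'"
    by (rule C1_cauchy_transform[OF n(1) n(2) n(2)]) (rule w, assumption)+
  have "cauchy_transform (dbar_of \<Phi>') z = (cauchy_transform (\<lambda>z. \<Phi>' z 1) z + \<i> * cauchy_transform (\<lambda>z. \<Phi>' z \<i>) z) / 2"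
  proof -
    have i: "integrable lebesgue (\<lambda>\<zeta>. \<Phi>' \<zeta> e / (\<zeta> - z))" for e using subcritical_kernel_integrable[OF n(2)] by blast
    have "dbar_of \<Phi>' \<zeta> / (\<zeta> - z) = (\<Phi>' \<zeta> 1 / (\<zeta> - z)) / 2 + \<i> * (\<Phi>' \<zeta> \<i> / (\<zeta> - z)) / 2" for \<zeta>
      by (simp add: dbar_of_def add_divide_distrib mult.commute)
    then have "cauchy_transform (dbar_of \<Phi>') z = (LINT \<zeta>|lebesgue. (\<Phi>' \<zeta> 1 / (\<zeta> - z)) / 2 + \<i> * (\<Phi>' \<zeta> \<i> / (\<zeta> - z)) / 2)"
      unfolding cauchy_transform_def by simp
    also have "\<dots> = (LINT \<zeta>|lebesgue. (\<Phi>' \<zeta> 1 / (\<zeta> - z)) / 2) + (LINT \<zeta>|lebesgue. \<i> * (\<Phi>' \<zeta> \<i> / (\<zeta> - z)) / 2)"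
      by (rule Bochner_Integration.integral_add) (intro integrable_divide integrable_mult_right i)+
    also have "\<dots> = (cauchy_transform (\<lambda>z. \<Phi>' z 1) z + \<i> * cauchy_transform (\<lambda>z. \<Phi>' z \<i>) z) / 2"
      unfolding cauchy_transform_def integral_divide_zero integral_mult_right_zero by (simp add: add_divide_distrib)
    finally show ?thesis .
  qed
  moreover have "cauchy_transform (dbar_of \<Phi>') z = - (of_real pi * \<Phi> z)"
    by (rule cauchy_pompeiu[OF assms(1,2)]) (rule assms(3))
  ultimately show "dbar_of (\<lambda>z h. Re h *\<^sub>R cauchy_transform (\<lambda>z. \<Phi>' z 1) z + Im h *\<^sub>R cauchy_transform (\<lambda>z. \<Phi>' z \<i>) z) z = - (of_real pi * \<Phi> z)"
    by (simp add: dbar_of_def)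
qed

text \<open>For a cutoff \<open>ch\<close>, the product \<open>ch * u\<close> is a multiple of the Cauchy transform of \<open>u\<close> times the
  \<open>z\<close>-bar derivative of \<open>ch\<close>, a density that vanishes where \<open>ch\<close> is constant.\<close>

theorem weyl_lemma_local:
  assumes D: "open D" and w: "has_weak_deriv D 1 u ux" "has_weak_deriv D \<i> u uy"
    and ae: "AE z in lebesgue. z \<in> D \<longrightarrow> ux z + \<i> * uy z = 0"
    and R: "0 < r" "r < R" "cball z0 R \<subseteq> D"
  obtains f where "f holomorphic_on ball z0 r" "AE z in lebesgue. z \<in> ball z0 r \<longrightarrow> u z = f z"
proof -
  obtain ch ch' where ch: "C1_on UNIV ch ch'" "\<And>z. z \<in> cball z0 r \<Longrightarrow> ch z = (1::real)"
    "\<And>z. z \<notin> cball z0 R \<Longrightarrow> ch z = 0"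
    using C1_on_ex_cutoff[OF R(1,2), of z0] by auto
  let ?X = "\<lambda>z. complex_of_real (ch z)" and ?X' = "\<lambda>z h. complex_of_real (ch' z h)"
  have X: "C1_on UNIV ?X ?X'" by (rule C1_on_of_real[OF ch(1)])
  have v: "ch' z e = 0" if "z \<notin> cball z0 R" for z e
    using C1_on_vanish[OF ch(1) closed_cball ch(3) that] by blast
  have v1: "ch' z e = 0" if "z \<in> ball z0 r" for z e
  proof -
    have "((\<lambda>z. ch z - 1) has_derivative (\<lambda>h. 0)) (at z)"
      by (rule has_derivative_locally_zero[of "ball z0 r"]) (use that ch(2) in auto)
    from has_derivative_add[OF this has_derivative_const[of 1]]
    have "(ch has_derivative (\<lambda>h. 0)) (at z)" by simp
    then have "ch' z = (\<lambda>h. 0)" using C1_onD(1)[OF ch(1)] has_derivative_unique by blast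
    then show ?thesis by simp
  qed
  have lu: "locally_integrable D u" using has_weak_deriv_locally_integrable[OF w(1)] by simp
  have cX: "continuous_on D (dbar_of ?X')" "continuous_on D ?X"
    by (rule continuous_on_subset[OF continuous_on_dbar_of[OF X]], simp)
      (rule continuous_on_subset[OF C1_on_imp_continuous_on[OF X]], simp)
  define g where "g z = dbar_of ?X' z * u z" for z
  have dX0: "dbar_of ?X' z = 0" if "z \<notin> cball z0 R" for z using v[OF that] by (simp add: dbar_of_def)
  have ig: "integrable lebesgue g" unfolding g_def[abs_def]
    by (rule integrable_mult_compact_support[OF lu cX(1) compact_cball R(3) dX0])
  have iX: "integrable lebesgue (\<lambda>z. ?X z * u z)"
    by (rule integrable_mult_compact_support[OF lu cX(2) compact_cball R(3)]) (simp add: ch(3))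
  \<comment> \<open>The density \<open>g\<close> is merely integrable, so no pointwise bound on its
    transform is available; integrability over \<open>K\<close> follows from skew symmetry with the
    indicator of \<open>K\<close>, which is subcritical.\<close>
  have lc: "locally_integrable UNIV (cauchy_transform g)"
    unfolding locally_integrable_iff
  proof (intro allI impI)
    fix K :: "complex set" assume K: "compact K \<and> K \<subseteq> UNIV"
    then obtain B where B: "\<And>z. z \<in> K \<Longrightarrow> norm z \<le> B" using compact_imp_bounded bounded_iff by metis
    have "subcritical (\<lambda>z. indicator K z)"
    proof (rule subcritical_bounded)
      show "(\<lambda>z. indicator K z :: complex) \<in> borel_measurable lebesgue"
        using K by (intro borel_measurable_lebesgueI borel_measurable_indicator) (simp add: borel_compact)
      show "norm (indicator K z :: complex) \<le> 1" for z by (simp add: indicator_def)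
      show "(indicator K z :: complex) = 0" if "z \<notin> cball 0 B" for z
        using B[of z] that by (auto simp: indicator_def)
    qed
    from cauchy_transform_skew(2)[OF ig this]
    have "integrable lebesgue (\<lambda>z. indicator K z * cauchy_transform g z)" .
    moreover have "(\<lambda>z. indicator K z * cauchy_transform g z) = (\<lambda>z. indicator K z *\<^sub>R cauchy_transform g z)"
      by (auto simp: indicator_def)
    ultimately show "integrable lebesgue (\<lambda>z. indicator K z *\<^sub>R cauchy_transform g z)" by simp
  qed
  have "AE z in lebesgue. z \<in> UNIV \<longrightarrow> ?X z * u z + cauchy_transform g z / of_real pi = 0"
  proof (rule fundamental_lemma_variations[OF _ open_UNIV])
    show "locally_integrable UNIV (\<lambda>z. ?X z * u z + cauchy_transform g z / of_real pi)"
      unfolding locally_integrable_def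
    proof (intro allI impI Bochner_Integration.integrable_add integrable_divide)
      fix K :: "complex set" assume K: "compact K \<and> K \<subseteq> UNIV"
      show "integrable (lebesgue_on K) (\<lambda>z. ?X z * u z)" "integrable (lebesgue_on K) (cauchy_transform g)"
        using K lc integrable_locally_integrable[OF iX, of UNIV] unfolding locally_integrable_def by blast+
    qed
    fix \<phi> :: "complex \<Rightarrow> real" and \<phi>' K
    assume h: "C1_on UNIV \<phi> \<phi>'" "compact K" "K \<subseteq> UNIV" "\<And>z. z \<notin> K \<Longrightarrow> \<phi> z = 0"
    let ?\<Phi> = "\<lambda>z. complex_of_real (\<phi> z)" and ?\<Phi>' = "\<lambda>z h. complex_of_real (\<phi>' z h)"
    have \<Phi>: "C1_on UNIV ?\<Phi> ?\<Phi>'" by (rule C1_on_of_real[OF h(1)])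
    have z: "?\<Phi> z = 0" if "z \<notin> K" for z using h(4)[OF that] by simp
    have n\<Phi>: "subcritical ?\<Phi>" by (rule subcritical_continuous[OF C1_on_imp_continuous_on[OF \<Phi>] h(2) z])
    obtain \<Psi>' where \<Psi>: "C1_on UNIV (cauchy_transform ?\<Phi>) \<Psi>'" "\<And>z. dbar_of \<Psi>' z = - (of_real pi * ?\<Phi> z)"
      using C1_cauchy_transform_test[OF \<Phi> h(2) z] by blast
    \<comment> \<open>The transform of \<open>\<Phi>\<close> becomes an admissible test function
      after multiplication by the cutoff. Its derivative consists of a multiple of
      \<open>\<Phi>\<close> and a term with the derivative of the cutoff, which pairs with
      \<open>u\<close> to give \<open>g\<close>.\<close>
    have P: "C1_on UNIV (\<lambda>z. ?X z * cauchy_transform ?\<Phi> z) (\<lambda>z h. ?X z * \<Psi>' z h + ?X' z h * cauchy_transform ?\<Phi> z)"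
      (is "C1_on _ _ ?P'")
      by (rule C1_on_mult[OF X \<Psi>(1)])
    have P0: "?X z * cauchy_transform ?\<Phi> z = 0" if "z \<notin> cball z0 R" for z using ch(3)[OF that] by simp
    have dP: "dbar_of ?P' z * u z = cauchy_transform ?\<Phi> z * g z - of_real pi * (?X z * ?\<Phi> z * u z)" for z
    proof -
      have e: "dbar_of ?P' z = ?X z * dbar_of \<Psi>' z + dbar_of ?X' z * cauchy_transform ?\<Phi> z"
        by (simp add: dbar_of_def field_simps)
      show ?thesis unfolding e \<Psi>(2) g_def by (simp add: algebra_simps)
    qed
    have "(LINT z|lebesgue. dbar_of ?P' z * u z) = - (LINT z|lebesgue. (?X z * cauchy_transform ?\<Phi> z) * ((ux z + \<i> * uy z) / 2))"
      by (rule weak_dbar_complex_test[OF w D P compact_cball R(3) P0])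
    also have "(LINT z|lebesgue. (?X z * cauchy_transform ?\<Phi> z) * ((ux z + \<i> * uy z) / 2)) = 0"
    proof (rule integral_eq_zero_AE)
      show "AE z in lebesgue. (?X z * cauchy_transform ?\<Phi> z) * ((ux z + \<i> * uy z) / 2) = 0"
        using ae
      proof eventually_elim
        fix z assume *: "z \<in> D \<longrightarrow> ux z + \<i> * uy z = 0"
        show "(?X z * cauchy_transform ?\<Phi> z) * ((ux z + \<i> * uy z) / 2) = 0"
        proof (cases "z \<in> cball z0 R")
          case True
          then have "ux z + \<i> * uy z = 0" using * R(3) by blast
          then show ?thesis by simp
        next
          case False
          then show ?thesis using P0[OF False] by simp
        qed
      qed
    qed
    finally have e0: "(LINT z|lebesgue. cauchy_transform ?\<Phi> z * g z - of_real pi * (?X z * ?\<Phi> z * u z)) = 0"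
      unfolding dP by simp
    have cc: "continuous_on D (\<lambda>z. cauchy_transform ?\<Phi> z * dbar_of ?X' z)" "continuous_on D (\<lambda>z. ?X z * ?\<Phi> z)"
      "continuous_on D ?\<Phi>"
      using continuous_on_subset[OF C1_on_imp_continuous_on[OF \<Psi>(1)], of D]
        continuous_on_subset[OF C1_on_imp_continuous_on[OF \<Phi>], of D] cX
      by (auto intro!: continuous_on_mult)
    have i1: "integrable lebesgue (\<lambda>z. cauchy_transform ?\<Phi> z * g z)"
      unfolding g_def mult.assoc[symmetric]
      by (rule integrable_mult_compact_support[OF lu cc(1) compact_cball R(3)]) (simp add: dX0)
    have i2: "integrable lebesgue (\<lambda>z. ?X z * ?\<Phi> z * u z)"
      by (rule integrable_mult_compact_support[OF lu cc(2) compact_cball R(3)]) (simp add: ch(3))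
    have e1: "(LINT z|lebesgue. cauchy_transform ?\<Phi> z * g z) = of_real pi * (LINT z|lebesgue. ?X z * ?\<Phi> z * u z)"
      using e0 i1 i2 by (subst (asm) Bochner_Integration.integral_diff) auto
    have i3: "integrable lebesgue (\<lambda>z. ?\<Phi> z * cauchy_transform g z)" by (rule cauchy_transform_skew(2)[OF ig n\<Phi>])
    have e2: "(LINT z|lebesgue. ?\<Phi> z * cauchy_transform g z) = - (of_real pi * (LINT z|lebesgue. ?X z * ?\<Phi> z * u z))"
      using cauchy_transform_skew(1)[OF ig n\<Phi>] e1 by (simp add: mult.commute[of "g _"])
    have "\<phi> z *\<^sub>R (?X z * u z + cauchy_transform g z / of_real pi) = ?X z * ?\<Phi> z * u z + (?\<Phi> z * cauchy_transform g z) / of_real pi" for z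
      by (simp add: scaleR_conv_of_real algebra_simps)
    then have "(LINT z|lebesgue. \<phi> z *\<^sub>R (?X z * u z + cauchy_transform g z / of_real pi)) =
        (LINT z|lebesgue. ?X z * ?\<Phi> z * u z) + (LINT z|lebesgue. ?\<Phi> z * cauchy_transform g z) / of_real pi"
      using i2 i3 by simp
    also have "\<dots> = 0" unfolding e2 by simp
    finally show "(LINT z|lebesgue. \<phi> z *\<^sub>R (?X z * u z + cauchy_transform g z / of_real pi)) = 0" .
  qed
  then have ae2: "AE z in lebesgue. z \<in> ball z0 r \<longrightarrow> u z = - cauchy_transform g z / of_real pi"
  proof eventually_elim
    fix z assume *: "z \<in> UNIV \<longrightarrow> ?X z * u z + cauchy_transform g z / of_real pi = 0"
    show "z \<in> ball z0 r \<longrightarrow> u z = - cauchy_transform g z / of_real pi"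
      using * ch(2)[of z] by (auto simp: eq_neg_iff_add_eq_0)
  qed
  have "cauchy_transform g holomorphic_on ball z0 r"
    by (rule cauchy_transform_holomorphic_off_support[OF ig]) (simp add: g_def dbar_of_def v1)
  then have "(\<lambda>z. - cauchy_transform g z / of_real pi) holomorphic_on ball z0 r"
    by (intro holomorphic_intros) auto
  with ae2 show ?thesis using that by blast
qed

lemma continuous_AE_eq:
  fixes f g :: "complex \<Rightarrow> complex"
  assumes "open S" "continuous_on S f" "continuous_on S g" "AE z in lebesgue. z \<in> S \<longrightarrow> f z = g z" "z \<in> S"
  shows "f z = g z"
proof (rule ccontr)
  assume ne: "f z \<noteq> g z"
  let ?U = "{w \<in> S. f w - g w \<in> - {0}}"
  have "open (S \<inter> (\<lambda>w. f w - g w) -` (- {0}))"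
    by (rule continuous_open_preimage[OF continuous_on_diff[OF assms(2,3)] assms(1)]) auto
  moreover have "S \<inter> (\<lambda>w. f w - g w) -` (- {0}) = ?U" by blast
  ultimately have o: "open ?U" by simp
  have "AE w in lebesgue. w \<notin> ?U" using assms(4) by eventually_elim simp
  moreover have "?U \<in> sets lebesgue" using borel_open[OF o] by simp
  ultimately have "?U \<in> null_sets lebesgue" by (simp only: AE_iff_null_sets)
  then have "negligible ?U" by (simp add: negligible_iff_null_sets)
  moreover have "?U \<noteq> {}" using ne assms(5) by auto
  ultimately show False using open_not_negligible[OF o] by blast
qed

lemma C1_on_cnj: "C1_on S cnj (\<lambda>z h. cnj h)"
  by (intro C1_onI bounded_linear_imp_has_derivative[OF bounded_linear_cnj]) auto

lemma C1_on_bianalytic: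
  assumes "f0 holomorphic_on S" "f1 holomorphic_on S" "open S"
  obtains f' where "C1_on S (\<lambda>z. f0 z + cnj z * f1 z) f'" "\<And>z. dbar_of f' z = f1 z"
proof (rule that)
  show "C1_on S (\<lambda>z. f0 z + cnj z * f1 z) (\<lambda>z h. deriv f0 z * h + (cnj z * (deriv f1 z * h) + cnj h * f1 z))"
    by (rule C1_on_add[OF C1_on_holomorphic[OF assms(1,3)] C1_on_mult[OF C1_on_cnj C1_on_holomorphic[OF assms(2,3)]]])
  show "dbar_of (\<lambda>z h. deriv f0 z * h + (cnj z * (deriv f1 z * h) + cnj h * f1 z)) z = f1 z" for z
    by (simp add: dbar_of_def algebra_simps)
qed

text \<open>Weyl's lemma makes \<open>\<psi>\<close> locally equal to a holomorphic
  \<open>f1\<close>; subtracting \<open>cnj z * f1\<close> from \<open>\<phi>\<close> leaves a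
  function to which Weyl's lemma applies again. Continuity of \<open>\<phi>\<close> turns equality
  almost everywhere into equality.\<close>

theorem weak_bianalytic:
  assumes D: "open D" and c: "continuous_on D \<phi>"
    and w: "has_weak_deriv D 1 \<phi> px" "has_weak_deriv D \<i> \<phi> py"
    and ae: "AE z in lebesgue. z \<in> D \<longrightarrow> (px z + \<i> * py z) / 2 = \<psi> z"
    and w2: "has_weak_deriv D 1 \<psi> qx" "has_weak_deriv D \<i> \<psi> qy"
    and ae2: "AE z in lebesgue. z \<in> D \<longrightarrow> qx z + \<i> * qy z = 0"
  obtains F0 F1 where "F0 holomorphic_on D" "F1 holomorphic_on D" "\<And>z. z \<in> D \<Longrightarrow> \<phi> z = F0 z + cnj z * F1 z"
proof -
  have loc: "\<exists>r>0. \<exists>f0 f1. ball z0 r \<subseteq> D \<and> f0 holomorphic_on ball z0 r \<and> f1 holomorphic_on ball z0 r \<and>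
      (\<forall>z\<in>ball z0 r. \<phi> z = f0 z + cnj z * f1 z)" if z0: "z0 \<in> D" for z0
  proof -
    obtain R where R: "R > 0" "cball z0 R \<subseteq> D" using D z0 open_contains_cball by blast
    obtain f1 where f1: "f1 holomorphic_on ball z0 (R/2)" "AE z in lebesgue. z \<in> ball z0 (R/2) \<longrightarrow> \<psi> z = f1 z"
      using weyl_lemma_local[OF D w2 ae2 _ _ R(2), of "R/2"] R(1) by auto
    let ?B = "ball z0 (R/2)"
    have BD: "?B \<subseteq> D" using R by (intro order_trans[OF _ R(2)]) auto
    obtain f' where f': "C1_on ?B (\<lambda>z. 0 + cnj z * f1 z) f'" "\<And>z. dbar_of f' z = f1 z"
      using C1_on_bianalytic[OF holomorphic_on_const f1(1) open_ball] by blast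
    have C: "C1_on ?B (\<lambda>z. cnj z * f1 z) f'" using f'(1) by simp
    define u where "u z = \<phi> z - cnj z * f1 z" for z
    have ux: "has_weak_deriv ?B 1 u (\<lambda>z. px z - f' z 1)" and uy: "has_weak_deriv ?B \<i> u (\<lambda>z. py z - f' z \<i>)"
      unfolding u_def[abs_def]
      by (intro has_weak_deriv_diff C1_on_imp_has_weak_deriv[OF C] has_weak_deriv_subset[OF w(1) D _ BD]
          has_weak_deriv_subset[OF w(2) D _ BD] open_ball)+
    have ae3: "AE z in lebesgue. z \<in> ?B \<longrightarrow> (px z - f' z 1) + \<i> * (py z - f' z \<i>) = 0"
      using ae f1(2)
    proof eventually_elim
      fix z assume a: "z \<in> D \<longrightarrow> (px z + \<i> * py z) / 2 = \<psi> z" "z \<in> ?B \<longrightarrow> \<psi> z = f1 z"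
      show "z \<in> ?B \<longrightarrow> (px z - f' z 1) + \<i> * (py z - f' z \<i>) = 0"
      proof
        assume "z \<in> ?B"
        then have "(px z + \<i> * py z) / 2 = dbar_of f' z" using a BD f'(2)[of z] by auto
        then have "px z + \<i> * py z = f' z 1 + \<i> * f' z \<i>" by (simp only: dbar_of_def divide_cancel_right) simp
        then show "(px z - f' z 1) + \<i> * (py z - f' z \<i>) = 0" by (simp add: algebra_simps)
      qed
    qed
    \<comment> \<open>Weyl's lemma needs a closed disc inside the domain and returns a smaller one,
      so two applications shrink the radius to \<open>R / 8\<close>.\<close>
    have sub: "cball z0 (R/4) \<subseteq> ?B" using R by auto
    obtain f0 where f0: "f0 holomorphic_on ball z0 (R/8)" "AE z in lebesgue. z \<in> ball z0 (R/8) \<longrightarrow> u z = f0 z"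
      using weyl_lemma_local[OF open_ball ux uy ae3 _ _ sub, of "R/8"] R(1) by auto
    have s2: "ball z0 (R/8) \<subseteq> ?B" using R by auto
    have f1': "f1 holomorphic_on ball z0 (R/8)" using f1(1) s2 holomorphic_on_subset by blast
    have cu: "continuous_on (ball z0 (R/8)) u"
      unfolding u_def[abs_def]
      by (intro continuous_intros holomorphic_on_imp_continuous_on[OF f1'] continuous_on_subset[OF c])
        (use s2 BD in blast)
    have "u z = f0 z" if "z \<in> ball z0 (R/8)" for z
      by (rule continuous_AE_eq[OF open_ball cu holomorphic_on_imp_continuous_on[OF f0(1)] f0(2) that])
    then have "\<forall>z\<in>ball z0 (R/8). \<phi> z = f0 z + cnj z * f1 z" unfolding u_def by (auto simp: algebra_simps)
    moreover have "ball z0 (R/8) \<subseteq> D" using s2 BD by blast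
    ultimately show ?thesis using f0(1) f1' R(1) by (intro exI[of _ "R/8"]) auto
  qed
  \<comment> \<open>The local coefficient \<open>f1\<close> is the derivative of
    \<open>\<phi>\<close> with respect to \<open>cnj z\<close>; defining \<open>F1\<close> by that
    derivative makes it independent of the disc, so the local pieces fit together.\<close>
  define F1 where "F1 z = dbar_of (\<lambda>z. frechet_derivative \<phi> (at z)) z" for z
  define F0 where "F0 z = \<phi> z - cnj z * F1 z" for z
  have loc2: "\<exists>r>0. F0 holomorphic_on ball z0 r \<and> F1 holomorphic_on ball z0 r" if z0: "z0 \<in> D" for z0
  proof -
    obtain r f0 f1 where r: "r > 0" "ball z0 r \<subseteq> D" "f0 holomorphic_on ball z0 r" "f1 holomorphic_on ball z0 r"
      "\<And>z. z \<in> ball z0 r \<Longrightarrow> \<phi> z = f0 z + cnj z * f1 z" using loc[OF z0] by blast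
    obtain f' where f': "C1_on (ball z0 r) (\<lambda>z. f0 z + cnj z * f1 z) f'" "\<And>z. dbar_of f' z = f1 z"
      using C1_on_bianalytic[OF r(3,4) open_ball] by blast
    have F1: "F1 z = f1 z" if "z \<in> ball z0 r" for z
    proof -
      have "(\<phi> has_derivative f' z) (at z)"
        by (rule has_derivative_transform_within_open[OF C1_onD(1)[OF f'(1) that] open_ball that]) (simp add: r(5))
      then have "frechet_derivative \<phi> (at z) = f' z" using frechet_derivative_at by metis
      then show ?thesis using f'(2)[of z] by (simp add: F1_def dbar_of_def)
    qed
    have "F1 holomorphic_on ball z0 r" using holomorphic_transform[OF r(4)] F1 by metis
    moreover have "F0 holomorphic_on ball z0 r"
      by (rule holomorphic_transform[OF r(3)]) (simp add: F0_def F1 r(5))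
    ultimately show ?thesis using r(1) by blast
  qed
  have "F0 holomorphic_on D" "F1 holomorphic_on D"
  proof -
    have fd: "F0 field_differentiable at z \<and> F1 field_differentiable at z" if "z \<in> D" for z
      using loc2[OF that] holomorphic_on_imp_differentiable_at[OF _ open_ball centre_in_ball[THEN iffD2]] by blast
    show "F0 holomorphic_on D" "F1 holomorphic_on D"
      unfolding holomorphic_on_def using fd by (simp_all add: field_differentiable_at_within)
  qed
  then show ?thesis by (rule that) (simp add: F0_def)
qed

section \<open>Bianalytic functions in an ellipse\<close>

text \<open>Decay is known at the outer circle only. With the weight \<open>t ^ n\<close> the
  maximum principle bounds \<open>norm (G t0) * norm t0 ^ n\<close> by the contribution of an inner
  circle of radius \<open>r < norm t0\<close>, and the quotient \<open>(r / norm t0) ^ n\<close>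
  tends to 0.\<close>

lemma holomorphic_annulus_zero:
  assumes hol: "G holomorphic_on {t. a < norm t \<and> norm t < 1}" and a: "0 < a"
    and lim: "\<And>e. e > 0 \<Longrightarrow> \<exists>\<rho><1. \<forall>t. \<rho> < norm t \<and> norm t < 1 \<longrightarrow> norm (G t) < e"
    and t0: "a < norm t0" "norm t0 < 1"
  shows "G t0 = (0::complex)"
proof -
  define r where "r = (a + norm t0) / 2"
  have r: "a < r" "r < norm t0" using t0 by (auto simp: r_def)
  have r0: "r > 0" using r a by linarith
  have cont: "continuous_on {t. a < norm t \<and> norm t < 1} G" using hol by (rule holomorphic_on_imp_continuous_on)
  have "compact (sphere (0::complex) r)" by simp
  moreover have "continuous_on (sphere 0 r) G" by (rule continuous_on_subset[OF cont]) (use r t0 in auto)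
  ultimately have "bounded (G ` sphere 0 r)" using compact_continuous_image compact_imp_bounded by blast
  then obtain M where "\<forall>t\<in>sphere 0 r. norm (G t) \<le> M" by (auto simp: bounded_iff)
  then have M: "norm (G t) \<le> M" if "norm t = r" for t using that by simp
  have M0: "M \<ge> 0" using M[of "of_real r"] r0 by (smt (verit) norm_ge_zero norm_of_real)
  have key: "norm (G t0) * norm t0 ^ n \<le> M * r ^ n" for n
  proof (rule field_le_epsilon)
    fix e :: real assume e: "e > 0"
    obtain \<rho> where \<rho>: "\<rho> < 1" "\<And>t. \<rho> < norm t \<Longrightarrow> norm t < 1 \<Longrightarrow> norm (G t) < e" using lim[OF e] by blast
    \<comment> \<open>The outer radius depends on \<open>e\<close>: it must lie beyond
      \<open>\<rho>\<close>, where \<open>G\<close> is smaller than \<open>e\<close>, and beyond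
      \<open>norm t0\<close>.\<close>
    define s where "s = (max \<rho> (norm t0) + 1) / 2"
    have s: "\<rho> < s" "norm t0 < s" "s < 1" using \<rho> t0 by (auto simp: s_def)
    let ?S = "cball (0::complex) s - ball 0 r"
    have sub: "?S \<subseteq> {t. a < norm t \<and> norm t < 1}" using r s by auto
    have cl: "closed ?S" by (intro closed_Diff) auto
    have "norm (G t0 * t0 ^ n) \<le> M * r ^ n + e"
    proof (rule maximum_modulus_frontier[where S="?S" and f="\<lambda>t. G t * t ^ n"])
      show "(\<lambda>t. G t * t ^ n) holomorphic_on interior ?S"
        by (intro holomorphic_intros holomorphic_on_subset[OF hol] order_trans[OF interior_subset sub])
      show "continuous_on (closure ?S) (\<lambda>t. G t * t ^ n)"
        unfolding closure_closed[OF cl] by (intro continuous_intros continuous_on_subset[OF cont sub])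
      show "bounded ?S" by (rule bounded_subset[OF bounded_cball]) auto
      show "t0 \<in> ?S" using r s by auto
      fix z assume "z \<in> frontier ?S"
      then have zS: "z \<in> ?S" and zi: "z \<notin> interior ?S"
        using cl by (auto simp: frontier_def)
      have "norm z = r \<or> norm z = s"
      proof (rule ccontr)
        assume "\<not> (norm z = r \<or> norm z = s)"
        then have "z \<in> ball 0 s \<inter> - cball 0 r" using zS by auto
        moreover have "open (ball (0::complex) s \<inter> - cball 0 r)" by (intro open_Int open_Compl) auto
        moreover have "ball 0 s \<inter> - cball 0 r \<subseteq> ?S" by auto
        ultimately show False using zi interior_maximal by blast
      qed
      then show "norm (G z * z ^ n) \<le> M * r ^ n + e"
      proof
        assume n: "norm z = r"
        then have "norm (G z) * r ^ n \<le> M * r ^ n" using M[OF n] r0 by (intro mult_right_mono) auto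
        then show ?thesis using e n by (simp add: norm_mult norm_power)
      next
        assume n: "norm z = s"
        have "norm (G z) * s ^ n \<le> e * 1"
          using \<rho>(2)[of z] n s r r0 e by (intro mult_mono power_le_one) auto
        moreover have "0 \<le> M * r ^ n" using M0 r0 by simp
        ultimately show ?thesis using n by (simp add: norm_mult norm_power)
      qed
    qed
    then show "norm (G t0) * norm t0 ^ n \<le> M * r ^ n + e" by (simp add: norm_mult norm_power)
  qed
  have t0p: "norm t0 > 0" using t0 a by linarith
  have "norm (G t0) \<le> M * (r / norm t0) ^ n" for n
    using key[of n] t0p by (simp add: power_divide field_simps)
  moreover have "(\<lambda>n. M * (r / norm t0) ^ n) \<longlonglongrightarrow> M * 0"
    using r r0 t0p by (intro tendsto_mult tendsto_const LIMSEQ_realpow_zero) auto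
  ultimately have "norm (G t0) \<le> M * 0" by (intro LIMSEQ_le_const) auto
  then show ?thesis by simp
qed

text \<open>On the circle of radius \<open>r\<close> about \<open>z\<close> one has \<open>cnj w = cnj z + r\<^sup>2 / (w - z)\<close>, so that
  \<open>(w - z) * \<phi> w\<close> has the boundary values of a holomorphic function.\<close>

lemma bianalytic_coefficient_bound:
  assumes hol: "f0 holomorphic_on S" "f1 holomorphic_on S" "open S" and r: "r > 0" "cball z r \<subseteq> S"
    and B: "\<And>w. norm (w - z) = r \<Longrightarrow> norm (f0 w + cnj w * f1 w) \<le> B"
  shows "norm (f1 z) \<le> B / r"
proof -
  \<comment> \<open>At the centre the first summand vanishes and the value is
    \<open>r ^ 2 * f1 z\<close>, so the maximum principle for this function is the desired
    bound.\<close>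
  let ?H = "\<lambda>w. (w - z) * (f0 w + cnj z * f1 w) + of_real (r\<^sup>2) * f1 w"
  have bS: "ball z r \<subseteq> S" using r(2) ball_subset_cball by blast
  have h: "f0 holomorphic_on cball z r" "f1 holomorphic_on cball z r"
    using hol r holomorphic_on_subset by blast+
  have h2: "f0 holomorphic_on ball z r" "f1 holomorphic_on ball z r"
    using hol bS holomorphic_on_subset by blast+
  have "norm (?H z) \<le> r * B"
  proof (rule maximum_modulus_frontier[where S="cball z r" and f="?H"])
    show "?H holomorphic_on interior (cball z r)"
      by (simp only: interior_cball) (intro holomorphic_intros h2)
    show "continuous_on (closure (cball z r)) ?H"
      by (simp only: closure_closed[OF closed_cball])
         (intro continuous_intros holomorphic_on_imp_continuous_on h)
    fix w assume "w \<in> frontier (cball z r)"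
    then have w: "norm (w - z) = r" using r by (simp add: frontier_cball dist_norm norm_minus_commute)
    have rr: "(w - z) * cnj (w - z) = of_real (r\<^sup>2)" using w complex_norm_square by metis
    have "?H w = (w - z) * (f0 w + cnj w * f1 w)" unfolding rr[symmetric] by (simp add: algebra_simps)
    then show "norm (?H w) \<le> r * B" using B[OF w] w r by (simp add: norm_mult mult_left_mono)
  qed (use r in auto)
  then have "r\<^sup>2 * norm (f1 z) \<le> r * B" by (simp add: norm_mult norm_power)
  then have "r * norm (f1 z) \<le> B" using r by (simp add: power2_eq_square)
  then show ?thesis using r by (simp add: field_simps)
qed

text \<open>For \<open>z = u + \<kappa> * cnj u\<close> one has \<open>N z = (1 - k\<^sup>2) * norm u\<close>, so that \<open>E\<close> below is the image of the unit disc;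
  it is also the image of the annulus \<open>k < norm t < 1\<close> under the Joukowski map \<open>J\<close>.\<close>

locale ellipse =
  fixes \<kappa> :: complex and k :: real
  assumes k: "k = norm \<kappa>" "0 < k" "k < 1"
begin

definition N :: "complex \<Rightarrow> real" where "N z = norm (z - \<kappa> * cnj z)"

definition E :: "complex set" where "E = {z. N z < 1 - k\<^sup>2}"

definition J :: "complex \<Rightarrow> complex" where "J t = t + \<kappa> / t"

section \<open>Geometry of the ellipse and of the Joukowski map\<close>

lemma kappa_cnj_kappa: "\<kappa> * cnj \<kappa> = of_real (k\<^sup>2)" using k(1) complex_norm_square by metis

lemma k_square_less_1: "k\<^sup>2 < 1" using k by (simp add: power_less_one_iff)

lemma nz: "\<kappa> \<noteq> 0" using k by auto

lemma continuous_N: "continuous_on S N" unfolding N_def[abs_def] by (intro continuous_intros)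

lemma open_E: "open E" unfolding E_def by (intro open_Collect_less continuous_N continuous_intros)

lemma N_lipschitz: "N w \<le> N z + (1 + k) * norm (w - z)"
proof -
  have "w - \<kappa> * cnj w = (z - \<kappa> * cnj z) + ((w - z) - \<kappa> * cnj (w - z))" by (simp add: algebra_simps)
  then have "N w \<le> N z + norm ((w - z) - \<kappa> * cnj (w - z))" unfolding N_def by (metis norm_triangle_ineq)
  also have "norm ((w - z) - \<kappa> * cnj (w - z)) \<le> norm (w - z) + norm (\<kappa> * cnj (w - z))" by (rule norm_triangle_ineq4)
  also have "\<dots> = (1 + k) * norm (w - z)" using k by (simp add: norm_mult algebra_simps del: complex_cnj_diff)
  finally show ?thesis by simp
qed

text \<open>\<open>J t - \<kappa> * cnj (J t)\<close> is the sum of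
  \<open>t * (1 - k ^ 2 / norm t ^ 2)\<close> and
  \<open>\<kappa> * cnj t * (1 / norm t ^ 2 - 1)\<close>; the second summand vanishes on the unit
  circle and is a perturbation nearby.\<close>

lemma N_J:
  assumes t: "k \<le> norm t"
  shows "N (J t) \<le> (norm t - k\<^sup>2 / norm t) + k * \<bar>1 / norm t - norm t\<bar>"
    and "N (J t) \<ge> (norm t - k\<^sup>2 / norm t) - k * \<bar>1 / norm t - norm t\<bar>"
proof -
  have assms: "t \<noteq> 0" using t k by auto
  let ?r = "norm t"
  have r: "?r > 0" using assms by simp
  have tt: "t * cnj t = of_real (?r\<^sup>2)" using complex_norm_square by metis
  then have c: "cnj t = of_real (?r\<^sup>2) / t" using assms by (simp add: field_simps)
  have ct: "cnj t \<noteq> 0" using assms by simp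
  have A: "t - of_real (k\<^sup>2) / cnj t = t * of_real (1 - k\<^sup>2 / ?r\<^sup>2)"
    unfolding c using assms r by (simp add: field_simps)
  have Bq: "\<kappa> / t - \<kappa> * cnj t = \<kappa> * cnj t * of_real (1 / ?r\<^sup>2 - 1)"
    unfolding c using assms r by (simp add: field_simps)
  have "J t - \<kappa> * cnj (J t) = (t - (\<kappa> * cnj \<kappa>) / cnj t) + (\<kappa> / t - \<kappa> * cnj t)"
    by (simp add: J_def algebra_simps)
  then have e: "J t - \<kappa> * cnj (J t) = t * of_real (1 - k\<^sup>2 / ?r\<^sup>2) + \<kappa> * cnj t * of_real (1 / ?r\<^sup>2 - 1)"
    unfolding kappa_cnj_kappa A Bq .
  have n1: "norm (t * of_real (1 - k\<^sup>2 / ?r\<^sup>2)) = \<bar>?r - k\<^sup>2 / ?r\<bar>"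
  proof -
    have "norm (t * of_real (1 - k\<^sup>2 / ?r\<^sup>2)) = \<bar>?r * (1 - k\<^sup>2 / ?r\<^sup>2)\<bar>"
      by (simp only: norm_mult norm_of_real abs_mult abs_norm_cancel)
    also have "?r * (1 - k\<^sup>2 / ?r\<^sup>2) = ?r - k\<^sup>2 / ?r" using r by (simp add: field_simps power2_eq_square)
    finally show ?thesis .
  qed
  have n2: "norm (\<kappa> * cnj t * of_real (1 / ?r\<^sup>2 - 1)) = k * \<bar>1 / ?r - ?r\<bar>"
  proof -
    have "norm (\<kappa> * cnj t * of_real (1 / ?r\<^sup>2 - 1)) = k * \<bar>?r * (1 / ?r\<^sup>2 - 1)\<bar>"
      using k(1) by (simp only: norm_mult norm_of_real abs_mult abs_norm_cancel complex_mod_cnj mult.assoc)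
    also have "?r * (1 / ?r\<^sup>2 - 1) = 1 / ?r - ?r" using r by (simp add: field_simps power2_eq_square)
    finally show ?thesis .
  qed
  have "N (J t) \<ge> \<bar>?r - k\<^sup>2 / ?r\<bar> - k * \<bar>1 / ?r - ?r\<bar>"
    unfolding N_def e n1[symmetric] n2[symmetric] by (rule norm_diff_ineq)
  then show "N (J t) \<ge> (?r - k\<^sup>2 / ?r) - k * \<bar>1 / ?r - ?r\<bar>" by linarith
  have "k * k \<le> ?r * ?r" using t k by (intro mult_mono) auto
  then have "?r - k\<^sup>2 / ?r \<ge> 0" using r by (simp add: field_simps power2_eq_square)
  moreover have "N (J t) \<le> \<bar>?r - k\<^sup>2 / ?r\<bar> + k * \<bar>1 / ?r - ?r\<bar>"
    unfolding N_def e n1[symmetric] n2[symmetric] by (rule norm_triangle_ineq)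
  ultimately show "N (J t) \<le> (?r - k\<^sup>2 / ?r) + k * \<bar>1 / ?r - ?r\<bar>" by linarith
qed

text \<open>In factored form the two bounds show that the gap between \<open>N (J t)\<close> and the
  boundary level \<open>1 - k ^ 2\<close> is comparable with \<open>1 - norm t\<close> in both
  directions, as long as \<open>norm t\<close> stays away from \<open>k\<close>.\<close>

lemma N_J_inner:
  assumes "k \<le> norm t" "norm t \<le> 1"
  shows "N (J t) \<le> (1 - k\<^sup>2) - (1 - k) * (1 - norm t) * (1 - k / norm t)"
    and "N (J t) \<ge> (1 - k\<^sup>2) - (1 + k) * (1 - norm t) * (1 + k / norm t)"
proof -
  have r: "norm t > 0" using assms k by linarith
  have "1 / norm t - norm t \<ge> 0" using r assms by (simp add: field_simps mult_le_one)
  then have a: "\<bar>1 / norm t - norm t\<bar> = 1 / norm t - norm t" by simp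
  have "(norm t - k\<^sup>2 / norm t) + k * (1 / norm t - norm t) = (1 - k\<^sup>2) - (1 - k) * (1 - norm t) * (1 - k / norm t)"
    using r by (simp add: field_simps power2_eq_square)
  then show "N (J t) \<le> (1 - k\<^sup>2) - (1 - k) * (1 - norm t) * (1 - k / norm t)"
    using N_J(1)[OF assms(1)] unfolding a by simp
  have "(norm t - k\<^sup>2 / norm t) - k * (1 / norm t - norm t) = (1 - k\<^sup>2) - (1 + k) * (1 - norm t) * (1 + k / norm t)"
    using r by (simp add: field_simps power2_eq_square)
  then show "N (J t) \<ge> (1 - k\<^sup>2) - (1 + k) * (1 - norm t) * (1 + k / norm t)"
    using N_J(2)[OF assms(1)] unfolding a by simp
qed

lemma J_in_E:
  assumes "k < norm t" "norm t < 1"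
  shows "J t \<in> E"
proof -
  have "k / norm t < 1" using assms k by (simp add: divide_less_eq)
  then have "(1 - k) * (1 - norm t) * (1 - k / norm t) > 0" using assms k by simp
  then show ?thesis using N_J_inner(1)[of t] assms by (simp add: E_def)
qed

text \<open>The candidates are the roots of \<open>X ^ 2 - z * X + \<kappa>\<close>. Their product
  is \<open>\<kappa>\<close>, so the root of larger modulus satisfies
  \<open>norm t ^ 2 \<ge> k > k ^ 2\<close>; if its modulus were at least 1, the lower bound for
  \<open>N (J t)\<close> would place \<open>z\<close> outside \<open>E\<close>.\<close>

lemma in_E_imp_J:
  assumes z: "z \<in> E"
  obtains t where "z = J t" "k < norm t" "norm t < 1"
proof -
  define d where "d = csqrt (z\<^sup>2 - 4 * \<kappa>)"
  have d: "d * d = z\<^sup>2 - 4 * \<kappa>" using power2_csqrt[of "z\<^sup>2 - 4 * \<kappa>"] by (simp add: d_def power2_eq_square)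
  define p where "p = (z + d) / 2"
  define q where "q = (z - d) / 2"
  have pq: "p + q = z" "p * q = \<kappa>"
    using d by (simp_all add: p_def q_def field_simps power2_eq_square)
  have "\<exists>t s. t + s = z \<and> t * s = \<kappa> \<and> norm s \<le> norm t"
    using pq by (metis add.commute mult.commute linear)
  then obtain t s where ts: "t + s = z" "t * s = \<kappa>" "norm s \<le> norm t" by blast
  have t0: "t \<noteq> 0" using ts(2) nz by auto
  have "norm t * norm s = k" using ts(2) k(1) by (metis norm_mult)
  then have kt: "k \<le> norm t * norm t" using mult_left_mono[OF ts(3), of "norm t"] by simp
  have kt1: "k < norm t"
  proof (rule ccontr)
    assume "\<not> k < norm t"
    then have "norm t * norm t \<le> k * k" using k(2) by (intro mult_mono) auto
    also have "\<dots> < k" using k by simp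
    finally show False using kt by simp
  qed
  have zJ: "z = J t" 
  proof -
    have "s = \<kappa> / t" using ts(2) t0 by (metis nonzero_mult_div_cancel_left)
    then show ?thesis using ts(1) by (simp add: J_def)
  qed
  have "norm t < 1"
  proof (rule ccontr)
    assume n: "\<not> norm t < 1"
    have "1 / norm t \<le> 1" using n by (simp add: divide_le_eq_1)
    then have "1 / norm t - norm t \<le> 0" using n by linarith
    then have a: "\<bar>1 / norm t - norm t\<bar> = norm t - 1 / norm t" by simp
    have "k / norm t \<le> 1" using kt1 k by (simp add: divide_le_eq)
    then have "0 \<le> (norm t - 1) * (1 - k / norm t) * (1 - k)" using n k by simp
    also have "\<dots> = (norm t - k\<^sup>2 / norm t) - k * (norm t - 1 / norm t) - (1 - k\<^sup>2)"
      using t0 by (simp add: field_simps power2_eq_square)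
    finally have "N (J t) \<ge> 1 - k\<^sup>2" using N_J(2)[of t] kt1 unfolding a by simp
    then show False using z zJ by (simp add: E_def)
  qed
  then show ?thesis using that zJ kt1 by blast
qed

text \<open>On the unit circle \<open>cnj t = 1 / t\<close>. Inside, both
  \<open>cnj t - 1 / t\<close> and \<open>1 / cnj t - t\<close> carry the factor
  \<open>norm t ^ 2 - 1\<close>.\<close>

lemma cnj_J:
  assumes "a \<le> norm t" "0 < a" "norm t < 1"
  shows "norm (cnj (J t) - (1 / t + cnj \<kappa> * t)) \<le> 2 * (1 + k) * (1 - norm t) / a"
proof -
  let ?r = "norm t"
  have r: "?r > 0" using assms by linarith
  then have t0: "t \<noteq> 0" by auto
  have "t * cnj t = of_real (?r\<^sup>2)" using complex_norm_square by metis
  then have c: "cnj t = of_real (?r\<^sup>2) / t" using t0 by (simp add: field_simps)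
  have "cnj (J t) - (1 / t + cnj \<kappa> * t) = (cnj t - 1 / t) + cnj \<kappa> * (1 / cnj t - t)"
    by (simp add: J_def algebra_simps)
  also have "cnj t - 1 / t = of_real (?r\<^sup>2 - 1) / t" unfolding c by (simp add: diff_divide_distrib)
  also have "1 / cnj t - t = t * of_real (1 / ?r\<^sup>2 - 1)" unfolding c using t0 r by (simp add: field_simps)
  finally have "norm (cnj (J t) - (1 / t + cnj \<kappa> * t)) \<le> norm (of_real (?r\<^sup>2 - 1) / t) + norm (cnj \<kappa> * (t * of_real (1 / ?r\<^sup>2 - 1)))"
    using norm_triangle_ineq by metis
  also have "\<dots> = \<bar>?r\<^sup>2 - 1\<bar> / ?r + k * (?r * \<bar>1 / ?r\<^sup>2 - 1\<bar>)"
    using k(1) by (simp only: norm_divide norm_mult norm_of_real complex_mod_cnj)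
  also have "\<dots> = (1 - ?r) * (1 + ?r) * (1 + k) / ?r"
  proof -
    have "?r\<^sup>2 < 1" using assms r by (simp add: power_less_one_iff)
    then have "\<bar>?r\<^sup>2 - 1\<bar> = 1 - ?r\<^sup>2" "\<bar>1 / ?r\<^sup>2 - 1\<bar> = 1 / ?r\<^sup>2 - 1" using r by (auto simp: field_simps)
    then show ?thesis using r by (simp add: field_simps power2_eq_square)
  qed
  also have "\<dots> \<le> (1 - ?r) * 2 * (1 + k) / a"
    using assms k r by (intro frac_le mult_mono mult_nonneg_nonneg) auto
  finally show ?thesis by (simp only: mult.commute mult.left_commute)
qed

text \<open>At the boundary \<open>f1\<close> may blow up, but only like \<open>o(1 / (1 - norm t))\<close> because \<open>f0 + cnj z * f1\<close> tends
  to \<open>0\<close>, whereas \<open>cnj (J t)\<close> differs from \<open>1 / t + cnj \<kappa> * t\<close> by \<open>O(1 - norm t)\<close>.\<close>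

lemma functional_equation:
  assumes hol: "f0 holomorphic_on E" "f1 holomorphic_on E"
    and lim: "\<And>e. e > 0 \<Longrightarrow> \<exists>\<eta>>0. \<forall>z\<in>E. N z > 1 - k\<^sup>2 - \<eta> \<longrightarrow> norm (f0 z + cnj z * f1 z) < e"
    and t0: "k < norm t0" "norm t0 < 1"
  shows "f0 (J t0) + (1 / t0 + cnj \<kappa> * t0) * f1 (J t0) = 0"
proof -
  define a where "a = (k + norm t0) / 2"
  have a: "k < a" "a < norm t0" "a < 1" using t0 by (auto simp: a_def)
  have a0: "0 < a" using a k by linarith
  \<comment> \<open>For the radius \<open>d = c * (1 - norm t)\<close> the Lipschitz constant
    \<open>1 + k\<close> of \<open>N\<close> allows \<open>N\<close> to grow by at most half of the
    gap between \<open>N (J t)\<close> and \<open>1 - k ^ 2\<close>, so the disc about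
    \<open>J t\<close> stays in \<open>E\<close>.\<close>
  define c where "c = (1 - k) * (1 - k / a) / (2 * (1 + k))"
  have ka: "k / a < 1" using a a0 by simp
  have c: "c > 0" using k(2,3) ka by (simp add: c_def)
  have cc: "(1 + k) * c = (1 - k) * (1 - k / a) / 2" proof -
    have "(1 + k) * (Y / (2 * (1 + k))) = Y / 2" for Y using k(2) by (simp add: field_simps)
    then show ?thesis unfolding c_def .
  qed
  let ?G = "\<lambda>t. f0 (J t) + (1 / t + cnj \<kappa> * t) * f1 (J t)"
  show ?thesis
  proof (rule holomorphic_annulus_zero[where G="?G" and a=a])
    have JJ: "J holomorphic_on {t. a < norm t \<and> norm t < 1}"
      unfolding J_def[abs_def] using a0 by (intro holomorphic_intros) auto
    have im: "J ` {t. a < norm t \<and> norm t < 1} \<subseteq> E" using J_in_E a by force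
    have "(\<lambda>t. f0 (J t)) holomorphic_on {t. a < norm t \<and> norm t < 1}"
      "(\<lambda>t. f1 (J t)) holomorphic_on {t. a < norm t \<and> norm t < 1}"
      using holomorphic_on_compose_gen[OF JJ hol(1) im] holomorphic_on_compose_gen[OF JJ hol(2) im]
      by (simp_all add: o_def)
    then show "?G holomorphic_on {t. a < norm t \<and> norm t < 1}"
      using a0 by (intro holomorphic_intros) auto
    fix e :: real assume e: "e > 0"
    \<comment> \<open>The denominator is the sum of the two error contributions: 1 from the boundary
      condition, the rest from replacing \<open>cnj (J t)\<close> by its meromorphic
      counterpart.\<close>
    define e' where "e' = e / (1 + 2 * (1 + k) / (a * c))"
    have dpos: "1 + 2 * (1 + k) / (a * c) > 0" using k(2) a0 c by (simp add: add_pos_nonneg)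
    have e': "e' > 0" using e dpos by (simp add: e'_def)
    obtain \<eta> where \<eta>: "\<eta> > 0" "\<And>z. z \<in> E \<Longrightarrow> N z > 1 - k\<^sup>2 - \<eta> \<Longrightarrow> norm (f0 z + cnj z * f1 z) < e'"
      using lim[OF e'] by blast
    \<comment> \<open>Close enough to the unit circle that every point of the disc of radius
      \<open>d\<close> about \<open>J t\<close> lies above the level
      \<open>1 - k ^ 2 - \<eta>\<close>; the 2 accounts for the depth of the centre and
      \<open>c\<close> for the radius.\<close>
    define \<rho> where "\<rho> = max a (1 - \<eta> / ((1 + k) * (2 + c)))"
    have \<rho>: "\<rho> < 1" using a(3) \<eta>(1) k(2) c by (simp add: \<rho>_def)
    have "norm (?G t) < e" if t: "\<rho> < norm t" "norm t < 1" for t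
    proof -
      let ?r = "norm t" and ?z = "J t"
      have ar: "a < ?r" using t by (simp add: \<rho>_def)
      then have kr: "k \<le> ?r" using a by linarith
      have r0: "?r > 0" using a0 ar by linarith
      define d where "d = c * (1 - ?r)"
      have d: "d > 0" using c t by (simp add: d_def)
      have "1 - \<eta> / ((1 + k) * (2 + c)) < ?r" using t by (simp add: \<rho>_def)
      then have "1 - ?r < \<eta> / ((1 + k) * (2 + c))" by linarith
      moreover have "(1 + k) * (2 + c) > 0" using k(2) c by simp
      ultimately have "(1 - ?r) * ((1 + k) * (2 + c)) < \<eta>" by (simp only: pos_less_divide_eq)
      then have small: "(1 + k) * (1 - ?r) * 2 + (1 + k) * d < \<eta>" by (simp add: d_def algebra_simps)
      have ball: "w \<in> E \<and> N w > 1 - k\<^sup>2 - \<eta>" if w: "norm (w - ?z) \<le> d" for w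
      proof
        have "k / ?r \<le> k / a" using ar a0 k(2) r0 by (intro divide_left_mono mult_pos_pos) auto
        then have "(1 - k) * (1 - ?r) * (1 - k / a) \<le> (1 - k) * (1 - ?r) * (1 - k / ?r)"
          using k(2,3) t by (intro mult_left_mono) auto
        then have up: "N ?z \<le> (1 - k\<^sup>2) - (1 - k) * (1 - ?r) * (1 - k / a)"
          using N_J_inner(1)[OF kr] t by linarith
        have "N w \<le> N ?z + (1 + k) * norm (w - ?z)" by (rule N_lipschitz)
        also have "\<dots> \<le> N ?z + (1 + k) * d" using w k(2) by simp
        also have "(1 + k) * d = (1 - k) * (1 - ?r) * (1 - k / a) / 2"
          unfolding d_def mult.assoc[symmetric] cc by (simp add: mult_ac)
        finally have le: "N w \<le> N ?z + (1 - k) * (1 - ?r) * (1 - k / a) / 2" .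
        have pos: "(1 - k) * (1 - ?r) * (1 - k / a) > 0" using k(2,3) t ka by simp
        have lin: "w' < x" if "z' \<le> x - X" "w' \<le> z' + X / 2" "X > 0" for w' x X z' :: real
          using that by linarith
        show "w \<in> E" using lin[OF up le pos] by (simp add: E_def)
        have "k / ?r \<le> 1" using kr r0 by simp
        then have "(1 + k) * (1 - ?r) * (1 + k / ?r) \<le> (1 + k) * (1 - ?r) * 2"
          using k(2,3) t by (intro mult_left_mono) auto
        then have lo: "N ?z \<ge> (1 - k\<^sup>2) - (1 + k) * (1 - ?r) * 2"
          using N_J_inner(2)[OF kr] t by linarith
        have "N ?z \<le> N w + (1 + k) * norm (?z - w)" by (rule N_lipschitz)
        also have "\<dots> \<le> N w + (1 + k) * d" using w k(2) by (simp add: norm_minus_commute)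
        finally show "N w > 1 - k\<^sup>2 - \<eta>" using lo small by linarith
      qed
      have zE: "norm (f0 ?z + cnj ?z * f1 ?z) < e'" using ball[of ?z] d \<eta>(2) by simp
      \<comment> \<open>The growth of order \<open>1 / (1 - norm t)\<close> is cancelled by the
        error of that order in \<open>cnj (J t)\<close>, and the small factor \<open>e'\<close>
        survives.\<close>
      have "norm (f1 ?z) \<le> e' / d"
      proof (rule bianalytic_coefficient_bound[OF hol open_E d])
        show "cball ?z d \<subseteq> E" using ball by (auto simp: dist_norm norm_minus_commute)
        show "norm (f0 w + cnj w * f1 w) \<le> e'" if "norm (w - ?z) = d" for w
          using ball[of w] that \<eta>(2) by (simp add: less_imp_le)
      qed
      moreover have "norm (cnj ?z - (1 / t + cnj \<kappa> * t)) \<le> 2 * (1 + k) * (1 - ?r) / a"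
        using cnj_J[of a t] ar a0 t by simp
      ultimately have "norm (cnj ?z - (1 / t + cnj \<kappa> * t)) * norm (f1 ?z) \<le> (2 * (1 + k) * (1 - ?r) / a) * (e' / d)"
        using k(2,3) t a0 by (intro mult_mono) auto
      also have "\<dots> = e' * (2 * (1 + k) / (a * c))" using t a0 c by (simp add: d_def field_simps)
      finally have b: "norm ((cnj ?z - (1 / t + cnj \<kappa> * t)) * f1 ?z) \<le> e' * (2 * (1 + k) / (a * c))"
        by (simp add: norm_mult)
      have "?G t = (f0 ?z + cnj ?z * f1 ?z) - (cnj ?z - (1 / t + cnj \<kappa> * t)) * f1 ?z" by (simp add: algebra_simps)
      then have "norm (?G t) \<le> norm (f0 ?z + cnj ?z * f1 ?z) + norm ((cnj ?z - (1 / t + cnj \<kappa> * t)) * f1 ?z)"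
        by (metis norm_triangle_ineq4)
      also have "\<dots> < e' + e' * (2 * (1 + k) / (a * c))" using zE b by linarith
      also have "\<dots> = e' * (1 + 2 * (1 + k) / (a * c))" by (simp add: algebra_simps)
      also have "\<dots> = e" using dpos by (simp add: e'_def)
      finally show ?thesis .
    qed
    then show "\<exists>\<rho><1. \<forall>t. \<rho> < norm t \<and> norm t < 1 \<longrightarrow> norm (?G t) < e" using \<rho> by blast
  qed (use a a0 t0 in auto)
qed

theorem bianalytic_unique:
  assumes hol: "f0 holomorphic_on E" "f1 holomorphic_on E"
    and lim: "\<And>e. e > 0 \<Longrightarrow> \<exists>\<eta>>0. \<forall>z\<in>E. N z > 1 - k\<^sup>2 - \<eta> \<longrightarrow> norm (f0 z + cnj z * f1 z) < e"
    and z: "z \<in> E"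
  shows "f0 z = 0" "f1 z = 0"
proof -
  have G: "f0 (J t) + (1 / t + cnj \<kappa> * t) * f1 (J t) = 0" if "k < norm t" "norm t < 1" for t
    by (rule functional_equation[OF hol lim that])
  \<comment> \<open>The excluded points are the foci, the images of the fixed points of
    \<open>t \<mapsto> \<kappa> / t\<close>; there the two equations coincide. They form a finite
    set, and continuity of \<open>f1\<close> covers them afterwards.\<close>
  have f1: "f1 z = 0" if z: "z \<in> E" "z\<^sup>2 \<noteq> 4 * \<kappa>" for z
  proof -
    obtain t where t: "z = J t" "k < norm t" "norm t < 1" using in_E_imp_J[OF z(1)] by blast
    have t0: "t \<noteq> 0" using t k by auto
    define s where "s = \<kappa> / t"
    have s: "k < norm s" "norm s < 1"
    proof -
      have n: "norm s = k / norm t" by (simp only: s_def norm_divide k(1))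
      have tp: "norm t > 0" using t0 by simp
      show "k < norm s" unfolding n pos_less_divide_eq[OF tp] using k(2) t(3) by simp
      show "norm s < 1" unfolding n pos_divide_less_eq[OF tp] using t(2) by simp
    qed
    have Js: "J s = J t" using t0 nz by (simp add: J_def s_def)
    have "(1 / t + cnj \<kappa> * t) * f1 z = (1 / s + cnj \<kappa> * s) * f1 z"
    proof -
      have "f0 z + (1 / t + cnj \<kappa> * t) * f1 z = 0" "f0 z + (1 / s + cnj \<kappa> * s) * f1 z = 0"
        using G[OF t(2,3)] G[OF s] unfolding Js t(1)[symmetric] by blast+
      then show ?thesis by (simp add: add_eq_0_iff)
    qed
    moreover have "1 / s + cnj \<kappa> * s = t / \<kappa> + of_real (k\<^sup>2) / t"
      using t0 nz kappa_cnj_kappa by (simp add: s_def field_simps)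
    ultimately have e1: "((1 / t + cnj \<kappa> * t) - (t / \<kappa> + of_real (k\<^sup>2) / t)) * f1 z = 0"
      by (simp only: left_diff_distrib right_minus_eq)
    \<comment> \<open>Factoring the difference of the two coefficients shows that it vanishes only
      where \<open>t ^ 2 = \<kappa>\<close>.\<close>
    have e2: "(1 / t + cnj \<kappa> * t) - (t / \<kappa> + of_real (k\<^sup>2) / t) = of_real (1 - k\<^sup>2) * (\<kappa> - t * t) / (\<kappa> * t)"
    proof -
      have "cnj \<kappa> = of_real (k\<^sup>2) / \<kappa>" using kappa_cnj_kappa nz by (simp add: field_simps)
      then show ?thesis using t0 nz by (simp add: field_simps)
    qed
    have e3: "\<kappa> - t * t \<noteq> 0"
    proof
      assume "\<kappa> - t * t = 0"
      then have kt: "\<kappa> = t * t" by simp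
      have "J t = 2 * t" unfolding J_def using t0 by (simp add: kt)
      then show False using z(2) t(1) kt by (simp add: power2_eq_square)
    qed
    have e4: "of_real (1 - k\<^sup>2) \<noteq> (0::complex)" using k_square_less_1 by (metis less_irrefl of_real_eq_0_iff diff_gt_0_iff_gt)
    have "(1 / t + cnj \<kappa> * t) - (t / \<kappa> + of_real (k\<^sup>2) / t) \<noteq> 0"
      unfolding e2 divide_eq_0_iff mult_eq_0_iff using e3 e4 t0 nz by blast
    then show ?thesis using e1 mult_eq_0_iff by blast
  qed
  have "finite {z. z\<^sup>2 = 4 * \<kappa>}"
    by (rule finite_subset[of _ "{csqrt (4 * \<kappa>), - csqrt (4 * \<kappa>)}"]) (use power2_eq_iff[of _ "csqrt (4 * \<kappa>)"] power2_csqrt[of "4 * \<kappa>"] in auto)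
  then have "{z. z\<^sup>2 = 4 * \<kappa>} \<in> null_sets lebesgue"
    using negligible_finite negligible_iff_null_sets by blast
  from AE_not_in[OF this] have "AE z in lebesgue. z \<in> E \<longrightarrow> f1 z = 0"
    by eventually_elim (use f1 in auto)
  then have *: "f1 z = 0" if "z \<in> E" for z
    by (rule continuous_AE_eq[OF open_E holomorphic_on_imp_continuous_on[OF hol(2)] continuous_on_const _ that])
  show "f1 z = 0" by (rule *[OF z])
  show "f0 z = 0"
  proof -
    obtain t where t: "z = J t" "k < norm t" "norm t < 1" using in_E_imp_J[OF z] by blast
    show ?thesis using G[OF t(2,3)] *[OF z] t(1) by simp
  qed
qed

text \<open>The Dickson polynomials with parameter \<open>\<kappa>\<close>, that is, rescaled
  Chebyshev polynomials; for positive index they are the Faber polynomials of the ellipse. The value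
  2 at index 0 makes the recursion and \<open>T_J\<close> hold without exception.\<close>

fun T :: "nat \<Rightarrow> complex \<Rightarrow> complex" where
  "T 0 z = 2"
| "T (Suc 0) z = z"
| "T (Suc (Suc n)) z = z * T (Suc n) z - \<kappa> * T n z"

lemma holomorphic_T: "T n holomorphic_on UNIV"
  by (induction n rule: induct_nat_012) (auto intro!: holomorphic_intros simp: fun_eq_iff[symmetric] cong: holomorphic_cong)

lemma T_J: "t \<noteq> 0 \<Longrightarrow> T n (J t) = t ^ n + \<kappa> ^ n * (1 / t) ^ n"
proof (induction n rule: induct_nat_012)
  case (ge2 n)
  define s where "s = 1 / t"
  have ts: "t * s = 1" using ge2 by (simp add: s_def)
  have J: "J t = t + \<kappa> * s" by (simp add: J_def s_def)
  have 1: "T (Suc n) (J t) = t ^ Suc n + \<kappa> ^ Suc n * s ^ Suc n" "T n (J t) = t ^ n + \<kappa> ^ n * s ^ n"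
    using ge2.IH[OF ge2.prems] by (simp_all only: s_def)
  have "T (Suc (Suc n)) (J t) = (t + \<kappa> * s) * (t ^ Suc n + \<kappa> ^ Suc n * s ^ Suc n) - \<kappa> * (t ^ n + \<kappa> ^ n * s ^ n)"
    by (simp only: T.simps 1) (simp only: J)
  also have "\<dots> = t ^ Suc (Suc n) + \<kappa> ^ Suc (Suc n) * s ^ Suc (Suc n)
      + (t * s - 1) * (\<kappa> * t ^ n + \<kappa> ^ Suc n * s ^ n)"
    by (simp add: algebra_simps)
  finally show ?case unfolding ts by (simp add: s_def)
qed (auto simp: J_def)

text \<open>The coefficients are asked to be entire, so the function obtained is continuous across
  the curve and no boundary limit has to be discussed.\<close>

definition boundary_solvable :: "(complex \<Rightarrow> complex) \<Rightarrow> bool"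
  where "boundary_solvable g \<longleftrightarrow> (\<exists>f0 f1. f0 holomorphic_on UNIV \<and> f1 holomorphic_on UNIV \<and>
    (\<forall>t. norm t = 1 \<longrightarrow> f0 (J t) + cnj (J t) * f1 (J t) = g t))"

lemma boundary_solvableI:
  "f0 holomorphic_on UNIV \<Longrightarrow> f1 holomorphic_on UNIV \<Longrightarrow>
    (\<And>t. norm t = 1 \<Longrightarrow> f0 (J t) + cnj (J t) * f1 (J t) = g t) \<Longrightarrow> boundary_solvable g"
  unfolding boundary_solvable_def by blast

lemma boundary_solvable_cong: "boundary_solvable g \<Longrightarrow> (\<And>t. norm t = 1 \<Longrightarrow> g t = h t) \<Longrightarrow> boundary_solvable h"
  unfolding boundary_solvable_def by metis

lemma boundary_solvable_add: "boundary_solvable g \<Longrightarrow> boundary_solvable h \<Longrightarrow> boundary_solvable (\<lambda>t. g t + h t)"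
proof -
  assume "boundary_solvable g" "boundary_solvable h"
  then obtain f0 f1 g0 g1 where f: "f0 holomorphic_on UNIV" "f1 holomorphic_on UNIV"
    "\<And>t. norm t = 1 \<Longrightarrow> f0 (J t) + cnj (J t) * f1 (J t) = g t"
    and g: "g0 holomorphic_on UNIV" "g1 holomorphic_on UNIV"
    "\<And>t. norm t = 1 \<Longrightarrow> g0 (J t) + cnj (J t) * g1 (J t) = h t"
    unfolding boundary_solvable_def by blast
  show ?thesis
  proof (rule boundary_solvableI)
    show "(\<lambda>z. f0 z + g0 z) holomorphic_on UNIV" "(\<lambda>z. f1 z + g1 z) holomorphic_on UNIV"
      by (intro holomorphic_intros f g)+
    show "f0 (J t) + g0 (J t) + cnj (J t) * (f1 (J t) + g1 (J t)) = g t + h t" if "norm t = 1" for t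
      unfolding f(3)[OF that, symmetric] g(3)[OF that, symmetric] by (simp add: algebra_simps)
  qed
qed

lemma boundary_solvable_cmult: "boundary_solvable g \<Longrightarrow> boundary_solvable (\<lambda>t. c * g t)"
proof -
  assume "boundary_solvable g"
  then obtain f0 f1 where f: "f0 holomorphic_on UNIV" "f1 holomorphic_on UNIV"
    "\<And>t. norm t = 1 \<Longrightarrow> f0 (J t) + cnj (J t) * f1 (J t) = g t"
    unfolding boundary_solvable_def by blast
  show ?thesis
  proof (rule boundary_solvableI)
    show "(\<lambda>z. c * f0 z) holomorphic_on UNIV" "(\<lambda>z. c * f1 z) holomorphic_on UNIV"
      by (intro holomorphic_intros f)+
    show "c * f0 (J t) + cnj (J t) * (c * f1 (J t)) = c * g t" if "norm t = 1" for t
      unfolding f(3)[OF that, symmetric] by (simp add: algebra_simps)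
  qed
qed

lemma boundary_solvable_sum: "(\<And>i. i \<in> I \<Longrightarrow> boundary_solvable (g i)) \<Longrightarrow> boundary_solvable (\<lambda>t. \<Sum>i\<in>I. g i t)"
proof (induction I rule: infinite_finite_induct)
  case (insert x F)
  then show ?case using boundary_solvable_add[of "g x" "\<lambda>t. \<Sum>i\<in>F. g i t"] by simp
qed (auto intro!: boundary_solvableI[of "\<lambda>z. 0" "\<lambda>z. 0"])

lemma cnj_J_circle:
  assumes "norm t = 1"
  shows "cnj (J t) = 1 / t + cnj \<kappa> * t" "t * (1 / t) = 1"
proof -
  have "t * cnj t = 1" using assms complex_norm_square[of t] by simp
  moreover have t0: "t \<noteq> 0" using assms by auto
  ultimately have "cnj t = 1 / t" by (simp add: field_simps)
  then show "cnj (J t) = 1 / t + cnj \<kappa> * t" using t0 by (simp add: J_def)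
  show "t * (1 / t) = 1" using t0 by simp
qed

text \<open>On the unit circle \<open>cnj z * T (n + 1) z - cnj \<kappa> * T (n + 2) z - T n z\<close> with \<open>z = J t\<close> is
  \<open>\<kappa> ^ n * (1 - k\<^sup>2) * (\<kappa> * (1 / t) ^ (n + 2) - (1 / t) ^ n)\<close>, which gives a two-step recursion.\<close>

lemma boundary_solvable_inverse_power: "boundary_solvable (\<lambda>t. (1 / t) ^ n)"
proof (induction n rule: induct_nat_012)
  case 0
  show ?case by (rule boundary_solvableI[of "\<lambda>z. 1" "\<lambda>z. 0"]) auto
next
  case 1
  let ?c = "complex_of_real (1 - k\<^sup>2)"
  have c0: "?c \<noteq> 0" using k_square_less_1 by (metis less_irrefl of_real_eq_0_iff diff_gt_0_iff_gt)
  show ?case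
  proof (rule boundary_solvableI[of "\<lambda>z. - (cnj \<kappa> / ?c) * z" "\<lambda>z. 1 / ?c"])
    fix t :: complex assume t: "norm t = 1"
    have "- (cnj \<kappa> / ?c) * J t + cnj (J t) * (1 / ?c) = (cnj (J t) - cnj \<kappa> * J t) / ?c"
      by (simp add: diff_divide_distrib)
    also have "cnj (J t) - cnj \<kappa> * J t = (1 / t) * (1 - \<kappa> * cnj \<kappa>)"
      unfolding cnj_J_circle(1)[OF t] by (simp add: J_def algebra_simps)
    also have "\<dots> / ?c = 1 / t" unfolding kappa_cnj_kappa using c0 by simp
    finally show "- (cnj \<kappa> / ?c) * J t + cnj (J t) * (1 / ?c) = (1 / t) ^ Suc 0" by simp
  qed (auto intro!: holomorphic_intros)
next
  case (ge2 n)
  let ?c = "complex_of_real (1 - k\<^sup>2)"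
  have c0: "?c \<noteq> 0" using k_square_less_1 by (metis less_irrefl of_real_eq_0_iff diff_gt_0_iff_gt)
  have kn: "\<kappa> ^ n * ?c \<noteq> 0" using c0 nz by simp
  let ?h = "\<lambda>t. (1 / (\<kappa> ^ n * ?c)) * (cnj (J t) * T (Suc n) (J t) - cnj \<kappa> * T (Suc (Suc n)) (J t) - T n (J t))"
  have h: "boundary_solvable ?h"
  proof (rule boundary_solvable_cmult, rule boundary_solvableI[of "\<lambda>z. - (cnj \<kappa> * T (Suc (Suc n)) z) - T n z" "T (Suc n)"])
    show "(\<lambda>z. - (cnj \<kappa> * T (Suc (Suc n)) z) - T n z) holomorphic_on UNIV"
      by (intro holomorphic_intros holomorphic_T)
  qed (auto intro: holomorphic_T simp del: T.simps)
  \<comment> \<open>By the identity, \<open>?h t + (1 / t) ^ n\<close> is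
    \<open>\<kappa> * (1 / t) ^ (n + 2)\<close> on the circle, so dividing by
    \<open>\<kappa>\<close> advances the exponent by two.\<close>
  have "boundary_solvable (\<lambda>t. (1 / \<kappa>) * (?h t + (1 / t) ^ n))" by (rule boundary_solvable_cmult[OF boundary_solvable_add[OF h ge2.IH(1)]])
  then show ?case
  proof (rule boundary_solvable_cong)
    fix t :: complex assume t: "norm t = 1"
    define s where "s = 1 / t"
    have ts: "t * s = 1" using cnj_J_circle(2)[OF t] by (simp add: s_def)
    have t0: "t \<noteq> 0" using t by auto
    have TT: "T m (J t) = t ^ m + \<kappa> ^ m * s ^ m" for m using T_J[OF t0] by (simp add: s_def)
    have "cnj (J t) * T (Suc n) (J t) - cnj \<kappa> * T (Suc (Suc n)) (J t) - T n (J t) =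
        (s + cnj \<kappa> * t) * (t ^ Suc n + \<kappa> ^ Suc n * s ^ Suc n) - cnj \<kappa> * (t ^ Suc (Suc n) + \<kappa> ^ Suc (Suc n) * s ^ Suc (Suc n))
          - (t ^ n + \<kappa> ^ n * s ^ n)"
      unfolding TT cnj_J_circle(1)[OF t] s_def ..
    also have "\<dots> = \<kappa> ^ n * (1 - \<kappa> * cnj \<kappa>) * (\<kappa> * s ^ Suc (Suc n) - s ^ n)
        + (t * s - 1) * (t ^ n + cnj \<kappa> * \<kappa> ^ Suc n * s ^ n)"
      by (simp add: algebra_simps)
    also have "\<dots> = \<kappa> ^ n * ?c * (\<kappa> * s ^ Suc (Suc n) - s ^ n)"
      unfolding ts kappa_cnj_kappa by simp
    finally have "?h t = \<kappa> * s ^ Suc (Suc n) - s ^ n" using kn by simp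
    then show "(1 / \<kappa>) * (?h t + (1 / t) ^ n) = (1 / t) ^ Suc (Suc n)"
      using nz by (simp add: s_def)
  qed
qed

lemma boundary_solvable_power: "boundary_solvable (\<lambda>t. t ^ n)"
proof -
  have 1: "boundary_solvable (\<lambda>t. T n (J t))"
    by (rule boundary_solvableI[of "T n" "\<lambda>z. 0"]) (auto intro: holomorphic_T)
  have "boundary_solvable (\<lambda>t. T n (J t) + (- (\<kappa> ^ n)) * (1 / t) ^ n)"
    by (rule boundary_solvable_add[OF 1 boundary_solvable_cmult[OF boundary_solvable_inverse_power]])
  then show ?thesis
  proof (rule boundary_solvable_cong)
    fix t :: complex assume "norm t = 1"
    then have "t \<noteq> 0" by auto
    then show "T n (J t) + (- (\<kappa> ^ n)) * (1 / t) ^ n = t ^ n" by (simp add: T_J)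
  qed
qed

text \<open>Solvability for \<open>g\<close> alone does not pass to products. Demanding it for all
  shifts of \<open>g\<close> by powers of \<open>t\<close> gives a property that is preserved by
  multiplication with \<open>c0 + c1 * t + c2 / t\<close>.\<close>

definition robustly_solvable :: "(complex \<Rightarrow> complex) \<Rightarrow> bool"
  where "robustly_solvable g \<longleftrightarrow> (\<forall>m. boundary_solvable (\<lambda>t. g t * t ^ m) \<and> boundary_solvable (\<lambda>t. g t * (1 / t) ^ m))"

lemma robustly_solvable_step:
  assumes "robustly_solvable g"
  shows "robustly_solvable (\<lambda>t. g t * (c0 + c1 * t + c2 * (1 / t)))"
  unfolding robustly_solvable_def
proof (intro allI conjI)
  fix m
  have p: "boundary_solvable (\<lambda>t. g t * t ^ m)" and q: "boundary_solvable (\<lambda>t. g t * (1 / t) ^ m)" for m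
    using assms by (auto simp: robustly_solvable_def)
  have r1: "boundary_solvable (\<lambda>t. g t * (t ^ m * (1 / t)))"
  proof (cases m)
    case 0 then show ?thesis using q[of 1] by simp
  next
    case (Suc n)
    show ?thesis using p[of n] by (rule boundary_solvable_cong) (use Suc in auto)
  qed
  have r2: "boundary_solvable (\<lambda>t. g t * ((1 / t) ^ m * t))"
  proof (cases m)
    case 0 then show ?thesis using p[of 1] by simp
  next
    case (Suc n)
    show ?thesis using q[of n] by (rule boundary_solvable_cong) (use Suc in auto)
  qed
  have "boundary_solvable (\<lambda>t. c0 * (g t * t ^ m) + c1 * (g t * t ^ Suc m) + c2 * (g t * (t ^ m * (1 / t))))"
    by (intro boundary_solvable_add boundary_solvable_cmult p r1)
  then show "boundary_solvable (\<lambda>t. g t * (c0 + c1 * t + c2 * (1 / t)) * t ^ m)"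
    by (rule boundary_solvable_cong) (simp add: algebra_simps)
  have "boundary_solvable (\<lambda>t. c0 * (g t * (1 / t) ^ m) + c1 * (g t * ((1 / t) ^ m * t)) + c2 * (g t * (1 / t) ^ Suc m))"
    by (intro boundary_solvable_add boundary_solvable_cmult q r2)
  then show "boundary_solvable (\<lambda>t. g t * (c0 + c1 * t + c2 * (1 / t)) * (1 / t) ^ m)"
    by (rule boundary_solvable_cong) (simp add: algebra_simps)
qed

text \<open>The two bases are the shape that the real coordinates take on the parametrised ellipse;
  each further factor is one application of \<open>robustly_solvable_step\<close>.\<close>

theorem boundary_solvable_polynomial:
  "boundary_solvable (\<lambda>t. \<Sum>i\<le>M. \<Sum>j\<le>M. C i j * (a0 + a1 * t + a2 * (1 / t)) ^ i * (b0 + b1 * t + b2 * (1 / t)) ^ j)"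
proof -
  let ?X = "\<lambda>t. a0 + a1 * t + a2 * (1 / t)" and ?Y = "\<lambda>t. b0 + b1 * t + b2 * (1 / t)"
  have 0: "robustly_solvable (\<lambda>t. 1)" unfolding robustly_solvable_def using boundary_solvable_power boundary_solvable_inverse_power by simp
  have X: "robustly_solvable (\<lambda>t. ?X t ^ i)" for i
  proof (induction i)
    case (Suc i) then show ?case using robustly_solvable_step[OF Suc, of a0 a1 a2] by (simp add: mult.commute)
  qed (simp add: 0)
  have XY: "robustly_solvable (\<lambda>t. ?X t ^ i * ?Y t ^ j)" for i j
  proof (induction j)
    case (Suc j) then show ?case using robustly_solvable_step[OF Suc, of b0 b1 b2] by (simp add: mult_ac)
  qed (use X[of i] in simp)
  have "boundary_solvable (\<lambda>t. ?X t ^ i * ?Y t ^ j)" for i j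
  proof -
    have "boundary_solvable (\<lambda>t. (?X t ^ i * ?Y t ^ j) * t ^ 0)" using XY[of i j] unfolding robustly_solvable_def by blast
    then show ?thesis by simp
  qed
  then have "boundary_solvable (\<lambda>t. C i j * (?X t ^ i * ?Y t ^ j))" for i j by (rule boundary_solvable_cmult)
  then show ?thesis by (intro boundary_solvable_sum) (simp add: mult.assoc)
qed

end

section \<open>Elliptic conics\<close>

definition quad :: "real \<Rightarrow> real \<Rightarrow> real \<Rightarrow> complex \<Rightarrow> real"
  where "quad a b c v = a * (Re v)\<^sup>2 + b * Re v * Im v + c * (Im v)\<^sup>2"

definition conic_poly :: "real \<Rightarrow> real \<Rightarrow> real \<Rightarrow> real \<Rightarrow> real \<Rightarrow> real \<Rightarrow> complex \<Rightarrow> real"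
  where "conic_poly a b c d e f z = quad a b c z + d * Re z + e * Im z + f"

lemma conic_eq: "conic a b c d e f = {z. conic_poly a b c d e f z = 0}"
  by (simp add: conic_def conic_poly_def quad_def)

lemma conic_poly_minus: "conic_poly (-a) (-b) (-c) (-d) (-e) (-f) z = - conic_poly a b c d e f z"
  and quad_minus: "quad (-a) (-b) (-c) z = - quad a b c z"
  by (simp_all add: conic_poly_def quad_def)

lemma conic_minus: "conic (-a) (-b) (-c) (-d) (-e) (-f) = conic a b c d e f"
  by (simp add: conic_eq conic_poly_minus)

text \<open>The polynomial stays positive along one of the two rays from \<open>z\<close> in the directions \<open>\<plusminus>v\<close>.\<close>

lemma not_inside_positive:
  assumes v: "v \<noteq> 0" "quad a b c v \<ge> 0" and z: "conic_poly a b c d e f z > 0"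
  shows "z \<notin> inside (conic a b c d e f)"
proof
  let ?Q = "conic_poly a b c d e f" and ?S = "conic a b c d e f"
  assume "z \<in> inside ?S"
  then have bd: "bounded (connected_component_set (- ?S) z)" by (simp add: inside_def)
  define l where "l = ?Q (z + v) - ?Q z - quad a b c v"
  have Q: "?Q (z + of_real t * v) = ?Q z + t * l + t\<^sup>2 * quad a b c v" for t
    by (simp add: l_def conic_poly_def quad_def algebra_simps power2_eq_square)
  define u where "u = (if l \<ge> 0 then v else - v)"
  have pos: "?Q (z + of_real t * u) > 0" if "t \<ge> 0" for t
  proof (cases "l \<ge> 0")
    case True
    then have "0 \<le> t * l" "0 \<le> t\<^sup>2 * quad a b c v" using that v by auto
    then show ?thesis using Q[of t] z True by (simp add: u_def)
  next
    case False
    then have "0 \<le> (-t) * l" "0 \<le> t\<^sup>2 * quad a b c v" using that v by (auto simp: mult_nonneg_nonpos)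
    then show ?thesis using Q[of "-t"] z False by (simp add: u_def)
  qed
  have u0: "u \<noteq> 0" using v by (simp add: u_def)
  define R where "R = (\<lambda>t. z + of_real t * u) ` {0..}"
  have "connected R" unfolding R_def
    by (intro connected_continuous_image continuous_intros) simp
  moreover have "z \<in> R" unfolding R_def by (rule image_eqI[of _ _ 0]) auto
  moreover have "R \<subseteq> - ?S" using pos unfolding R_def conic_eq by fastforce
  ultimately have "R \<subseteq> connected_component_set (- ?S) z" by (intro connected_component_maximal)
  then have "bounded R" using bd bounded_subset by blast
  then obtain B where B: "\<And>w. w \<in> R \<Longrightarrow> norm w \<le> B" by (auto simp: bounded_iff)
  define t where "t = (\<bar>B\<bar> + norm z + 1) / norm u"
  have t: "t \<ge> 0" unfolding t_def by (intro divide_nonneg_nonneg) auto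
  then have "norm (z + of_real t * u) \<le> B" by (intro B) (auto simp: R_def)
  moreover have "norm (of_real t * u) = \<bar>B\<bar> + norm z + 1"
  proof -
    have "norm (of_real t * u) = t * norm u" using t by (simp add: norm_mult)
    then show ?thesis using u0 by (simp add: t_def)
  qed
  moreover have "norm (of_real t * u) \<le> norm (z + of_real t * u) + norm z"
    using norm_triangle_ineq4[of "z + of_real t * u" z] by simp
  ultimately show False by linarith
qed

lemma not_inside_negative:
  assumes "v \<noteq> 0" "quad a b c v \<le> 0" "conic_poly a b c d e f z < 0"
  shows "z \<notin> inside (conic a b c d e f)"
  using not_inside_positive[of v "-a" "-b" "-c" "-d" "-e" "-f" z] assms
  by (simp add: conic_minus conic_poly_minus quad_minus)

text \<open>If the discriminant is not positive, the quadratic part is nonnegative in one direction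
  and nonpositive in another. Then every point off the conic, whatever the sign of the polynomial
  there, can be joined to infinity without crossing the conic.\<close>

lemma elliptic_discriminant:
  assumes "inside (conic a b c d e f) \<noteq> {}"
  shows "4 * a * c - b\<^sup>2 > 0"
proof (rule ccontr)
  assume n: "\<not> 4 * a * c - b\<^sup>2 > 0"
  have q1: "quad a b c 1 = a" "quad a b c \<i> = c" by (simp_all add: quad_def)
  \<comment> \<open>The vector \<open>(-b, 2 * a)\<close> is conjugate to \<open>(1, 0)\<close> for
    the quadratic form; its value is \<open>a\<close> times the discriminant, so its sign is
    opposite to that of \<open>a\<close>, or zero.\<close>
  have q2: "quad a b c (Complex (-b) (2 * a)) = a * (4 * a * c - b\<^sup>2)"
    by (simp add: quad_def power2_eq_square algebra_simps)
  have "\<exists>v w. v \<noteq> 0 \<and> w \<noteq> 0 \<and> quad a b c v \<ge> 0 \<and> quad a b c w \<le> 0"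
  proof (cases "a = 0")
    case True
    then show ?thesis using q1 by (intro exI[of _ 1] exI[of _ 1]) auto
  next
    case False
    then have w: "Complex (-b) (2 * a) \<noteq> 0" by (simp add: complex_eq_iff)
    show ?thesis
    proof (cases "a > 0")
      case True
      then have "a * (4 * a * c - b\<^sup>2) \<le> 0" using n by (intro mult_nonneg_nonpos) auto
      then show ?thesis using w q1 q2 True by (intro exI[of _ 1] exI[of _ "Complex (-b) (2 * a)"]) auto
    next
      case neg: False
      then have "a * (4 * a * c - b\<^sup>2) \<ge> 0" using n by (intro mult_nonpos_nonpos) auto
      then show ?thesis using w q1 q2 neg by (intro exI[of _ "Complex (-b) (2 * a)"] exI[of _ 1]) auto
    qed
  qed
  then obtain v w where vw: "v \<noteq> 0" "w \<noteq> 0" "quad a b c v \<ge> 0" "quad a b c w \<le> 0" by blast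
  obtain z where z: "z \<in> inside (conic a b c d e f)" using assms by blast
  then have "z \<notin> conic a b c d e f" using inside_no_overlap by blast
  then have "conic_poly a b c d e f z \<noteq> 0" by (simp add: conic_eq)
  then consider "conic_poly a b c d e f z > 0" | "conic_poly a b c d e f z < 0" by linarith
  then show False
    using not_inside_positive[OF vw(1,3)] not_inside_negative[OF vw(2,4)] z by cases blast+
qed

context ellipse
begin

lemma N_scale: "t \<ge> 0 \<Longrightarrow> N (of_real t * z) = t * N z"
proof -
  assume t: "t \<ge> 0"
  have "of_real t * z - \<kappa> * cnj (of_real t * z) = of_real t * (z - \<kappa> * cnj z)" by (simp add: algebra_simps)
  then show ?thesis unfolding N_def using t by (simp add: norm_mult)
qed

lemma norm_le_N: "(1 - k) * norm z \<le> N z"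
proof -
  have "norm z - norm (\<kappa> * cnj z) \<le> N z" unfolding N_def by (rule norm_triangle_ineq2)
  then show ?thesis using k(1) by (simp add: norm_mult algebra_simps)
qed

end

text \<open>The cross term \<open>Re (\<gamma> * z ^ 2)\<close> is how a trace-free quadratic form
  looks in complex notation.\<close>

lemma norm_reflected_sum:
  "(norm (of_real p * z + of_real r * (cnj \<gamma> * cnj z)))\<^sup>2 =
    p\<^sup>2 * (norm z)\<^sup>2 + r\<^sup>2 * (norm \<gamma>)\<^sup>2 * (norm z)\<^sup>2 + 2 * p * r * Re (\<gamma> * z\<^sup>2)"
  unfolding cmod_power2 by (simp add: power2_eq_square algebra_simps)

text \<open>The form is \<open>s * norm z ^ 2 + Re (\<gamma> * z ^ 2)\<close> with \<open>s\<close>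
  half the trace and eigenvalues \<open>s + g\<close> and \<open>s - g\<close>, where
  \<open>g = norm \<gamma>\<close>. Matching it with
  \<open>(norm (p * z - p * \<kappa> * cnj z)) ^ 2\<close> requires \<open>p ^ 2 + m ^ 2 = s\<close>
  and \<open>2 * p * m = g\<close> for \<open>m = p * norm \<kappa>\<close>, hence the half sum and
  half difference of the roots of the eigenvalues.\<close>

lemma ellipse_quad:
  assumes a: "a > 0" and disc: "4 * a * c - b\<^sup>2 > 0" and nc: "\<not> (a = c \<and> b = 0)"
  obtains \<kappa> k p where "ellipse \<kappa> k" "p > 0" "\<And>z. quad a b c z = (p * ellipse.N \<kappa> z)\<^sup>2"
proof -
  define s where "s = (a + c) / 2"
  define \<gamma> where "\<gamma> = Complex ((a - c) / 2) (- b / 2)"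
  define g where "g = norm \<gamma>"
  have "4 * a * c > 0" using disc by (smt (verit) zero_le_power2)
  then have c: "c > 0" using a by (simp add: zero_less_mult_iff)
  have g2: "g\<^sup>2 = ((a - c) / 2)\<^sup>2 + (b / 2)\<^sup>2" by (simp add: g_def \<gamma>_def cmod_power2)
  have "g\<^sup>2 < s\<^sup>2" unfolding g2 s_def using disc by (simp add: power2_eq_square field_simps)
  then have gs: "g < s" by (rule power2_less_imp_less) (use a c in \<open>simp add: s_def\<close>)
  have g0: "g > 0" using nc by (auto simp: g_def \<gamma>_def complex_eq_iff)
  define p where "p = (sqrt (s + g) + sqrt (s - g)) / 2"
  define m where "m = (sqrt (s + g) - sqrt (s - g)) / 2"
  have s1: "sqrt (s + g) > sqrt (s - g)" "sqrt (s - g) > 0" using gs g0 by auto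
  have "0 < (x + y) / 2 \<and> 0 < (x - y) / 2 \<and> (x - y) / 2 < (x + y) / 2" if "y < x" "0 < y" for x y :: real
    using that by (simp add: field_simps)
  from this[OF s1] have pm: "p > 0" "m > 0" "m < p" unfolding p_def m_def by blast+
  have sq: "(sqrt (s + g))\<^sup>2 = s + g" "(sqrt (s - g))\<^sup>2 = s - g" using gs g0 by auto
  have p2: "p\<^sup>2 + m\<^sup>2 = s" "2 * p * m = g"
    using sq by (simp_all add: p_def m_def power2_eq_square field_simps)
  \<comment> \<open>The modulus is \<open>m / p\<close>; the argument is chosen so that the cross
    term becomes \<open>Re (\<gamma> * z ^ 2)\<close>.\<close>
  define \<kappa> where "\<kappa> = of_real (m / p) * (- cnj \<gamma> / of_real g)"
  have nk: "norm \<kappa> = m / p"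
    using pm g0 by (simp add: \<kappa>_def norm_mult norm_divide g_def)
  have el: "ellipse \<kappa> (m / p)" using nk pm by (simp add: ellipse_def)
  have "quad a b c z = (p * ellipse.N \<kappa> z)\<^sup>2" for z
  proof -
    have pk: "of_real p * \<kappa> = of_real (m / g) * (- cnj \<gamma>)" using pm g0 by (simp add: \<kappa>_def)
    have "(p * ellipse.N \<kappa> z)\<^sup>2 = (norm (of_real p * (z - \<kappa> * cnj z)))\<^sup>2"
      unfolding ellipse.N_def[OF el] using pm by (simp add: norm_mult power_mult_distrib)
    also have "of_real p * (z - \<kappa> * cnj z) = of_real p * z - (of_real p * \<kappa>) * cnj z" by (simp add: algebra_simps)
    also have "\<dots> = of_real p * z + of_real (m / g) * (cnj \<gamma> * cnj z)" unfolding pk by simp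
    also have "(norm \<dots>)\<^sup>2 = p\<^sup>2 * (norm z)\<^sup>2 + (m / g)\<^sup>2 * (norm \<gamma>)\<^sup>2 * (norm z)\<^sup>2 + 2 * p * (m / g) * Re (\<gamma> * z\<^sup>2)"
      by (rule norm_reflected_sum)
    also have "(m / g)\<^sup>2 * (norm \<gamma>)\<^sup>2 = m\<^sup>2" using g0 by (simp add: g_def power_divide)
    also have "2 * p * (m / g) = 1" using p2(2) g0 by (simp add: field_simps)
    also have "p\<^sup>2 * (norm z)\<^sup>2 + m\<^sup>2 * (norm z)\<^sup>2 + 1 * Re (\<gamma> * z\<^sup>2) = s * (norm z)\<^sup>2 + Re (\<gamma> * z\<^sup>2)"
      by (simp add: p2(1)[symmetric] algebra_simps)
    also have "\<dots> = quad a b c z"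
      unfolding cmod_power2 quad_def s_def \<gamma>_def by (simp add: power2_eq_square field_simps)
    finally show ?thesis by simp
  qed
  then show ?thesis using that[OF el pm(1)] by blast
qed

text \<open>Translating to the centre removes the linear terms; the remaining constant is negative
  because the polynomial is negative at every point inside, and a dilation brings it to the level
  \<open>1 - k ^ 2\<close>.\<close>

lemma conic_ellipse_pos:
  assumes a: "a > 0" and ins: "inside (conic a b c d e f) \<noteq> {}" and nc: "\<not> (a = c \<and> b = 0)"
  obtains \<kappa> k \<beta> \<mu> P where "ellipse \<kappa> k" "\<mu> > 0" "P > 0"
    "\<And>z. conic_poly a b c d e f z = P * ((ellipse.N \<kappa> ((z - \<beta>) / of_real \<mu>))\<^sup>2 - (1 - k\<^sup>2)\<^sup>2)"
proof -
  have disc: "4 * a * c - b\<^sup>2 > 0" by (rule elliptic_discriminant[OF ins])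
  obtain \<kappa> k p where el: "ellipse \<kappa> k" and p: "p > 0" and q: "\<And>z. quad a b c z = (p * ellipse.N \<kappa> z)\<^sup>2"
    using ellipse_quad[OF a disc nc] by blast
  \<comment> \<open>Cramer's rule for the critical point of the polynomial.\<close>
  define x0 where "x0 = (b * e - 2 * c * d) / (4 * a * c - b\<^sup>2)"
  define y0 where "y0 = (b * d - 2 * a * e) / (4 * a * c - b\<^sup>2)"
  have c1: "2 * a * x0 + b * y0 + d = 0"
    using disc by (simp add: x0_def y0_def divide_simps) (simp add: power2_eq_square algebra_simps)
  have c2: "b * x0 + 2 * c * y0 + e = 0"
    using disc by (simp add: x0_def y0_def divide_simps) (simp add: power2_eq_square algebra_simps)
  define \<beta> where "\<beta> = Complex x0 y0"
  define h where "h = - conic_poly a b c d e f \<beta>"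
  have Qz: "conic_poly a b c d e f z = quad a b c (z - \<beta>) - h" for z
  proof -
    have "conic_poly a b c d e f z - (quad a b c (z - \<beta>) - h) =
       (Re z - x0) * (2 * a * x0 + b * y0 + d) + (Im z - y0) * (b * x0 + 2 * c * y0 + e)"
      by (simp add: h_def \<beta>_def conic_poly_def quad_def power2_eq_square algebra_simps)
    then show ?thesis unfolding c1 c2 by simp
  qed
  obtain z where z: "z \<in> inside (conic a b c d e f)" using ins by blast
  then have "z \<notin> conic a b c d e f" using inside_no_overlap by blast
  then have "conic_poly a b c d e f z \<noteq> 0" by (simp add: conic_eq)
  moreover have "\<not> conic_poly a b c d e f z > 0"
    using not_inside_positive[of 1 a b c d e f z] z a by (auto simp: quad_def)
  ultimately have "conic_poly a b c d e f z < 0" by linarith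
  then have h: "h > 0" unfolding Qz q using zero_le_power2[of "p * ellipse.N \<kappa> (z - \<beta>)"] by linarith
  have k1: "1 - k\<^sup>2 > 0" using ellipse.k_square_less_1[OF el] by simp
  \<comment> \<open>Makes \<open>p * \<mu> * (1 - k ^ 2)\<close> equal to
    \<open>sqrt h\<close>.\<close>
  define \<mu> where "\<mu> = sqrt h / (p * (1 - k\<^sup>2))"
  have \<mu>: "\<mu> > 0" using h p k1 by (simp add: \<mu>_def)
  have "conic_poly a b c d e f z = (p * \<mu>)\<^sup>2 * ((ellipse.N \<kappa> ((z - \<beta>) / of_real \<mu>))\<^sup>2 - (1 - k\<^sup>2)\<^sup>2)" for z
  proof -
    have N: "ellipse.N \<kappa> (z - \<beta>) = \<mu> * ellipse.N \<kappa> ((z - \<beta>) / of_real \<mu>)"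
      using ellipse.N_scale[OF el, of \<mu> "(z - \<beta>) / of_real \<mu>"] \<mu> by simp
    have "(p * \<mu> * (1 - k\<^sup>2))\<^sup>2 = (sqrt h)\<^sup>2" using p k1 by (simp add: \<mu>_def)
    then have hh: "h = (p * \<mu>)\<^sup>2 * (1 - k\<^sup>2)\<^sup>2" using h by (simp add: power_mult_distrib)
    show ?thesis unfolding Qz q N by (subst hh) (simp add: power_mult_distrib algebra_simps)
  qed
  moreover have "(p * \<mu>)\<^sup>2 > 0" using p \<mu> by simp
  ultimately show ?thesis using that[OF el \<mu>] by blast
qed

locale scaled_ellipse = ellipse +
  fixes \<beta> :: complex and \<mu> :: real
  assumes \<mu>: "\<mu> > 0"
begin

definition M :: "complex \<Rightarrow> real" where "M z = N ((z - \<beta>) / of_real \<mu>)"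

definition D :: "complex set" where "D = {z. M z < 1 - k\<^sup>2}"

definition \<Gamma> :: "complex set" where "\<Gamma> = {z. M z = 1 - k\<^sup>2}"

lemma continuous_M: "continuous_on S M"
  unfolding M_def[abs_def] N_def using \<mu> by (intro continuous_intros) auto

lemma open_D: "open D"
  unfolding D_def by (intro open_Collect_less continuous_M continuous_intros)

lemma compact_sublevel: "compact {z. M z \<le> 1 - k\<^sup>2}"
proof (rule compact_eq_bounded_closed[THEN iffD2], rule conjI)
  show "closed {z. M z \<le> 1 - k\<^sup>2}" by (intro closed_Collect_le continuous_M continuous_intros)
  have "norm z \<le> norm \<beta> + \<mu> * ((1 - k\<^sup>2) / (1 - k))" if "M z \<le> 1 - k\<^sup>2" for z
  proof -
    let ?u = "(z - \<beta>) / of_real \<mu>"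
    have "(1 - k) * norm ?u \<le> 1 - k\<^sup>2" using norm_le_N[of ?u] that by (simp add: M_def)
    moreover have "1 - k > 0" using k(3) by simp
    ultimately have "norm ?u \<le> (1 - k\<^sup>2) / (1 - k)" by (simp only: pos_le_divide_eq mult.commute)
    then have "\<mu> * norm ?u \<le> \<mu> * ((1 - k\<^sup>2) / (1 - k))" using \<mu> by (intro mult_left_mono) auto
    moreover have "z = \<beta> + of_real \<mu> * ?u" using \<mu> by simp
    then have "norm z \<le> norm \<beta> + norm (of_real \<mu> * ?u)" by (metis norm_triangle_ineq)
    moreover have "norm (of_real \<mu> * ?u) = \<mu> * norm ?u" using \<mu> by (simp only: norm_mult norm_of_real abs_of_pos)
    ultimately show ?thesis by linarith
  qed
  then show "bounded {z. M z \<le> 1 - k\<^sup>2}" unfolding bounded_iff by blast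
qed

lemma bounded_D: "bounded D"
  by (rule bounded_subset[OF compact_imp_bounded[OF compact_sublevel]]) (auto simp: D_def)

lemma closure_D: "closure D = {z. M z \<le> 1 - k\<^sup>2}"
proof
  show "closure D \<subseteq> {z. M z \<le> 1 - k\<^sup>2}"
    by (rule closure_minimal[OF _ compact_imp_closed[OF compact_sublevel]]) (auto simp: D_def)
  show "{z. M z \<le> 1 - k\<^sup>2} \<subseteq> closure D"
  proof
    fix z assume "z \<in> {z. M z \<le> 1 - k\<^sup>2}"
    then have z: "M z \<le> 1 - k\<^sup>2" by simp
    \<comment> \<open>Shrinking towards the centre \<open>\<beta>\<close> multiplies
      \<open>M\<close> by a factor smaller than 1, so the sequence lies in \<open>D\<close> even
      when \<open>z\<close> is on the curve.\<close>
    define f where "f n = \<beta> + of_real (1 - 1 / real (Suc n)) * (z - \<beta>)" for n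
    have "f n \<in> D" for n
    proof -
      have t: "0 \<le> 1 - 1 / real (Suc n)" "1 - 1 / real (Suc n) < 1" by simp_all
      have eq: "(f n - \<beta>) / of_real \<mu> = of_real (1 - 1 / real (Suc n)) * ((z - \<beta>) / of_real \<mu>)"
        by (simp only: f_def add_diff_cancel_left' times_divide_eq_right)
      have e: "M (f n) = (1 - 1 / real (Suc n)) * M z" unfolding M_def eq by (rule N_scale[OF t(1)])
      have "(1 - 1 / real (Suc n)) * M z \<le> (1 - 1 / real (Suc n)) * (1 - k\<^sup>2)" using z t by (intro mult_left_mono)
      also have "\<dots> < 1 * (1 - k\<^sup>2)" using t k_square_less_1 by (intro mult_strict_right_mono) auto
      finally show ?thesis using e by (simp add: D_def)
    qed
    moreover have "f \<longlonglongrightarrow> \<beta> + of_real (1 - 0) * (z - \<beta>)"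
      unfolding f_def by (intro tendsto_intros LIMSEQ_Suc[OF lim_1_over_n])
    ultimately show "z \<in> closure D" unfolding closure_sequential by auto
  qed
qed

lemma closure_D_eq: "closure D = D \<union> \<Gamma>"
  by (subst closure_D) (auto simp: D_def \<Gamma>_def)

text \<open>On a component of the complement \<open>M\<close> omits the value
  \<open>1 - k ^ 2\<close>, so by connectedness a component that meets \<open>D\<close> stays in the
  bounded set \<open>D\<close>.\<close>

lemma D_subset_inside: "D \<subseteq> inside \<Gamma>"
proof
  fix z assume z: "z \<in> D"
  let ?C = "connected_component_set (- \<Gamma>) z"
  have zC: "z \<in> ?C" using z by (auto simp: D_def \<Gamma>_def)
  have con: "connected (M ` ?C)" by (intro connected_continuous_image continuous_M connected_connected_component)
  have "?C \<subseteq> D"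
  proof
    fix w assume w: "w \<in> ?C"
    show "w \<in> D"
    proof (rule ccontr)
      assume "w \<notin> D"
      then have "M z \<le> 1 - k\<^sup>2" "1 - k\<^sup>2 \<le> M w" using z by (auto simp: D_def)
      then have "1 - k\<^sup>2 \<in> M ` ?C"
        using connectedD_interval[OF con imageI[OF zC] imageI[OF w]] by blast
      then show False using connected_component_subset[of "- \<Gamma>" z] by (auto simp: \<Gamma>_def)
    qed
  qed
  then show "z \<in> inside \<Gamma>" using z bounded_subset[OF bounded_D]
    by (auto simp: inside_def D_def \<Gamma>_def)
qed

text \<open>The real-linear map \<open>t \<mapsto> t + \<kappa> * cnj t\<close> has the inverse
  \<open>u \<mapsto> (u - \<kappa> * cnj u) / (1 - k ^ 2)\<close>, and on the unit circle it agrees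
  with \<open>J\<close>.\<close>

lemma circle_param:
  assumes "z \<in> \<Gamma>"
  obtains t where "norm t = 1" "z = \<beta> + of_real \<mu> * J t"
proof -
  define u where "u = (z - \<beta>) / of_real \<mu>"
  have z: "z = \<beta> + of_real \<mu> * u" using \<mu> by (simp add: u_def)
  define t where "t = (u - \<kappa> * cnj u) / of_real (1 - k\<^sup>2)"
  have kp: "1 - k\<^sup>2 > 0" using k_square_less_1 by simp
  have "norm (u - \<kappa> * cnj u) = 1 - k\<^sup>2" using assms by (simp add: \<Gamma>_def M_def N_def u_def)
  then have nt: "norm t = 1" using kp unfolding t_def norm_divide norm_of_real by simp
  have "t * cnj t = 1" using nt complex_norm_square[of t] by simp
  moreover have t0: "t \<noteq> 0" using nt by auto
  ultimately have ct: "1 / t = cnj t" by (simp add: field_simps)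
  have "J t = t + \<kappa> * cnj t" using ct by (simp add: J_def divide_inverse)
  also have "\<dots> = ((u - \<kappa> * cnj u) + \<kappa> * (cnj u - cnj \<kappa> * u)) / of_real (1 - k\<^sup>2)"
    unfolding t_def by (simp add: add_divide_distrib)
  also have "(u - \<kappa> * cnj u) + \<kappa> * (cnj u - cnj \<kappa> * u) = u * (1 - \<kappa> * cnj \<kappa>)" by (simp add: algebra_simps)
  also have "\<dots> / of_real (1 - k\<^sup>2) = u"
  proof -
    have "of_real (1 - k\<^sup>2) \<noteq> (0::complex)" using kp by (metis less_irrefl of_real_eq_0_iff)
    then show ?thesis unfolding kappa_cnj_kappa by simp
  qed
  finally show ?thesis using that nt z by simp
qed

end

text \<open>Changing the sign of all coefficients reduces to \<open>a > 0\<close>. A point where the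
  polynomial is positive is joined to infinity by a ray, so the inside lies in \<open>D\<close>; the
  converse is \<open>D_subset_inside\<close>.\<close>

theorem conic_normal_form:
  assumes ins: "inside (conic a b c d e f) \<noteq> {}" and nc: "\<not> (a = c \<and> b = 0)"
  obtains \<kappa> k \<beta> \<mu> where "scaled_ellipse \<kappa> k \<mu>"
    "conic a b c d e f = scaled_ellipse.\<Gamma> \<kappa> k \<beta> \<mu>"
    "inside (conic a b c d e f) = scaled_ellipse.D \<kappa> k \<beta> \<mu>"
proof -
  have pos: thesis if a: "a > 0" and ins: "inside (conic a b c d e f) \<noteq> {}" and nc: "\<not> (a = c \<and> b = 0)"
    and th: "\<And>\<kappa> k \<beta> \<mu>. scaled_ellipse \<kappa> k \<mu> \<Longrightarrow> conic a b c d e f = scaled_ellipse.\<Gamma> \<kappa> k \<beta> \<mu> \<Longrightarrow>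
      inside (conic a b c d e f) = scaled_ellipse.D \<kappa> k \<beta> \<mu> \<Longrightarrow> thesis" for a b c d e f
  proof -
    obtain \<kappa> k \<beta> \<mu> P where el: "ellipse \<kappa> k" "\<mu> > 0" and P: "P > 0"
      "\<And>z. conic_poly a b c d e f z = P * ((ellipse.N \<kappa> ((z - \<beta>) / of_real \<mu>))\<^sup>2 - (1 - k\<^sup>2)\<^sup>2)"
      by (rule conic_ellipse_pos[OF a ins nc]) (erule that, assumption+)
    have se: "scaled_ellipse \<kappa> k \<mu>" using el by (simp add: scaled_ellipse_def scaled_ellipse_axioms_def)
    interpret scaled_ellipse \<kappa> k \<beta> \<mu> by (rule se)
    have Q: "conic_poly a b c d e f z = P * ((M z)\<^sup>2 - (1 - k\<^sup>2)\<^sup>2)" for z using P(2) by (simp add: M_def)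
    have M0: "M z \<ge> 0" for z by (simp add: M_def N_def)
    have kp: "1 - k\<^sup>2 > 0" using k_square_less_1 by simp
    have G: "conic a b c d e f = \<Gamma>"
      unfolding conic_eq \<Gamma>_def Q using P(1) M0 kp by (auto simp: power2_eq_iff_nonneg)
    have "inside \<Gamma> \<subseteq> D"
    proof
      fix z assume z: "z \<in> inside \<Gamma>"
      then have "z \<notin> \<Gamma>" using inside_no_overlap by blast
      moreover have "\<not> conic_poly a b c d e f z > 0"
        using not_inside_positive[of 1 a b c d e f z] z a unfolding G by (auto simp: quad_def)
      ultimately have "(M z)\<^sup>2 \<le> (1 - k\<^sup>2)\<^sup>2" "M z \<noteq> 1 - k\<^sup>2" unfolding Q \<Gamma>_def using P(1) by (auto simp: zero_less_mult_iff not_less)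
      then show "z \<in> D" using power2_le_imp_le[of "M z" "1 - k\<^sup>2"] kp by (simp add: D_def)
    qed
    then have "inside \<Gamma> = D" using D_subset_inside by blast
    then show thesis using th[OF se, of \<beta>] G by simp
  qed
  have "4 * a * c - b\<^sup>2 > 0" by (rule elliptic_discriminant[OF ins])
  then have "a \<noteq> 0" using zero_le_power2[of b] by auto
  then consider "a > 0" | "- a > 0" by linarith
  then show ?thesis
  proof cases
    case 1 show ?thesis by (rule pos[OF 1 ins nc that])
  next
    case 2
    have "inside (conic (-a) (-b) (-c) (-d) (-e) (-f)) \<noteq> {}" "\<not> (- a = - c \<and> - b = 0)" using ins nc by (simp_all add: conic_minus)
    from pos[OF 2 this, unfolded conic_minus, OF that] show ?thesis .
  qed
qed

section \<open>The Dirichlet problem in complex components\<close>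

definition complex_vekua :: "complex set \<Rightarrow> (complex \<Rightarrow> complex) \<Rightarrow> (complex \<Rightarrow> complex) \<Rightarrow> (complex \<Rightarrow> complex) \<Rightarrow> bool"
  where "complex_vekua D A w v \<longleftrightarrow> (\<exists>wx wy. has_weak_deriv D 1 w wx \<and> has_weak_deriv D \<i> w wy \<and>
    (AE z in lebesgue. z \<in> D \<longrightarrow> v z = (wx z + \<i> * wy z) / 2 - A z * w z))"

text \<open>The factor makes the derivative with respect to \<open>cnj z\<close> equal to
  \<open>A\<close> itself, where \<open>cauchy_transform\<close> produces
  \<open>- pi * A\<close>.\<close>

definition complex_T :: "complex set \<Rightarrow> (complex \<Rightarrow> complex) \<Rightarrow> complex \<Rightarrow> complex"
  where "complex_T D A z = - cauchy_transform (\<lambda>z. indicator D z * A z) z / of_real pi"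

lemma complex_vekua_diff:
  assumes "complex_vekua D A w v" "complex_vekua D A w' v'" "open D"
  shows "complex_vekua D A (\<lambda>z. w z - w' z) (\<lambda>z. v z - v' z)"
proof -
  obtain wx wy where w: "has_weak_deriv D 1 w wx" "has_weak_deriv D \<i> w wy"
    "AE z in lebesgue. z \<in> D \<longrightarrow> v z = (wx z + \<i> * wy z) / 2 - A z * w z"
    using assms(1) unfolding complex_vekua_def by blast
  obtain wx' wy' where w': "has_weak_deriv D 1 w' wx'" "has_weak_deriv D \<i> w' wy'"
    "AE z in lebesgue. z \<in> D \<longrightarrow> v' z = (wx' z + \<i> * wy' z) / 2 - A z * w' z"
    using assms(2) unfolding complex_vekua_def by blast
  have "AE z in lebesgue. z \<in> D \<longrightarrow> v z - v' z = ((wx z - wx' z) + \<i> * (wy z - wy' z)) / 2 - A z * (w z - w' z)"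
    using w(3) w'(3) by eventually_elim (auto simp: field_simps)
  then show ?thesis
    unfolding complex_vekua_def
    using has_weak_deriv_diff[OF w(1) w'(1) assms(3)] has_weak_deriv_diff[OF w(2) w'(2) assms(3)] by blast
qed

lemma complex_T_C1:
  assumes "open D" "sobolev_subcritical D A"
  obtains T' where "C1_on D (complex_T D A) T'" "AE z in lebesgue. z \<in> D \<longrightarrow> dbar_of T' z = A z"
proof -
  let ?c = "cauchy_transform (\<lambda>z. indicator D z * A z)"
  obtain C' where C: "C1_on D ?c C'" using C1_cauchy_transform_sobolev[OF assms] by blast
  have d: "AE z in lebesgue. z \<in> D \<longrightarrow> dbar_of C' z = - (of_real pi * A z)"
    by (rule dbar_cauchy_transform_sobolev[OF assms C])
  have "bounded_linear (\<lambda>x::complex. - x / of_real pi)"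
    by (intro bounded_linear_divide[THEN bounded_linear_compose] bounded_linear_minus bounded_linear_ident)
  from C1_on_linear[OF C this]
  have "C1_on D (complex_T D A) (\<lambda>z h. - C' z h / of_real pi)" unfolding complex_T_def[abs_def] .
  moreover have "AE z in lebesgue. z \<in> D \<longrightarrow> dbar_of (\<lambda>z h. - C' z h / of_real pi) z = A z"
    using d
  proof eventually_elim
    fix z assume "z \<in> D \<longrightarrow> dbar_of C' z = - (of_real pi * A z)"
    moreover have "dbar_of (\<lambda>z h. - C' z h / of_real pi) z = - dbar_of C' z / of_real pi"
      by (simp add: dbar_of_def field_simps)
    ultimately show "z \<in> D \<longrightarrow> dbar_of (\<lambda>z h. - C' z h / of_real pi) z = A z" by simp
  qed
  ultimately show ?thesis using that by blast
qed

lemma continuous_complex_T: "sobolev_subcritical D A \<Longrightarrow> continuous_on UNIV (complex_T D A)"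
  unfolding complex_T_def[abs_def] sobolev_subcritical_def by (intro continuous_intros continuous_cauchy_transform) auto

lemma exp_C1:
  fixes T :: "complex \<Rightarrow> complex"
  assumes "C1_on D T T'"
  shows "C1_on D (\<lambda>z. exp (c * T z)) (\<lambda>z h. exp (c * T z) * (c * T' z h))"
proof -
  have "C1_on D (\<lambda>z. c * T z) (\<lambda>z h. c * T' z h)"
    by (rule C1_on_linear[OF assms bounded_linear_mult_right])
  moreover have "(exp :: complex \<Rightarrow> complex) holomorphic_on UNIV" by (intro holomorphic_intros)
  ultimately have "C1_on D (\<lambda>z. exp (c * T z)) (\<lambda>z h. deriv exp (c * T z) * (c * T' z h))"
    by (rule C1_on_compose_entire)
  then show ?thesis by (simp add: DERIV_imp_deriv[OF DERIV_exp])
qed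

text \<open>A general right-hand side \<open>v\<close> allows two applications, from
  \<open>w\<close> to \<open>v\<close> and from \<open>v\<close> to 0; together they say that
  \<open>exp (- T) * w\<close> has the second derivative 0 with respect to
  \<open>cnj z\<close>.\<close>

lemma complex_vekua_conjugate:
  assumes D: "open D" and T: "C1_on D T T'" "AE z in lebesgue. z \<in> D \<longrightarrow> dbar_of T' z = A z"
    and w: "complex_vekua D A w v"
  obtains px py where "has_weak_deriv D 1 (\<lambda>z. exp (-1 * T z) * w z) px" "has_weak_deriv D \<i> (\<lambda>z. exp (-1 * T z) * w z) py"
    "AE z in lebesgue. z \<in> D \<longrightarrow> (px z + \<i> * py z) / 2 = exp (-1 * T z) * v z"
proof -
  obtain wx wy where w: "has_weak_deriv D 1 w wx" "has_weak_deriv D \<i> w wy"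
    "AE z in lebesgue. z \<in> D \<longrightarrow> v z = (wx z + \<i> * wy z) / 2 - A z * w z"
    using w unfolding complex_vekua_def by blast
  note E = exp_C1[OF T(1), of "-1"]
  let ?E = "\<lambda>z. exp (-1 * T z)"
  have "AE z in lebesgue. z \<in> D \<longrightarrow> ((?E z * wx z + ?E z * (-1 * T' z 1) * w z) + \<i> * (?E z * wy z + ?E z * (-1 * T' z \<i>) * w z)) / 2 = ?E z * v z"
    using w(3) T(2)
  proof eventually_elim
    fix z assume a: "z \<in> D \<longrightarrow> v z = (wx z + \<i> * wy z) / 2 - A z * w z" "z \<in> D \<longrightarrow> dbar_of T' z = A z"
    have "((?E z * wx z + ?E z * (-1 * T' z 1) * w z) + \<i> * (?E z * wy z + ?E z * (-1 * T' z \<i>) * w z)) / 2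
        = ?E z * ((wx z + \<i> * wy z) / 2 - dbar_of T' z * w z)"
      by (simp add: dbar_of_def field_simps)
    then show "z \<in> D \<longrightarrow> ((?E z * wx z + ?E z * (-1 * T' z 1) * w z) + \<i> * (?E z * wy z + ?E z * (-1 * T' z \<i>) * w z)) / 2 = ?E z * v z"
      using a by simp
  qed
  then show ?thesis by (rule that[OF has_weak_deriv_mult[OF w(1) E D] has_weak_deriv_mult[OF w(2) E D]])
qed

context scaled_ellipse
begin

theorem dirichlet_unique_zero:
  assumes A: "sobolev_subcritical D A" and w: "complex_vekua D A w v" and v: "complex_vekua D A v (\<lambda>z. 0)"
    and c: "continuous_on (closure D) w" and b: "\<And>z. z \<in> \<Gamma> \<Longrightarrow> w z = 0" and z: "z \<in> closure D"
  shows "w z = 0"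
proof (cases "z \<in> \<Gamma>")
  case False
  then have zD: "z \<in> D" using z unfolding closure_D_eq by simp
  let ?T = "complex_T D A"
  obtain T' where T: "C1_on D ?T T'" "AE z in lebesgue. z \<in> D \<longrightarrow> dbar_of T' z = A z"
    using complex_T_C1[OF open_D A] by blast
  let ?E = "\<lambda>z. exp (-1 * ?T z)"
  obtain px py where p: "has_weak_deriv D 1 (\<lambda>z. ?E z * w z) px" "has_weak_deriv D \<i> (\<lambda>z. ?E z * w z) py"
    "AE z in lebesgue. z \<in> D \<longrightarrow> (px z + \<i> * py z) / 2 = ?E z * v z"
    using complex_vekua_conjugate[OF open_D T w] by blast
  obtain qx qy where q: "has_weak_deriv D 1 (\<lambda>z. ?E z * v z) qx" "has_weak_deriv D \<i> (\<lambda>z. ?E z * v z) qy"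
    "AE z in lebesgue. z \<in> D \<longrightarrow> (qx z + \<i> * qy z) / 2 = ?E z * 0"
    using complex_vekua_conjugate[OF open_D T v] by blast
  have q0: "AE z in lebesgue. z \<in> D \<longrightarrow> qx z + \<i> * qy z = 0" using q(3) by eventually_elim auto
  define \<phi> where "\<phi> z = ?E z * w z" for z
  have cT: "continuous_on S ?T" for S using continuous_on_subset[OF continuous_complex_T[OF A]] by blast
  have c\<phi>: "continuous_on (closure D) \<phi>" unfolding \<phi>_def[abs_def] by (intro continuous_intros cT c)
  have c\<phi>D: "continuous_on D \<phi>" using continuous_on_subset[OF c\<phi> closure_subset] .
  obtain F0 F1 where F: "F0 holomorphic_on D" "F1 holomorphic_on D" "\<And>z. z \<in> D \<Longrightarrow> \<phi> z = F0 z + cnj z * F1 z"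
    using weak_bianalytic[OF open_D c\<phi>D[unfolded \<phi>_def[abs_def]] p q(1,2) q0] unfolding \<phi>_def by blast
  let ?m = "\<lambda>u. \<beta> + of_real \<mu> * u"
  have M: "M (?m u) = N u" for u using \<mu> by (simp add: M_def)
  have im: "?m ` E \<subseteq> D" using M by (auto simp: E_def D_def)
  have hm: "?m holomorphic_on E" by (intro holomorphic_intros)
  have F0m: "(\<lambda>u. F0 (?m u)) holomorphic_on E" and F1m: "(\<lambda>u. F1 (?m u)) holomorphic_on E"
    using holomorphic_on_compose_gen[OF hm F(1) im] holomorphic_on_compose_gen[OF hm F(2) im] by (simp_all add: o_def)
  \<comment> \<open>With \<open>z = \<beta> + \<mu> * u\<close> one has
    \<open>cnj z = cnj \<beta> + \<mu> * cnj u\<close>; the constant part of the factor of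
    \<open>F1\<close> is absorbed into \<open>f0\<close>.\<close>
  define f0 where "f0 u = F0 (?m u) + cnj \<beta> * F1 (?m u)" for u
  define f1 where "f1 u = of_real \<mu> * F1 (?m u)" for u
  have hol: "f0 holomorphic_on E" "f1 holomorphic_on E"
    unfolding f0_def[abs_def] f1_def[abs_def] by (intro holomorphic_intros F0m F1m)+
  have eq: "f0 u + cnj u * f1 u = \<phi> (?m u)" if "u \<in> E" for u
  proof -
    have "?m u \<in> D" using im that by blast
    then show ?thesis by (simp add: F(3) f0_def f1_def algebra_simps)
  qed
  \<comment> \<open>The set where \<open>norm (\<phi> z) \<ge> e\<close> is compact and misses the
    curve, so \<open>M\<close> has a maximum below \<open>1 - k ^ 2\<close> on it;
    \<open>\<eta>\<close> is the remaining gap.\<close>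
  have lim: "\<exists>\<eta>>0. \<forall>u\<in>E. N u > 1 - k\<^sup>2 - \<eta> \<longrightarrow> norm (f0 u + cnj u * f1 u) < e" if e: "e > 0" for e
  proof -
    let ?S = "{z \<in> closure D. norm (\<phi> z) \<ge> e}"
    have "closed ?S"
      using continuous_closed_preimage[OF continuous_on_norm[OF c\<phi>] closed_closure, of "{e..}"]
      by (simp add: vimage_def Int_def conj_commute)
    moreover have "bounded ?S" using compact_imp_bounded[OF compact_sublevel] unfolding closure_D
      by (rule bounded_subset) auto
    ultimately have cS: "compact ?S" by (simp add: compact_eq_bounded_closed)
    show ?thesis
    proof (cases "?S = {}")
      case True
      have "norm (f0 u + cnj u * f1 u) < e" if "u \<in> E" for u
        using True eq[OF that] im that closure_subset[of D] by (auto simp: not_le)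
      then show ?thesis by (intro exI[of _ 1]) auto
    next
      case False
      obtain x where x: "x \<in> ?S" "\<And>y. y \<in> ?S \<Longrightarrow> M y \<le> M x"
        using continuous_attains_sup[OF cS False continuous_M] by blast
      have "x \<notin> \<Gamma>" using x(1) b[of x] e by (auto simp: \<phi>_def)
      then have "M x < 1 - k\<^sup>2" using x(1) unfolding closure_D_eq by (auto simp: D_def)
      moreover have "norm (f0 u + cnj u * f1 u) < e" if u: "u \<in> E" "N u > 1 - k\<^sup>2 - (1 - k\<^sup>2 - M x)" for u
      proof (rule ccontr)
        assume "\<not> norm (f0 u + cnj u * f1 u) < e"
        then have "?m u \<in> ?S" using eq[OF u(1)] im u(1) closure_subset[of D] by (auto simp: not_less)
        then show False using x(2)[of "?m u"] M[of u] u(2) by simp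
      qed
      ultimately show ?thesis by (intro exI[of _ "1 - k\<^sup>2 - M x"]) auto
    qed
  qed
  let ?u = "(z - \<beta>) / of_real \<mu>"
  have zu: "?m ?u = z" using \<mu> by simp
  have uE: "?u \<in> E" using zD by (simp add: E_def D_def M_def)
  have "f0 ?u = 0" "f1 ?u = 0" using bianalytic_unique[OF hol lim uE] by auto
  then have "\<phi> z = 0" using eq[OF uE] unfolding zu by simp
  then show ?thesis by (simp add: \<phi>_def)
qed (use b in auto)

theorem dirichlet_exists:
  assumes A: "sobolev_subcritical D A"
    and p: "\<And>z. p z = (\<Sum>i\<le>n. \<Sum>j\<le>n. C i j * of_real (Re z) ^ i * of_real (Im z) ^ j)"
  obtains w v where "continuous_on UNIV w" "complex_vekua D A w v" "complex_vekua D A v (\<lambda>z. 0)"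
    "\<And>z. z \<in> \<Gamma> \<Longrightarrow> w z = exp (complex_T D A z) * p z"
proof -
  \<comment> \<open>The real coordinates of \<open>\<beta> + \<mu> * J t\<close> on the unit circle,
    obtained from half the sum and half the difference with the conjugate, where
    \<open>cnj (J t) = 1 / t + cnj \<kappa> * t\<close>.\<close>
  let ?X = "\<lambda>t. of_real (Re \<beta>) + (of_real \<mu> * (1 + cnj \<kappa>) / 2) * t + (of_real \<mu> * (\<kappa> + 1) / 2) * (1 / t)"
  let ?Y = "\<lambda>t. of_real (Im \<beta>) + (of_real \<mu> * (1 - cnj \<kappa>) / (2 * \<i>)) * t + (of_real \<mu> * (\<kappa> - 1) / (2 * \<i>)) * (1 / t)"
  let ?m = "\<lambda>u. \<beta> + of_real \<mu> * u"
  have "boundary_solvable (\<lambda>t. \<Sum>i\<le>n. \<Sum>j\<le>n. C i j * ?X t ^ i * ?Y t ^ j)" by (rule boundary_solvable_polynomial)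
  then obtain f0 f1 where f: "f0 holomorphic_on UNIV" "f1 holomorphic_on UNIV"
    "\<And>t. norm t = 1 \<Longrightarrow> f0 (J t) + cnj (J t) * f1 (J t) = (\<Sum>i\<le>n. \<Sum>j\<le>n. C i j * ?X t ^ i * ?Y t ^ j)"
    unfolding boundary_solvable_def by blast
  have XY: "of_real (Re (?m (J t))) = ?X t" "of_real (Im (?m (J t))) = ?Y t" if t: "norm t = 1" for t
  proof -
    have c: "cnj (?m (J t)) = cnj \<beta> + of_real \<mu> * (1 / t + cnj \<kappa> * t)" using cnj_J_circle(1)[OF t] by simp
    have "of_real (Re w) = (w + cnj w) / 2" "of_real (Im w) = (w - cnj w) / (2 * \<i>)" for w
      by (simp_all add: complex_eq_iff)
    then have r: "of_real (Re (?m (J t))) = (?m (J t) + cnj (?m (J t))) / 2"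
      "of_real (Im (?m (J t))) = (?m (J t) - cnj (?m (J t))) / (2 * \<i>)"
      "of_real (Re \<beta>) = (\<beta> + cnj \<beta>) / 2" "of_real (Im \<beta>) = (\<beta> - cnj \<beta>) / (2 * \<i>)" by blast+
    define s where "s = 1 / t"
    have J: "J t = t + \<kappa> * s" by (simp add: J_def s_def)
    show "of_real (Re (?m (J t))) = ?X t"
    proof -
      have "(\<beta> + m * (t + \<kappa> * s) + (b' + m * (s + k' * t))) / 2 = (\<beta> + b') / 2 + (m * (1 + k') / 2) * t + (m * (\<kappa> + 1) / 2) * s"
        for m b' k' by (simp add: field_simps)
      then show ?thesis unfolding r unfolding c unfolding J s_def[symmetric] .
    qed
    show "of_real (Im (?m (J t))) = ?Y t"
    proof -
      have "(\<beta> + m * (t + \<kappa> * s) - (b' + m * (s + k' * t))) / q = (\<beta> - b') / q + (m * (1 - k') / q) * t + (m * (\<kappa> - 1) / q) * s"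
        for m b' k' q by (simp add: diff_divide_distrib add_divide_distrib algebra_simps)
      then show ?thesis unfolding r unfolding c unfolding J s_def[symmetric] .
    qed
  qed
  let ?u = "\<lambda>z. (z - \<beta>) / of_real \<mu>"
  \<comment> \<open>\<open>F0\<close> and \<open>F1\<close> undo the affine change of variable:
    \<open>cnj ?u\<close> is \<open>(cnj z - cnj \<beta>) / \<mu>\<close>.\<close>
  define F1 where "F1 z = f1 (?u z) / of_real \<mu>" for z
  define F0 where "F0 z = f0 (?u z) - cnj \<beta> * F1 z" for z
  have "?u holomorphic_on UNIV" using \<mu> by (intro holomorphic_intros) auto
  then have hu: "(\<lambda>z. f0 (?u z)) holomorphic_on UNIV" "(\<lambda>z. f1 (?u z)) holomorphic_on UNIV"
    using holomorphic_on_compose_gen[OF _ f(1), of ?u UNIV] holomorphic_on_compose_gen[OF _ f(2), of ?u UNIV]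
    by (simp_all add: o_def)
  have hF1: "F1 holomorphic_on UNIV" unfolding F1_def[abs_def] using \<mu> by (intro holomorphic_intros hu) auto
  have hF0: "F0 holomorphic_on UNIV" unfolding F0_def[abs_def] by (intro holomorphic_intros hu hF1)
  define \<phi> where "\<phi> z = F0 z + cnj z * F1 z" for z
  have \<phi>\<Gamma>: "\<phi> z = p z" if z: "z \<in> \<Gamma>" for z
  proof -
    obtain t where t: "norm t = 1" "z = ?m (J t)" using circle_param[OF z] by blast
    have u: "?u z = J t" unfolding t(2) using \<mu> by simp
    have "\<phi> z = f0 (J t) + (cnj z - cnj \<beta>) * (f1 (J t) / of_real \<mu>)" unfolding \<phi>_def F0_def F1_def u by (simp add: algebra_simps diff_divide_distrib)
    also have "cnj z - cnj \<beta> = of_real \<mu> * cnj (J t)" unfolding t(2) by simp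
    also have "f0 (J t) + of_real \<mu> * cnj (J t) * (f1 (J t) / of_real \<mu>) = f0 (J t) + cnj (J t) * f1 (J t)" using \<mu> by simp
    also have "\<dots> = p z" unfolding f(3)[OF t(1)] p unfolding t(2) XY[OF t(1)] ..
    finally show ?thesis .
  qed
  obtain \<phi>' where \<phi>: "C1_on UNIV \<phi> \<phi>'" "\<And>z. dbar_of \<phi>' z = F1 z"
    using C1_on_bianalytic[OF hF0 hF1 open_UNIV] unfolding \<phi>_def[abs_def] by blast
  \<comment> \<open>The holomorphic \<open>F1\<close> is read as a bianalytic function with second
    coefficient 0, so that \<open>cv\<close> also covers the second application of the
    operator.\<close>
  obtain F1' where F1': "C1_on UNIV (\<lambda>z. F1 z + cnj z * 0) F1'" "\<And>z. dbar_of F1' z = 0"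
    using C1_on_bianalytic[OF hF1 holomorphic_on_const[of 0] open_UNIV] by blast
  let ?T = "complex_T D A"
  obtain T' where T: "C1_on D ?T T'" "AE z in lebesgue. z \<in> D \<longrightarrow> dbar_of T' z = A z"
    using complex_T_C1[OF open_D A] by blast
  note E = exp_C1[OF T(1), of 1]
  let ?E = "\<lambda>z. exp (1 * ?T z)"
  \<comment> \<open>The derivative of \<open>exp T * g\<close> is \<open>exp T\<close> times the
    derivative of \<open>g\<close> plus \<open>A * exp T * g\<close>, and the operator subtracts the
    last term. So it acts on \<open>exp T * g\<close> as plain differentiation of
    \<open>g\<close>.\<close>
  have cv: "complex_vekua D A (\<lambda>z. ?E z * g z) (\<lambda>z. ?E z * h z)" if g: "C1_on UNIV g g'" "\<And>z. dbar_of g' z = h z" for g g' h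
  proof -
    have P: "C1_on D (\<lambda>z. ?E z * g z) (\<lambda>z h. ?E z * g' z h + ?E z * (1 * T' z h) * g z)"
      (is "C1_on _ _ ?P'")
      by (rule C1_on_mult[OF E C1_on_subset[OF g(1)]]) simp
    have "AE z in lebesgue. z \<in> D \<longrightarrow> ?E z * h z = (?P' z 1 + \<i> * ?P' z \<i>) / 2 - A z * (?E z * g z)"
      using T(2)
    proof eventually_elim
      fix z assume a: "z \<in> D \<longrightarrow> dbar_of T' z = A z"
      have eq: "(?P' z 1 + \<i> * ?P' z \<i>) / 2 = ?E z * dbar_of g' z + ?E z * dbar_of T' z * g z"
        by (simp add: dbar_of_def field_simps)
      show "z \<in> D \<longrightarrow> ?E z * h z = (?P' z 1 + \<i> * ?P' z \<i>) / 2 - A z * (?E z * g z)"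
        unfolding eq g(2) using a by (auto simp: algebra_simps)
    qed
    then show ?thesis unfolding complex_vekua_def
      using C1_on_imp_has_weak_deriv[OF P open_D, of 1] C1_on_imp_has_weak_deriv[OF P open_D, of \<i>] by blast
  qed
  show ?thesis
  proof (rule that)
    show "continuous_on UNIV (\<lambda>z. ?E z * \<phi> z)"
      by (intro continuous_intros continuous_complex_T[OF A] C1_on_imp_continuous_on[OF \<phi>(1)])
    show "complex_vekua D A (\<lambda>z. ?E z * \<phi> z) (\<lambda>z. ?E z * F1 z)" by (rule cv[OF \<phi>])
    show "complex_vekua D A (\<lambda>z. ?E z * F1 z) (\<lambda>z. 0)" using cv[OF F1'] by simp
    show "?E z * \<phi> z = exp (?T z) * p z" if "z \<in> \<Gamma>" for z using \<phi>\<Gamma>[OF that] by simp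
  qed
qed

end

section \<open>Bicomplex components\<close>

text \<open>The conjugate of the plus component and the minus component both carry \<open>bc_j\<close> to \<open>\<i>\<close>, so that the
  bicomplex problem becomes the same complex problem in either component.\<close>

definition bc_hom :: "(bicomplex \<Rightarrow> complex) \<Rightarrow> bool"
  where "bc_hom U \<longleftrightarrow> bounded_linear U \<and> (\<forall>v w. U (v * w) = U v * U w) \<and> U 1 = 1 \<and> U bc_j = \<i>"

definition bc_plus_cnj :: "bicomplex \<Rightarrow> complex"
  where "bc_plus_cnj w = cnj (bc_plus w)"

definition bc_pair :: "complex \<Rightarrow> complex \<Rightarrow> bicomplex"
  where "bc_pair u v = idem_plus * bc_of_complex (cnj u) + idem_minus * bc_of_complex v"

lemma bc_hom_components: "bc_hom bc_plus_cnj" "bc_hom bc_minus"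
proof -
  have "linear bc_plus_cnj" "linear bc_minus"
    by (rule linearI; simp add: bc_plus_cnj_def bc_plus_def bc_minus_def algebra_simps)+
  then have "bounded_linear bc_plus_cnj" "bounded_linear bc_minus"
    by (simp_all add: linear_conv_bounded_linear)
  then show "bc_hom bc_plus_cnj" "bc_hom bc_minus"
    by (simp_all add: bc_hom_def bc_plus_cnj_def bc_plus_def bc_minus_def bc_j_def algebra_simps)
qed

lemma bc_pair_components:
  "bc_plus_cnj (bc_pair u v) = u" "bc_minus (bc_pair u v) = v"
  by (simp_all add: bc_plus_cnj_def bc_pair_def idempotent_components)

lemma bicomplex_eqI:
  assumes "bc_plus_cnj v = bc_plus_cnj w" "bc_minus v = bc_minus w"
  shows "v = w"
proof -
  have "bc_plus v = bc_plus w" using assms(1) by (simp add: bc_plus_cnj_def)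
  then show ?thesis using assms(2) idempotent_decomposition[of v] idempotent_decomposition[of w] by simp
qed

lemma bounded_linear_bc_pair: "bounded_linear (\<lambda>u. bc_pair u 0)" "bounded_linear (\<lambda>v. bc_pair 0 v)"
proof -
  have "linear (\<lambda>u. bc_pair u 0)" "linear (\<lambda>v. bc_pair 0 v)"
    by (rule linearI; simp add: bc_pair_def bicomplex_eq_iff bc_of_complex_def idem_plus_def idem_minus_def bc_j_def algebra_simps)+
  then show "bounded_linear (\<lambda>u. bc_pair u 0)" "bounded_linear (\<lambda>v. bc_pair 0 v)"
    by (simp_all add: linear_conv_bounded_linear)
qed

lemma bc_pair_add: "bc_pair u v = bc_pair u 0 + bc_pair 0 v"
  by (simp add: bc_pair_def bicomplex_eq_iff bc_of_complex_def)

lemma has_weak_deriv_bc_pair: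
  assumes "has_weak_deriv D e f f'" "has_weak_deriv D e g g'" "open D"
  shows "has_weak_deriv D e (\<lambda>z. bc_pair (f z) (g z)) (\<lambda>z. bc_pair (f' z) (g' z))"
proof -
  have "has_weak_deriv D e (\<lambda>z. bc_pair (f z) 0 + bc_pair 0 (g z)) (\<lambda>z. bc_pair (f' z) 0 + bc_pair 0 (g' z))"
    by (rule has_weak_deriv_add[OF has_weak_deriv_linear[OF assms(1) bounded_linear_bc_pair(1) assms(3)]
          has_weak_deriv_linear[OF assms(2) bounded_linear_bc_pair(2) assms(3)] assms(3)])
  then show ?thesis by (simp only: bc_pair_add[symmetric])
qed

lemma continuous_on_bc_pair:
  assumes "continuous_on S f" "continuous_on S g"
  shows "continuous_on S (\<lambda>z. bc_pair (f z) (g z))"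
proof -
  have "continuous_on S (\<lambda>z. bc_pair (f z) 0 + bc_pair 0 (g z))"
    by (intro continuous_on_add bounded_linear.continuous_on[OF bounded_linear_bc_pair(1)]
        bounded_linear.continuous_on[OF bounded_linear_bc_pair(2)] assms)
  then show ?thesis by (simp only: bc_pair_add[symmetric])
qed

lemma bc_hom_simps:
  assumes "bc_hom U"
  shows "U (v + w) = U v + U w" "U (v - w) = U v - U w" "U (v * w) = U v * U w"
    "U (r *\<^sub>R v) = r *\<^sub>R U v" "U bc_j = \<i>" "U 0 = 0" "U (of_real r) = of_real r" "U (v ^ n) = U v ^ n"
    "U (sum f I) = (\<Sum>i\<in>I. U (f i))"
proof -
  interpret bounded_linear U using assms by (simp add: bc_hom_def)
  show "U (v + w) = U v + U w" "U (v - w) = U v - U w" "U (r *\<^sub>R v) = r *\<^sub>R U v" "U 0 = 0"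
    "U (sum f I) = (\<Sum>i\<in>I. U (f i))"
    by (simp_all add: add diff scaleR sum)
  show m: "U (v * w) = U v * U w" for v w using assms by (simp add: bc_hom_def)
  show "U bc_j = \<i>" using assms by (simp add: bc_hom_def)
  have 1: "U 1 = 1" using assms by (simp add: bc_hom_def)
  show "U (of_real r) = of_real r" by (simp add: of_real_def scaleR 1)
  show "U (v ^ n) = U v ^ n" by (induction n) (simp_all add: 1 m)
qed

lemma AE_lebesgue_on:
  "D \<in> sets lebesgue \<Longrightarrow> (AE z in lebesgue_on D. P z) \<longleftrightarrow> (AE z in lebesgue. z \<in> D \<longrightarrow> P z)"
  by (rule AE_restrict_space_iff) simp

lemma vekua_op_imp_complex_vekua:
  assumes U: "bc_hom U" and D: "open D" and w: "vekua_op D A w v"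
  shows "complex_vekua D (\<lambda>z. U (A z)) (\<lambda>z. U (w z)) (\<lambda>z. U (v z))"
proof -
  have Dm: "D \<in> sets lebesgue" using D by simp
  have bl: "bounded_linear U" using U by (simp add: bc_hom_def)
  obtain g wx wy where W: "has_weak_deriv D 1 w wx" "has_weak_deriv D \<i> w wy"
    and g: "AE z in lebesgue. z \<in> D \<longrightarrow> g z = (1 / 2) *\<^sub>R (wx z + bc_j * wy z)"
    and v: "AE z in lebesgue. z \<in> D \<longrightarrow> v z = g z - A z * w z"
    using w unfolding vekua_op_def has_dbar_def AE_lebesgue_on[OF Dm] by blast
  have "AE z in lebesgue. z \<in> D \<longrightarrow> U (v z) = (U (wx z) + \<i> * U (wy z)) / 2 - U (A z) * U (w z)"
    using g v by eventually_elim (auto simp: bc_hom_simps[OF U] scaleR_conv_of_real)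
  then show ?thesis
    unfolding complex_vekua_def using has_weak_deriv_linear[OF W(1) bl D] has_weak_deriv_linear[OF W(2) bl D] by blast
qed

lemma complex_vekua_imp_vekua_op:
  assumes D: "open D" and w1: "complex_vekua D (\<lambda>z. bc_plus_cnj (A z)) w1 v1" and w2: "complex_vekua D (\<lambda>z. bc_minus (A z)) w2 v2"
  shows "vekua_op D A (\<lambda>z. bc_pair (w1 z) (w2 z)) (\<lambda>z. bc_pair (v1 z) (v2 z))"
proof -
  have Dm: "D \<in> sets lebesgue" using D by simp
  obtain x1 y1 where W1: "has_weak_deriv D 1 w1 x1" "has_weak_deriv D \<i> w1 y1"
    "AE z in lebesgue. z \<in> D \<longrightarrow> v1 z = (x1 z + \<i> * y1 z) / 2 - bc_plus_cnj (A z) * w1 z"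
    using w1 unfolding complex_vekua_def by blast
  obtain x2 y2 where W2: "has_weak_deriv D 1 w2 x2" "has_weak_deriv D \<i> w2 y2"
    "AE z in lebesgue. z \<in> D \<longrightarrow> v2 z = (x2 z + \<i> * y2 z) / 2 - bc_minus (A z) * w2 z"
    using w2 unfolding complex_vekua_def by blast
  let ?x = "\<lambda>z. bc_pair (x1 z) (x2 z)" and ?y = "\<lambda>z. bc_pair (y1 z) (y2 z)"
  let ?g = "\<lambda>z. (1 / 2) *\<^sub>R (?x z + bc_j * ?y z)"
  have "has_dbar D (\<lambda>z. bc_pair (w1 z) (w2 z)) ?g"
    unfolding has_dbar_def
    using has_weak_deriv_bc_pair[OF W1(1) W2(1) D] has_weak_deriv_bc_pair[OF W1(2) W2(2) D] by (intro exI conjI) auto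
  moreover have "AE z in lebesgue_on D. bc_pair (v1 z) (v2 z) = ?g z - A z * bc_pair (w1 z) (w2 z)"
    unfolding AE_lebesgue_on[OF Dm] using W1(3) W2(3)
  proof eventually_elim
    fix z assume 1: "z \<in> D \<longrightarrow> v1 z = (x1 z + \<i> * y1 z) / 2 - bc_plus_cnj (A z) * w1 z"
      and 2: "z \<in> D \<longrightarrow> v2 z = (x2 z + \<i> * y2 z) / 2 - bc_minus (A z) * w2 z"
    show "z \<in> D \<longrightarrow> bc_pair (v1 z) (v2 z) = ?g z - A z * bc_pair (w1 z) (w2 z)"
    proof
      assume "z \<in> D"
      then show "bc_pair (v1 z) (v2 z) = ?g z - A z * bc_pair (w1 z) (w2 z)"
        using 1 2 by (intro bicomplex_eqI)
          (simp_all only: bc_hom_simps[OF bc_hom_components(1)] bc_hom_simps[OF bc_hom_components(2)]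
            bc_pair_components, simp_all add: scaleR_conv_of_real)
    qed
  qed
  ultimately show ?thesis unfolding vekua_op_def by blast
qed

text \<open>Needed because the solution is restricted to \<open>closure D\<close>, and its values
  outside differ from those of the function constructed.\<close>

lemma has_weak_deriv_cong:
  assumes "has_weak_deriv D e f g" "open D" "\<And>z. z \<in> D \<Longrightarrow> f z = f' z"
  shows "has_weak_deriv D e f' g"
  unfolding has_weak_deriv_iff[OF assms(2)]
proof (intro conjI allI impI)
  note l = has_weak_deriv_locally_integrable[OF assms(1)]
  show "locally_integrable D g" by (rule l(2))
  show "locally_integrable D f'"
    unfolding locally_integrable_iff
  proof (intro allI impI)
    fix K assume K: "compact K \<and> K \<subseteq> D"
    have "(\<lambda>z. indicator K z *\<^sub>R f z) = (\<lambda>z. indicator K z *\<^sub>R f' z)"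
      using K assms(3) by (fastforce simp: indicator_def)
    then show "integrable lebesgue (\<lambda>z. indicator K z *\<^sub>R f' z)"
      using locally_integrableD[OF l(1), of K] K by simp
  qed
  fix \<phi> :: "complex \<Rightarrow> real" and \<phi>' K
  assume h: "C1_on UNIV \<phi> \<phi>'" "compact K" "K \<subseteq> D" "\<forall>z. z \<notin> K \<longrightarrow> \<phi> z = 0"
  have e: "\<phi>' z e *\<^sub>R f' z = \<phi>' z e *\<^sub>R f z" for z
    using C1_on_vanish[OF h(1) compact_imp_closed[OF h(2)], of z e] h(3,4) assms(3)[of z] by (cases "z \<in> K") auto
  show "(LINT z|lebesgue. \<phi>' z e *\<^sub>R f' z) = - (LINT z|lebesgue. \<phi> z *\<^sub>R g z)"
    unfolding e using assms(1) h unfolding has_weak_deriv_iff[OF assms(2)] by blast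
qed

lemma vekua_op_cong:
  assumes "vekua_op D A w v" "open D" "\<And>z. z \<in> D \<Longrightarrow> w z = w' z"
  shows "vekua_op D A w' v"
proof -
  have Dm: "D \<in> sets lebesgue" using assms(2) by simp
  obtain g wx wy where W: "has_weak_deriv D 1 w wx" "has_weak_deriv D \<i> w wy"
    and g: "AE z in lebesgue_on D. g z = (1 / 2) *\<^sub>R (wx z + bc_j * wy z)"
    and v: "AE z in lebesgue. z \<in> D \<longrightarrow> v z = g z - A z * w z"
    using assms(1) unfolding vekua_op_def has_dbar_def AE_lebesgue_on[OF Dm, of "\<lambda>z. v z = _ z"] by blast
  have "AE z in lebesgue. z \<in> D \<longrightarrow> v z = g z - A z * w' z"
    using v by eventually_elim (simp add: assms(3))
  moreover have "has_dbar D w' g"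
    unfolding has_dbar_def using has_weak_deriv_cong[OF W(1) assms(2,3)] has_weak_deriv_cong[OF W(2) assms(2,3)] g by blast
  ultimately show ?thesis unfolding vekua_op_def AE_lebesgue_on[OF Dm] by blast
qed

text \<open>The plus part of the operator has the conjugated kernel; conjugating the whole component
  turns it into the ordinary Cauchy kernel applied to the conjugated density.\<close>

lemma T_op_components:
  assumes "D \<in> sets lebesgue"
  shows "bc_plus_cnj (T_op D A z) = complex_T D (\<lambda>z. bc_plus_cnj (A z)) z"
    and "bc_minus (T_op D A z) = complex_T D (\<lambda>z. bc_minus (A z)) z"
proof -
  have c: "(LINT \<zeta>|lebesgue_on D. f \<zeta> / (\<zeta> - z)) = cauchy_transform (\<lambda>z. indicator D z * f z) z" for f
  proof -
    have "(LINT \<zeta>|lebesgue_on D. f \<zeta> / (\<zeta> - z)) = (LINT \<zeta>|lebesgue. indicator D \<zeta> *\<^sub>R (f \<zeta> / (\<zeta> - z)))"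
      using assms by (intro integral_restrict_space) simp
    also have "\<dots> = cauchy_transform (\<lambda>z. indicator D z * f z) z"
      unfolding cauchy_transform_def by (rule Bochner_Integration.integral_cong) (auto simp: indicator_def)
    finally show ?thesis .
  qed
  show "bc_minus (T_op D A z) = complex_T D (\<lambda>z. bc_minus (A z)) z"
    unfolding T_op_def idempotent_components complex_T_def c by simp
  have "cnj (LINT \<zeta>|lebesgue_on D. bc_plus (A \<zeta>) / (cnj \<zeta> - cnj z)) = (LINT \<zeta>|lebesgue_on D. cnj (bc_plus (A \<zeta>) / (cnj \<zeta> - cnj z)))"
    by (rule Bochner_Integration.integral_cnj[symmetric])
  also have "\<dots> = (LINT \<zeta>|lebesgue_on D. bc_plus_cnj (A \<zeta>) / (\<zeta> - z))"
    by (simp add: bc_plus_cnj_def)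
  finally have e: "cnj (LINT \<zeta>|lebesgue_on D. bc_plus (A \<zeta>) / (cnj \<zeta> - cnj z)) = cauchy_transform (\<lambda>z. indicator D z * bc_plus_cnj (A z)) z"
    unfolding c .
  show "bc_plus_cnj (T_op D A z) = complex_T D (\<lambda>z. bc_plus_cnj (A z)) z"
  proof -
    have "bc_plus (T_op D A z) = - (1 / of_real pi) * (LINT \<zeta>|lebesgue_on D. bc_plus (A \<zeta>) / (cnj \<zeta> - cnj z))"
      unfolding T_op_def idempotent_components ..
    then have "bc_plus_cnj (T_op D A z) = cnj (- (1 / of_real pi)) * cauchy_transform (\<lambda>z. indicator D z * bc_plus_cnj (A z)) z"
      unfolding bc_plus_cnj_def[of "T_op D A z"] by (simp only: complex_cnj_mult e)
    then show ?thesis by (simp add: complex_T_def)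
  qed
qed

lemma bc_exp_components: "bc_plus_cnj (bc_exp w) = exp (bc_plus_cnj w)" "bc_minus (bc_exp w) = exp (bc_minus w)"
  by (simp_all add: bc_exp_def bc_plus_cnj_def idempotent_components exp_cnj)

lemma subcritical_Lq_space:
  assumes f: "f \<in> Lq_space q D" and q: "q > 2" and D: "open D" "bounded D" and U: "bounded_linear U"
  shows "subcritical (\<lambda>z. indicator D z * U (f z))"
proof -
  have Dm: "D \<in> sets lebesgue" "D \<inter> space lebesgue \<in> sets lebesgue" using D by simp_all
  have mf: "f \<in> borel_measurable (lebesgue_on D)" and i: "integrable (lebesgue_on D) (\<lambda>z. norm (f z) powr q)"
    using f by (auto simp: Lq_space_def)
  have "continuous_on UNIV U" using U by (simp add: linear_continuous_on)
  then have "U \<in> borel_measurable borel" by (rule borel_measurable_continuous_onI)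
  then have "(\<lambda>z. U (f z)) \<in> borel_measurable (lebesgue_on D)" using mf by (rule measurable_compose[rotated])
  then have "(\<lambda>z. indicator D z *\<^sub>R U (f z)) \<in> borel_measurable lebesgue"
    by (simp only: borel_measurable_restrict_space_iff[OF Dm(2)])
  moreover have eq: "(\<lambda>z. indicator D z *\<^sub>R U (f z)) = (\<lambda>z. indicator D z * U (f z))" by (auto simp: indicator_def)
  ultimately have m: "(\<lambda>z. indicator D z * U (f z)) \<in> borel_measurable lebesgue" by simp
  obtain K where K: "K > 0" "\<And>x. norm (U x) \<le> norm x * K" using bounded_linear.pos_bounded[OF U] by blast
  obtain R where R: "\<And>z. z \<in> D \<Longrightarrow> norm z \<le> R" using D(2) by (auto simp: bounded_iff)
  show ?thesis
  proof (rule subcritical_Lq[OF q m])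
    have i2: "integrable lebesgue (\<lambda>z. K powr q * (indicator D z *\<^sub>R (norm (f z) powr q)))"
      using i by (intro integrable_mult_right) (simp only: integrable_restrict_space[OF Dm(2)])
    show "integrable lebesgue (\<lambda>z. norm (indicator D z * U (f z)) powr q)"
    proof (rule Bochner_Integration.integrable_bound[OF i2])
      show "(\<lambda>z. norm (indicator D z * U (f z)) powr q) \<in> borel_measurable lebesgue" using m by measurable
      have "norm (U (f z)) powr q \<le> K powr q * norm (f z) powr q" for z
      proof -
        have "norm (U (f z)) powr q \<le> (norm (f z) * K) powr q" using K q by (intro powr_mono2) auto
        then show ?thesis using K by (simp add: powr_mult mult.commute)
      qed
      then show "AE z in lebesgue. norm (norm (indicator D z * U (f z)) powr q) \<le> norm (K powr q * (indicator D z *\<^sub>R (norm (f z) powr q)))"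
        by (intro AE_I2) (auto simp: indicator_def)
    qed
    show "indicator D z * U (f z) = 0" if "z \<notin> cball 0 R" for z using R[of z] that by (auto simp: indicator_def)
  qed
qed

lemma sobolev_subcritical_component:
  assumes A: "A \<in> sobolev_W1 q D" and q: "q > 2" and D: "open D" "bounded D" and U: "bounded_linear U"
  shows "sobolev_subcritical D (\<lambda>z. U (A z))"
proof -
  obtain Ax Ay where "A \<in> Lq_space q D" "Ax \<in> Lq_space q D" "Ay \<in> Lq_space q D"
    "has_weak_deriv D 1 A Ax" "has_weak_deriv D \<i> A Ay" using A unfolding sobolev_W1_def by blast
  then show ?thesis
    unfolding sobolev_subcritical_def using subcritical_Lq_space[OF _ q D U] has_weak_deriv_linear[OF _ U D(1)] by blast
qed

theorem theorem3p18:
  fixes a b c d e f q :: real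
    and \<Gamma> D :: "complex set"
    and P A :: "complex \<Rightarrow> bicomplex"
  assumes "nondegenerate_conic a b c d e f"
    and "\<not> (a = c \<and> b = 0)"
    and "\<Gamma> = conic a b c d e f"
    and "D = inside \<Gamma>"
    and "D \<noteq> {}"
    and "bc_polynomial P"
    and "q > 2"
    and "A \<in> sobolev_W1 q D"
  shows "\<exists>!w. w \<in> extensional (closure D) \<and>
    solves_dirichlet D \<Gamma> A (\<lambda>z. bc_exp (T_op D A z) * P z) w"
proof -
  have "inside (conic a b c d e f) \<noteq> {}" using assms(3-5) by simp
  from conic_normal_form[OF this assms(2)] obtain \<kappa> k \<beta> \<mu> where
    se: "scaled_ellipse \<kappa> k \<mu>" and G: "\<Gamma> = scaled_ellipse.\<Gamma> \<kappa> k \<beta> \<mu>" and Deq: "D = scaled_ellipse.D \<kappa> k \<beta> \<mu>"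
    unfolding assms(3,4) by metis
  interpret S: scaled_ellipse \<kappa> k \<beta> \<mu> by (rule se)
  have D: "open D" "bounded D" and Dm: "D \<in> sets lebesgue" using S.open_D S.bounded_D by (simp_all add: Deq)
  have cl: "closure D = D \<union> \<Gamma>" using S.closure_D_eq by (simp add: Deq G)
  note hom = bc_hom_components
  have bl: "bounded_linear U" if "bc_hom U" for U using that by (simp add: bc_hom_def)
  have subcritical: "sobolev_subcritical D (\<lambda>z. U (A z))" if "bc_hom U" for U
    by (rule sobolev_subcritical_component[OF assms(8,7) D bl[OF that]])
  obtain n C where P: "\<And>z. P z = (\<Sum>i\<le>n. \<Sum>j\<le>n. C i j * of_real (Re z) ^ i * of_real (Im z) ^ j)"
    using assms(6) unfolding bc_polynomial_def by blast
  have UP: "U (P z) = (\<Sum>i\<le>n. \<Sum>j\<le>n. U (C i j) * of_real (Re z) ^ i * of_real (Im z) ^ j)" if "bc_hom U" for U z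
    unfolding P by (simp only: bc_hom_simps[OF that])
  have ex: "\<exists>w v. continuous_on UNIV w \<and> complex_vekua D (\<lambda>z. U (A z)) w v \<and> complex_vekua D (\<lambda>z. U (A z)) v (\<lambda>z. 0) \<and>
      (\<forall>z\<in>\<Gamma>. w z = exp (complex_T D (\<lambda>z. U (A z)) z) * U (P z))" if U: "bc_hom U" for U
    using S.dirichlet_exists[OF subcritical[OF U, unfolded Deq] UP[OF U]] unfolding Deq G by metis
  obtain w1 v1 where w1: "continuous_on UNIV w1" "complex_vekua D (\<lambda>z. bc_plus_cnj (A z)) w1 v1"
    "complex_vekua D (\<lambda>z. bc_plus_cnj (A z)) v1 (\<lambda>z. 0)"
    "\<And>z. z \<in> \<Gamma> \<Longrightarrow> w1 z = exp (complex_T D (\<lambda>z. bc_plus_cnj (A z)) z) * bc_plus_cnj (P z)"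
    using ex[OF hom(1)] by blast
  obtain w2 v2 where w2: "continuous_on UNIV w2" "complex_vekua D (\<lambda>z. bc_minus (A z)) w2 v2"
    "complex_vekua D (\<lambda>z. bc_minus (A z)) v2 (\<lambda>z. 0)"
    "\<And>z. z \<in> \<Gamma> \<Longrightarrow> w2 z = exp (complex_T D (\<lambda>z. bc_minus (A z)) z) * bc_minus (P z)"
    using ex[OF hom(2)] by blast
  \<comment> \<open>Fixing the default value outside \<open>closure D\<close> makes uniqueness an
    equality of functions.\<close>
  define w where "w = restrict (\<lambda>z. bc_pair (w1 z) (w2 z)) (closure D)"
  have "solves_dirichlet D \<Gamma> A (\<lambda>z. bc_exp (T_op D A z) * P z) w"
    unfolding solves_dirichlet_def
  proof (intro conjI ballI)
    have "continuous_on (closure D) (\<lambda>z. bc_pair (w1 z) (w2 z))"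
      by (intro continuous_on_bc_pair continuous_on_subset[OF w1(1)] continuous_on_subset[OF w2(1)]) auto
    moreover have "continuous_on (closure D) w \<longleftrightarrow> continuous_on (closure D) (\<lambda>z. bc_pair (w1 z) (w2 z))"
      by (rule continuous_on_cong) (auto simp: w_def)
    ultimately show "continuous_on (closure D) w" by simp
    have "vekua_op D A w (\<lambda>z. bc_pair (v1 z) (v2 z))"
      by (rule vekua_op_cong[OF complex_vekua_imp_vekua_op[OF D(1) w1(2) w2(2)] D(1)]) (simp add: w_def cl)
    moreover have "vekua_op D A (\<lambda>z. bc_pair (v1 z) (v2 z)) (\<lambda>z. bc_pair 0 0)"
      by (rule complex_vekua_imp_vekua_op[OF D(1) w1(3) w2(3)])
    moreover have "bc_pair 0 0 = 0" by (rule bicomplex_eqI) (simp_all add: bc_pair_components bc_hom_simps[OF hom(1)] bc_hom_simps[OF hom(2)])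
    ultimately show "vekua_op_squared D A w (\<lambda>z. 0)" unfolding vekua_op_squared_def by auto
    fix z assume z: "z \<in> \<Gamma>"
    then have "w z = bc_pair (w1 z) (w2 z)" by (simp add: w_def cl)
    also have "\<dots> = bc_exp (T_op D A z) * P z"
      by (rule bicomplex_eqI)
        (simp_all only: bc_pair_components bc_hom_simps(3)[OF hom(1)] bc_hom_simps(3)[OF hom(2)]
          bc_exp_components T_op_components[OF Dm] w1(4)[OF z] w2(4)[OF z])
    finally show "w z = bc_exp (T_op D A z) * P z" .
  qed
  moreover have "w \<in> extensional (closure D)" by (simp add: w_def)
  \<comment> \<open>The boundary data are arbitrary here: the difference of two solutions solves the
    homogeneous equation in each component and vanishes on the curve. The intermediate functions
    \<open>v'\<close> and \<open>v''\<close> are subtracted along with the solutions.\<close>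
  moreover have "w' = w''"
    if s: "solves_dirichlet D \<Gamma> A h w'" "solves_dirichlet D \<Gamma> A h w''"
      and x: "w' \<in> extensional (closure D)" "w'' \<in> extensional (closure D)" for w' w'' h
  proof (rule extensionalityI[OF x])
    fix z assume z: "z \<in> closure D"
    have "U (w' z) = U (w'' z)" if U: "bc_hom U" for U
    proof -
      obtain v' where v': "vekua_op D A w' v'" "vekua_op D A v' (\<lambda>z. 0)"
        using s(1) unfolding solves_dirichlet_def vekua_op_squared_def by blast
      obtain v'' where v'': "vekua_op D A w'' v''" "vekua_op D A v'' (\<lambda>z. 0)"
        using s(2) unfolding solves_dirichlet_def vekua_op_squared_def by blast
      note c = vekua_op_imp_complex_vekua[OF U D(1)]
      have 1: "complex_vekua D (\<lambda>z. U (A z)) (\<lambda>z. U (w' z) - U (w'' z)) (\<lambda>z. U (v' z) - U (v'' z))"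
        by (rule complex_vekua_diff[OF c[OF v'(1)] c[OF v''(1)] D(1)])
      have 2: "complex_vekua D (\<lambda>z. U (A z)) (\<lambda>z. U (v' z) - U (v'' z)) (\<lambda>z. 0)"
        using complex_vekua_diff[OF c[OF v'(2)] c[OF v''(2)] D(1)] by simp
      have 3: "continuous_on (closure D) (\<lambda>z. U (w' z) - U (w'' z))"
        using s unfolding solves_dirichlet_def
        by (intro continuous_on_diff bounded_linear.continuous_on[OF bl[OF U]]) auto
      have 4: "U (w' z) - U (w'' z) = 0" if "z \<in> \<Gamma>" for z
        using s that unfolding solves_dirichlet_def by simp
      have "U (w' z) - U (w'' z) = 0"
        using S.dirichlet_unique_zero[OF subcritical[OF U, unfolded Deq] 1[unfolded Deq] 2[unfolded Deq] 3[unfolded Deq] 4[unfolded G] z[unfolded Deq]] .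
      then show ?thesis by simp
    qed
    then show "w' z = w'' z" using hom by (intro bicomplex_eqI) blast+
  qed
  ultimately show ?thesis by blast
qed

end
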